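(* Let $G$ be an algebraic group acting rationally by Poisson automorphisms on a complex affine Poisson algebra $A$. If the set of $G$-orbits of symplectic leaves of $A$ is finite, or if the set of $G$-orbits of symplectic cores of $A$ is finite, then $A$ satisfies the Poisson Dixmier-Moeglin equivalence.
   Context: A complex affine Poisson algebra is a finitely generated commutative $\mathbb{C}$-algebra $A$ with a bilinear map $\{-,-\}:A\times A\to A$ that is both a Lie bracket and a biderivation. An ideal $I$ is a Poisson ideal if $\{I,A\}\subseteq I$. The Poisson core $\mathcal{P}(J)$ of an ideal $J$ is the largest Poisson ideal contained in $J$. A Poisson primitive ideal is the Poisson core of a maximal ideal of $A$. A Poisson prime ideal is a prime ideal that is also a Poisson ideal; ${\rm P.spec}\,A$ denotes the set of Poisson prime ideals with the subspace topology from ${\rm spec}\,A$ (Zariski topology). The Poisson center of a Poisson algebra $B$ is $Z_P(B)=\{a\in B : \{a,b\}=0\ \forall b\in B\}$. For a Poisson prime ideal $P$, the bracket of $A$ induces one on $A/P$ and extends uniquely to ${\rm Frac}(A/P)$; $P$ is Poisson rational if $Z_P({\rm Frac}(A/P))=\mathbb{C}$. A Poisson prime ideal $P$ is locally closed if $\{P\}$ is the intersection of an open and a closed subset of ${\rm P.spec}\,A$. $A$ satisfies the Poisson Dixmier-Moeglin equivalence if the following three sets of Poisson prime ideals coincide: the locally closed Poisson prime ideals, the Poisson primitive ideals, and the Poisson rational ideals. Algebraic group means affine algebraic group over $\mathbb{C}$. $G$ acts rationally by Poisson automorphisms on $A$ if $G$ acts on $A$ by $\mathbb{C}$-algebra automorphisms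 preserving the Poisson bracket and $A$ is a directed union of finite-dimensional $G$-invariant subspaces $V_i$ such that the restriction maps $G\to{\rm GL}(V_i)$ are morphisms of algebraic varieties. Let $\mathscr{A}={\rm max}\,A$ be the maximal spectrum. Symplectic cores are the classes of the equivalence relation on $\mathscr{A}$ given by $\mathfrak{m}\sim\mathfrak{n}\iff\mathcal{P}(\mathfrak{m})=\mathcal{P}(\mathfrak{n})$. Symplectic leaves: if $\mathscr{A}$ is smooth, they are the leaves of the symplectic foliation of the complex analytic Poisson manifold $\mathscr{A}$, i.e. the leaf of $\mathfrak{m}$ is the set of points that can be reached from $\mathfrak{m}$ by a finite concatenation of flows of Hamiltonian vector fields. In general (Brown-Gordon), put $\mathscr{A}_0=\mathscr{A}$ (with reduced structure) and let $\mathscr{A}_{i+1}$ be the singular locus of $\mathscr{A}_i$, a closed Poisson subvariety; each $\mathscr{A}_i\setminus\mathscr{A}_{i+1}$ is a smooth complex Poisson manifold, and the symplectic leaves of $\mathscr{A}$ are the symplectic leaves of these manifolds. $G$ acts on $\mathscr{A}$ and permutes the symplectic leaves and the symplectic cores; the $G$-orbits are those of these induced permutation actions. *)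

theory Defs
  imports
    "HOL-Analysis.Analysis"
    "HOL-Library.Extended_Nat"
    "HOL-Algebra.QuotRing"
    "HOL-Algebra.Ideal_Product"
    "HOL-Algebra.Embedded_Algebras"
    "HOL-Algebra.Generated_Rings"
    "HOL-Algebra.Group_Action"
    "HOL-Algebra.Algebraic_Closure_Type"
begin

record 'a poisson_algebra = "(complex, 'a) module" +
  poisson_bracket :: "'a \<Rightarrow> 'a \<Rightarrow> 'a"  (\<open>\<lbrace>_, _\<rbrace>\<index>\<close>)

definition scalars :: "(complex, 'a, 'b) module_scheme \<Rightarrow> 'a set" where
  "scalars A = range (\<lambda>c. c \<odot>\<^bsub>A\<^esub> \<one>\<^bsub>A\<^esub>)"

locale complex_poisson_algebra =
  Module.algebra "ring_of_type_algebra :: complex ring" A for A :: "('a, 'b) poisson_algebra_scheme" (structure) +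
  assumes bracket_closed:
      "\<lbrakk>a \<in> carrier A; b \<in> carrier A\<rbrakk> \<Longrightarrow> \<lbrace>a, b\<rbrace> \<in> carrier A"
    and bracket_add_left:
      "\<lbrakk>a \<in> carrier A; b \<in> carrier A; c \<in> carrier A\<rbrakk> \<Longrightarrow>
        \<lbrace>a \<oplus>\<^bsub>A\<^esub> b, c\<rbrace> = \<lbrace>a, c\<rbrace> \<oplus>\<^bsub>A\<^esub> \<lbrace>b, c\<rbrace>"
    and bracket_add_right:
      "\<lbrakk>a \<in> carrier A; b \<in> carrier A; c \<in> carrier A\<rbrakk> \<Longrightarrow>
        \<lbrace>a, b \<oplus>\<^bsub>A\<^esub> c\<rbrace> = \<lbrace>a, b\<rbrace> \<oplus>\<^bsub>A\<^esub> \<lbrace>a, c\<rbrace>"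
    and bracket_smult_left:
      "\<lbrakk>a \<in> carrier A; b \<in> carrier A\<rbrakk> \<Longrightarrow> \<lbrace>z \<odot>\<^bsub>A\<^esub> a, b\<rbrace> = z \<odot>\<^bsub>A\<^esub> \<lbrace>a, b\<rbrace>"
    and bracket_smult_right:
      "\<lbrakk>a \<in> carrier A; b \<in> carrier A\<rbrakk> \<Longrightarrow> \<lbrace>a, z \<odot>\<^bsub>A\<^esub> b\<rbrace> = z \<odot>\<^bsub>A\<^esub> \<lbrace>a, b\<rbrace>"
    and bracket_self:
      "a \<in> carrier A \<Longrightarrow> \<lbrace>a, a\<rbrace> = \<zero>\<^bsub>A\<^esub>"
    and bracket_jacobi:
      "\<lbrakk>a \<in> carrier A; b \<in> carrier A; c \<in> carrier A\<rbrakk> \<Longrightarrow>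
        \<lbrace>a, \<lbrace>b, c\<rbrace>\<rbrace> \<oplus>\<^bsub>A\<^esub> \<lbrace>b, \<lbrace>c, a\<rbrace>\<rbrace> \<oplus>\<^bsub>A\<^esub> \<lbrace>c, \<lbrace>a, b\<rbrace>\<rbrace> = \<zero>\<^bsub>A\<^esub>"
    and bracket_mult_left:
      "\<lbrakk>a \<in> carrier A; b \<in> carrier A; c \<in> carrier A\<rbrakk> \<Longrightarrow>
        \<lbrace>a \<otimes>\<^bsub>A\<^esub> b, c\<rbrace> = a \<otimes>\<^bsub>A\<^esub> \<lbrace>b, c\<rbrace> \<oplus>\<^bsub>A\<^esub> b \<otimes>\<^bsub>A\<^esub> \<lbrace>a, c\<rbrace>"
    and bracket_mult_right:
      "\<lbrakk>a \<in> carrier A; b \<in> carrier A; c \<in> carrier A\<rbrakk> \<Longrightarrow>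
        \<lbrace>a, b \<otimes>\<^bsub>A\<^esub> c\<rbrace> = b \<otimes>\<^bsub>A\<^esub> \<lbrace>a, c\<rbrace> \<oplus>\<^bsub>A\<^esub> c \<otimes>\<^bsub>A\<^esub> \<lbrace>a, b\<rbrace>"

locale complex_affine_poisson_algebra = complex_poisson_algebra +
  assumes finitely_generated:
    "\<exists>S. finite S \<and> S \<subseteq> carrier A \<and> generate_ring A (scalars A \<union> S) = carrier A"

definition poisson_ideal :: "('a, 'b) poisson_algebra_scheme \<Rightarrow> 'a set \<Rightarrow> bool" where
  "poisson_ideal A I \<longleftrightarrow> ideal I A \<and> (\<forall>x\<in>I. \<forall>a\<in>carrier A. \<lbrace>x, a\<rbrace>\<^bsub>A\<^esub> \<in> I)"

definition poisson_core :: "('a, 'b) poisson_algebra_scheme \<Rightarrow> 'a set \<Rightarrow> 'a set" where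
  "poisson_core A J = (GREATEST I. poisson_ideal A I \<and> I \<subseteq> J)"

definition maxspec :: "('a, 'b) ring_scheme \<Rightarrow> 'a set set" where
  "maxspec R = {m. maximalideal m R}"

definition poisson_primitive :: "('a, 'b) poisson_algebra_scheme \<Rightarrow> 'a set \<Rightarrow> bool" where
  "poisson_primitive A P \<longleftrightarrow> (\<exists>m\<in>maxspec A. P = poisson_core A m)"

definition poisson_prime :: "('a, 'b) poisson_algebra_scheme \<Rightarrow> 'a set \<Rightarrow> bool" where
  "poisson_prime A P \<longleftrightarrow> primeideal P A \<and> poisson_ideal A P"

lemma (in complex_poisson_algebra) poisson_core_greatest:
  assumes J: "ideal J A"
  shows "poisson_ideal A (poisson_core A J)" "poisson_core A J \<subseteq> J"
    "\<And>I. poisson_ideal A I \<Longrightarrow> I \<subseteq> J \<Longrightarrow> I \<subseteq> poisson_core A J"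
proof -
  define U where "U = \<Union>{I. poisson_ideal A I \<and> I \<subseteq> J}"
  define K where "K = genideal A U"
  have UJ: "U \<subseteq> J" by (auto simp: U_def)
  have Jc: "J \<subseteq> carrier A"
    by (rule additive_subgroup.a_subset[OF ideal.axioms(1)[OF J]])
  have Uc: "U \<subseteq> carrier A" using UJ Jc by blast
  have KI: "ideal K A" unfolding K_def by (rule genideal_ideal[OF Uc])
  have UK: "U \<subseteq> K" unfolding K_def by (rule genideal_self[OF Uc])
  have KJ: "K \<subseteq> J" unfolding K_def by (rule genideal_minimal[OF J UJ])
  interpret K: ideal K A by (rule KI)
  have zero_br: "\<lbrace>\<zero>\<^bsub>A\<^esub>, a\<rbrace> = \<zero>\<^bsub>A\<^esub>" if a: "a \<in> carrier A" for a
  proof -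
    have "\<lbrace>0 \<odot>\<^bsub>A\<^esub> \<zero>\<^bsub>A\<^esub>, a\<rbrace> = 0 \<odot>\<^bsub>A\<^esub> \<lbrace>\<zero>\<^bsub>A\<^esub>, a\<rbrace>"
      using a by (intro bracket_smult_left) auto
    moreover have "0 \<odot>\<^bsub>A\<^esub> x = \<zero>\<^bsub>A\<^esub>" if "x \<in> carrier A" for x
      using smult_l_null[OF that] by (simp add: ring_of_type_algebra_def)
    ultimately show ?thesis using a bracket_closed by simp
  qed
  define L where "L = {x\<in>K. \<forall>a\<in>carrier A. \<lbrace>x, a\<rbrace> \<in> K}"
  have mult_L: "b \<otimes>\<^bsub>A\<^esub> x \<in> L" if x: "x \<in> L" and b: "b \<in> carrier A" for x b
  proof -
    have xK: "x \<in> K" and xc: "x \<in> carrier A" using x by (auto simp: L_def)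
    have "\<lbrace>b \<otimes>\<^bsub>A\<^esub> x, a\<rbrace> \<in> K" if a: "a \<in> carrier A" for a
    proof -
      have "\<lbrace>x, a\<rbrace> \<in> K" using x a by (auto simp: L_def)
      then show ?thesis
        using bracket_mult_left[OF b xc a] bracket_closed[OF b a] xK b
        by (simp add: K.I_l_closed K.I_r_closed K.a_closed)
    qed
    then show ?thesis using xK b by (simp add: L_def K.I_l_closed)
  qed
  have "ideal L A"
  proof (rule idealI)
    show "ring A" by (rule cring.axioms(1)[OF M_cring])
    show "subgroup L (add_monoid A)"
    proof (rule add.subgroupI)
      show "L \<subseteq> carrier A" by (auto simp: L_def)
      have "\<zero>\<^bsub>A\<^esub> \<in> L" by (simp add: L_def zero_br)
      then show "L \<noteq> {}" by blast
      show "x \<oplus>\<^bsub>A\<^esub> y \<in> L" if "x \<in> L" "y \<in> L" for x y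
        using that by (auto simp: L_def bracket_add_left)
      show "\<ominus>\<^bsub>A\<^esub> x \<in> L" if x: "x \<in> L" for x
      proof -
        have "x \<in> carrier A" using x by (auto simp: L_def)
        then have "\<ominus>\<^bsub>A\<^esub> x = (\<ominus>\<^bsub>A\<^esub> \<one>\<^bsub>A\<^esub>) \<otimes>\<^bsub>A\<^esub> x" by (simp add: l_minus)
        then show ?thesis using mult_L[OF x] by simp
      qed
    qed
    show "b \<otimes>\<^bsub>A\<^esub> x \<in> L" if "x \<in> L" "b \<in> carrier A" for x b
      using mult_L that .
    show "x \<otimes>\<^bsub>A\<^esub> b \<in> L" if "x \<in> L" "b \<in> carrier A" for x b
      using mult_L[OF that] that by (auto simp: L_def m_comm)
  qed
  moreover have "U \<subseteq> L"
    using UK by (auto simp: L_def U_def poisson_ideal_def)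
  ultimately have "K \<subseteq> L" unfolding K_def by (rule genideal_minimal)
  then have KP: "poisson_ideal A K" using KI by (auto simp: poisson_ideal_def L_def)
  have ub: "I \<subseteq> K" if "poisson_ideal A I" "I \<subseteq> J" for I
    using that UK by (auto simp: U_def)
  have "poisson_core A J = K"
    unfolding poisson_core_def by (rule Greatest_equality) (use KP KJ ub in auto)
  with KP KJ ub show "poisson_ideal A (poisson_core A J)" "poisson_core A J \<subseteq> J"
    "\<And>I. poisson_ideal A I \<Longrightarrow> I \<subseteq> J \<Longrightarrow> I \<subseteq> poisson_core A J" by simp_all
qed

definition poisson_quot ::
    "('a, 'b) poisson_algebra_scheme \<Rightarrow> 'a set \<Rightarrow> 'a set poisson_algebra" where
  "poisson_quot A I =
    \<lparr>carrier = carrier (A Quot I), mult = mult (A Quot I), one = one (A Quot I),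
     zero = zero (A Quot I), add = add (A Quot I),
     smult = (\<lambda>c V. \<Union>x\<in>V. I +>\<^bsub>A\<^esub> (c \<odot>\<^bsub>A\<^esub> x)),
     poisson_bracket = (\<lambda>V W. \<Union>x\<in>V. \<Union>y\<in>W. I +>\<^bsub>A\<^esub> \<lbrace>x, y\<rbrace>\<^bsub>A\<^esub>)\<rparr>"

definition frac_rel :: "('a, 'b) ring_scheme \<Rightarrow> (('a \<times> 'a) \<times> ('a \<times> 'a)) set" where
  "frac_rel R = {((a, s), (b, t)).
     a \<in> carrier R \<and> s \<in> carrier R - {\<zero>\<^bsub>R\<^esub>} \<and> b \<in> carrier R \<and> t \<in> carrier R - {\<zero>\<^bsub>R\<^esub>} \<and>
     a \<otimes>\<^bsub>R\<^esub> t = b \<otimes>\<^bsub>R\<^esub> s}"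

definition fraction :: "('a, 'b) ring_scheme \<Rightarrow> 'a \<Rightarrow> 'a \<Rightarrow> ('a \<times> 'a) set" where
  "fraction R a s = frac_rel R `` {(a, s)}"

text \<open>
  The fraction field of a Poisson domain. Its bracket is the unique extension as a
  biderivation, which by the quotient rule is
  \<open>{a/s, b/t} = (st{a,b} - at{s,b} - sb{a,t} + ab{s,t}) / (s\<^sup>2t\<^sup>2)\<close>.
\<close>

definition poisson_frac ::
    "('a, 'b) poisson_algebra_scheme \<Rightarrow> ('a \<times> 'a) set poisson_algebra" where
  "poisson_frac R =
    \<lparr>carrier = (carrier R \<times> (carrier R - {\<zero>\<^bsub>R\<^esub>})) // frac_rel R,
     mult = (\<lambda>V W. \<Union>(a, s)\<in>V. \<Union>(b, t)\<in>W. fraction R (a \<otimes>\<^bsub>R\<^esub> b) (s \<otimes>\<^bsub>R\<^esub> t)),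
     one = fraction R \<one>\<^bsub>R\<^esub> \<one>\<^bsub>R\<^esub>,
     zero = fraction R \<zero>\<^bsub>R\<^esub> \<one>\<^bsub>R\<^esub>,
     add = (\<lambda>V W. \<Union>(a, s)\<in>V. \<Union>(b, t)\<in>W.
       fraction R (a \<otimes>\<^bsub>R\<^esub> t \<oplus>\<^bsub>R\<^esub> b \<otimes>\<^bsub>R\<^esub> s) (s \<otimes>\<^bsub>R\<^esub> t)),
     smult = (\<lambda>c V. \<Union>(a, s)\<in>V. fraction R (c \<odot>\<^bsub>R\<^esub> a) s),
     poisson_bracket = (\<lambda>V W. \<Union>(a, s)\<in>V. \<Union>(b, t)\<in>W.
       fraction R
         ((s \<otimes>\<^bsub>R\<^esub> t \<otimes>\<^bsub>R\<^esub> \<lbrace>a, b\<rbrace>\<^bsub>R\<^esub> \<oplus>\<^bsub>R\<^esub> a \<otimes>\<^bsub>R\<^esub> b \<otimes>\<^bsub>R\<^esub> \<lbrace>s, t\<rbrace>\<^bsub>R\<^esub>) \<ominus>\<^bsub>R\<^esub>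
          (a \<otimes>\<^bsub>R\<^esub> t \<otimes>\<^bsub>R\<^esub> \<lbrace>s, b\<rbrace>\<^bsub>R\<^esub> \<oplus>\<^bsub>R\<^esub> s \<otimes>\<^bsub>R\<^esub> b \<otimes>\<^bsub>R\<^esub> \<lbrace>a, t\<rbrace>\<^bsub>R\<^esub>))
         (s \<otimes>\<^bsub>R\<^esub> s \<otimes>\<^bsub>R\<^esub> (t \<otimes>\<^bsub>R\<^esub> t)))\<rparr>"

definition poisson_center :: "('a, 'b) poisson_algebra_scheme \<Rightarrow> 'a set" where
  "poisson_center B = {a \<in> carrier B. \<forall>b\<in>carrier B. \<lbrace>a, b\<rbrace>\<^bsub>B\<^esub> = \<zero>\<^bsub>B\<^esub>}"

definition poisson_rational :: "('a, 'b) poisson_algebra_scheme \<Rightarrow> 'a set \<Rightarrow> bool" where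
  "poisson_rational A P \<longleftrightarrow> poisson_prime A P \<and>
     poisson_center (poisson_frac (poisson_quot A P)) = scalars (poisson_frac (poisson_quot A P))"

definition zariski :: "('a, 'b) ring_scheme \<Rightarrow> 'a set topology" where
  "zariski R = topology (\<lambda>U. \<exists>S\<subseteq>carrier R. U = {P. primeideal P R \<and> \<not> S \<subseteq> P})"

lemma primeideal_mult_mem_iff:
  assumes P: "primeideal P R" and st: "s \<in> carrier R" "t \<in> carrier R"
  shows "s \<otimes>\<^bsub>R\<^esub> t \<in> P \<longleftrightarrow> s \<in> P \<or> t \<in> P"
proof -
  have I: "ideal P R" by (rule primeideal.axioms(1)[OF P])
  have "s \<otimes>\<^bsub>R\<^esub> t \<in> P" if "s \<in> P" by (rule ideal.I_r_closed[OF I that st(2)])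
  moreover have "s \<otimes>\<^bsub>R\<^esub> t \<in> P" if "t \<in> P" by (rule ideal.I_l_closed[OF I that st(1)])
  moreover have "s \<in> P \<or> t \<in> P" if "s \<otimes>\<^bsub>R\<^esub> t \<in> P"
    by (rule primeideal.I_prime[OF P st that])
  ultimately show ?thesis by blast
qed

lemma istopology_zariski:
  "istopology (\<lambda>U. \<exists>S\<subseteq>carrier R. U = {P. primeideal P R \<and> \<not> S \<subseteq> P})"
proof -
  define D where "D S = {P. primeideal P R \<and> \<not> S \<subseteq> P}" for S
  have Int: "\<exists>Q\<subseteq>carrier R. D S \<inter> D T = D Q" if S: "S \<subseteq> carrier R" and T: "T \<subseteq> carrier R" for S T
  proof -
    define Q where "Q = {q \<in> carrier R. \<exists>s\<in>S. \<exists>t\<in>T. q = s \<otimes>\<^bsub>R\<^esub> t}"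
    have "P \<in> D S \<inter> D T \<longleftrightarrow> P \<in> D Q" for P
    proof (cases "primeideal P R")
      case False
      then show ?thesis by (simp add: D_def)
    next
      case True
      have R: "cring R" by (rule primeideal.axioms(2)[OF True])
      have mem: "s \<otimes>\<^bsub>R\<^esub> t \<in> P \<longleftrightarrow> s \<in> P \<or> t \<in> P" "s \<otimes>\<^bsub>R\<^esub> t \<in> Q" if "s \<in> S" "t \<in> T" for s t
      proof -
        have c: "s \<in> carrier R" "t \<in> carrier R" using that S T by blast+
        show "s \<otimes>\<^bsub>R\<^esub> t \<in> P \<longleftrightarrow> s \<in> P \<or> t \<in> P" by (rule primeideal_mult_mem_iff[OF True c])
        have "s \<otimes>\<^bsub>R\<^esub> t \<in> carrier R"
          by (rule monoid.m_closed[OF ring.is_monoid[OF cring.axioms(1)[OF R]] c])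
        then show "s \<otimes>\<^bsub>R\<^esub> t \<in> Q" using that unfolding Q_def by blast
      qed
      have "Q \<subseteq> P \<longleftrightarrow> S \<subseteq> P \<or> T \<subseteq> P"
      proof
        assume QP: "Q \<subseteq> P"
        show "S \<subseteq> P \<or> T \<subseteq> P"
        proof (rule ccontr)
          assume "\<not> (S \<subseteq> P \<or> T \<subseteq> P)"
          then obtain s t where "s \<in> S" "s \<notin> P" "t \<in> T" "t \<notin> P" by blast
          then show False using mem QP by blast
        qed
      next
        assume ST: "S \<subseteq> P \<or> T \<subseteq> P"
        show "Q \<subseteq> P"
        proof
          fix q assume "q \<in> Q"
          then obtain s t where "s \<in> S" "t \<in> T" "q = s \<otimes>\<^bsub>R\<^esub> t" unfolding Q_def by blast
          then show "q \<in> P" using mem(1) ST by blast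
        qed
      qed
      then show ?thesis using True unfolding D_def by blast
    qed
    moreover have "Q \<subseteq> carrier R" unfolding Q_def by blast
    ultimately show ?thesis by blast
  qed
  have Un: "\<exists>Q\<subseteq>carrier R. \<Union>\<U> = D Q" if \<U>: "\<forall>U\<in>\<U>. \<exists>S\<subseteq>carrier R. U = D S" for \<U>
  proof -
    from \<U> obtain f where f: "\<And>U. U \<in> \<U> \<Longrightarrow> f U \<subseteq> carrier R \<and> U = D (f U)" by metis
    have "\<Union>\<U> = (\<Union>U\<in>\<U>. D (f U))" using f by blast
    also have "\<dots> = D (\<Union>U\<in>\<U>. f U)" unfolding D_def by blast
    finally have "\<Union>\<U> = D (\<Union>U\<in>\<U>. f U)" .
    moreover have "(\<Union>U\<in>\<U>. f U) \<subseteq> carrier R" using f by blast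
    ultimately show ?thesis by blast
  qed
  show ?thesis
    unfolding istopology_def D_def[symmetric]
  proof (intro conjI allI impI)
    fix U V
    assume "\<exists>S\<subseteq>carrier R. U = D S" "\<exists>S\<subseteq>carrier R. V = D S"
    then obtain S T where "S \<subseteq> carrier R" "U = D S" "T \<subseteq> carrier R" "V = D T" by blast
    then show "\<exists>S\<subseteq>carrier R. U \<inter> V = D S" using Int by simp
  next
    fix \<U>
    assume "\<forall>U\<in>\<U>. \<exists>S\<subseteq>carrier R. U = D S"
    then show "\<exists>S\<subseteq>carrier R. \<Union>\<U> = D S" by (rule Un)
  qed
qed

lemma openin_zariski:
  "openin (zariski R) U \<longleftrightarrow> (\<exists>S\<subseteq>carrier R. U = {P. primeideal P R \<and> \<not> S \<subseteq> P})"
  unfolding zariski_def by (simp add: topology_inverse' istopology_zariski)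

definition poisson_spec :: "('a, 'b) poisson_algebra_scheme \<Rightarrow> 'a set topology" where
  "poisson_spec A = subtopology (zariski A) {P. poisson_prime A P}"

definition poisson_locally_closed :: "('a, 'b) poisson_algebra_scheme \<Rightarrow> 'a set \<Rightarrow> bool" where
  "poisson_locally_closed A P \<longleftrightarrow> poisson_prime A P \<and>
     (\<exists>U C. openin (poisson_spec A) U \<and> closedin (poisson_spec A) C \<and> {P} = U \<inter> C)"

definition poisson_dixmier_moeglin :: "('a, 'b) poisson_algebra_scheme \<Rightarrow> bool" where
  "poisson_dixmier_moeglin A \<longleftrightarrow>
     {P. poisson_locally_closed A P} = {P. poisson_primitive A P} \<and>
     {P. poisson_primitive A P} = {P. poisson_rational A P}"

inductive_set polynomial_funs :: "('x \<Rightarrow> complex) set \<Rightarrow> ('x \<Rightarrow> complex) set"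
  for \<Gamma> :: "('x \<Rightarrow> complex) set" where
  const: "(\<lambda>_. c) \<in> polynomial_funs \<Gamma>"
| coord: "f \<in> \<Gamma> \<Longrightarrow> f \<in> polynomial_funs \<Gamma>"
| add: "f \<in> polynomial_funs \<Gamma> \<Longrightarrow> g \<in> polynomial_funs \<Gamma> \<Longrightarrow> (\<lambda>x. f x + g x) \<in> polynomial_funs \<Gamma>"
| mult: "f \<in> polynomial_funs \<Gamma> \<Longrightarrow> g \<in> polynomial_funs \<Gamma> \<Longrightarrow> (\<lambda>x. f x * g x) \<in> polynomial_funs \<Gamma>"

abbreviation polys :: "(complex ^ 'n \<Rightarrow> complex) set" where
  "polys \<equiv> polynomial_funs (range (\<lambda>i x. x $ i))"

abbreviation polys2 :: "((complex ^ 'n) \<times> (complex ^ 'n) \<Rightarrow> complex) set" where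
  "polys2 \<equiv> polynomial_funs (range (\<lambda>i (x, y). x $ i) \<union> range (\<lambda>i (x, y). y $ i))"

definition affine_variety :: "(complex ^ 'n) set \<Rightarrow> bool" where
  "affine_variety V \<longleftrightarrow> (\<exists>F\<subseteq>polys. V = {x. \<forall>f\<in>F. f x = 0})"

definition regular_function :: "(complex ^ 'n) set \<Rightarrow> (complex ^ 'n \<Rightarrow> complex) \<Rightarrow> bool" where
  "regular_function V f \<longleftrightarrow> (\<exists>p\<in>polys. \<forall>x\<in>V. f x = p x)"

definition algebraic_group :: "(complex ^ 'n) monoid \<Rightarrow> bool" where
  "algebraic_group G \<longleftrightarrow> group G \<and> affine_variety (carrier G) \<and>
     (\<forall>i. \<exists>p\<in>polys2. \<forall>x\<in>carrier G. \<forall>y\<in>carrier G. (x \<otimes>\<^bsub>G\<^esub> y) $ i = p (x, y)) \<and>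
     (\<forall>i. regular_function (carrier G) (\<lambda>x. (inv\<^bsub>G\<^esub> x) $ i))"

definition linear_form_on ::
    "(complex, 'a, 'b) module_scheme \<Rightarrow> 'a set \<Rightarrow> ('a \<Rightarrow> complex) \<Rightarrow> bool" where
  "linear_form_on A V \<xi> \<longleftrightarrow>
     (\<forall>u\<in>V. \<forall>v\<in>V. \<xi> (u \<oplus>\<^bsub>A\<^esub> v) = \<xi> u + \<xi> v) \<and> (\<forall>c. \<forall>v\<in>V. \<xi> (c \<odot>\<^bsub>A\<^esub> v) = c * \<xi> v)"

text \<open>
  A homomorphism \<open>G \<rightarrow> GL(V)\<close> is a morphism of varieties iff all its matrix coefficients
  \<open>g \<mapsto> \<xi>(g v)\<close> are regular on \<open>G\<close>, since \<open>GL(V)\<close> is open in \<open>End(V)\<close>.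
\<close>

definition rational_poisson_action ::
    "(complex ^ 'n) monoid \<Rightarrow> ('a, 'b) poisson_algebra_scheme \<Rightarrow> (complex ^ 'n \<Rightarrow> 'a \<Rightarrow> 'a) \<Rightarrow> bool"
  where
  "rational_poisson_action G A \<phi> \<longleftrightarrow>
     group_action G (carrier A) \<phi> \<and>
     (\<forall>g\<in>carrier G. \<phi> g \<in> ring_hom A A \<and>
        (\<forall>c. \<forall>a\<in>carrier A. \<phi> g (c \<odot>\<^bsub>A\<^esub> a) = c \<odot>\<^bsub>A\<^esub> \<phi> g a) \<and>
        (\<forall>a\<in>carrier A. \<forall>b\<in>carrier A. \<phi> g \<lbrace>a, b\<rbrace>\<^bsub>A\<^esub> = \<lbrace>\<phi> g a, \<phi> g b\<rbrace>\<^bsub>A\<^esub>)) \<and>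
     (\<exists>\<V>. \<Union>\<V> = carrier A \<and>
        (\<forall>V\<in>\<V>. \<forall>W\<in>\<V>. \<exists>E\<in>\<V>. V \<union> W \<subseteq> E) \<and>
        (\<forall>V\<in>\<V>. ring.finite_dimension A (scalars A) V \<and>
           (\<forall>g\<in>carrier G. \<phi> g ` V \<subseteq> V) \<and>
           (\<forall>v\<in>V. \<forall>\<xi>. linear_form_on A V \<xi> \<longrightarrow>
              regular_function (carrier G) (\<lambda>g. \<xi> (\<phi> g v)))))"

text \<open>
  The height of a prime ideal is the Krull dimension of the local ring there; a point is smooth
  if this equals the dimension of the cotangent space \<open>n/n\<^sup>2\<close>, which is computed inside the
  algebra \<open>B/n\<^sup>2\<close>.
\<close>

definition height :: "('a, 'b) ring_scheme \<Rightarrow> 'a set \<Rightarrow> enat" where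
  "height R P = Sup {enat k | k.
     \<exists>C :: nat \<Rightarrow> 'a set. (\<forall>i\<le>k. primeideal (C i) R) \<and> (\<forall>i<k. C i \<subset> C (Suc i)) \<and> C k = P}"

definition cotangent_dimension ::
    "(complex, 'a, 'b) module_scheme \<Rightarrow> 'a set \<Rightarrow> nat \<Rightarrow> bool" where
  "cotangent_dimension B n d \<longleftrightarrow>
     (let q = n \<cdot>\<^bsub>B\<^esub> n
      in ring.dimension (B Quot q) d ((\<lambda>x. q +>\<^bsub>B\<^esub> x) ` scalars B) ((\<lambda>x. q +>\<^bsub>B\<^esub> x) ` n))"

definition smooth_point :: "(complex, 'a, 'b) module_scheme \<Rightarrow> 'a set \<Rightarrow> bool" where
  "smooth_point B n \<longleftrightarrow> (\<exists>d. cotangent_dimension B n d \<and> height B n = enat d)"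

definition vanishing_ideal :: "('a, 'b) ring_scheme \<Rightarrow> 'a set set \<Rightarrow> 'a set" where
  "vanishing_ideal A Z = carrier A \<inter> \<Inter>Z"

definition singular_locus :: "('a, 'b) poisson_algebra_scheme \<Rightarrow> 'a set set \<Rightarrow> 'a set set" where
  "singular_locus A Z =
     (let I = vanishing_ideal A Z
      in {m \<in> Z. \<not> smooth_point (poisson_quot A I) ((\<lambda>x. I +>\<^bsub>A\<^esub> x) ` m)})"

primrec sing_filtration :: "('a, 'b) poisson_algebra_scheme \<Rightarrow> nat \<Rightarrow> 'a set set" where
  "sing_filtration A 0 = maxspec A"
| "sing_filtration A (Suc i) = singular_locus A (sing_filtration A i)"

definition smooth_stratum :: "('a, 'b) poisson_algebra_scheme \<Rightarrow> nat \<Rightarrow> 'a set set" where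
  "smooth_stratum A i = sing_filtration A i - sing_filtration A (Suc i)"

definition eval_at :: "(complex, 'a, 'b) module_scheme \<Rightarrow> 'a set \<Rightarrow> 'a \<Rightarrow> complex" where
  "eval_at A m a = (THE c. a \<ominus>\<^bsub>A\<^esub> c \<odot>\<^bsub>A\<^esub> \<one>\<^bsub>A\<^esub> \<in> m)"

definition eval_coords ::
    "(complex, 'a, 'b) module_scheme \<Rightarrow> 'a set \<Rightarrow> 'a set \<Rightarrow> ('a \<Rightarrow> complex)" where
  "eval_coords A S m = (\<lambda>a. if a \<in> S then eval_at A m a else 0)"

text \<open>
  \<open>F\<close> is holomorphic on the open set \<open>U\<close> in the variables indexed by the finite set \<open>S\<close>
  (continuously differentiable with complex partial derivatives), with partials \<open>D\<close>.
  Only points vanishing outside \<open>S\<close>, a copy of \<open>\<complex>\<^sup>S\<close>, will matter; openness refers to the product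
  topology, which restricts to the usual topology there.
\<close>

definition holomorphic_partials ::
    "'i set \<Rightarrow> ('i \<Rightarrow> complex) set \<Rightarrow> (('i \<Rightarrow> complex) \<Rightarrow> complex) \<Rightarrow>
     ('i \<Rightarrow> ('i \<Rightarrow> complex) \<Rightarrow> complex) \<Rightarrow> bool" where
  "holomorphic_partials S U F D \<longleftrightarrow> open U \<and>
     (\<forall>i\<in>S. continuous_on U (D i) \<and>
        (\<forall>x\<in>U. ((\<lambda>w. F (x(i := w))) has_field_derivative D i x) (at (x i))))"

text \<open>
  Around each of its points, a holomorphic function on a smooth locally closed
  \<open>M \<subseteq> maxspec A\<close> has the form \<open>h = F(a\<^sub>1, \<dots>, a\<^sub>k)\<close> with \<open>F\<close> holomorphic on an open subset of
  \<open>\<complex>\<^sup>k\<close> and \<open>a\<^sub>1, \<dots>, a\<^sub>k\<close> in \<open>A\<close>. Its Hamiltonian vector field is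
  \<open>{h, b} = \<Sum>\<^sub>j (\<partial>\<^sub>j F)(a\<^sub>1, \<dots>, a\<^sub>k) {a\<^sub>j, b}\<close>. Since flows will be concatenated, it is enough to
  consider integral curves on which one such expression is valid throughout. Time is real:
  flowing along \<open>h\<close> for complex time \<open>c\<close> on a segment is flowing along \<open>c h\<close> for real time.
\<close>

definition hamiltonian_curve ::
    "('a, 'b) poisson_algebra_scheme \<Rightarrow> 'a set set \<Rightarrow> real \<Rightarrow> (real \<Rightarrow> 'a set) \<Rightarrow> bool" where
  "hamiltonian_curve A M T \<gamma> \<longleftrightarrow> \<gamma> \<in> {0..T} \<rightarrow> M \<and>
     (\<exists>S U F D. finite S \<and> S \<subseteq> carrier A \<and> holomorphic_partials S U F D \<and>
        (\<forall>t\<in>{0..T}. eval_coords A S (\<gamma> t) \<in> U \<and>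
           (\<forall>b\<in>carrier A.
              ((\<lambda>s. eval_at A (\<gamma> s) b) has_vector_derivative
                (\<Sum>a\<in>S. D a (eval_coords A S (\<gamma> t)) * eval_at A (\<gamma> t) \<lbrace>a, b\<rbrace>\<^bsub>A\<^esub>))
              (at t within {0..T}))))"

definition hamiltonian_step ::
    "('a, 'b) poisson_algebra_scheme \<Rightarrow> 'a set set \<Rightarrow> 'a set \<Rightarrow> 'a set \<Rightarrow> bool" where
  "hamiltonian_step A M m n \<longleftrightarrow>
     (\<exists>T \<gamma>. 0 \<le> T \<and> hamiltonian_curve A M T \<gamma> \<and> \<gamma> 0 = m \<and> \<gamma> T = n)"

definition symplectic_leaf ::
    "('a, 'b) poisson_algebra_scheme \<Rightarrow> 'a set set \<Rightarrow> 'a set \<Rightarrow> 'a set set" where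
  "symplectic_leaf A M m = {n. (hamiltonian_step A M)\<^sup>*\<^sup>* m n}"

definition symplectic_leaves :: "('a, 'b) poisson_algebra_scheme \<Rightarrow> 'a set set set" where
  "symplectic_leaves A =
     {symplectic_leaf A (smooth_stratum A i) m | i m. m \<in> smooth_stratum A i}"

definition symplectic_cores :: "('a, 'b) poisson_algebra_scheme \<Rightarrow> 'a set set set" where
  "symplectic_cores A =
     maxspec A // {(m, n). m \<in> maxspec A \<and> n \<in> maxspec A \<and> poisson_core A m = poisson_core A n}"

definition act_on_point_sets :: "('g \<Rightarrow> 'a \<Rightarrow> 'a) \<Rightarrow> 'g \<Rightarrow> 'a set set \<Rightarrow> 'a set set" where
  "act_on_point_sets \<phi> g L = (\<lambda>m. \<phi> g ` m) ` L"

end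

theory Submission
  imports Defs "HOL-Computational_Algebra.Polynomial" "HOL-Library.Function_Algebras"
begin

text \<open>
  Locally closed primes are primitive because a Poisson prime is the intersection of the Poisson
  cores of the maximal ideals containing it, and primitive ideals are rational because a central
  fraction \<open>z\<close> of \<open>A/P\<close> has, by the Nullstellensatz, a value \<open>\<zeta>\<close> at the maximal ideal, so that
  the multiples of \<open>z - \<zeta>\<close> in \<open>A/P\<close> form a Poisson ideal inside it.

  Let \<open>P\<close> be rational. If \<open>P \<subseteq> gQ\<close> for all \<open>g\<close> in \<open>E \<subseteq> G\<close> and \<open>P = (\<Inter>g\<in>E. gQ)\<close>, then \<open>P = gQ\<close> for
  some \<open>g \<in> E\<close>: as a generator \<open>q\<close> of \<open>Q\<close> moves in a finite dimensional space, a linear relation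
  \<open>\<Sum>c\<^sub>i(g) a\<^sub>i \<in> gQ\<close> that holds for generic \<open>g\<close> can be shortened by taking brackets, unless all quotients
  \<open>a\<^sub>i/a\<^sub>j\<close> are Poisson central modulo \<open>P\<close>, that is, constants. Hence if the primitive ideals
  form finitely many orbits, then the ones properly containing \<open>P\<close> do not intersect in \<open>P\<close>,
  and \<open>P\<close> is locally closed.

  Poisson cores are constant along Hamiltonian curves by a Gronwall estimate applied to
  generators of the core, so leaves lie in symplectic cores. Every maximal ideal lies on some leaf
  since a variety is generically smooth, which makes the ideals of the iterated singular loci
  a strictly ascending chain.
\<close>

text \<open>The coefficients c_i(g) are treated as bare functions on E. "Generic" means: away from
  the g for which one fixed element outside P lies in gQ; since P is the intersection of the gQ,
  such g exist. Bracketing a relation with b and eliminating a_n leaves the same coefficients, now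
  on w_i = a_n {a_i, b} - a_i {a_n, b}, and w_n = 0. By induction this shorter relation holds modulo
  P already. If some w_i is not in P, the coefficients therefore obey one fixed linear relation, and
  that relation removes an a_k from the original one.

  The other obstacle is that smoothness equates a height with a cotangent dimension, so generic
  smoothness needs dimension theory. It is developed along a tower of simple extensions C[b] with a
  number r that grows by one when b is transcendental over C and stays when b is algebraic. Going
  down and explicit primes give chains of length r, counting monomials forbids longer ones, and
  point derivations show that r differentials form a cotangent basis. All of this holds where one
  nonzero function f does not vanish; f collects the leading coefficients and derivatives of the
  minimal polynomials.\<close>

section \<open>Prime ideals avoiding a multiplicative set\<close>

definition set_ring :: "'r::comm_ring_1 set \<Rightarrow> 'r ring" where
  "set_ring C = \<lparr>carrier = C, mult = (*), one = 1, zero = 0, add = (+)\<rparr>"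

lemma set_ring_simps [simp]:
  "carrier (set_ring C) = C" "mult (set_ring C) = (*)" "one (set_ring C) = 1"
  "zero (set_ring C) = 0" "add (set_ring C) = (+)"
  by (simp_all add: set_ring_def)

text \<open>Zorn's lemma gives an ideal maximal among those that miss \<open>S\<close>, and such an
  ideal is prime. The last conclusion is maximality in terms of elements; in the Nullstellensatz it
  inverts a - c up to a power of f.\<close>

lemma (in cring) exists_maximal_avoiding:
  assumes I: "ideal I R" and S: "S \<subseteq> carrier R" "\<one> \<in> S"
    and mult: "\<And>s t. s \<in> S \<Longrightarrow> t \<in> S \<Longrightarrow> s \<otimes> t \<in> S"
    and disj: "I \<inter> S = {}"
  obtains P where "primeideal P R" "I \<subseteq> P" "P \<inter> S = {}"
    "\<And>a. a \<in> carrier R \<Longrightarrow> a \<notin> P \<Longrightarrow> \<exists>m\<in>P. \<exists>r\<in>carrier R. m \<oplus> r \<otimes> a \<in> S"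
proof -
  define \<A> where "\<A> = {J. ideal J R \<and> I \<subseteq> J \<and> J \<inter> S = {}}"
  have "\<exists>M\<in>\<A>. (\<forall>Y\<in>\<A>. M \<subseteq> Y \<longrightarrow> Y = M)"
  proof (rule subset_Zorn_nonempty)
    show "\<A> \<noteq> {}" using I disj unfolding \<A>_def by blast
  next
    fix \<C> assume ne: "\<C> \<noteq> {}" and ch: "subset.chain \<A> \<C>"
    have sub: "\<C> \<subseteq> \<A>" using ch by (simp add: subset.chain_def)
    have "subset.chain {I. ideal I R} \<C>"
      using ch unfolding subset.chain_def \<A>_def by blast
    from chain_Union_is_ideal[OF this] have "ideal (\<Union>\<C>) R" using ne by simp
    then show "\<Union>\<C> \<in> \<A>" using sub ne unfolding \<A>_def by blast
  qed
  then obtain M where M: "ideal M R" "I \<subseteq> M" "M \<inter> S = {}"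
    and max: "\<And>Y. ideal Y R \<Longrightarrow> M \<subseteq> Y \<Longrightarrow> Y \<inter> S = {} \<Longrightarrow> Y = M"
    unfolding \<A>_def by (metis (mono_tags, lifting) mem_Collect_eq subset_trans)
  interpret M: ideal M R by fact
  have hit: "\<exists>m\<in>M. \<exists>r\<in>carrier R. m \<oplus> r \<otimes> a \<in> S" if a: "a \<in> carrier R" "a \<notin> M" for a
  proof -
    let ?Y = "M <+>\<^bsub>R\<^esub> PIdl a"
    have Y: "ideal ?Y R" using M(1) cgenideal_ideal[OF a(1)] by (rule add_ideals)
    have PI: "PIdl a = {r \<otimes> a | r. r \<in> carrier R}" by (simp add: cgenideal_def)
    have "M \<subseteq> ?Y"
    proof
      fix m assume m: "m \<in> M"
      have "\<zero> \<in> PIdl a" using a by (auto simp: PI intro!: exI[of _ "\<zero>"])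
      moreover have "m = m \<oplus> \<zero>" using m by simp
      ultimately show "m \<in> ?Y" using m unfolding set_add_def' by blast
    qed
    moreover have "a \<in> ?Y"
    proof -
      have "a \<in> PIdl a" by (rule cgenideal_self[OF a(1)])
      moreover have "a = \<zero> \<oplus> a" using a by simp
      ultimately show ?thesis using M.zero_closed unfolding set_add_def' by blast
    qed
    ultimately have "?Y \<inter> S \<noteq> {}" using max[OF Y] a(2) by blast
    then show ?thesis unfolding set_add_def' PI by blast
  qed
  have "primeideal M R"
  proof (rule primeidealI[OF M(1)])
    show "cring R" by (rule is_cring)
    show "carrier R \<noteq> M" using M(3) S by blast
    fix a b assume ab: "a \<in> carrier R" "b \<in> carrier R" "a \<otimes> b \<in> M"
    show "a \<in> M \<or> b \<in> M"
    proof (rule ccontr)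
      assume "\<not> (a \<in> M \<or> b \<in> M)"
      then obtain m r n t where mr: "m \<in> M" "r \<in> carrier R" "m \<oplus> r \<otimes> a \<in> S"
        and nt: "n \<in> M" "t \<in> carrier R" "n \<oplus> t \<otimes> b \<in> S"
        using hit ab by metis
      have mc: "m \<in> carrier R" "n \<in> carrier R" using mr nt by auto
      have "(m \<oplus> r \<otimes> a) \<otimes> (n \<oplus> t \<otimes> b) = (n \<oplus> t \<otimes> b) \<otimes> m \<oplus> ((r \<otimes> a) \<otimes> n \<oplus> (r \<otimes> t) \<otimes> (a \<otimes> b))"
        using mc mr(2) nt(2) ab by (simp add: r_distr l_distr m_ac a_ac)
      also have "\<dots> \<in> M"
        using M.I_l_closed[OF mr(1), of "n \<oplus> t \<otimes> b"] M.I_l_closed[OF nt(1), of "r \<otimes> a"]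
          M.I_l_closed[OF ab(3), of "r \<otimes> t"] mr nt ab mc by (intro M.a_closed) simp_all
      finally show False using mult[OF mr(3) nt(3)] M(3) by blast
    qed
  qed
  then show ?thesis using that M hit by blast
qed

lemma (in cring) exists_prime_avoiding:
  assumes I: "ideal I R" and S: "S \<subseteq> carrier R" "\<one> \<in> S"
    and mult: "\<And>s t. s \<in> S \<Longrightarrow> t \<in> S \<Longrightarrow> s \<otimes> t \<in> S"
    and disj: "I \<inter> S = {}"
  shows "\<exists>P. primeideal P R \<and> I \<subseteq> P \<and> P \<inter> S = {}"
  using exists_maximal_avoiding[OF I S mult disj] by metis

text \<open>The library's \<^const>\<open>pderiv\<close> requires a ring without zero divisors, which rings of functions are not.\<close>

definition pder :: "'s::comm_ring_1 poly \<Rightarrow> 's poly" where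
  "pder G = (\<Sum>i<Polynomial.degree G. Polynomial.monom (of_nat (Suc i) * Polynomial.coeff G (Suc i)) i)"

lemma coeff_pder: "Polynomial.coeff (pder G) n = of_nat (Suc n) * Polynomial.coeff G (Suc n)"
  by (auto simp: pder_def coeff_sum Polynomial.coeff_monom coeff_eq_0 simp del: of_nat_Suc)

lemma pder_0 [simp]: "pder 0 = 0" by (simp add: pder_def)

lemma pder_pCons: "pder (pCons c G) = G + pCons 0 (pder G)"
  by (rule poly_eqI) (auto simp: coeff_pder coeff_pCons algebra_simps split: nat.splits)

section \<open>Subalgebras of a complex algebra with evaluation points\<close>

text \<open>A complex algebra with structure map \<open>\<kappa>\<close> and a family of complex
  points \<open>ev x\<close>. Subalgebras are sets inside one fixed type, so a whole tower of
  extensions can use the type class polynomials over \<open>'r\<close>. Since there is at least one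
  point, 1 differs from 0.\<close>

locale complex_eval =
  fixes \<kappa> :: "complex \<Rightarrow> 'r::comm_ring_1" and ev :: "'x \<Rightarrow> 'r \<Rightarrow> complex"
  assumes kadd: "\<kappa> (a + b) = \<kappa> a + \<kappa> b" and kmult: "\<kappa> (a * b) = \<kappa> a * \<kappa> b"
    and kone: "\<kappa> 1 = 1"
    and eadd: "ev x (u + v) = ev x u + ev x v" and emult: "ev x (u * v) = ev x u * ev x v"
    and ek: "ev x (\<kappa> c) = c"
begin

lemma kzero: "\<kappa> 0 = 0" using kadd[of 0 0] by simp
lemma kminus: "\<kappa> (- a) = - \<kappa> a" using kadd[of a "- a"] kzero by (simp add: eq_neg_iff_add_eq_0 add.commute)
lemma kdiff: "\<kappa> (a - b) = \<kappa> a - \<kappa> b" using kadd[of a "- b"] kminus by simp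
lemma kof_nat: "\<kappa> (of_nat n) = of_nat n" by (induction n) (simp_all add: kzero kadd kone)
lemma ezero: "ev x 0 = 0" using eadd[of x 0 0] by simp
lemma eone: "ev x 1 = 1" using ek[of x 1] kone by simp
lemma eminus: "ev x (- u) = - ev x u" using eadd[of x u "- u"] ezero by (simp add: eq_neg_iff_add_eq_0 add.commute)
lemma ediff: "ev x (u - v) = ev x u - ev x v" using eadd[of x u "- v"] eminus by simp
lemma epower: "ev x (u ^ n) = ev x u ^ n" by (induction n) (simp_all add: eone emult)
lemma kcancel: "c \<noteq> 0 \<Longrightarrow> \<kappa> (inverse c) * \<kappa> c = 1" by (simp flip: kmult add: kone)

lemmas ksimps = kadd kmult kone kzero kminus kdiff
lemmas esimps = eadd emult eone ezero eminus ediff ek epower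

sublocale V: vector_space "\<lambda>c u. \<kappa> c * u"
  by unfold_locales (simp_all add: ksimps algebra_simps)

definition csub :: "'r set \<Rightarrow> bool" where
  "csub C \<longleftrightarrow> range \<kappa> \<subseteq> C \<and> (\<forall>u\<in>C. \<forall>v\<in>C. u + v \<in> C \<and> u * v \<in> C)"

lemma csubD:
  assumes "csub C"
  shows "\<kappa> c \<in> C" "0 \<in> C" "1 \<in> C" "u \<in> C \<Longrightarrow> v \<in> C \<Longrightarrow> u + v \<in> C"
    "u \<in> C \<Longrightarrow> v \<in> C \<Longrightarrow> u * v \<in> C" "u \<in> C \<Longrightarrow> - u \<in> C" "u \<in> C \<Longrightarrow> v \<in> C \<Longrightarrow> u - v \<in> C"
    "of_nat n \<in> C" "u \<in> C \<Longrightarrow> u ^ n \<in> C"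
proof -
  have k: "\<kappa> c \<in> C" for c using assms by (auto simp: csub_def)
  show "\<kappa> c \<in> C" "0 \<in> C" "1 \<in> C" "of_nat n \<in> C"
    using k[of c] k[of 0] k[of 1] k[of "of_nat n"] by (simp_all add: ksimps kof_nat)
  have m: "\<And>u v. u \<in> C \<Longrightarrow> v \<in> C \<Longrightarrow> u * v \<in> C" and a: "\<And>u v. u \<in> C \<Longrightarrow> v \<in> C \<Longrightarrow> u + v \<in> C"
    using assms by (auto simp: csub_def)
  show "u \<in> C \<Longrightarrow> v \<in> C \<Longrightarrow> u + v \<in> C" "u \<in> C \<Longrightarrow> v \<in> C \<Longrightarrow> u * v \<in> C" using a m by auto
  have n: "- u \<in> C" if "u \<in> C" for u using m[OF k[of "-1"] that] by (simp add: ksimps)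
  show "u \<in> C \<Longrightarrow> - u \<in> C" using n .
  show "u \<in> C \<Longrightarrow> v \<in> C \<Longrightarrow> u - v \<in> C" using a[OF _ n, of u v] by simp
  show "u \<in> C \<Longrightarrow> u ^ n \<in> C" using k[of 1] by (induction n) (auto simp: kone m)
qed

lemma csub_sum: "csub C \<Longrightarrow> (\<And>i. i \<in> I \<Longrightarrow> g i \<in> C) \<Longrightarrow> (\<Sum>i\<in>I. g i) \<in> C"
  by (induction I rule: infinite_finite_induct) (auto simp: csubD)

lemma cring_set_ring: assumes "csub C" shows "cring (set_ring C)"
proof (rule cringI)
  show "abelian_group (set_ring C)"
  proof (rule abelian_groupI)
    fix x assume "x \<in> carrier (set_ring C)"
    then show "\<exists>y\<in>carrier (set_ring C). y \<oplus>\<^bsub>set_ring C\<^esub> x = \<zero>\<^bsub>set_ring C\<^esub>"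
      using csubD(6)[OF assms] by (intro bexI[of _ "- x"]) auto
  qed (use csubD[OF assms] in \<open>auto simp: algebra_simps\<close>)
  show "Group.comm_monoid (set_ring C)"
    by (rule comm_monoidI) (use csubD[OF assms] in \<open>auto simp: algebra_simps\<close>)
qed (auto simp: algebra_simps)

definition cideal :: "'r set \<Rightarrow> 'r set \<Rightarrow> bool" where
  "cideal C I \<longleftrightarrow> I \<subseteq> C \<and> 0 \<in> I \<and> (\<forall>u\<in>I. \<forall>v\<in>I. u + v \<in> I) \<and> (\<forall>c\<in>C. \<forall>u\<in>I. c * u \<in> I)"

definition cprime :: "'r set \<Rightarrow> 'r set \<Rightarrow> bool" where
  "cprime C P \<longleftrightarrow> cideal C P \<and> 1 \<notin> P \<and> (\<forall>u\<in>C. \<forall>v\<in>C. u * v \<in> P \<longrightarrow> u \<in> P \<or> v \<in> P)"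

text \<open>Polynomials need a type class ring, while the ideal theory is stated for ring records.
  This lemma and the next carry ideals and primes between the two.\<close>

lemma ideal_set_ring: assumes C: "csub C" shows "ideal I (set_ring C) \<longleftrightarrow> cideal C I"
proof
  assume "ideal I (set_ring C)"
  then interpret I: ideal I "set_ring C" .
  show "cideal C I" unfolding cideal_def
    using I.a_subset additive_subgroup.zero_closed[OF I.additive_subgroup_axioms]
      additive_subgroup.a_closed[OF I.additive_subgroup_axioms] I.I_l_closed by simp
next
  assume I: "cideal C I"
  interpret R: cring "set_ring C" by (rule cring_set_ring[OF C])
  show "ideal I (set_ring C)"
  proof (rule idealI)
    show "ring (set_ring C)" by (rule R.ring_axioms)
    show "subgroup I (add_monoid (set_ring C))"
    proof (rule R.add.subgroupI)
      show "I \<noteq> {}" "I \<subseteq> carrier (set_ring C)" using I by (auto simp: cideal_def)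
      fix u assume u: "u \<in> I"
      then have uC: "u \<in> C" using I by (auto simp: cideal_def)
      have "\<ominus>\<^bsub>set_ring C\<^esub> u = - u"
        using uC csubD(6)[OF C uC] by (intro R.minus_equality) auto
      also have "- u = \<kappa> (-1) * u" by (simp add: ksimps)
      also have "\<dots> \<in> I" using I u csubD(1)[OF C] unfolding cideal_def by blast
      finally show "\<ominus>\<^bsub>set_ring C\<^esub> u \<in> I" .
    next
      fix u v assume "u \<in> I" "v \<in> I"
      then show "u \<oplus>\<^bsub>set_ring C\<^esub> v \<in> I" using I by (auto simp: cideal_def)
    qed
    fix a u assume a: "a \<in> I" and u: "u \<in> carrier (set_ring C)"
    then have "u * a \<in> I" using I by (auto simp: cideal_def)
    then show "u \<otimes>\<^bsub>set_ring C\<^esub> a \<in> I" "a \<otimes>\<^bsub>set_ring C\<^esub> u \<in> I"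
      by (simp_all add: mult.commute)
  qed
qed

lemma primeideal_set_ring: assumes C: "csub C" shows "primeideal P (set_ring C) \<longleftrightarrow> cprime C P"
proof
  assume "primeideal P (set_ring C)"
  then interpret primeideal P "set_ring C" .
  have "1 \<notin> P" using I_notcarr one_imp_carrier by auto
  then show "cprime C P"
    unfolding cprime_def using is_ideal ideal_set_ring[OF C] I_prime by auto
next
  assume P: "cprime C P"
  then have "ideal P (set_ring C)" by (simp add: ideal_set_ring[OF C] cprime_def)
  then show "primeideal P (set_ring C)"
    by (rule primeidealI) (use P cring_set_ring[OF C] csubD(3)[OF C] in \<open>auto simp: cprime_def\<close>)
qed

lemma cprimeD:
  assumes "cprime C P"
  shows "P \<subseteq> C" "0 \<in> P" "1 \<notin> P" "u \<in> P \<Longrightarrow> v \<in> P \<Longrightarrow> u + v \<in> P" "c \<in> C \<Longrightarrow> u \<in> P \<Longrightarrow> c * u \<in> P"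
    "u \<in> C \<Longrightarrow> v \<in> C \<Longrightarrow> u * v \<in> P \<Longrightarrow> u \<in> P \<or> v \<in> P"
  using assms by (auto simp: cprime_def cideal_def)

lemma cprime_power: "csub C \<Longrightarrow> cprime C P \<Longrightarrow> u \<in> C \<Longrightarrow> u ^ n \<in> P \<Longrightarrow> u \<in> P"
  by (induction n) (auto dest: cprimeD csubD)

lemma cideal_sum: "cideal C I \<Longrightarrow> (\<And>i. i \<in> J \<Longrightarrow> g i \<in> I) \<Longrightarrow> (\<Sum>i\<in>J. g i) \<in> I"
  by (induction J rule: infinite_finite_induct) (auto simp: cideal_def)

text \<open>The maximal ideal of the point \<open>x\<close> in \<open>C\<close>.\<close>

definition nx :: "'r set \<Rightarrow> 'x \<Rightarrow> 'r set" where "nx C x = {u \<in> C. ev x u = 0}"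

lemma cprime_nx: "csub C \<Longrightarrow> cprime C (nx C x)"
  by (auto simp: cprime_def cideal_def nx_def esimps csubD)

subsection \<open>Simple extensions\<close>

definition polc :: "'r set \<Rightarrow> 'r poly set" where "polc C = {G. \<forall>i. Polynomial.coeff G i \<in> C}"

definition adj :: "'r set \<Rightarrow> 'r \<Rightarrow> 'r set" where "adj C b = (\<lambda>G. poly G b) ` polc C"

lemma polc_pCons: "csub C \<Longrightarrow> pCons c G \<in> polc C \<longleftrightarrow> c \<in> C \<and> G \<in> polc C"
  by (auto simp: polc_def coeff_pCons split: nat.splits)

lemma polc_closed:
  assumes C: "csub C"
  shows "0 \<in> polc C" "G \<in> polc C \<Longrightarrow> H \<in> polc C \<Longrightarrow> G + H \<in> polc C"
    "G \<in> polc C \<Longrightarrow> H \<in> polc C \<Longrightarrow> G - H \<in> polc C"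
    "G \<in> polc C \<Longrightarrow> H \<in> polc C \<Longrightarrow> G * H \<in> polc C"
    "c \<in> C \<Longrightarrow> G \<in> polc C \<Longrightarrow> Polynomial.smult c G \<in> polc C" "c \<in> C \<Longrightarrow> Polynomial.monom c n \<in> polc C"
    "G \<in> polc C \<Longrightarrow> pder G \<in> polc C"
  using C by (auto simp: polc_def coeff_mult coeff_pder Polynomial.coeff_monom csubD simp del: of_nat_Suc intro!: csub_sum csubD)

lemma polc_induct [consumes 2, case_names 0 pCons]:
  assumes "csub C" "G \<in> polc C" "P 0"
    "\<And>c G. c \<in> C \<Longrightarrow> G \<in> polc C \<Longrightarrow> P G \<Longrightarrow> P (pCons c G)"
  shows "P G"
  using assms(2) by (induction G) (auto simp: polc_pCons[OF assms(1)] assms(3,4))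

lemma poly_in: assumes C: "csub C" shows "G \<in> polc C \<Longrightarrow> b \<in> C \<Longrightarrow> poly G b \<in> C"
  using C by (induction rule: polc_induct) (simp_all add: csubD(2,4,5)[OF C])

lemma csub_adj: assumes C: "csub C" shows "csub (adj C b)"
proof -
  have "\<kappa> c \<in> adj C b" for c
    using csubD(1,2)[OF C] polc_closed(1)[OF C]
    by (auto simp: adj_def polc_pCons[OF C] intro!: image_eqI[of _ _ "[:\<kappa> c:]"])
  moreover have "u + v \<in> adj C b \<and> u * v \<in> adj C b" if "u \<in> adj C b" "v \<in> adj C b" for u v
  proof -
    from that obtain G H where GH: "G \<in> polc C" "H \<in> polc C" "u = poly G b" "v = poly H b"
      by (auto simp: adj_def)
    then show ?thesis using polc_closed(2,4)[OF C GH(1,2)] by (auto simp: adj_def simp flip: poly_add poly_mult)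
  qed
  ultimately show ?thesis by (auto simp: csub_def)
qed

lemma adj_sup: assumes C: "csub C" shows "C \<subseteq> adj C b" "b \<in> adj C b"
proof -
  show "C \<subseteq> adj C b"
  proof
    fix c assume "c \<in> C"
    then show "c \<in> adj C b" using polc_closed(1)[OF C]
      by (auto simp: adj_def polc_pCons[OF C] intro!: image_eqI[of _ _ "[:c:]"])
  qed
  show "b \<in> adj C b" using polc_closed(1)[OF C] csubD(2,3)[OF C]
      by (auto simp: adj_def polc_pCons[OF C] intro!: image_eqI[of _ _ "[:0,1:]"])
qed

lemma adj_least: "csub D \<Longrightarrow> C \<subseteq> D \<Longrightarrow> b \<in> D \<Longrightarrow> adj C b \<subseteq> D"
  by (force simp: adj_def polc_def intro!: poly_in)

lemma adj_mem: "G \<in> polc C \<Longrightarrow> poly G b \<in> adj C b" by (auto simp: adj_def)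

definition cdom :: "'r set \<Rightarrow> bool" where
  "cdom C \<longleftrightarrow> csub C \<and> (\<forall>u\<in>C. \<forall>v\<in>C. u * v = 0 \<longrightarrow> u = 0 \<or> v = 0)"

lemma cdomD: assumes "cdom C" shows "csub C" "u \<in> C \<Longrightarrow> v \<in> C \<Longrightarrow> u * v = 0 \<Longrightarrow> u = 0 \<or> v = 0"
    "u \<in> C \<Longrightarrow> u ^ n = 0 \<Longrightarrow> u = 0"
proof -
  show 1: "csub C" using assms by (auto simp: cdom_def)
  show 2: "u \<in> C \<Longrightarrow> v \<in> C \<Longrightarrow> u * v = 0 \<Longrightarrow> u = 0 \<or> v = 0" for u v using assms by (auto simp: cdom_def)
  have "(1::'r) \<noteq> 0" using eone ezero by (metis zero_neq_one)
  then show "u \<in> C \<Longrightarrow> u ^ n = 0 \<Longrightarrow> u = 0"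
    by (induction n) (auto dest: 2 intro: csubD(9)[OF 1] simp: csubD(9)[OF 1])
qed

lemma cideal_diff: assumes "csub C" "cideal C I" "u \<in> I" "v \<in> I" shows "u - v \<in> I"
proof -
  have "\<kappa> (-1) * v \<in> I" using assms csubD(1)[OF assms(1)] unfolding cideal_def by blast
  then have "u + \<kappa> (-1) * v \<in> I" using assms unfolding cideal_def by blast
  then show ?thesis by (simp add: ksimps)
qed

text \<open>The leading coefficient of \<open>F\<close> need not be invertible, so each of the
  \<open>n\<close> cancellations costs one factor of it. Keeping the coefficients of
  \<open>G\<close> in an ideal \<open>I\<close> keeps the remainder over \<open>I\<close> as well:
  going down takes for \<open>I\<close> a prime of \<open>C\<close>, and ordinary division takes
  \<open>C\<close>.\<close>

lemma pseudo_division: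
  assumes C: "csub C" and F: "F \<in> polc C" and I: "cideal C I"
  shows "G \<in> polc I \<Longrightarrow> (\<forall>i\<ge>Polynomial.degree F + n. Polynomial.coeff G i = 0) \<Longrightarrow>
    \<exists>H\<in>polc C. \<exists>S\<in>polc I. Polynomial.smult (Polynomial.coeff F (Polynomial.degree F) ^ n) G = F * H + S \<and>
      (\<forall>i\<ge>Polynomial.degree F. Polynomial.coeff S i = 0)"
proof (induction n arbitrary: G)
  case 0
  then show ?case by (intro bexI[of _ 0] bexI[of _ G]) (auto simp: polc_closed[OF C])
next
  case (Suc n)
  let ?d = "Polynomial.degree F"
  let ?l = "Polynomial.coeff F ?d"
  define c where "c = Polynomial.coeff G (?d + n)"
  define G' where "G' = Polynomial.smult ?l G - Polynomial.monom c n * F"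
  have lC: "?l \<in> C" and cI: "c \<in> I" using F Suc.prems by (auto simp: polc_def c_def)
  then have cC: "c \<in> C" using I by (auto simp: cideal_def)
  have G': "G' \<in> polc I"
    unfolding polc_def
  proof (intro CollectI allI)
    fix i
    have "?l * Polynomial.coeff G i \<in> I" using Suc.prems(1) lC I by (auto simp: polc_def cideal_def)
    moreover have "Polynomial.coeff F (i - n) * c \<in> I" "0 \<in> I"
      using F cI I by (auto simp: polc_def cideal_def)
    then have "Polynomial.coeff (Polynomial.monom c n * F) i \<in> I"
      by (simp add: Polynomial.coeff_monom_mult mult.commute[of c])
    ultimately show "Polynomial.coeff G' i \<in> I"
      unfolding G'_def by (simp add: cideal_diff[OF C I])
  qed
  have "Polynomial.coeff G' i = 0" if "i \<ge> ?d + n" for i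
  proof (cases "i = ?d + n")
    case True
    then show ?thesis by (simp add: G'_def Polynomial.coeff_monom_mult c_def)
  next
    case False
    then have "Polynomial.coeff G i = 0" "Polynomial.coeff F (i - n) = 0" using Suc.prems that by (auto intro: coeff_eq_0)
    then show ?thesis by (simp add: G'_def Polynomial.coeff_monom_mult)
  qed
  then obtain H S where HS: "H \<in> polc C" "S \<in> polc I" "Polynomial.smult (?l ^ n) G' = F * H + S"
    "\<forall>i\<ge>?d. Polynomial.coeff S i = 0" using Suc.IH[OF G'] by auto
  have "Polynomial.smult (?l ^ Suc n) G = Polynomial.smult (?l ^ n) G' + Polynomial.smult (?l ^ n) (Polynomial.monom c n) * F"
    by (simp add: G'_def smult_diff_right mult.commute)
  also have "\<dots> = F * (H + Polynomial.smult (?l ^ n) (Polynomial.monom c n)) + S" using HS(3) by (simp add: algebra_simps)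
  finally show ?case using HS lC cC
    by (intro bexI[of _ "H + Polynomial.smult (?l ^ n) (Polynomial.monom c n)"] bexI[of _ S] polc_closed[OF C] csubD[OF C]) auto
qed

lemma cideal_self: "csub C \<Longrightarrow> cideal C C" by (auto simp: cideal_def csubD)

text \<open>A polynomial of least degree vanishing at an algebraic element.\<close>

definition minpoly :: "'r set \<Rightarrow> 'r \<Rightarrow> 'r poly \<Rightarrow> bool" where
  "minpoly C b F \<longleftrightarrow> F \<in> polc C \<and> F \<noteq> 0 \<and> poly F b = 0 \<and>
     (\<forall>G\<in>polc C. poly G b = 0 \<longrightarrow> (\<forall>i\<ge>Polynomial.degree F. Polynomial.coeff G i = 0) \<longrightarrow> G = 0)"

lemma exists_minpoly:
  assumes "G \<in> polc C" "G \<noteq> 0" "poly G b = 0" shows "\<exists>F. minpoly C b F"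
proof -
  let ?Q = "\<lambda>F. F \<in> polc C \<and> F \<noteq> 0 \<and> poly F b = 0"
  define F where "F = arg_min Polynomial.degree ?Q"
  have F: "?Q F" "\<And>H. ?Q H \<Longrightarrow> Polynomial.degree F \<le> Polynomial.degree H"
    using arg_min_nat_lemma[of ?Q G Polynomial.degree] assms unfolding F_def by auto
  have "H = 0" if "H \<in> polc C" "poly H b = 0" "\<forall>i\<ge>Polynomial.degree F. Polynomial.coeff H i = 0" for H
  proof (rule ccontr)
    assume "H \<noteq> 0"
    then have "Polynomial.coeff H (Polynomial.degree H) \<noteq> 0" by simp
    then have "Polynomial.degree H < Polynomial.degree F" using that(3) by (meson not_less)
    then show False using F(2)[of H] that \<open>H \<noteq> 0\<close> by auto
  qed
  then show ?thesis using F(1) unfolding minpoly_def by blast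
qed

text \<open>The remainder of pseudo-division vanishes at \<open>b\<close> below the degree of
  \<open>F\<close>, so minimality makes it zero. This replaces division over the fraction field of
  \<open>C\<close>.\<close>

lemma minpoly_dvd:
  assumes C: "csub C" and F: "minpoly C b F" and G: "G \<in> polc C" "poly G b = 0"
  shows "\<exists>n. \<exists>H\<in>polc C. Polynomial.smult (Polynomial.coeff F (Polynomial.degree F) ^ n) G = F * H"
proof -
  let ?d = "Polynomial.degree F"
  have FC: "F \<in> polc C" "poly F b = 0" using F by (auto simp: minpoly_def)
  have "\<forall>i\<ge>?d + Suc (Polynomial.degree G). Polynomial.coeff G i = 0" by (auto intro: coeff_eq_0)
  from pseudo_division[OF C FC(1) cideal_self[OF C] G(1) this] obtain H S where HS: "H \<in> polc C" "S \<in> polc C"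
    "Polynomial.smult (Polynomial.coeff F ?d ^ Suc (Polynomial.degree G)) G = F * H + S" "\<forall>i\<ge>?d. Polynomial.coeff S i = 0" by blast
  have "poly S b = 0" using arg_cong[OF HS(3), of "\<lambda>p. poly p b"] G FC by simp
  then have "S = 0" using F HS by (auto simp: minpoly_def)
  then have "Polynomial.smult (Polynomial.coeff F ?d ^ Suc (Polynomial.degree G)) G = F * H" using HS(3) by simp
  then show ?thesis using HS(1) by blast
qed

text \<open>Separability in characteristic 0: the derivative has smaller degree, so if it vanished
  at \<open>b\<close> it would be the zero polynomial, and then so would be the degree of
  \<open>F\<close> times its leading coefficient.\<close>

lemma minpoly_degree:
  assumes C: "cdom C" and F: "minpoly C b F"
  shows "Polynomial.degree F > 0" "poly (pder F) b \<noteq> 0"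
proof -
  have FC: "F \<in> polc C" "poly F b = 0" "F \<noteq> 0" using F by (auto simp: minpoly_def)
  show d: "Polynomial.degree F > 0"
  proof (rule ccontr)
    assume "\<not> ?thesis"
    then obtain c where "F = [:c:]" by (auto elim: degree_eq_zeroE)
    then show False using FC by simp
  qed
  show "poly (pder F) b \<noteq> 0"
  proof
    assume 0: "poly (pder F) b = 0"
    let ?d = "Polynomial.degree F"
    have "\<forall>i\<ge>?d. Polynomial.coeff (pder F) i = 0" by (auto simp: coeff_pder coeff_eq_0)
    then have "pder F = 0"
      using F 0 polc_closed(7)[OF cdomD(1)[OF C] FC(1)] by (auto simp: minpoly_def)
    then have "Polynomial.coeff (pder F) (?d - 1) = 0" by simp
    then have "of_nat ?d * Polynomial.coeff F ?d = 0" using d by (simp add: coeff_pder del: of_nat_Suc)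
    then have "\<kappa> (inverse (of_nat ?d)) * (\<kappa> (of_nat ?d) * Polynomial.coeff F ?d) = 0" by (simp add: kof_nat)
    then have "Polynomial.coeff F ?d = 0" using kcancel[of "of_nat ?d"] d by (simp flip: mult.assoc)
    then show False using FC by simp
  qed
qed

end

context complex_eval begin

subsection \<open>Going down\<close>

lemma poly_in_prime: assumes C: "csub C" and I: "cideal (adj C b) Q" shows "U \<in> polc C \<Longrightarrow> U \<in> polc Q \<Longrightarrow> poly U b \<in> Q"
  using C
proof (induction rule: polc_induct)
  case 0 then show ?case using I by (simp add: cideal_def)
next
  case (pCons c G)
  have "c \<in> Q" "G \<in> polc Q"
    using pCons.prems by (force simp: polc_def coeff_pCons split: nat.splits)+
  then show ?case using pCons adj_sup(2)[OF C] I by (simp add: cideal_def)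
qed

text \<open>Once the leading coefficient l of \<open>F\<close> is inverted, C[b] is free over
  \<open>C\<close> on the powers of \<open>b\<close> below the degree of \<open>F\<close>, and free
  extensions have going down. Concretely, the new prime contains P C[b] and avoids a set
  \<open>S\<close>. If s g with s outside \<open>Q\<close> and g outside \<open>P\<close> were in P
  C[b], comparing remainders modulo \<open>F\<close> would put l^n s into P C[b], hence into
  \<open>Q\<close>.\<close>

lemma going_down:
  assumes C: "csub C" and F: "minpoly C b F" and Q: "cprime (adj C b) Q"
    and l: "Polynomial.coeff F (Polynomial.degree F) \<notin> Q" and P: "cprime C P" "P \<subseteq> Q"
  shows "\<exists>Q'. cprime (adj C b) Q' \<and> Q' \<subseteq> Q \<and> Q' \<inter> C = P"
proof -
  let ?A = "adj C b" and ?d = "Polynomial.degree F"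
  let ?l = "Polynomial.coeff F ?d"
  have A: "csub ?A" by (rule csub_adj[OF C])
  interpret R: cring "set_ring ?A" by (rule cring_set_ring[OF A])
  have FC: "F \<in> polc C" "poly F b = 0" using F by (auto simp: minpoly_def)
  have PC: "P \<subseteq> C" and QA: "Q \<subseteq> ?A" using P Q by (auto dest: cprimeD)
  have PI: "cideal C P" and QI: "cideal ?A Q" using P Q by (auto simp: cprime_def)
  have lC: "?l \<in> C" using FC by (auto simp: polc_def)
  have CA: "C \<subseteq> ?A" by (rule adj_sup[OF C])
  define I where "I = (\<lambda>U. poly U b) ` polc P"
  \<comment> \<open>Avoiding the products with g = 1 keeps \<open>Q'\<close> inside
    \<open>Q\<close>; avoiding those with s = 1 keeps the contraction of \<open>Q'\<close> inside
    \<open>P\<close>.\<close>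
  define S where "S = {s * g | s g. s \<in> ?A - Q \<and> g \<in> C - P}"
  have polcP: "polc P \<subseteq> polc C" using PC by (auto simp: polc_def)
  have "cideal ?A I"
    unfolding cideal_def
  proof (intro conjI ballI)
    show "I \<subseteq> ?A" unfolding I_def using polcP by (auto simp: adj_def)
    have "0 \<in> polc P" using cprimeD(2)[OF P(1)] by (simp add: polc_def)
    then show "0 \<in> I" unfolding I_def by (auto intro!: image_eqI[of _ _ 0])
    fix u v assume "u \<in> I" "v \<in> I"
    then obtain U V where "u = poly U b" "v = poly V b" "U \<in> polc P" "V \<in> polc P" unfolding I_def by auto
    moreover from this have "U + V \<in> polc P" using cprimeD(4)[OF P(1)] by (auto simp: polc_def)
    ultimately show "u + v \<in> I" unfolding I_def by (auto simp flip: poly_add)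
  next
    fix c u assume "c \<in> ?A" "u \<in> I"
    then obtain G U where *: "c = poly G b" "u = poly U b" "G \<in> polc C" "U \<in> polc P" unfolding I_def adj_def by auto
    have "G * U \<in> polc P"
      using *(3,4) by (auto simp: polc_def coeff_mult intro!: cideal_sum[OF PI] cprimeD(5)[OF P(1)])
    then show "c * u \<in> I" unfolding I_def * by (auto simp flip: poly_mult)
  qed
  then have I: "ideal I (set_ring ?A)" by (simp add: ideal_set_ring[OF A])
  have disj: "I \<inter> S = {}"
  proof (rule ccontr)
    assume "I \<inter> S \<noteq> {}"
    then obtain y where y: "y \<in> I" "y \<in> S" by blast
    obtain U where U0: "U \<in> polc P" "y = poly U b" using y(1) unfolding I_def by blast
    obtain s g where s: "s \<in> ?A" "s \<notin> Q" and g: "g \<in> C" "g \<notin> P" and "y = s * g" using y(2) unfolding S_def by blast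
    with U0 have U: "U \<in> polc P" "s * g = poly U b" by simp_all
    obtain G where G: "G \<in> polc C" "s = poly G b" using s by (auto simp: adj_def)
    define n where "n = Suc (Polynomial.degree G + Polynomial.degree U)"
    have "\<forall>i\<ge>?d + n. Polynomial.coeff G i = 0" "\<forall>i\<ge>?d + n. Polynomial.coeff U i = 0"
      by (auto simp: n_def intro!: coeff_eq_0)
    then obtain H S' H' S'' where
      1: "H \<in> polc C" "S' \<in> polc C" "Polynomial.smult (?l ^ n) G = F * H + S'" "\<forall>i\<ge>?d. Polynomial.coeff S' i = 0" and
      2: "H' \<in> polc C" "S'' \<in> polc P" "Polynomial.smult (?l ^ n) U = F * H' + S''" "\<forall>i\<ge>?d. Polynomial.coeff S'' i = 0"
      using pseudo_division[OF C FC(1) cideal_self[OF C] G(1)] pseudo_division[OF C FC(1) PI U(1)] by metis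
    have e1: "?l ^ n * s = poly S' b" using arg_cong[OF 1(3), of "\<lambda>p. poly p b"] G FC by simp
    have e2: "?l ^ n * (s * g) = poly S'' b" using arg_cong[OF 2(3), of "\<lambda>p. poly p b"] U FC by simp
    \<comment> \<open>Remainders modulo \<open>F\<close> are unique: the difference vanishes at
      \<open>b\<close> and lies below the degree of \<open>F\<close>.\<close>
    have "Polynomial.smult g S' - S'' = 0"
    proof -
      have "Polynomial.smult g S' - S'' \<in> polc C" using 1 2 g polcP by (intro polc_closed[OF C]) auto
      moreover have "poly (Polynomial.smult g S' - S'') b = 0" using e1 e2 by (simp add: algebra_simps flip: e1 e2)
      moreover have "\<forall>i\<ge>?d. Polynomial.coeff (Polynomial.smult g S' - S'') i = 0" using 1(4) 2(4) by simp
      ultimately show ?thesis using F unfolding minpoly_def by blast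
    qed
    then have "g * Polynomial.coeff S' i = Polynomial.coeff S'' i" for i
      by (metis Polynomial.coeff_smult eq_iff_diff_eq_0)
    then have "g * Polynomial.coeff S' i \<in> P" for i using 2(2) by (simp add: polc_def)
    then have "S' \<in> polc P" using cprimeD(6)[OF P(1) g(1)] g(2) 1(2) by (auto simp: polc_def)
    then have "S' \<in> polc Q" using P by (auto simp: polc_def)
    then have "?l ^ n * s \<in> Q" unfolding e1 using poly_in_prime[OF C QI] 1 by blast
    moreover have "?l ^ n \<in> ?A" using csubD(9)[OF C lC] CA by blast
    ultimately have "?l ^ n \<in> Q" using cprimeD(6)[OF Q] s by blast
    then show False using cprime_power[OF A Q] lC CA l by blast
  qed
  have one: "1 \<in> S" using cprimeD(3)[OF P(1)] cprimeD(3)[OF Q] csubD(3)[OF C] csubD(3)[OF A]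
    unfolding S_def by (intro CollectI exI[of _ 1]) auto
  have "\<exists>Q'. primeideal Q' (set_ring ?A) \<and> I \<subseteq> Q' \<and> Q' \<inter> S = {}"
  proof (rule R.exists_prime_avoiding[OF I _ _ _ disj])
    show "S \<subseteq> carrier (set_ring ?A)" unfolding S_def using CA csubD(5)[OF A] by auto
    show "\<one>\<^bsub>set_ring ?A\<^esub> \<in> S" using one by simp
    fix s t assume "s \<in> S" "t \<in> S"
    then obtain s1 g1 s2 g2 where "s = s1 * g1" "t = s2 * g2" "s1 \<in> ?A - Q" "s2 \<in> ?A - Q" "g1 \<in> C - P" "g2 \<in> C - P"
      unfolding S_def by blast
    moreover from this have "s1 * s2 \<in> ?A - Q" "g1 * g2 \<in> C - P"
      using cprimeD(6)[OF Q] cprimeD(6)[OF P(1)] csubD(5)[OF A] csubD(5)[OF C] by blast+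
    ultimately have "(s1 * s2) * (g1 * g2) \<in> S" "s * t = (s1 * s2) * (g1 * g2)"
      unfolding S_def by (blast, simp only: ac_simps)
    then show "s \<otimes>\<^bsub>set_ring ?A\<^esub> t \<in> S" by simp
  qed
  then obtain Q' where Q': "cprime ?A Q'" "I \<subseteq> Q'" "Q' \<inter> S = {}" by (auto simp: primeideal_set_ring[OF A])
  have "Q' \<subseteq> Q"
  proof
    fix u assume u: "u \<in> Q'"
    show "u \<in> Q"
    proof (rule ccontr)
      assume "u \<notin> Q"
      then have "u * 1 \<in> S" using u cprimeD(1)[OF Q'(1)] cprimeD(3)[OF P(1)] csubD(3)[OF C] unfolding S_def by blast
      then show False using u Q'(3) by auto
    qed
  qed
  moreover have "Q' \<inter> C \<subseteq> P"
  proof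
    fix g assume g: "g \<in> Q' \<inter> C"
    show "g \<in> P"
    proof (rule ccontr)
      assume "g \<notin> P"
      then have "1 * g \<in> S" using g cprimeD(3)[OF Q] csubD(3)[OF A] unfolding S_def by blast
      then show False using g Q'(3) by auto
    qed
  qed
  moreover have "P \<subseteq> Q'"
  proof
    fix p assume "p \<in> P"
    then have "[:p:] \<in> polc P" using cprimeD(2)[OF P(1)] by (auto simp: polc_def coeff_pCons split: nat.splits)
    then have "poly [:p:] b \<in> I" unfolding I_def by blast
    then show "p \<in> Q'" using Q' by auto
  qed
  ultimately show ?thesis using Q' PC by blast
qed

definition prime_chain :: "'r set \<Rightarrow> nat \<Rightarrow> 'x \<Rightarrow> bool" where
  "prime_chain C r x \<longleftrightarrow> (\<exists>P. (\<forall>i\<le>r. cprime C (P i)) \<and> (\<forall>i<r. P i \<subset> P (Suc i)) \<and> P r = nx C x)"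

text \<open>The chain is lifted from the top downwards, starting at the maximal ideal of
  \<open>x\<close>. All lifted primes lie inside that ideal, so none contains the leading
  coefficient of \<open>F\<close>, which is nonzero at \<open>x\<close>, and going down applies at
  every stage.\<close>

lemma prime_chain_algebraic:
  assumes C: "csub C" and F: "minpoly C b F" and l: "ev x (Polynomial.coeff F (Polynomial.degree F)) \<noteq> 0"
    and ch: "prime_chain C r x"
  shows "prime_chain (adj C b) r x"
proof -
  let ?A = "adj C b"
  have A: "csub ?A" by (rule csub_adj[OF C])
  have CA: "C \<subseteq> ?A" by (rule adj_sup[OF C])
  obtain P where P: "\<And>i. i \<le> r \<Longrightarrow> cprime C (P i)" "\<And>i. i < r \<Longrightarrow> P i \<subset> P (Suc i)" "P r = nx C x"
    using ch unfolding prime_chain_def by blast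
  have "k \<le> r \<Longrightarrow> \<exists>Q. Q r = nx ?A x \<and> (\<forall>i. r - k \<le> i \<and> i \<le> r \<longrightarrow> cprime ?A (Q i) \<and> Q i \<inter> C = P i \<and> Q i \<subseteq> nx ?A x)
    \<and> (\<forall>i. r - k \<le> i \<and> i < r \<longrightarrow> Q i \<subseteq> Q (Suc i))" for k
  proof (induction k)
    case 0
    show ?case using cprime_nx[OF A] P(3) CA by (intro exI[of _ "\<lambda>_. nx ?A x"]) (auto simp: nx_def)
  next
    case (Suc k)
    then obtain Q where Q: "Q r = nx ?A x" "\<And>i. r - k \<le> i \<Longrightarrow> i \<le> r \<Longrightarrow> cprime ?A (Q i) \<and> Q i \<inter> C = P i \<and> Q i \<subseteq> nx ?A x"
      "\<And>i. r - k \<le> i \<Longrightarrow> i < r \<Longrightarrow> Q i \<subseteq> Q (Suc i)" by auto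
    define j where "j = r - Suc k"
    have j: "Suc j = r - k" "j < r" using Suc.prems by (auto simp: j_def)
    have Qj: "cprime ?A (Q (Suc j))" "Q (Suc j) \<inter> C = P (Suc j)" "Q (Suc j) \<subseteq> nx ?A x" using Q(2)[of "Suc j"] j by auto
    have "Polynomial.coeff F (Polynomial.degree F) \<notin> Q (Suc j)" using Qj(3) l by (auto simp: nx_def)
    moreover have "P j \<subseteq> Q (Suc j)" using P(2)[OF j(2)] Qj(2) by blast
    ultimately obtain Q' where Q': "cprime ?A Q'" "Q' \<subseteq> Q (Suc j)" "Q' \<inter> C = P j"
      using going_down[OF C F Qj(1) _ P(1)] j by (meson less_imp_le)
    have "Q' \<subseteq> nx ?A x" using Q'(2) Qj(3) by blast
    moreover have "i = j \<or> r - k \<le> i" if "r - Suc k \<le> i" for i using that j(1) by (auto simp: j_def)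
    ultimately show ?case using Q Q' j
      by (intro exI[of _ "Q(j := Q')"]) (auto simp: j_def[symmetric])
  qed
  from this[of r] obtain Q where Q: "Q r = nx ?A x" "\<And>i. i \<le> r \<Longrightarrow> cprime ?A (Q i) \<and> Q i \<inter> C = P i"
      "\<And>i. i < r \<Longrightarrow> Q i \<subseteq> Q (Suc i)" by auto
  have "Q i \<subset> Q (Suc i)" if i: "i < r" for i
    using Q(2)[of i] Q(2)[of "Suc i"] Q(3)[OF i] P(2)[OF i] i by auto
  then show ?thesis unfolding prime_chain_def using Q by (intro exI[of _ Q]) auto
qed

lemma cprime_zero: assumes "cdom C" shows "cprime C {0}"
proof -
  have "(1::'r) \<noteq> 0" using eone ezero by (metis zero_neq_one)
  then show ?thesis using cdomD(1,2)[OF assms] by (auto simp: cprime_def cideal_def csubD)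
qed

text \<open>Each prime p of \<open>C\<close> extends to \<open>E p\<close>, the prime generated by p
  and b - b(x): polynomials in \<open>b\<close> are tested after substituting the value of
  \<open>b\<close> at \<open>x\<close>. All these primes contain the nonzero element b - b(x), so
  {0} fits below them and the chain gains one step.\<close>

lemma prime_chain_transcendental:
  assumes A: "cdom (adj C b)" and C: "csub C" and b: "\<And>G. G \<in> polc C \<Longrightarrow> poly G b = 0 \<Longrightarrow> G = 0"
    and ch: "prime_chain C r x"
  shows "prime_chain (adj C b) (Suc r) x"
proof -
  let ?A = "adj C b" and ?\<beta> = "\<kappa> (ev x b)"
  have \<beta>: "?\<beta> \<in> C" by (rule csubD[OF C])
  obtain P where P: "\<And>i. i \<le> r \<Longrightarrow> cprime C (P i)" "\<And>i. i < r \<Longrightarrow> P i \<subset> P (Suc i)" "P r = nx C x"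
    using ch unfolding prime_chain_def by blast
  define E where "E p = {u. \<exists>G\<in>polc C. u = poly G b \<and> poly G ?\<beta> \<in> p}" for p
  have uniq: "G = H" if "G \<in> polc C" "H \<in> polc C" "poly G b = poly H b" for G H
    using b[of "G - H"] polc_closed(3)[OF C that(1,2)] that(3) by simp
  have E_iff: "poly G b \<in> E p \<longleftrightarrow> poly G ?\<beta> \<in> p" if "G \<in> polc C" for G p
    unfolding E_def using uniq that by blast
  have EA: "E p \<subseteq> ?A" for p unfolding E_def adj_def by blast
  have prime: "cprime ?A (E p)" if p: "cprime C p" for p
  proof -
    have "\<forall>u\<in>E p. \<forall>v\<in>E p. u + v \<in> E p"
    proof (intro ballI)
      fix u v assume "u \<in> E p" "v \<in> E p"
      then obtain U V where *: "u = poly U b" "v = poly V b" "U \<in> polc C" "V \<in> polc C" "poly U ?\<beta> \<in> p" "poly V ?\<beta> \<in> p"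
        unfolding E_def by auto
      have "poly U ?\<beta> + poly V ?\<beta> \<in> p" by (rule cprimeD(4)[OF p *(5,6)])
      then show "u + v \<in> E p" using E_iff[OF polc_closed(2)[OF C *(3,4)], of p] *(1,2) by simp
    qed
    moreover have "\<forall>c\<in>?A. \<forall>u\<in>E p. c * u \<in> E p"
    proof (intro ballI)
      fix u v assume "u \<in> ?A" "v \<in> E p"
      then obtain U V where *: "u = poly U b" "v = poly V b" "U \<in> polc C" "V \<in> polc C" "poly V ?\<beta> \<in> p"
        unfolding E_def adj_def by auto
      have "poly U ?\<beta> * poly V ?\<beta> \<in> p" by (rule cprimeD(5)[OF p poly_in[OF C *(3) \<beta>] *(5)])
      then show "u * v \<in> E p" using E_iff[OF polc_closed(4)[OF C *(3,4)], of p] *(1,2) by simp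
    qed
    moreover have "0 \<in> E p" using E_iff[of 0 p] polc_closed(1)[OF C] cprimeD(2)[OF p] by simp
    moreover have "1 \<notin> E p" 
    proof -
      have "[:1:] \<in> polc C" using polc_closed(1)[OF C] csubD(3)[OF C] by (simp add: polc_pCons[OF C])
      then show ?thesis using E_iff[of "[:1:]" p] cprimeD(3)[OF p] by simp
    qed
    moreover have "\<forall>u\<in>?A. \<forall>v\<in>?A. u * v \<in> E p \<longrightarrow> u \<in> E p \<or> v \<in> E p"
    proof (intro ballI impI)
      fix u v assume "u \<in> ?A" "v \<in> ?A" and uv: "u * v \<in> E p"
      then obtain U V where *: "u = poly U b" "v = poly V b" "U \<in> polc C" "V \<in> polc C"
        unfolding adj_def by auto
      have "poly U ?\<beta> * poly V ?\<beta> \<in> p" using uv E_iff[OF polc_closed(4)[OF C *(3,4)], of p] *(1,2) by simp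
      then show "u \<in> E p \<or> v \<in> E p"
        using E_iff[OF *(3)] E_iff[OF *(4)] *(1,2) cprimeD(6)[OF p] poly_in[OF C _ \<beta>] *(3,4) by blast
    qed
    ultimately show ?thesis using EA by (auto simp: cprime_def cideal_def)
  qed
  have const: "[:c:] \<in> polc C" if "c \<in> C" for c using that polc_closed(1)[OF C] by (simp add: polc_pCons[OF C])
  have inC: "E p \<inter> C = p" if "p \<subseteq> C" for p
    using E_iff[OF const, of _ p] that by auto
  have mono: "E p \<subseteq> E q" if "p \<subseteq> q" for p q using that unfolding E_def by blast
  have ev_poly: "ev x (poly G ?\<beta>) = ev x (poly G b)" for G
    by (induction G) (auto simp: esimps)
  have top: "E (nx C x) = nx ?A x"
    unfolding E_def nx_def adj_def using poly_in[OF C _ \<beta>] by (auto simp: ev_poly)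
  define Q where "Q i = (case i of 0 \<Rightarrow> {0} | Suc j \<Rightarrow> E (P j))" for i
  have "b - ?\<beta> \<in> E (P 0)"
  proof -
    have m: "[:- ?\<beta>, 1:] \<in> polc C" using \<beta> polc_closed(1)[OF C] csubD(3,6)[OF C] by (simp add: polc_pCons[OF C])
    show ?thesis using E_iff[OF m, of "P 0"] cprimeD(2)[OF P(1)[of 0]] by simp
  qed
  moreover have "b - ?\<beta> \<noteq> 0"
  proof
    assume 0: "b - ?\<beta> = 0"
    have m: "[:- ?\<beta>, 1:] \<in> polc C" using \<beta> polc_closed(1)[OF C] csubD(3,6)[OF C] by (simp add: polc_pCons[OF C])
    have "[:- ?\<beta>, 1:] = 0" by (rule b[OF m]) (use 0 in simp)
    then show False by simp
  qed
  moreover have "0 \<in> E (P 0)" using cprimeD(2)[OF prime[OF P(1)]] by simp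
  ultimately have "{0} \<subset> E (P 0)" by blast
  moreover have "E (P i) \<subset> E (P (Suc i))" if "i < r" for i
  proof -
    have "P i \<subseteq> C" "P (Suc i) \<subseteq> C" using cprimeD(1)[OF P(1)] that by simp_all
    then have "E (P i) \<inter> C = P i" "E (P (Suc i)) \<inter> C = P (Suc i)" by (simp_all add: inC)
    then show ?thesis using mono[of "P i" "P (Suc i)"] P(2)[OF that] by blast
  qed
  ultimately have "Q i \<subset> Q (Suc i)" if "i < Suc r" for i
    using that by (cases i) (simp_all add: Q_def)
  moreover have "cprime ?A (Q i)" if "i \<le> Suc r" for i
  proof (cases i)
    case 0 then show ?thesis using cprime_zero[OF A] by (simp add: Q_def)
  next
    case (Suc j) then show ?thesis using prime[OF P(1)[of j]] that by (simp add: Q_def)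
  qed
  moreover have "Q (Suc r) = nx ?A x" by (simp add: Q_def P(3) top)
  ultimately show ?thesis unfolding prime_chain_def by blast
qed

end

context complex_eval begin

subsection \<open>Cotangent spaces\<close>

text \<open>Modulo the square of the maximal ideal of \<open>x\<close>, this is the differential of
  \<open>u\<close> at \<open>x\<close>.\<close>

definition dv :: "'x \<Rightarrow> 'r \<Rightarrow> 'r" where "dv x u = u - \<kappa> (ev x u)"

definition lin :: "nat \<Rightarrow> (nat \<Rightarrow> 'r) \<Rightarrow> 'x \<Rightarrow> (nat \<Rightarrow> complex) \<Rightarrow> 'r" where
  "lin r t x f = (\<Sum>i<r. \<kappa> (f i) * dv x (t i))"

definition N2 :: "'r set \<Rightarrow> 'x \<Rightarrow> 'r set" where
  "N2 C x = V.span {u * v | u v. u \<in> nx C x \<and> v \<in> nx C x}"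

text \<open>The elements whose differential at \<open>x\<close> is a combination of those of t 0,
  ..., t (r - 1). That this is all of \<open>C\<close> says that these r differentials span the
  cotangent space; \<open>N2\<close> is the square of the maximal ideal.\<close>

definition spans :: "'r set \<Rightarrow> nat \<Rightarrow> (nat \<Rightarrow> 'r) \<Rightarrow> 'x \<Rightarrow> 'r set" where
  "spans C r t x = {u \<in> C. \<exists>f. dv x u - lin r t x f \<in> N2 C x}"

lemma N2_closed:
  "0 \<in> N2 C x" "u \<in> N2 C x \<Longrightarrow> v \<in> N2 C x \<Longrightarrow> u + v \<in> N2 C x"
  "u \<in> N2 C x \<Longrightarrow> v \<in> N2 C x \<Longrightarrow> u - v \<in> N2 C x" "u \<in> N2 C x \<Longrightarrow> \<kappa> c * u \<in> N2 C x"
  "u \<in> nx C x \<Longrightarrow> v \<in> nx C x \<Longrightarrow> u * v \<in> N2 C x"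
  unfolding N2_def using V.span_zero V.span_add V.span_diff V.span_scale
  by (auto intro!: V.span_base)

lemma N2_mono: "C \<subseteq> D \<Longrightarrow> N2 C x \<subseteq> N2 D x"
  unfolding N2_def by (rule V.span_mono) (auto simp: nx_def)

lemma lin_add: "lin r t x (\<lambda>i. f i + g i) = lin r t x f + lin r t x g"
  by (simp add: lin_def ksimps algebra_simps sum.distrib)

lemma lin_scale: "lin r t x (\<lambda>i. c * f i) = \<kappa> c * lin r t x f"
  unfolding lin_def sum_distrib_left by (rule sum.cong) (simp_all add: kmult)

lemma lin_0: "lin r t x (\<lambda>i. 0) = 0" by (simp add: lin_def ksimps)

lemma dv_in: "csub C \<Longrightarrow> u \<in> C \<Longrightarrow> dv x u \<in> nx C x"
  by (simp add: nx_def dv_def esimps csubD)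

lemma dv_simps: "dv x (u + v) = dv x u + dv x v" "dv x (\<kappa> c) = 0" "dv x 0 = 0"
  "dv x (u * v) = dv x u * dv x v + \<kappa> (ev x u) * dv x v + \<kappa> (ev x v) * dv x u"
  by (simp_all add: dv_def esimps ksimps algebra_simps)

text \<open>Differentials obey the Leibniz rule, so the elements in question form a subalgebra. For
  a simple extension it is then enough to look at \<open>C\<close> and at \<open>b\<close>.\<close>

lemma spans_closed:
  assumes C: "csub C"
  shows "\<kappa> c \<in> spans C r t x"
    and "u \<in> spans C r t x \<Longrightarrow> v \<in> spans C r t x \<Longrightarrow> u + v \<in> spans C r t x"
    and "u \<in> spans C r t x \<Longrightarrow> v \<in> spans C r t x \<Longrightarrow> u * v \<in> spans C r t x"
proof -
  show "\<kappa> c \<in> spans C r t x"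
    using csubD(1)[OF C] N2_closed(1) by (auto simp: spans_def dv_simps intro!: exI[of _ "\<lambda>_. 0"] simp: lin_0)
  assume "u \<in> spans C r t x" "v \<in> spans C r t x"
  then obtain f g where f: "u \<in> C" "dv x u - lin r t x f \<in> N2 C x" and g: "v \<in> C" "dv x v - lin r t x g \<in> N2 C x"
    by (auto simp: spans_def)
  have "dv x (u + v) - lin r t x (\<lambda>i. f i + g i) = (dv x u - lin r t x f) + (dv x v - lin r t x g)"
    by (simp add: dv_simps lin_add)
  then have "dv x (u + v) - lin r t x (\<lambda>i. f i + g i) \<in> N2 C x" using N2_closed(2)[OF f(2) g(2)] by simp
  then show "u + v \<in> spans C r t x" using f g csubD(4)[OF C] by (auto simp: spans_def)
  define h where "h = (\<lambda>i. ev x u * g i + ev x v * f i)"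
  have "lin r t x h = \<kappa> (ev x u) * lin r t x g + \<kappa> (ev x v) * lin r t x f"
    unfolding h_def by (simp add: lin_add lin_scale)
  then have "dv x (u * v) - lin r t x h =
      (dv x u * dv x v + \<kappa> (ev x u) * (dv x v - lin r t x g)) + \<kappa> (ev x v) * (dv x u - lin r t x f)"
    by (simp add: dv_simps algebra_simps)
  also have "\<dots> \<in> N2 C x"
    by (rule N2_closed(2)[OF N2_closed(2)[OF N2_closed(5)[OF dv_in[OF C f(1)] dv_in[OF C g(1)]] N2_closed(4)[OF g(2)]] N2_closed(4)[OF f(2)]])
  finally show "u * v \<in> spans C r t x" using f g csubD(5)[OF C] by (auto simp: spans_def)
qed

lemma spans_adj_least:
  assumes C: "csub C" and sub: "C \<subseteq> spans (adj C b) r t x" and b: "b \<in> spans (adj C b) r t x"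
  shows "spans (adj C b) r t x = adj C b"
proof
  have "csub (spans (adj C b) r t x)"
    using spans_closed[OF csub_adj[OF C]] by (auto simp: csub_def)
  then show "adj C b \<subseteq> spans (adj C b) r t x" using sub b by (rule adj_least)
qed (auto simp: spans_def)

lemma spans_mono: assumes "C \<subseteq> D" shows "spans C r t x \<subseteq> spans D r t x"
  using N2_mono[OF assms, of x] assms by (auto simp: spans_def)

text \<open>Differentiating F(b) = 0 at \<open>x\<close> expresses F'(b)(x) db through differentials
  of elements of \<open>C\<close>, and the factor F'(b)(x) is nonzero.\<close>

lemma spans_algebraic:
  assumes C: "csub C" and F: "F \<in> polc C" "poly F b = 0" "ev x (poly (pder F) b) \<noteq> 0"
    and sp: "spans C r t x = C"
  shows "spans (adj C b) r t x = adj C b"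
proof (rule spans_adj_least[OF C])
  let ?A = "adj C b"
  have CA: "C \<subseteq> ?A" by (rule adj_sup[OF C])
  have A: "csub ?A" by (rule csub_adj[OF C])
  have bA: "b \<in> ?A" by (rule adj_sup[OF C])
  show sub: "C \<subseteq> spans ?A r t x" using spans_mono[OF CA] sp by blast
  \<comment> \<open>First order expansion of G(b): the differentials of the coefficients contribute
    to \<open>lin\<close>, and the variable contributes G'(b)(x) db.\<close>
  have taylor: "\<exists>f. dv x (poly G b) - lin r t x f - \<kappa> (ev x (poly (pder G) b)) * dv x b \<in> N2 ?A x"
    if "G \<in> polc C" for G
    using C that
  proof (induction rule: polc_induct)
    case 0
    show ?case using N2_closed(1) by (intro exI[of _ "\<lambda>_. 0"]) (simp add: dv_simps lin_0 esimps ksimps)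
  next
    case (pCons c G)
    then obtain f where f: "dv x (poly G b) - lin r t x f - \<kappa> (ev x (poly (pder G) b)) * dv x b \<in> N2 ?A x" by blast
    obtain g where g: "dv x c - lin r t x g \<in> N2 ?A x" using sub pCons(1) by (auto simp: spans_def)
    define h where "h = (\<lambda>i. g i + ev x b * f i)"
    have h: "lin r t x h = lin r t x g + \<kappa> (ev x b) * lin r t x f"
      unfolding h_def by (simp add: lin_add lin_scale)
    have G: "poly G b \<in> ?A" by (rule adj_mem[OF pCons(2)])
    have "dv x (poly (pCons c G) b) - lin r t x h - \<kappa> (ev x (poly (pder (pCons c G)) b)) * dv x b =
      ((dv x c - lin r t x g) + dv x b * dv x (poly G b)) +
       \<kappa> (ev x b) * (dv x (poly G b) - lin r t x f - \<kappa> (ev x (poly (pder G) b)) * dv x b)"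
      by (simp add: dv_simps h pder_pCons esimps ksimps algebra_simps)
    also have "\<dots> \<in> N2 ?A x"
      by (rule N2_closed(2)[OF N2_closed(2)[OF g N2_closed(5)[OF dv_in[OF A bA] dv_in[OF A G]]] N2_closed(4)[OF f]])
    finally show ?case by blast
  qed
  obtain f where "dv x (poly F b) - lin r t x f - \<kappa> (ev x (poly (pder F) b)) * dv x b \<in> N2 ?A x"
    using taylor[OF F(1)] by blast
  define e where "e = ev x (poly (pder F) b)"
  have 1: "0 - lin r t x f - \<kappa> e * dv x b \<in> N2 ?A x" using \<open>dv x (poly F b) - _ - _ \<in> _\<close> by (simp add: F dv_simps e_def)
  have e: "e \<noteq> 0" using F by (simp add: e_def)
  have "\<kappa> (inverse e) * \<kappa> e = 1" by (rule kcancel[OF e])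
  then have "\<kappa> (inverse e) * (\<kappa> e * dv x b) = dv x b" by (simp flip: mult.assoc)
  then have "dv x b - lin r t x (\<lambda>i. (- inverse e) * f i) = \<kappa> (- inverse e) * (0 - lin r t x f - \<kappa> e * dv x b)"
    unfolding lin_scale kminus by (simp only: right_diff_distrib mult_minus_left) simp
  also have "\<dots> \<in> N2 ?A x" by (rule N2_closed(4)[OF 1])
  finally show "b \<in> spans ?A r t x" using bA unfolding spans_def by blast
qed

lemma lin_cong: "(\<And>i. i < r \<Longrightarrow> t i = t' i) \<Longrightarrow> (\<And>i. i < r \<Longrightarrow> f i = f' i) \<Longrightarrow> lin r t x f = lin r t' x f'"
  by (auto simp: lin_def intro!: sum.cong)

lemma spans_transcendental:
  assumes C: "csub C" and sp: "spans C r t x = C"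
  shows "spans (adj C b) (Suc r) (t(r := b)) x = adj C b"
proof (rule spans_adj_least[OF C])
  let ?A = "adj C b"
  have CA: "C \<subseteq> ?A" by (rule adj_sup[OF C])
  have bA: "b \<in> ?A" by (rule adj_sup[OF C])
  have ext: "lin (Suc r) (t(r := b)) x f = lin r t x f + \<kappa> (f r) * dv x b" for f
    using lin_cong[of r "t(r := b)" t f f x] by (simp add: lin_def)
  show "C \<subseteq> spans ?A (Suc r) (t(r := b)) x"
  proof
    fix u assume u: "u \<in> C"
    then obtain f where f: "dv x u - lin r t x f \<in> N2 C x" using sp unfolding spans_def by blast
    have "lin (Suc r) (t(r := b)) x (f(r := 0)) = lin r t x f"
      unfolding ext using lin_cong[of r t t "f(r := 0)" f x] by (simp add: ksimps)
    then have "dv x u - lin (Suc r) (t(r := b)) x (f(r := 0)) \<in> N2 ?A x" using f N2_mono[OF CA] by auto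
    then show "u \<in> spans ?A (Suc r) (t(r := b)) x" using u CA unfolding spans_def by blast
  qed
  have "lin (Suc r) (t(r := b)) x ((\<lambda>_. 0)(r := 1)) = dv x b"
    unfolding ext using lin_cong[of r t t "(\<lambda>_. 0)(r := 1)" "\<lambda>_. 0" x] by (simp add: ksimps lin_0)
  then have "dv x b - lin (Suc r) (t(r := b)) x ((\<lambda>_. 0)(r := 1)) \<in> N2 ?A x" using N2_closed(1) by simp
  then show "b \<in> spans ?A (Suc r) (t(r := b)) x" using bA unfolding spans_def by blast
qed

subsection \<open>Point derivations\<close>

definition pointder :: "'r set \<Rightarrow> 'x \<Rightarrow> ('r \<Rightarrow> complex) \<Rightarrow> bool" where
  "pointder C x \<delta> \<longleftrightarrow> (\<forall>u\<in>C. \<forall>v\<in>C. \<delta> (u + v) = \<delta> u + \<delta> v \<and> \<delta> (u * v) = ev x u * \<delta> v + ev x v * \<delta> u)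
     \<and> (\<forall>c. \<delta> (\<kappa> c) = 0)"

text \<open>Tangent vectors dual to the differentials of the \<open>t i\<close>, hence a witness of
  their independence. Independence itself is not obviously inherited by C[b], whose square
  \<open>N2\<close> is larger, whereas derivations can be extended to C[b].\<close>

definition duals :: "'r set \<Rightarrow> nat \<Rightarrow> (nat \<Rightarrow> 'r) \<Rightarrow> 'x \<Rightarrow> bool" where
  "duals C r t x \<longleftrightarrow> (\<forall>j<r. \<exists>\<delta>. pointder C x \<delta> \<and> (\<forall>i<r. \<delta> (t i) = (if i = j then 1 else 0)))"

text \<open>The value at \<open>G(b)\<close> of the extension of \<open>\<delta>\<close> sending \<open>b\<close> to \<open>w\<close>.\<close>

definition extval :: "('r \<Rightarrow> complex) \<Rightarrow> complex \<Rightarrow> 'r \<Rightarrow> 'x \<Rightarrow> 'r poly \<Rightarrow> complex" where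
  "extval \<delta> w b x G = poly (map_poly \<delta> G) (ev x b) + ev x (poly (pder G) b) * w"

lemma pointderD:
  assumes "pointder C x \<delta>"
  shows "u \<in> C \<Longrightarrow> v \<in> C \<Longrightarrow> \<delta> (u + v) = \<delta> u + \<delta> v"
    "u \<in> C \<Longrightarrow> v \<in> C \<Longrightarrow> \<delta> (u * v) = ev x u * \<delta> v + ev x v * \<delta> u" "\<delta> (\<kappa> c) = 0" "\<delta> 0 = 0" "\<delta> 1 = 0"
proof -
  show "\<delta> (\<kappa> c) = 0" for c using assms by (simp add: pointder_def)
  from this[of 0] this[of 1] show "\<delta> 0 = 0" "\<delta> 1 = 0" by (simp_all add: ksimps)
qed (use assms in \<open>simp_all add: pointder_def\<close>)

lemma pder_add: "pder (G + H) = pder G + pder H"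
  by (rule poly_eqI) (simp add: coeff_pder algebra_simps)

text \<open>Together these rules say that \<open>extval\<close> is a point derivation of the
  polynomial ring C[X] at the point over \<open>x\<close> where X takes the value of
  \<open>b\<close>. It is not yet a function on C[b].\<close>

lemma extval_rules:
  assumes C: "csub C" and d: "pointder C x \<delta>"
  shows "extval \<delta> w b x 0 = 0"
    and "extval \<delta> w b x (pCons c G) = \<delta> c + ev x b * extval \<delta> w b x G + ev x (poly G b) * w"
    and "G \<in> polc C \<Longrightarrow> H \<in> polc C \<Longrightarrow> extval \<delta> w b x (G + H) = extval \<delta> w b x G + extval \<delta> w b x H"
    and "c \<in> C \<Longrightarrow> H \<in> polc C \<Longrightarrow> extval \<delta> w b x (Polynomial.smult c H) = ev x c * extval \<delta> w b x H + \<delta> c * ev x (poly H b)"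
    and "G \<in> polc C \<Longrightarrow> H \<in> polc C \<Longrightarrow>
      extval \<delta> w b x (G * H) = ev x (poly G b) * extval \<delta> w b x H + ev x (poly H b) * extval \<delta> w b x G"
proof -
  show zero: "extval \<delta> w b x 0 = 0" by (simp add: extval_def esimps)
  show pc: "extval \<delta> w b x (pCons c G) = \<delta> c + ev x b * extval \<delta> w b x G + ev x (poly G b) * w" for c G
    by (simp add: extval_def pder_pCons map_poly_pCons pointderD[OF d] esimps algebra_simps)
  show add: "extval \<delta> w b x (G + H) = extval \<delta> w b x G + extval \<delta> w b x H" if "G \<in> polc C" "H \<in> polc C" for G H
  proof -
    have "map_poly \<delta> (G + H) = map_poly \<delta> G + map_poly \<delta> H"
      using that by (intro poly_eqI) (simp add: coeff_map_poly pointderD[OF d] polc_def)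
    then show ?thesis by (simp add: extval_def pder_add esimps algebra_simps)
  qed
  show sm: "extval \<delta> w b x (Polynomial.smult c H) = ev x c * extval \<delta> w b x H + \<delta> c * ev x (poly H b)"
    if "c \<in> C" "H \<in> polc C" for c H
    using C that(2)
  proof (induction rule: polc_induct)
    case 0 then show ?case by (simp add: zero esimps)
  next
    case (pCons a G)
    then show ?case using that(1) by (simp add: pc pointderD[OF d] esimps algebra_simps)
  qed
  assume G: "G \<in> polc C" and H: "H \<in> polc C"
  show "extval \<delta> w b x (G * H) = ev x (poly G b) * extval \<delta> w b x H + ev x (poly H b) * extval \<delta> w b x G"
    using C G
  proof (induction rule: polc_induct)
    case 0 then show ?case by (simp add: zero esimps)
  next
    case (pCons a G)
    have "Polynomial.smult a H \<in> polc C" "pCons 0 (G * H) \<in> polc C"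
      using pCons(1,2) H polc_closed(4,5)[OF C] csubD(2)[OF C] by (auto simp: polc_pCons[OF C])
    then show ?case using pCons H
      by (simp add: mult_pCons_left add pc sm pointderD[OF d] esimps algebra_simps)
  qed
qed

text \<open>A derivation of C[X] descends to C[b] as soon as it kills the relations of
  \<open>b\<close>; this is \<open>wd\<close>, and it makes the choice of the polynomial below
  irrelevant.\<close>

lemma pointder_extend:
  assumes C: "csub C" and d: "pointder C x \<delta>"
    and wd: "\<And>G. G \<in> polc C \<Longrightarrow> poly G b = 0 \<Longrightarrow> extval \<delta> w b x G = 0"
  shows "\<exists>\<delta>'. pointder (adj C b) x \<delta>' \<and> (\<forall>c\<in>C. \<delta>' c = \<delta> c) \<and> \<delta>' b = w"
proof -
  define \<delta>' where "\<delta>' u = extval \<delta> w b x (SOME G. G \<in> polc C \<and> poly G b = u)" for u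
  note r = extval_rules[OF C d]
  have val: "\<delta>' (poly G b) = extval \<delta> w b x G" if G: "G \<in> polc C" for G
  proof -
    define H where "H = (SOME H. H \<in> polc C \<and> poly H b = poly G b)"
    have H: "H \<in> polc C" "poly H b = poly G b"
      using someI[of "\<lambda>H. H \<in> polc C \<and> poly H b = poly G b" G] G unfolding H_def by auto
    have "extval \<delta> w b x H = extval \<delta> w b x (G + (H - G))" by simp
    also have "\<dots> = extval \<delta> w b x G + extval \<delta> w b x (H - G)"
      using G H polc_closed(3)[OF C] by (intro r(3)) auto
    also have "extval \<delta> w b x (H - G) = 0" using G H polc_closed(3)[OF C] by (intro wd) auto
    finally show ?thesis by (simp add: \<delta>'_def H_def)
  qed
  have const: "[:c:] \<in> polc C" if "c \<in> C" for c using that polc_closed(1)[OF C] by (simp add: polc_pCons[OF C])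
  have old: "\<delta>' c = \<delta> c" if "c \<in> C" for c
    using val[OF const[OF that]] by (simp add: r(1,2) esimps)
  have "[:0,1:] \<in> polc C" using const[OF csubD(3)[OF C]] csubD(2)[OF C] by (simp add: polc_pCons[OF C])
  from val[OF this] have new: "\<delta>' b = w" by (simp add: r(1,2) esimps pointderD[OF d])
  have "pointder (adj C b) x \<delta>'"
    unfolding pointder_def
  proof (intro conjI ballI allI)
    fix u v assume "u \<in> adj C b" "v \<in> adj C b"
    then obtain G H where GH: "G \<in> polc C" "H \<in> polc C" "u = poly G b" "v = poly H b" by (auto simp: adj_def)
    show "\<delta>' (u + v) = \<delta>' u + \<delta>' v"
      using val[OF polc_closed(2)[OF C GH(1,2)]] by (simp add: GH val r(3))
    show "\<delta>' (u * v) = ev x u * \<delta>' v + ev x v * \<delta>' u"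
      using val[OF polc_closed(4)[OF C GH(1,2)]] by (simp add: GH val r(5))
  next
    show "\<delta>' (\<kappa> c) = 0" for c using old[OF csubD(1)[OF C]] pointderD(3)[OF d] by simp
  qed
  then show ?thesis using old new by blast
qed

text \<open>It is enough to kill \<open>F\<close>: every relation of \<open>b\<close> is a multiple
  of \<open>F\<close> after multiplication by a power of the leading coefficient, and that power is
  nonzero at \<open>x\<close>.\<close>

lemma duals_algebraic:
  assumes C: "csub C" and F: "minpoly C b F" and l: "ev x (Polynomial.coeff F (Polynomial.degree F)) \<noteq> 0"
    and F': "ev x (poly (pder F) b) \<noteq> 0" and t: "\<And>i. i < r \<Longrightarrow> t i \<in> C" and du: "duals C r t x"
  shows "duals (adj C b) r t x"
  unfolding duals_def
proof (intro allI impI)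
  fix j assume "j < r"
  then obtain \<delta> where d: "pointder C x \<delta>" and dt: "\<forall>i<r. \<delta> (t i) = (if i = j then 1 else 0)"
    using du unfolding duals_def by blast
  \<comment> \<open>Implicit differentiation: the only value at \<open>b\<close> for which the
    extension kills \<open>F\<close>.\<close>
  define w where "w = - poly (map_poly \<delta> F) (ev x b) / ev x (poly (pder F) b)"
  have FC: "F \<in> polc C" "poly F b = 0" using F by (auto simp: minpoly_def)
  have F0: "extval \<delta> w b x F = 0" using F' by (simp add: extval_def w_def)
  have lC: "Polynomial.coeff F (Polynomial.degree F) \<in> C" using FC by (auto simp: polc_def)
  have "extval \<delta> w b x G = 0" if G: "G \<in> polc C" "poly G b = 0" for G
  proof -
    obtain n H where H: "H \<in> polc C" "Polynomial.smult (Polynomial.coeff F (Polynomial.degree F) ^ n) G = F * H"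
      using minpoly_dvd[OF C F G] by blast
    have "extval \<delta> w b x (Polynomial.smult (Polynomial.coeff F (Polynomial.degree F) ^ n) G) = extval \<delta> w b x (F * H)"
      using H by simp
    then have "ev x (Polynomial.coeff F (Polynomial.degree F)) ^ n * extval \<delta> w b x G = 0"
      using FC G H(1) F0 csubD(9)[OF C lC]
      by (simp add: extval_rules(4)[OF C d] extval_rules(5)[OF C d] esimps)
    then show ?thesis using l by simp
  qed
  from pointder_extend[OF C d this] obtain \<delta>' where "pointder (adj C b) x \<delta>'" "\<forall>c\<in>C. \<delta>' c = \<delta> c" by blast
  then show "\<exists>\<delta>. pointder (adj C b) x \<delta> \<and> (\<forall>i<r. \<delta> (t i) = (if i = j then 1 else 0))"
    using dt t by auto
qed

text \<open>Without relations the value at \<open>b\<close> is free. The old dual vectors are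
  extended by 0, and the new one extends the zero derivation by 1.\<close>

lemma duals_transcendental:
  assumes C: "csub C" and b: "\<And>G. G \<in> polc C \<Longrightarrow> poly G b = 0 \<Longrightarrow> G = 0"
    and t: "\<And>i. i < r \<Longrightarrow> t i \<in> C" and du: "duals C r t x"
  shows "duals (adj C b) (Suc r) (t(r := b)) x"
  unfolding duals_def
proof (intro allI impI)
  fix j assume j: "j < Suc r"
  have "\<exists>\<delta>. pointder C x \<delta> \<and> (\<forall>i<r. \<delta> (t i) = (if i = j then 1 else 0))"
  proof (cases "j < r")
    case True then show ?thesis using du unfolding duals_def by blast
  next
    case False then show ?thesis using j by (intro exI[of _ "\<lambda>_. 0"]) (simp add: pointder_def)
  qed
  then obtain \<delta> where d: "pointder C x \<delta>" and dt: "\<forall>i<r. \<delta> (t i) = (if i = j then 1 else 0)" by blast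
  have "extval \<delta> (if j = r then 1 else 0) b x G = 0" if "G \<in> polc C" "poly G b = 0" for G
    using b[OF that] by (simp add: extval_rules(1)[OF C d])
  from pointder_extend[OF C d this] obtain \<delta>' where "pointder (adj C b) x \<delta>'" "\<forall>c\<in>C. \<delta>' c = \<delta> c"
    "\<delta>' b = (if j = r then 1 else 0)" by blast
  then show "\<exists>\<delta>. pointder (adj C b) x \<delta> \<and> (\<forall>i<Suc r. \<delta> ((t(r := b)) i) = (if i = j then 1 else 0))"
    using dt t by (intro exI[of _ \<delta>']) (auto simp: less_Suc_eq)
qed

text \<open>A point derivation kills the square of the maximal ideal, so the \<open>j\<close>-th
  dual vector reads off the coefficient \<open>f j\<close>.\<close>

lemma duals_independent:
  assumes C: "csub C" and t: "\<And>i. i < r \<Longrightarrow> t i \<in> C" and du: "duals C r t x"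
    and l: "lin r t x f \<in> N2 C x" and j: "j < r"
  shows "f j = 0"
proof -
  obtain \<delta> where d: "pointder C x \<delta>" and dt: "\<forall>i<r. \<delta> (t i) = (if i = j then 1 else 0)"
    using du j unfolding duals_def by blast
  have N: "u \<in> C \<and> \<delta> u = 0" if "u \<in> N2 C x" for u
    using that unfolding N2_def
  proof (induction rule: V.span_induct_alt)
    case base then show ?case using csubD(2)[OF C] pointderD(4)[OF d] by simp
  next
    case (step c v y)
    then obtain p q where pq: "v = p * q" "p \<in> C" "q \<in> C" "ev x p = 0" "ev x q = 0" by (auto simp: nx_def)
    have "\<delta> v = 0" "v \<in> C" using pq pointderD(2)[OF d] csubD(5)[OF C] by auto
    then show ?case using step csubD(1,4,5)[OF C] pointderD[OF d] by (simp add: esimps)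
  qed
  have sum: "(\<Sum>i\<in>I. g i) \<in> C \<and> \<delta> (\<Sum>i\<in>I. g i) = (\<Sum>i\<in>I. \<delta> (g i))" if "finite I" "\<And>i. i \<in> I \<Longrightarrow> g i \<in> C" for I and g :: "nat \<Rightarrow> 'r"
    using that by (induction I) (auto simp: pointderD[OF d] csubD[OF C])
  have tC: "\<kappa> (f i) * dv x (t i) \<in> C" if "i < r" for i
    using csubD[OF C] t[OF that] by (auto simp: dv_def)
  have "\<delta> (dv x u) = \<delta> u" if "u \<in> C" for u
  proof -
    have "\<delta> (dv x u) = \<delta> (u + \<kappa> (- ev x u))" by (simp add: dv_def ksimps)
    also have "\<dots> = \<delta> u" using that csubD(1)[OF C] by (simp add: pointderD[OF d])
    finally show ?thesis .
  qed
  then have "\<delta> (\<kappa> (f i) * dv x (t i)) = f i * \<delta> (t i)" if "i < r" for i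
    using t[OF that] csubD[OF C] dv_in[OF C t[OF that], of x] by (simp add: pointderD[OF d] esimps nx_def)
  then have "\<delta> (lin r t x f) = (\<Sum>i<r. f i * \<delta> (t i))"
    unfolding lin_def using sum[of "{..<r}"] tC by simp
  also have "\<dots> = (\<Sum>i<r. if i = j then f i else 0)" using dt by (intro sum.cong) auto
  also have "\<dots> = f j" using j by simp
  finally show ?thesis using N[OF l] by simp
qed

end

context complex_eval begin

subsection \<open>Growth\<close>

fun pw :: "'r set \<Rightarrow> nat \<Rightarrow> 'r set" where
  "pw Y 0 = {1}"
| "pw Y (Suc m) = {y * u | y u. y \<in> Y \<and> u \<in> pw Y m}"

definition Sp :: "'r set \<Rightarrow> nat \<Rightarrow> 'r set" where "Sp Y m = V.span (pw Y m)"

text \<open>Gelfand-Kirillov dimension at most \<open>r\<close>, up to denominators: the products of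
  m elements of \<open>Y\<close>, once multiplied by a common nonzero \<open>h\<close>, lie in a
  space of dimension O((m + 1)^r). The factor \<open>h\<close> may depend on m and absorbs the
  powers of leading coefficients that arise in algebraic extensions.\<close>

definition growth :: "'r set \<Rightarrow> nat \<Rightarrow> bool" where
  "growth C r \<longleftrightarrow> (\<forall>Y. finite Y \<longrightarrow> Y \<subseteq> C \<longrightarrow> (\<exists>K::nat. \<forall>m. \<exists>h\<in>C. h \<noteq> 0 \<and>
     (\<exists>W. finite W \<and> card W \<le> K * (m + 1) ^ r \<and> (\<forall>u\<in>pw Y m. h * u \<in> V.span W))))"

lemma pw_mult: "u \<in> pw Y m \<Longrightarrow> v \<in> pw Y n \<Longrightarrow> u * v \<in> pw Y (m + n)"
proof (induction m arbitrary: u)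
  case (Suc m)
  then obtain y w where "u = y * w" "y \<in> Y" "w \<in> pw Y m" by auto
  then show ?case using Suc by (auto simp: mult.assoc)
qed simp

lemma pw_mono: assumes "1 \<in> Y" "m \<le> n" shows "pw Y m \<subseteq> pw Y n"
  using assms(2)
proof (induction n rule: dec_induct)
  case (step n)
  have "pw Y n \<subseteq> pw Y (Suc n)"
  proof
    fix u assume "u \<in> pw Y n"
    then have "1 * u \<in> pw Y (Suc n)" using assms(1) unfolding pw.simps by blast
    then show "u \<in> pw Y (Suc n)" by simp
  qed
  then show ?case using step by blast
qed simp

lemma Sp_closed:
  "0 \<in> Sp Y m" "u \<in> Sp Y m \<Longrightarrow> v \<in> Sp Y m \<Longrightarrow> u + v \<in> Sp Y m"
  "u \<in> Sp Y m \<Longrightarrow> v \<in> Sp Y m \<Longrightarrow> u - v \<in> Sp Y m" "(\<And>i. i \<in> I \<Longrightarrow> g i \<in> Sp Y m) \<Longrightarrow> (\<Sum>i\<in>I. g i) \<in> Sp Y m"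
  unfolding Sp_def by (auto intro: V.span_zero V.span_add V.span_diff V.span_sum)

lemma span_times:
  assumes "u \<in> V.span A" "\<And>a. a \<in> A \<Longrightarrow> a * v \<in> V.span B" shows "u * v \<in> V.span B"
  using assms(1)
proof (induction rule: V.span_induct_alt)
  case base then show ?case by (simp add: V.span_zero)
next
  case (step c a y)
  have "(\<kappa> c * a + y) * v = \<kappa> c * (a * v) + y * v" by (simp add: algebra_simps)
  then show ?case using step assms(2) by (auto intro: V.span_add V.span_scale)
qed

lemma span_times_left:
  assumes "u \<in> V.span A" "\<And>a. a \<in> A \<Longrightarrow> v * a \<in> V.span B" shows "v * u \<in> V.span B"
  using span_times[OF assms(1), of v B] assms(2) by (simp only: mult.commute[of _ v])

lemma Sp_times: assumes y: "y \<in> Y" and u: "u \<in> Sp Y m" shows "y * u \<in> Sp Y (Suc m)"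
  using u unfolding Sp_def by (rule span_times_left) (use y in \<open>auto intro!: V.span_base\<close>)

lemma finite_coeffs: "finite (range (Polynomial.coeff G))"
proof (rule finite_subset)
  show "range (Polynomial.coeff G) \<subseteq> insert 0 (Polynomial.coeff G ` {..Polynomial.degree G})"
  proof
    fix c assume "c \<in> range (Polynomial.coeff G)"
    then obtain i where "c = Polynomial.coeff G i" by blast
    then show "c \<in> insert 0 (Polynomial.coeff G ` {..Polynomial.degree G})"
      using coeff_eq_0[of G i] by (cases "i \<le> Polynomial.degree G") auto
  qed
qed simp

text \<open>Multiplying polynomials of degree at most \<open>e\<close> with coefficients in
  \<open>Z\<close>: after m factors the coefficients are sums of products of m elements of
  \<open>Z\<close>, and the degree is at most e m.\<close>

lemma pw_poly:
  assumes G: "\<And>y. y \<in> Y \<Longrightarrow> poly (G y) b = y" "\<And>y i. y \<in> Y \<Longrightarrow> Polynomial.coeff (G y) i \<in> Z"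
    and e: "\<And>y. y \<in> Y \<Longrightarrow> Polynomial.degree (G y) \<le> e"
  shows "u \<in> pw Y m \<Longrightarrow> \<exists>U. poly U b = u \<and> (\<forall>i. Polynomial.coeff U i \<in> Sp Z m) \<and> (\<forall>i>e*m. Polynomial.coeff U i = 0)"
proof (induction m arbitrary: u)
  case 0
  then show ?case
    by (intro exI[of _ "[:1:]"]) (auto simp: coeff_pCons Sp_closed split: nat.splits intro!: V.span_base simp: Sp_def V.span_zero)
next
  case (Suc m)
  then obtain y w where y: "u = y * w" "y \<in> Y" "w \<in> pw Y m" by auto
  obtain U where U: "poly U b = w" "\<And>i. Polynomial.coeff U i \<in> Sp Z m" "\<And>i. i>e*m \<Longrightarrow> Polynomial.coeff U i = 0"
    using Suc.IH[OF y(3)] by blast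
  have "Polynomial.coeff (G y * U) i \<in> Sp Z (Suc m)" for i
    unfolding coeff_mult using U(2) G(2)[OF y(2)] by (intro Sp_closed Sp_times) auto
  moreover have "Polynomial.coeff (G y * U) i = 0" if "i > e * Suc m" for i
    unfolding coeff_mult
  proof (rule sum.neutral, rule ballI)
    fix j assume "j \<in> {..i}"
    show "Polynomial.coeff (G y) j * Polynomial.coeff U (i - j) = 0"
    proof (cases "j > e")
      case True
      then have "Polynomial.coeff (G y) j = 0" using e[OF y(2)] by (intro coeff_eq_0) auto
      then show ?thesis by simp
    next
      case False
      then have "i - j > e * m" using that by auto
      then show ?thesis using U(3) by simp
    qed
  qed
  ultimately show ?case using U(1) G(1)[OF y(2)] y(1) by (intro exI[of _ "G y * U"]) auto
qed

lemma poly_sum_bound: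
  fixes U :: "'r poly"
  assumes "\<And>i. i > n \<Longrightarrow> Polynomial.coeff U i = 0"
  shows "poly U b = (\<Sum>i\<le>n. Polynomial.coeff U i * b ^ i)"
proof -
  have d: "Polynomial.degree U \<le> n" using assms by (meson degree_le)
  show ?thesis unfolding poly_altdef
    by (rule sum.mono_neutral_left) (use d in \<open>auto simp: coeff_eq_0\<close>)
qed

lemma span_power_basis:
  assumes u: "u = (\<Sum>i\<le>n. s i * b ^ i)" and s: "\<And>i. h * s i \<in> V.span W" and W: "finite W"
  shows "\<exists>W'. finite W' \<and> card W' \<le> card W * (n + 1) \<and> h * u \<in> V.span W' \<and> W' = (\<lambda>(w, i). w * b ^ i) ` (W \<times> {..n})"
proof -
  let ?W = "(\<lambda>(w, i). w * b ^ i) ` (W \<times> {..n})"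
  have "card ?W \<le> card (W \<times> {..n})" by (rule card_image_le) (use W in simp)
  moreover have "h * u \<in> V.span ?W"
  proof -
    have "h * u = (\<Sum>i\<le>n. (h * s i) * b ^ i)" by (simp add: u sum_distrib_left mult.assoc)
    also have "\<dots> \<in> V.span ?W"
    proof (rule V.span_sum)
      fix i assume i: "i \<in> {..n}"
      show "h * s i * b ^ i \<in> V.span ?W"
        using s[of i] by (rule span_times) (use i in \<open>auto intro!: V.span_base\<close>)
    qed
    finally show ?thesis .
  qed
  ultimately show ?thesis using W by (intro exI[of _ ?W]) (auto simp: card_cartesian_product)
qed

lemma Sp_scaled: assumes "\<forall>u\<in>pw Y m. h * u \<in> V.span W" "u \<in> Sp Y m" shows "h * u \<in> V.span W"
  using assms(2) unfolding Sp_def by (rule span_times_left) (use assms(1) in blast)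

lemma adj_coeff_data:
  assumes Y: "finite Y" "Y \<subseteq> adj C b"
  obtains G e where "\<And>y. y \<in> Y \<Longrightarrow> G y \<in> polc C" "\<And>y. y \<in> Y \<Longrightarrow> poly (G y) b = y"
    "\<And>y. y \<in> Y \<Longrightarrow> Polynomial.degree (G y) \<le> (e::nat)"
proof -
  have "\<forall>y\<in>Y. \<exists>G\<in>polc C. poly G b = y" using Y by (auto simp: adj_def)
  then obtain G where G: "\<And>y. y \<in> Y \<Longrightarrow> G y \<in> polc C" "\<And>y. y \<in> Y \<Longrightarrow> poly (G y) b = y" by metis
  show ?thesis
    by (rule that[of G "\<Sum>y\<in>Y. Polynomial.degree (G y)"]) (use G Y in \<open>auto intro: member_le_sum\<close>)
qed

text \<open>A product of m elements of C[b] has degree at most e m in \<open>b\<close>. Its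
  coefficients obey the bound for \<open>C\<close>, and the e m + 1 powers of \<open>b\<close> raise
  the exponent by one.\<close>

lemma growth_transcendental:
  assumes C: "csub C" and gr: "growth C r"
  shows "growth (adj C b) (Suc r)"
  unfolding growth_def
proof (intro allI impI)
  fix Y assume Y: "finite Y" "Y \<subseteq> adj C b"
  from adj_coeff_data[OF Y] obtain G e where G: "\<And>y. y \<in> Y \<Longrightarrow> G y \<in> polc C" "\<And>y. y \<in> Y \<Longrightarrow> poly (G y) b = y"
    "\<And>y. y \<in> Y \<Longrightarrow> Polynomial.degree (G y) \<le> e" by blast
  define Z where "Z = (\<Union>y\<in>Y. range (Polynomial.coeff (G y)))"
  have ZG: "\<And>y i. y \<in> Y \<Longrightarrow> Polynomial.coeff (G y) i \<in> Z" unfolding Z_def by blast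
  have fin: "finite Z" "Z \<subseteq> C" using Y G by (auto simp: Z_def finite_coeffs polc_def)
  from gr[unfolded growth_def, rule_format, OF fin] obtain K where K: "\<forall>m. \<exists>h\<in>C. h \<noteq> 0 \<and> (\<exists>W. finite W \<and> card W \<le> K * (m + 1) ^ r \<and> (\<forall>u\<in>pw Z m. h * u \<in> V.span W))" ..
  show "\<exists>K::nat. \<forall>m. \<exists>h\<in>adj C b. h \<noteq> 0 \<and> (\<exists>W. finite W \<and> card W \<le> K * (m + 1) ^ Suc r \<and> (\<forall>u\<in>pw Y m. h * u \<in> V.span W))"
  proof (intro exI[of _ "K * (e + 1)"] allI)
    fix m
    obtain h W where h: "h \<in> C" "h \<noteq> 0" and W: "finite W" "card W \<le> K * (m + 1) ^ r" "\<forall>u\<in>pw Z m. h * u \<in> V.span W"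
      using spec[OF K, of m] by blast
    let ?W = "(\<lambda>(w, i). w * b ^ i) ` (W \<times> {..e*m})"
    have "h * u \<in> V.span ?W" if u: "u \<in> pw Y m" for u
    proof -
      have "\<exists>U. poly U b = u \<and> (\<forall>i. Polynomial.coeff U i \<in> Sp Z m) \<and> (\<forall>i>e*m. Polynomial.coeff U i = 0)"
        by (rule pw_poly[of Y G b Z e u m]) (fact G(2) ZG G(3) u)+
      then obtain U where U: "poly U b = u" "\<And>i. Polynomial.coeff U i \<in> Sp Z m" "\<And>i. i>e*m \<Longrightarrow> Polynomial.coeff U i = 0"
        by blast
      have "u = (\<Sum>i\<le>e*m. Polynomial.coeff U i * b ^ i)" using poly_sum_bound[OF U(3)] U(1) by simp
      from span_power_basis[OF this, of h W] Sp_scaled[OF W(3) U(2)] W(1) show ?thesis by blast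
    qed
    moreover have "card ?W \<le> K * (e + 1) * (m + 1) ^ Suc r"
    proof -
      have "card ?W \<le> card (W \<times> {..e*m})" by (rule card_image_le) (use W in simp)
      also have "\<dots> = card W * (e * m + 1)" by (simp add: card_cartesian_product)
      also have "\<dots> \<le> (K * (m + 1) ^ r) * ((e + 1) * (m + 1))" using W(2) by (intro mult_mono) auto
      finally show ?thesis by (simp add: algebra_simps)
    qed
    ultimately show "\<exists>h\<in>adj C b. h \<noteq> 0 \<and> (\<exists>W. finite W \<and> card W \<le> K * (e + 1) * (m + 1) ^ Suc r \<and> (\<forall>u\<in>pw Y m. h * u \<in> V.span W))"
      using h adj_sup(1)[OF C] W(1) by (intro bexI[of _ h] conjI exI[of _ ?W]) auto
  qed
qed

text \<open>Pseudo-division with a record of word length: each cancellation multiplies coefficients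
  by one more coefficient of \<open>F\<close>, so \<open>n\<close> of them lead from
  \<open>Sp Z m\<close> to \<open>Sp Z (m + n)\<close>.\<close>

lemma Sp_reduction:
  assumes F: "poly F b = 0" "\<And>i. Polynomial.coeff F i \<in> Z"
  shows "(\<And>i. Polynomial.coeff S i \<in> Sp Z m) \<Longrightarrow> (\<And>i. i \<ge> Polynomial.degree F + n \<Longrightarrow> Polynomial.coeff S i = 0) \<Longrightarrow>
    \<exists>T. (\<forall>i. Polynomial.coeff T i \<in> Sp Z (m + n)) \<and> (\<forall>i\<ge>Polynomial.degree F. Polynomial.coeff T i = 0) \<and>
      poly T b = Polynomial.coeff F (Polynomial.degree F) ^ n * poly S b"
proof (induction n arbitrary: S m)
  case 0
  then show ?case by (intro exI[of _ S]) auto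
next
  case (Suc n)
  let ?d = "Polynomial.degree F"
  let ?l = "Polynomial.coeff F ?d"
  define c where "c = Polynomial.coeff S (?d + n)"
  define G' where "G' = Polynomial.smult ?l S - Polynomial.monom c n * F"
  have G': "Polynomial.coeff G' i \<in> Sp Z (Suc m)" for i
  proof -
    have "?l * Polynomial.coeff S i \<in> Sp Z (Suc m)" "Polynomial.coeff F (i - n) * c \<in> Sp Z (Suc m)"
      using F Suc.prems by (auto simp: c_def intro: Sp_times)
    then show ?thesis by (auto simp: G'_def Polynomial.coeff_monom_mult Sp_closed mult.commute[of c])
  qed
  have "Polynomial.coeff G' i = 0" if "i \<ge> ?d + n" for i
  proof (cases "i = ?d + n")
    case True
    then show ?thesis by (simp add: G'_def Polynomial.coeff_monom_mult c_def)
  next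
    case False
    then have "Polynomial.coeff S i = 0" "Polynomial.coeff F (i - n) = 0" using Suc.prems that by (auto intro: coeff_eq_0)
    then show ?thesis by (simp add: G'_def Polynomial.coeff_monom_mult)
  qed
  from Suc.IH[of G' "Suc m", OF G' this] obtain T where T: "\<And>i. Polynomial.coeff T i \<in> Sp Z (Suc m + n)" "\<forall>i\<ge>?d. Polynomial.coeff T i = 0"
    "poly T b = ?l ^ n * poly G' b" by blast
  have "poly G' b = ?l * poly S b" by (simp add: G'_def F)
  then show ?case using T by (intro exI[of _ T]) (auto simp: mult_ac)
qed

text \<open>Products of m elements have degree at most e m in \<open>b\<close> and are reduced
  modulo \<open>F\<close> by e m cancellations. This lengthens words in \<open>Z\<close> only by a
  constant factor, leaves boundedly many powers of \<open>b\<close>, and puts a power of the leading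
  coefficient into \<open>h\<close>; the exponent r survives.\<close>

lemma growth_algebraic:
  assumes C: "csub C" and A: "cdom (adj C b)" and F: "minpoly C b F" and gr: "growth C r"
  shows "growth (adj C b) r"
  unfolding growth_def
proof (intro allI impI)
  fix Y assume Y: "finite Y" "Y \<subseteq> adj C b"
  from adj_coeff_data[OF Y] obtain G e where G: "\<And>y. y \<in> Y \<Longrightarrow> G y \<in> polc C" "\<And>y. y \<in> Y \<Longrightarrow> poly (G y) b = y"
    "\<And>y. y \<in> Y \<Longrightarrow> Polynomial.degree (G y) \<le> e" by blast
  let ?d = "Polynomial.degree F"
  let ?l = "Polynomial.coeff F ?d"
  have FC: "F \<in> polc C" "poly F b = 0" "F \<noteq> 0" using F by (auto simp: minpoly_def)
  have CA: "C \<subseteq> adj C b" by (rule adj_sup[OF C])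
  have dC: "cdom C" using A C CA unfolding cdom_def by blast
  have d: "?d > 0" by (rule minpoly_degree[OF dC F])
  have l: "?l \<in> C" "?l \<noteq> 0" using FC by (auto simp: polc_def)
  define Z where "Z = insert 1 (range (Polynomial.coeff F) \<union> (\<Union>y\<in>Y. range (Polynomial.coeff (G y))))"
  have ZG: "\<And>y i. y \<in> Y \<Longrightarrow> Polynomial.coeff (G y) i \<in> Z" unfolding Z_def by blast
  have fin: "finite Z" "Z \<subseteq> C" using Y G FC csubD(3)[OF C] by (auto simp: Z_def finite_coeffs polc_def)
  from gr[unfolded growth_def, rule_format, OF fin] obtain K where K: "\<forall>m. \<exists>h\<in>C. h \<noteq> 0 \<and> (\<exists>W. finite W \<and> card W \<le> K * (m + 1) ^ r \<and> (\<forall>u\<in>pw Z m. h * u \<in> V.span W))" ..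
  show "\<exists>K::nat. \<forall>m. \<exists>h\<in>adj C b. h \<noteq> 0 \<and> (\<exists>W. finite W \<and> card W \<le> K * (m + 1) ^ r \<and> (\<forall>u\<in>pw Y m. h * u \<in> V.span W))"
  proof (intro exI[of _ "K * (e + 1) ^ r * (?d + 1)"] allI)
    fix m
    \<comment> \<open>The words have length (e + 1) m after reduction, whence the factor (e + 1)^r;
      the factor \<open>?d + 1\<close> counts the powers of \<open>b\<close>.\<close>
    obtain h W where h: "h \<in> C" "h \<noteq> 0" and W: "finite W" "card W \<le> K * ((m + e * m) + 1) ^ r" "\<forall>u\<in>pw Z (m + e * m). h * u \<in> V.span W"
      using spec[OF K, of "m + e * m"] by blast
    let ?W = "(\<lambda>(w, i). w * b ^ i) ` (W \<times> {..?d})"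
    have "(h * ?l ^ (e * m)) * u \<in> V.span ?W" if u: "u \<in> pw Y m" for u
    proof -
      have "\<exists>U. poly U b = u \<and> (\<forall>i. Polynomial.coeff U i \<in> Sp Z m) \<and> (\<forall>i>e*m. Polynomial.coeff U i = 0)"
        by (rule pw_poly[of Y G b Z e u m]) (fact G(2) ZG G(3) u)+
      then obtain U where U: "poly U b = u" "\<And>i. Polynomial.coeff U i \<in> Sp Z m" "\<And>i. i>e*m \<Longrightarrow> Polynomial.coeff U i = 0"
        by blast
      \<comment> \<open>Vanishing of the coefficients above e m gives vanishing from
        \<open>?d + e * m\<close> on, because \<open>?d\<close> is positive.\<close>
      have "\<exists>T. (\<forall>i. Polynomial.coeff T i \<in> Sp Z (m + e * m)) \<and> (\<forall>i\<ge>?d. Polynomial.coeff T i = 0) \<and>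
         poly T b = ?l ^ (e * m) * poly U b"
        by (rule Sp_reduction[OF FC(2)]) (use U d in \<open>auto simp: Z_def\<close>)
      then obtain T where T: "\<And>i. Polynomial.coeff T i \<in> Sp Z (m + e * m)" "\<And>i. i > ?d \<Longrightarrow> Polynomial.coeff T i = 0"
         "poly T b = ?l ^ (e * m) * poly U b" by (meson less_imp_le)
      have "poly T b = (\<Sum>i\<le>?d. Polynomial.coeff T i * b ^ i)" by (rule poly_sum_bound[OF T(2)])
      from span_power_basis[OF this, of h W] Sp_scaled[OF W(3) T(1)] W(1) have "h * poly T b \<in> V.span ?W" by blast
      then show ?thesis by (simp add: T(3) U(1) mult.assoc)
    qed
    moreover have "card ?W \<le> K * (e + 1) ^ r * (?d + 1) * (m + 1) ^ r"
    proof -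
      have "card ?W \<le> card (W \<times> {..?d})" by (rule card_image_le) (use W in simp)
      also have "\<dots> = card W * (?d + 1)" by (simp add: card_cartesian_product)
      also have "\<dots> \<le> (K * ((e + 1) * (m + 1)) ^ r) * (?d + 1)"
        using W(2) by (intro mult_right_mono order.trans[OF W(2)] mult_left_mono power_mono) auto
      finally show ?thesis by (simp only: power_mult_distrib mult_ac)
    qed
    moreover have "h * ?l ^ (e * m) \<noteq> 0"
      using cdomD(2)[OF dC h(1) csubD(9)[OF C l(1)]] cdomD(3)[OF dC l(1)] h l by blast
    moreover have "h * ?l ^ (e * m) \<in> adj C b" using CA csubD(5,9)[OF C] h l by blast
    ultimately show "\<exists>h\<in>adj C b. h \<noteq> 0 \<and> (\<exists>W. finite W \<and> card W \<le> K * (e + 1) ^ r * (?d + 1) * (m + 1) ^ r \<and> (\<forall>u\<in>pw Y m. h * u \<in> V.span W))"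
      using W(1) by (intro bexI[of _ "h * ?l ^ (e * m)"] conjI exI[of _ ?W]) auto
  qed
qed

lemma growth_base: "growth (range \<kappa>) 0"
  unfolding growth_def
proof (intro allI impI exI[of _ 1])
  fix Y m assume Y: "finite Y" "Y \<subseteq> range \<kappa>"
  have one: "1 \<noteq> (0::'r)" using eone ezero by (metis zero_neq_one)
  have "pw Y m \<subseteq> range \<kappa>"
  proof (induction m)
    case 0 then show ?case by (metis kone pw.simps(1) rangeI singletonD subsetI)
  next
    case (Suc m) then show ?case using Y(2) by (auto simp: image_iff) (metis kmult subsetD rangeE)
  qed
  then have "1 * u \<in> V.span {1}" if "u \<in> pw Y m" for u
  proof -
    obtain c where "u = \<kappa> c" using \<open>pw Y m \<subseteq> range \<kappa>\<close> \<open>u \<in> pw Y m\<close> by blast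
    then have "1 * u = \<kappa> c * 1" by simp
    then show ?thesis using V.span_scale[OF V.span_base, of 1 "{1}" c] by simp
  qed
  then show "\<exists>h\<in>range \<kappa>. h \<noteq> 0 \<and> (\<exists>W. finite W \<and> card W \<le> 1 * (m + 1) ^ 0 \<and> (\<forall>u\<in>pw Y m. h * u \<in> V.span W))"
    using one kone by (intro bexI[of _ 1] conjI exI[of _ "{1}"]) (auto simp: image_iff intro: exI[of _ 1])
qed

subsection \<open>Chains of primes\<close>

definition exps :: "nat \<Rightarrow> nat \<Rightarrow> nat list set" where
  "exps k m = {js. set js \<subseteq> {..m} \<and> length js = k}"

fun monv :: "'r list \<Rightarrow> nat list \<Rightarrow> 'r" where
  "monv (y # ys) (j # js) = y ^ j * monv ys js"
| "monv ys js = 1"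

lemma exps_Suc: "exps (Suc k) m = (\<lambda>(j, js). j # js) ` ({..m} \<times> exps k m)"
  by (auto simp: exps_def image_iff length_Suc_conv)

lemma finite_exps: "finite (exps k m)" and card_exps: "card (exps k m) = (m + 1) ^ k"
  unfolding exps_def using finite_lists_length_eq[of "{..m}" k] card_lists_length_eq[of "{..m}" k] by auto

lemma mono_in: "csub C \<Longrightarrow> set ys \<subseteq> C \<Longrightarrow> monv ys js \<in> C"
  by (induction ys js rule: monv.induct) (auto simp: csubD)

text \<open>Modulo \<open>Q\<close> only T 0 survives, so T 0 = 0. Then one factor y, which is not
  in \<open>P\<close>, is cancelled modulo \<open>P\<close>, and the argument repeats with the
  shifted sequence.\<close>

lemma graded_zero:
  assumes C: "csub C" and P: "cprime C P" and Q: "cprime C Q" "P \<subseteq> Q" and y: "y \<in> Q" "y \<notin> P"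
  shows "(\<And>j. T j \<in> C) \<Longrightarrow> (\<And>j. T j \<in> Q \<Longrightarrow> T j = 0) \<Longrightarrow> (\<Sum>j<n. y ^ j * T j) \<in> P \<Longrightarrow> j < n \<Longrightarrow> T j = 0"
proof (induction n arbitrary: T j)
  case (Suc n)
  have yC: "y \<in> C" using y cprimeD(1)[OF Q(1)] by blast
  have QI: "cideal C Q" using Q by (simp add: cprime_def)
  let ?s = "\<Sum>j<n. y ^ j * T (Suc j)"
  have s: "?s \<in> C" using Suc.prems(1) yC by (intro csub_sum[OF C] csubD[OF C])
  have eq: "(\<Sum>j<Suc n. y ^ j * T j) = T 0 + y * ?s"
    by (subst sum.lessThan_Suc_shift) (simp add: sum_distrib_left mult.assoc)
  have "T 0 = (T 0 + y * ?s) - ?s * y" by simp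
  also have "\<dots> \<in> Q"
    using Suc.prems(3) Q(2) cprimeD(5)[OF Q(1) s y(1)] unfolding eq by (intro cideal_diff[OF C QI]) auto
  finally have 0: "T 0 = 0" by (rule Suc.prems(2))
  then have "y * ?s \<in> P" using Suc.prems(3) unfolding eq by simp
  then have "?s \<in> P" using cprimeD(6)[OF P yC s] y by blast
  from Suc.IH[of "\<lambda>j. T (Suc j)", OF _ _ this] Suc.prems(1,2) have "T (Suc i) = 0" if "i < n" for i using that by blast
  then show ?case using 0 Suc.prems(4) by (cases j) auto
qed simp

text \<open>Elements picked from the successive gaps of a chain of primes are algebraically
  independent modulo its bottom. Expand in powers of the first one: the coefficients are
  combinations of monomials in the others, and by induction such a combination lies in
  \<open>P 1\<close> only if it is trivial.\<close>

lemma monomials_independent: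
  assumes C: "csub C"
  shows "(\<And>i. i \<le> k \<Longrightarrow> cprime C (P i)) \<Longrightarrow> (\<And>i. i < k \<Longrightarrow> P i \<subseteq> P (Suc i)) \<Longrightarrow> length ys = k \<Longrightarrow>
    (\<And>i. i < k \<Longrightarrow> ys ! i \<in> P (Suc i) - P i) \<Longrightarrow> (\<Sum>js\<in>exps k m. \<kappa> (c js) * monv ys js) \<in> P 0 \<Longrightarrow>
    js \<in> exps k m \<Longrightarrow> c js = 0"
proof (induction k arbitrary: P ys c js)
  case 0
  then have e: "exps 0 m = {[]}" by (auto simp: exps_def)
  have P0: "cprime C (P 0)" using 0 by simp
  have "\<kappa> (c []) \<in> P 0" using 0 unfolding e by simp
  then have "\<kappa> (inverse (c [])) * \<kappa> (c []) \<in> P 0" using cprimeD(5)[OF P0 csubD(1)[OF C]] by blast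
  then have "c [] = 0" using kcancel[of "c []"] cprimeD(3)[OF P0] by fastforce
  then show ?case using 0 e by auto
next
  case (Suc k)
  obtain y ys' where ys: "ys = y # ys'" using Suc.prems(3) by (cases ys) auto
  define T where "T j = (\<Sum>js\<in>exps k m. \<kappa> (c (j # js)) * monv ys' js)" for j
  have inj: "inj_on (\<lambda>(j, js). j # js) ({..m} \<times> exps k m)" by (auto simp: inj_on_def)
  have sum: "(\<Sum>js\<in>exps (Suc k) m. \<kappa> (c js) * monv ys js) = (\<Sum>j<Suc m. y ^ j * T j)"
    unfolding exps_Suc sum.reindex[OF inj] T_def sum_distrib_left
    by (simp add: sum.cartesian_product ys lessThan_Suc_atMost mult_ac case_prod_unfold)
  have IH: "c (j # js) = 0" if "T j \<in> P 1" "js \<in> exps k m" for j js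
  proof (rule Suc.IH[of "\<lambda>i. P (Suc i)" ys' "\<lambda>js. c (j # js)"])
    show "ys' ! i \<in> P (Suc (Suc i)) - P (Suc i)" if "i < k" for i
      using Suc.prems(4)[of "Suc i"] that by (simp add: ys)
  qed (use Suc.prems that in \<open>auto simp: ys T_def\<close>)
  have y: "y \<in> P 1 - P 0" using Suc.prems(4)[of 0] by (simp add: ys)
  have ysC: "set ys' \<subseteq> C"
  proof
    fix z assume "z \<in> set ys'"
    then obtain i where "i < k" "z = ys' ! i" using Suc.prems(3) by (auto simp: ys in_set_conv_nth)
    then have "z \<in> P (Suc (Suc i))" using Suc.prems(4)[of "Suc i"] by (simp add: ys)
    then show "z \<in> C" using cprimeD(1)[OF Suc.prems(1)[of "Suc (Suc i)"]] \<open>i < k\<close> by auto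
  qed
  have T0: "T j = 0" if "j < Suc m" for j
  proof (rule graded_zero[OF C Suc.prems(1)[of 0] Suc.prems(1)[of 1], of y T "Suc m" j])
    show "T j \<in> C" for j unfolding T_def using ysC by (intro csub_sum[OF C] csubD(1,5)[OF C] mono_in[OF C])
    show "T j = 0" if "T j \<in> P 1" for j unfolding T_def using IH[OF that] by (simp add: kzero)
    show "(\<Sum>j<Suc m. y ^ j * T j) \<in> P 0" using Suc.prems(5) unfolding sum .
  qed (use y that Suc.prems(2)[of 0] in auto)
  obtain j js' where js: "js = j # js'" "j \<le> m" "js' \<in> exps k m" using Suc.prems(6) unfolding exps_Suc by auto
  have "T j \<in> P 1" using T0[of j] js(2) cprimeD(2)[OF Suc.prems(1)[of 1]] by simp
  then show ?case using IH js by blast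
qed

lemma mono_pw:
  assumes "1 \<in> Y"
  shows "set ys \<subseteq> Y \<Longrightarrow> length js = length ys \<Longrightarrow> set js \<subseteq> {..m} \<Longrightarrow> monv ys js \<in> pw Y (length ys * m)"
proof (induction ys js rule: monv.induct)
  case (1 y ys j js)
  have "y ^ n \<in> pw Y n" for n using 1 by (induction n) auto
  then have "y ^ j \<in> pw Y m" using pw_mono[OF assms, of j m] 1 by auto
  then show ?case using 1 pw_mult by auto
qed auto

text \<open>A chain of length k supplies (m + 1)^k independent monomials with exponents at most m,
  while growth leaves room for only O((m + 1)^r). Cancelling \<open>h\<close> uses that
  \<open>C\<close> is a domain.\<close>

lemma chain_length_le:
  assumes C: "cdom C" and gr: "growth C r"
    and P: "\<And>i. i \<le> k \<Longrightarrow> cprime C (P i)" "\<And>i. i < k \<Longrightarrow> P i \<subset> P (Suc i)"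
  shows "k \<le> r"
proof -
  have cs: "csub C" by (rule cdomD[OF C])
  have "\<forall>i. \<exists>y. i < k \<longrightarrow> y \<in> P (Suc i) - P i" using P(2) by blast
  then obtain y where y: "\<And>i. i < k \<Longrightarrow> y i \<in> P (Suc i) - P i" by metis
  define ys where "ys = map y [0..<k]"
  have ys: "length ys = k" "\<And>i. i < k \<Longrightarrow> ys ! i \<in> P (Suc i) - P i" using y by (auto simp: ys_def)
  have ysC: "set ys \<subseteq> C"
  proof
    fix z assume "z \<in> set ys"
    then obtain i where i: "i < k" "z = y i" by (auto simp: ys_def)
    then show "z \<in> C" using y[OF i(1)] cprimeD(1)[OF P(1)[of "Suc i"]] by auto
  qed
  \<comment> \<open>With 1 in \<open>Y\<close>, monomials of smaller degree also count as products
    of exactly k m factors.\<close>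
  define Y where "Y = insert 1 (set ys)"
  have fin: "finite Y" "Y \<subseteq> C" using ysC csubD(3)[OF cs] by (auto simp: Y_def)
  from gr[unfolded growth_def, rule_format, OF fin] obtain K where K: "\<forall>m. \<exists>h\<in>C. h \<noteq> 0 \<and> (\<exists>W. finite W \<and> card W \<le> K * (m + 1) ^ r \<and> (\<forall>u\<in>pw Y m. h * u \<in> V.span W))" ..
  have bound: "(m + 1) ^ k \<le> K * (k + 1) ^ r * (m + 1) ^ r" for m
  proof -
    obtain h W where h: "h \<in> C" "h \<noteq> 0" and W: "finite W" "card W \<le> K * (k * m + 1) ^ r" "\<forall>u\<in>pw Y (k * m). h * u \<in> V.span W"
      using spec[OF K, of "k * m"] by blast
    let ?f = "\<lambda>js. h * monv ys js"
    have ind: "c js = 0" if "(\<Sum>js\<in>exps k m. \<kappa> (c js) * ?f js) = 0" "js \<in> exps k m" for c js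
    proof -
      have "h * (\<Sum>js\<in>exps k m. \<kappa> (c js) * monv ys js) = 0" using that(1) by (simp add: sum_distrib_left mult_ac)
      moreover have "(\<Sum>js\<in>exps k m. \<kappa> (c js) * monv ys js) \<in> C"
        using ysC by (intro csub_sum[OF cs] csubD(1,5)[OF cs] mono_in[OF cs])
      ultimately have P0: "(\<Sum>js\<in>exps k m. \<kappa> (c js) * monv ys js) \<in> P 0"
        using cdomD(2)[OF C h(1)] h(2) cprimeD(2)[OF P(1)[of 0]] by force
      show ?thesis
        by (rule monomials_independent[OF cs P(1) _ ys(1) ys(2) P0 that(2)])
          (use P(2) in \<open>auto intro: psubset_imp_subset\<close>)
    qed
    have inj: "inj_on ?f (exps k m)"
    proof (rule inj_onI, rule ccontr)
      fix a b assume ab: "a \<in> exps k m" "b \<in> exps k m" "?f a = ?f b" "a \<noteq> b"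
      define c :: "nat list \<Rightarrow> complex" where "c js = (if js = a then 1 else if js = b then -1 else 0)" for js
      have "(\<Sum>js\<in>exps k m. \<kappa> (c js) * ?f js) = (\<Sum>js\<in>{a, b}. \<kappa> (c js) * ?f js)"
        using ab finite_exps by (intro sum.mono_neutral_right) (auto simp: c_def kzero)
      also have "\<dots> = 0" using ab by (simp add: c_def ksimps)
      finally have "c a = 0" using ind ab(1) by blast
      then show False by (simp add: c_def)
    qed
    have "\<not> V.dependent (?f ` exps k m)"
    proof
      assume "V.dependent (?f ` exps k m)"
      then obtain c where c: "\<exists>v\<in>?f ` exps k m. c v \<noteq> 0" "(\<Sum>v\<in>?f ` exps k m. \<kappa> (c v) * v) = 0"
        using V.dependent_finite[of "?f ` exps k m"] finite_exps by auto
      have "(\<Sum>js\<in>exps k m. \<kappa> (c (?f js)) * ?f js) = 0" using c(2) by (simp add: sum.reindex[OF inj])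
      then show False using ind[of "\<lambda>js. c (?f js)"] c(1) by blast
    qed
    moreover have "?f ` exps k m \<subseteq> V.span W"
    proof
      fix v assume "v \<in> ?f ` exps k m"
      then obtain js where js: "js \<in> exps k m" "v = ?f js" by blast
      have "monv ys js \<in> pw Y (length ys * m)" by (rule mono_pw) (use js ys in \<open>auto simp: Y_def exps_def\<close>)
      then show "v \<in> V.span W" using W(3) js ys by auto
    qed
    ultimately have "card (?f ` exps k m) \<le> card W" using V.independent_span_bound[OF W(1)] by blast
    then have "(m + 1) ^ k \<le> card W" by (simp add: card_image[OF inj] card_exps)
    also have "\<dots> \<le> K * ((k + 1) * (m + 1)) ^ r"
      by (rule order.trans[OF W(2)]) (intro mult_left_mono power_mono, auto)
    finally show ?thesis by (simp only: power_mult_distrib mult_ac)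
  qed
  show "k \<le> r"
  proof (rule ccontr)
    assume "\<not> k \<le> r"
    \<comment> \<open>Taking m = M in the bound would give (M + 1)^(r + 1) <= M (M + 1)^r.\<close>
    define M where "M = K * (k + 1) ^ r"
    have "(M + 1) ^ r * (M + 1) = (M + 1) ^ Suc r" by simp
    also have "\<dots> \<le> (M + 1) ^ k" using \<open>\<not> k \<le> r\<close> by (intro power_increasing) auto
    also have "\<dots> \<le> M * (M + 1) ^ r" using bound[of M] by (simp add: M_def)
    finally show False by simp
  qed
qed

subsection \<open>Hilbert's basis theorem\<close>

text \<open>That \<open>B\<close> generates \<open>I\<close> is said through the ideals containing
  \<open>B\<close>, so no linear combinations have to be written down.\<close>

definition noeth :: "'r set \<Rightarrow> bool" where
  "noeth C \<longleftrightarrow> (\<forall>I. cideal C I \<longrightarrow> (\<exists>B. finite B \<and> B \<subseteq> I \<and> (\<forall>J. cideal C J \<longrightarrow> B \<subseteq> J \<longrightarrow> I \<subseteq> J)))"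

lemma noethE:
  assumes "noeth C" "cideal C I"
  obtains B where "finite B" "B \<subseteq> I" "\<And>J. cideal C J \<Longrightarrow> B \<subseteq> J \<Longrightarrow> I \<subseteq> J"
proof -
  from assms(1)[unfolded noeth_def, rule_format, OF assms(2)]
  obtain B where B: "finite B \<and> B \<subseteq> I \<and> (\<forall>J. cideal C J \<longrightarrow> B \<subseteq> J \<longrightarrow> I \<subseteq> J)" ..
  then show thesis by (intro that[of B]) simp_all
qed

lemma noeth_base: "noeth (range \<kappa>)"
  unfolding noeth_def
proof (intro allI impI)
  fix I assume I: "cideal (range \<kappa>) I"
  show "\<exists>B. finite B \<and> B \<subseteq> I \<and> (\<forall>J. cideal (range \<kappa>) J \<longrightarrow> B \<subseteq> J \<longrightarrow> I \<subseteq> J)"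
  proof (cases "I \<subseteq> {0}")
    case True
    then show ?thesis by (intro exI[of _ "{}"]) (auto simp: cideal_def)
  next
    case False
    then obtain u where "u \<in> I" "u \<noteq> 0" by blast
    then obtain c where c: "\<kappa> c \<in> I" "\<kappa> c \<noteq> 0" using I unfolding cideal_def by blast
    have "\<kappa> (inverse c) * \<kappa> c \<in> I" using c I unfolding cideal_def by blast
    then have "1 \<in> I" using kcancel[of c] c kzero by (cases "c = 0") auto
    moreover have "I \<subseteq> J" if J: "cideal (range \<kappa>) J" "1 \<in> J" for J
    proof
      fix u assume "u \<in> I"
      then have "u \<in> range \<kappa>" using I by (auto simp: cideal_def)
      then have "u * 1 \<in> J" using J unfolding cideal_def by blast
      then show "u \<in> J" by simp
    qed
    ultimately show ?thesis by (intro exI[of _ "{1}"]) auto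
  qed
qed

text \<open>The ideal of n-th coefficients of polynomials of degree at most n whose value at
  \<open>b\<close> lies in \<open>I\<close>. Since C[b] is only a quotient of C[X], membership is
  imposed on the value and not on the polynomial.\<close>

definition leads :: "'r set \<Rightarrow> 'r \<Rightarrow> 'r set \<Rightarrow> nat \<Rightarrow> 'r set" where
  "leads C b I n = {c. \<exists>U\<in>polc C. (\<forall>i>n. Polynomial.coeff U i = 0) \<and> Polynomial.coeff U n = c \<and> poly U b \<in> I}"

lemma leads_ideal: assumes C: "csub C" and I: "cideal (adj C b) I" shows "cideal C (leads C b I n)"
  unfolding cideal_def
proof (intro conjI ballI)
  show "leads C b I n \<subseteq> C" by (auto simp: leads_def polc_def)
  show "0 \<in> leads C b I n" using I polc_closed(1)[OF C] unfolding leads_def cideal_def by (auto intro!: bexI[of _ 0])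
  fix u v assume "u \<in> leads C b I n" "v \<in> leads C b I n"
  then obtain U V where *: "U \<in> polc C" "V \<in> polc C" "\<forall>i>n. Polynomial.coeff U i = 0" "\<forall>i>n. Polynomial.coeff V i = 0"
    "Polynomial.coeff U n = u" "Polynomial.coeff V n = v" "poly U b \<in> I" "poly V b \<in> I" unfolding leads_def by blast
  have "poly (U + V) b \<in> I" using * I by (simp add: cideal_def)
  then show "u + v \<in> leads C b I n" using * polc_closed(2)[OF C *(1,2)] unfolding leads_def by (auto intro!: bexI[of _ "U + V"])
next
  fix c u assume c: "c \<in> C" and "u \<in> leads C b I n"
  then obtain U where *: "U \<in> polc C" "\<forall>i>n. Polynomial.coeff U i = 0"
    "Polynomial.coeff U n = u" "poly U b \<in> I" unfolding leads_def by blast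
  have "c \<in> adj C b" using c adj_sup(1)[OF C] by blast
  then have "c * poly U b \<in> I" using *(4) I unfolding cideal_def by blast
  then have "poly (Polynomial.smult c U) b \<in> I" by simp
  then show "c * u \<in> leads C b I n" using * polc_closed(5)[OF C c *(1)] unfolding leads_def by (auto intro!: bexI[of _ "Polynomial.smult c U"])
qed

lemma leads_mono: assumes C: "csub C" and I: "cideal (adj C b) I" and mn: "m \<le> n" shows "leads C b I m \<subseteq> leads C b I n"
  using mn
proof (induction n rule: dec_induct)
  case (step n)
  have "leads C b I n \<subseteq> leads C b I (Suc n)"
  proof
    fix u assume "u \<in> leads C b I n"
    then obtain U where *: "U \<in> polc C" "\<forall>i>n. Polynomial.coeff U i = 0"
      "Polynomial.coeff U n = u" "poly U b \<in> I" unfolding leads_def by blast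
    have "poly (pCons 0 U) b \<in> I" using * I adj_sup(2)[OF C] by (auto simp: cideal_def)
    moreover have "\<forall>i>Suc n. Polynomial.coeff (pCons 0 U) i = 0" using * by (auto simp: coeff_pCons split: nat.splits)
    ultimately show "u \<in> leads C b I (Suc n)" using * csubD(2)[OF C] unfolding leads_def
      by (auto intro!: bexI[of _ "pCons 0 U"] simp: polc_pCons[OF C])
  qed
  then show ?case using step by blast
qed simp

lemma cideal_Int: "cideal C I \<Longrightarrow> cideal C J \<Longrightarrow> cideal C (I \<inter> J)"
  by (auto simp: cideal_def)

text \<open>The coefficient ideals of \<open>I\<close> increase with n, so a finite generating set
  of their union lies in the one at some stage \<open>M\<close>. Lifts of generators of the ideals
  up to \<open>M\<close> generate \<open>I\<close>.\<close>

lemma noeth_adj: assumes C: "csub C" and N: "noeth C" shows "noeth (adj C b)"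
  unfolding noeth_def
proof (intro allI impI)
  let ?A = "adj C b"
  have A: "csub ?A" by (rule csub_adj[OF C])
  fix I assume I: "cideal ?A I"
  let ?L = "leads C b I"
  have Lw: "cideal C (\<Union>n. ?L n)"
    unfolding cideal_def
  proof (intro conjI ballI)
    show "(\<Union>n. ?L n) \<subseteq> C" using leads_ideal[OF C I] unfolding cideal_def by blast
    show "0 \<in> (\<Union>n. ?L n)" using leads_ideal[OF C I] unfolding cideal_def by blast
    fix u v assume "u \<in> (\<Union>n. ?L n)" "v \<in> (\<Union>n. ?L n)"
    then obtain m n where "u \<in> ?L m" "v \<in> ?L n" by blast
    then have "u \<in> ?L (max m n)" "v \<in> ?L (max m n)"
      using leads_mono[OF C I, of m "max m n"] leads_mono[OF C I, of n "max m n"] by auto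
    then show "u + v \<in> (\<Union>n. ?L n)" using leads_ideal[OF C I, of "max m n"] unfolding cideal_def by blast
  next
    fix c u assume "c \<in> C" "u \<in> (\<Union>n. ?L n)"
    then show "c * u \<in> (\<Union>n. ?L n)" using leads_ideal[OF C I] unfolding cideal_def by blast
  qed
  obtain B where B: "finite B" "B \<subseteq> (\<Union>n. ?L n)" "\<And>J. cideal C J \<Longrightarrow> B \<subseteq> J \<Longrightarrow> (\<Union>n. ?L n) \<subseteq> J"
    by (rule noethE[OF N Lw]) (rule that)
  have "\<exists>n. B \<subseteq> ?L n" using B(1,2)
  proof (induction B)
    case (insert c B)
    then obtain n m where "B \<subseteq> ?L n" "c \<in> ?L m" by auto
    then show ?case using leads_mono[OF C I, of m "max m n"] leads_mono[OF C I, of n "max m n"]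
      by (intro exI[of _ "max m n"]) auto
  qed simp
  then obtain M where M: "B \<subseteq> ?L M" by blast
  then have stab: "?L n \<subseteq> ?L M" for n using B(3)[OF leads_ideal[OF C I] M] by blast
  have "\<forall>n. \<exists>B. finite B \<and> B \<subseteq> ?L n \<and> (\<forall>J. cideal C J \<longrightarrow> B \<subseteq> J \<longrightarrow> ?L n \<subseteq> J)"
  proof
    fix n
    show "\<exists>B. finite B \<and> B \<subseteq> ?L n \<and> (\<forall>J. cideal C J \<longrightarrow> B \<subseteq> J \<longrightarrow> ?L n \<subseteq> J)"
      by (rule N[unfolded noeth_def, rule_format, OF leads_ideal[OF C I]])
  qed
  then obtain B' where B': "\<And>n. finite (B' n)" "\<And>n. B' n \<subseteq> ?L n" "\<And>n J. cideal C J \<Longrightarrow> B' n \<subseteq> J \<Longrightarrow> ?L n \<subseteq> J" by metis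
  have "\<forall>n c. \<exists>U. c \<in> B' n \<longrightarrow> U \<in> polc C \<and> (\<forall>i>n. Polynomial.coeff U i = 0) \<and> Polynomial.coeff U n = c \<and> poly U b \<in> I"
    using B'(2) unfolding leads_def by blast
  then obtain U where U: "\<And>n c. c \<in> B' n \<Longrightarrow> U n c \<in> polc C \<and> (\<forall>i>n. Polynomial.coeff (U n c) i = 0) \<and> Polynomial.coeff (U n c) n = c \<and> poly (U n c) b \<in> I"
    by metis
  define E where "E = (\<Union>n\<in>{..M}. (\<lambda>c. poly (U n c) b) ` B' n)"
  have "finite E" "E \<subseteq> I" using B'(1) U by (auto simp: E_def)
  moreover have "I \<subseteq> J" if J: "cideal ?A J" and EJ: "E \<subseteq> J" for J
  proof -
    \<comment> \<open>To see that \<open>I\<close> lies in \<open>J\<close>, compare the coefficient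
      ideals of \<open>I\<close> with those of the intersection. Once they agree, top coefficients
      can be removed one by one with elements that lie in both.\<close>
    let ?K = "leads C b (I \<inter> J)"
    have IJ: "cideal ?A (I \<inter> J)" by (rule cideal_Int[OF I J])
    have low: "?L n \<subseteq> ?K n" if "n \<le> M" for n
    proof (rule B'(3)[OF leads_ideal[OF C IJ]])
      show "B' n \<subseteq> ?K n"
      proof
        fix c assume c: "c \<in> B' n"
        have "poly (U n c) b \<in> J" using c that EJ by (auto simp: E_def)
        then show "c \<in> ?K n" using U[OF c] unfolding leads_def by blast
      qed
    qed
    have all: "?L n \<subseteq> ?K n" for n
    proof (cases "n \<le> M")
      case False
      then have "?L n \<subseteq> ?K M" using stab[of n] low[of M] by blast
      then show ?thesis using leads_mono[OF C IJ, of M n] False by auto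
    qed (rule low)
    have "W \<in> polc C \<Longrightarrow> \<forall>i\<ge>n. Polynomial.coeff W i = 0 \<Longrightarrow> poly W b \<in> I \<Longrightarrow> poly W b \<in> J" for n W
    proof (induction n arbitrary: W)
      case 0
      then have "W = 0" by (intro poly_eqI) auto
      then show ?case using J by (simp add: cideal_def)
    next
      case (Suc n)
      have "Polynomial.coeff W n \<in> ?L n" unfolding leads_def
        by (intro CollectI bexI[of _ W]) (use Suc.prems in auto)
      then have "Polynomial.coeff W n \<in> ?K n" using all by blast
      then obtain T where T: "T \<in> polc C" "\<forall>i>n. Polynomial.coeff T i = 0" "Polynomial.coeff T n = Polynomial.coeff W n"
        "poly T b \<in> I \<inter> J" unfolding leads_def by blast
      have "\<forall>i\<ge>n. Polynomial.coeff (W - T) i = 0"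
      proof (intro allI impI)
        fix i assume "n \<le> i"
        then show "Polynomial.coeff (W - T) i = 0" using T Suc.prems(2) by (cases "i = n") auto
      qed
      moreover have "poly (W - T) b \<in> I" using Suc.prems(3) T(4) cideal_diff[OF A I] by simp
      ultimately have "poly (W - T) b \<in> J" using Suc.IH[OF polc_closed(3)[OF C Suc.prems(1) T(1)]] by blast
      then have "poly (W - T) b + poly T b \<in> J" using T(4) J unfolding cideal_def by blast
      then show ?case by simp
    qed
    note step = this
    show "I \<subseteq> J"
    proof
      fix u assume u: "u \<in> I"
      then have "u \<in> ?A" using I by (auto simp: cideal_def)
      then obtain W where W: "W \<in> polc C" "u = poly W b" by (auto simp: adj_def)
      show "u \<in> J" using step[OF W(1), of "Suc (Polynomial.degree W)"] u W(2) by (auto simp: coeff_eq_0)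
    qed
  qed
  ultimately show "\<exists>B. finite B \<and> B \<subseteq> I \<and> (\<forall>J. cideal ?A J \<longrightarrow> B \<subseteq> J \<longrightarrow> I \<subseteq> J)" by blast
qed

subsection \<open>Generic smoothness\<close>

definition adjoin :: "'r list \<Rightarrow> 'r set" where "adjoin bs = foldr (\<lambda>b C. adj C b) bs (range \<kappa>)"

lemma adjoin_simps: "adjoin [] = range \<kappa>" "adjoin (b # bs) = adj (adjoin bs) b"
  by (simp_all add: adjoin_def)

lemma csub_base: "csub (range \<kappa>)"
  unfolding csub_def by (auto simp: image_iff) (metis kadd, metis kmult)

lemma csub_adjoin: "csub (adjoin bs)"
  by (induction bs) (simp_all add: adjoin_simps csub_base csub_adj)

lemma set_adjoin: "set bs \<subseteq> adjoin bs"
  by (induction bs) (use adj_sup[OF csub_adjoin] in \<open>auto simp: adjoin_simps\<close>)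

lemma adjoin_least: "csub D \<Longrightarrow> set bs \<subseteq> D \<Longrightarrow> adjoin bs \<subseteq> D"
proof (induction bs)
  case Nil then show ?case by (simp add: adjoin_simps csub_def)
next
  case (Cons b bs) then show ?case unfolding adjoin_simps by (intro adj_least) auto
qed

lemma noeth_adjoin: "noeth (adjoin bs)"
  by (induction bs) (simp_all add: adjoin_simps noeth_base noeth_adj csub_adjoin)

text \<open>Here r is the transcendence degree of the domain and the \<open>t i\<close> are the
  transcendental generators met along the tower. The chain of primes and the growth bound will give
  height r; \<open>spans\<close> and \<open>duals\<close> give a basis of the cotangent
  space.\<close>

theorem generically_smooth:
  "cdom (adjoin bs) \<Longrightarrow> \<exists>r t. growth (adjoin bs) r \<and> (\<forall>i<r. t i \<in> adjoin bs) \<and>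
     (\<exists>f\<in>adjoin bs. f \<noteq> 0 \<and> (\<forall>x. ev x f \<noteq> 0 \<longrightarrow>
        prime_chain (adjoin bs) r x \<and> spans (adjoin bs) r t x = adjoin bs \<and> duals (adjoin bs) r t x))"
proof (induction bs)
  case Nil
  have C: "csub (range \<kappa>)" by (rule csub_base)
  have one: "1 \<noteq> (0::'r)" using eone ezero by (metis zero_neq_one)
  have "prime_chain (range \<kappa>) 0 x" for x
    unfolding prime_chain_def using cprime_nx[OF C] by (intro exI[of _ "\<lambda>_. nx (range \<kappa>) x"]) auto
  moreover have "spans (range \<kappa>) 0 t x = range \<kappa>" for t x
    unfolding spans_def lin_def using N2_closed(1) by (auto simp: dv_simps)
  moreover have "duals (range \<kappa>) 0 t x" for t x by (simp add: duals_def)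
  ultimately show ?case unfolding adjoin_simps using one growth_base csubD(3)[OF C]
    by (intro exI[of _ 0] exI[of _ "\<lambda>_. 0"] conjI bexI[of _ 1]) auto
next
  case (Cons b bs)
  let ?C = "adjoin bs" and ?A = "adj (adjoin bs) b"
  have C: "csub ?C" by (rule csub_adjoin)
  have CA: "?C \<subseteq> ?A" by (rule adj_sup[OF C])
  have A: "cdom ?A" using Cons.prems by (simp add: adjoin_simps)
  have As: "csub ?A" by (rule cdomD[OF A])
  have dC: "cdom ?C" using A C CA unfolding cdom_def by blast
  obtain r t f where gr: "growth ?C r" and t: "\<forall>i<r. t i \<in> ?C" and f: "f \<in> ?C" "f \<noteq> 0"
    and x: "\<And>x. ev x f \<noteq> 0 \<Longrightarrow> prime_chain ?C r x \<and> spans ?C r t x = ?C \<and> duals ?C r t x"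
    using Cons.IH[OF dC] by blast
  show ?case unfolding adjoin_simps
  proof (cases "\<exists>G\<in>polc ?C. G \<noteq> 0 \<and> poly G b = 0")
    case True
    then obtain F where F: "minpoly ?C b F" using exists_minpoly by blast
    have FC: "F \<in> polc ?C" "poly F b = 0" "F \<noteq> 0" using F by (auto simp: minpoly_def)
    let ?l = "Polynomial.coeff F (Polynomial.degree F)" and ?e = "poly (pder F) b"
    have l: "?l \<in> ?A" "?l \<noteq> 0" using FC CA by (auto simp: polc_def)
    have e: "?e \<in> ?A" "?e \<noteq> 0" using minpoly_degree(2)[OF dC F] adj_mem polc_closed(7)[OF C FC(1)] by auto
    have fA: "f \<in> ?A" using f CA by blast
    \<comment> \<open>The three factors allow, in turn, the induction hypothesis, going down with
      extension of derivations, and the implicit differentiation of \<open>F\<close>.\<close>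
    have "f * ?l \<noteq> 0" using cdomD(2)[OF A fA l(1)] f l by blast
    then have "f * ?l * ?e \<noteq> 0" using cdomD(2)[OF A csubD(5)[OF As fA l(1)] e(1)] e by blast
    moreover have "f * ?l * ?e \<in> ?A" using csubD(5)[OF As] fA l e by blast
    moreover have "prime_chain ?A r y \<and> spans ?A r t y = ?A \<and> duals ?A r t y" if "ev y (f * ?l * ?e) \<noteq> 0" for y
    proof -
      have nz: "ev y f \<noteq> 0" "ev y ?l \<noteq> 0" "ev y ?e \<noteq> 0" using that by (auto simp: esimps)
      show ?thesis
        using x[OF nz(1)] t prime_chain_algebraic[OF C F nz(2)] spans_algebraic[OF C FC(1,2) nz(3)]
          duals_algebraic[OF C F nz(2,3)] by blast
    qed
    moreover have "growth ?A r" by (rule growth_algebraic[OF C A F gr])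
    moreover have "\<forall>i<r. t i \<in> ?A" using t CA by blast
    ultimately show "\<exists>r t. growth ?A r \<and> (\<forall>i<r. t i \<in> ?A) \<and> (\<exists>f\<in>?A. f \<noteq> 0 \<and> (\<forall>x. ev x f \<noteq> 0 \<longrightarrow>
        prime_chain ?A r x \<and> spans ?A r t x = ?A \<and> duals ?A r t x))" by blast
  next
    case False
    then have b: "\<And>G. G \<in> polc ?C \<Longrightarrow> poly G b = 0 \<Longrightarrow> G = 0" by blast
    have "prime_chain ?A (Suc r) y \<and> spans ?A (Suc r) (t(r := b)) y = ?A \<and> duals ?A (Suc r) (t(r := b)) y"
      if "ev y f \<noteq> 0" for y
      using x[OF that] t prime_chain_transcendental[OF A C b] spans_transcendental[OF C]
          duals_transcendental[OF C b] by blast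
    moreover have "growth ?A (Suc r)" by (rule growth_transcendental[OF C gr])
    moreover have "\<forall>i<Suc r. (t(r := b)) i \<in> ?A" using t CA adj_sup(2)[OF C] by (auto simp: less_Suc_eq)
    ultimately show "\<exists>r t. growth ?A r \<and> (\<forall>i<r. t i \<in> ?A) \<and> (\<exists>f\<in>?A. f \<noteq> 0 \<and> (\<forall>x. ev x f \<noteq> 0 \<longrightarrow>
        prime_chain ?A r x \<and> spans ?A r t x = ?A \<and> duals ?A r t x))" using f CA by blast
  qed
qed

end

section \<open>Poisson algebras\<close>

context complex_poisson_algebra begin

definition sc :: "complex \<Rightarrow> 'a" where "sc c = c \<odot> \<one>"

lemma smult_in [simp]: "a \<in> carrier A \<Longrightarrow> c \<odot> a \<in> carrier A"
  by (rule smult_closed) (simp_all add: ring_of_type_algebra_def)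

lemma smult_simps:
  assumes "a \<in> carrier A" "b \<in> carrier A"
  shows "(c + d) \<odot> a = c \<odot> a \<oplus> d \<odot> a" "c \<odot> (a \<oplus> b) = c \<odot> a \<oplus> c \<odot> b" "(c * d) \<odot> a = c \<odot> (d \<odot> a)"
    "1 \<odot> a = a" "c \<odot> a \<otimes> b = c \<odot> (a \<otimes> b)"
  using assms smult_l_distr[of c d a] smult_r_distr[of c a b] smult_assoc1[of c d a] smult_one[of a] smult_assoc2[of c a b]
  by (simp_all add: ring_of_type_algebra_def)

lemma sc_in [simp]: "sc c \<in> carrier A" by (simp add: sc_def)

lemma smult_sc: "a \<in> carrier A \<Longrightarrow> c \<odot> a = sc c \<otimes> a"
  using smult_simps(5)[of \<one> a] by (simp add: sc_def)

lemma sc_add: "sc (c + d) = sc c \<oplus> sc d" and sc_mult: "sc (c * d) = sc c \<otimes> sc d" and sc_1: "sc 1 = \<one>"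
  unfolding sc_def using smult_simps(1,3,4)[OF one_closed one_closed] smult_simps(5)[OF one_closed smult_in[OF one_closed]]
  by simp_all

lemma sc_0: "sc 0 = \<zero>"
proof -
  have "sc 0 \<oplus> sc 0 = sc 0 \<oplus> \<zero>" using sc_add[of 0 0] by simp
  then show ?thesis using add.l_cancel by simp
qed

lemma sc_minus: "sc (- c) = \<ominus> sc c"
proof -
  have "sc (- c) \<oplus> sc c = \<zero>" using sc_add[of "- c" c] sc_0 by simp
  then show ?thesis by (simp add: minus_equality)
qed

lemma sc_inverse: "c \<noteq> 0 \<Longrightarrow> sc (inverse c) \<otimes> sc c = \<one>"
  by (simp add: sc_mult[symmetric] sc_1)

lemma scalars_sc: "scalars A = range sc" by (simp add: scalars_def sc_def)

lemma ideal_sc_cancel: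
  assumes "ideal J A" "x \<in> carrier A" "c \<noteq> 0" "sc c \<otimes> x \<in> J" shows "x \<in> J"
proof -
  have "sc (inverse c) \<otimes> (sc c \<otimes> x) \<in> J" using ideal.I_l_closed[OF assms(1,4)] by simp
  then show ?thesis using sc_inverse[OF assms(3)] assms(2) by (simp add: m_assoc[symmetric])
qed

lemma bracket_one: assumes "a \<in> carrier A" shows "\<lbrace>\<one>, a\<rbrace> = \<zero>"
proof -
  have "\<lbrace>\<one>, a\<rbrace> \<oplus> \<lbrace>\<one>, a\<rbrace> = \<lbrace>\<one>, a\<rbrace> \<oplus> \<zero>" using bracket_mult_left[of \<one> \<one> a] assms bracket_closed by simp
  then show ?thesis using assms bracket_closed add.l_cancel by simp
qed

lemma bracket_sc: "a \<in> carrier A \<Longrightarrow> \<lbrace>sc c, a\<rbrace> = \<zero>"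
  by (simp add: sc_def bracket_smult_left bracket_one smult_sc[of \<zero>])

lemma bracket_skew: assumes "a \<in> carrier A" "b \<in> carrier A" shows "\<lbrace>a, b\<rbrace> = \<ominus> \<lbrace>b, a\<rbrace>"
proof -
  have "\<zero> = \<lbrace>a \<oplus> b, a \<oplus> b\<rbrace>" by (rule bracket_self[symmetric]) (use assms in simp)
  also have "\<dots> = (\<lbrace>a, a\<rbrace> \<oplus> \<lbrace>b, a\<rbrace>) \<oplus> (\<lbrace>a, b\<rbrace> \<oplus> \<lbrace>b, b\<rbrace>)" using assms
    by (simp add: bracket_add_left bracket_add_right)
  also have "\<dots> = \<lbrace>a, b\<rbrace> \<oplus> \<lbrace>b, a\<rbrace>" using assms bracket_closed by (simp add: bracket_self a_comm)
  finally show ?thesis using assms bracket_closed by (simp add: minus_equality)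
qed

lemma bracket_zero: "a \<in> carrier A \<Longrightarrow> \<lbrace>\<zero>, a\<rbrace> = \<zero>" using bracket_sc[of a 0] sc_0 by simp

lemma bracket_minus: assumes "a \<in> carrier A" "b \<in> carrier A" shows "\<lbrace>\<ominus> a, b\<rbrace> = \<ominus> \<lbrace>a, b\<rbrace>"
proof -
  have "\<ominus> a = (-1) \<odot> a" using assms sc_minus[of 1] by (simp add: smult_sc sc_1 l_minus)
  then have "\<lbrace>\<ominus> a, b\<rbrace> = (-1) \<odot> \<lbrace>a, b\<rbrace>" using assms by (simp only: bracket_smult_left)
  then have "\<lbrace>\<ominus> a, b\<rbrace> = sc (-1) \<otimes> \<lbrace>a, b\<rbrace>" using assms bracket_closed by (simp add: smult_sc)
  then show ?thesis using assms sc_minus[of 1] bracket_closed by (simp add: sc_1 l_minus)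
qed

lemma ideal_subset: "ideal J A \<Longrightarrow> J \<subseteq> carrier A"
  by (rule additive_subgroup.a_subset[OF ideal.axioms(1)])

lemma ideal_closed:
  assumes "ideal J A"
  shows "\<zero> \<in> J" "a \<in> J \<Longrightarrow> b \<in> J \<Longrightarrow> a \<oplus> b \<in> J" "a \<in> J \<Longrightarrow> \<ominus> a \<in> J" "a \<in> J \<Longrightarrow> b \<in> J \<Longrightarrow> a \<ominus> b \<in> J"
    "a \<in> J \<Longrightarrow> c \<in> carrier A \<Longrightarrow> c \<otimes> a \<in> J" "a \<in> J \<Longrightarrow> c \<in> carrier A \<Longrightarrow> a \<otimes> c \<in> J"
proof -
  interpret J: ideal J A by fact
  show "\<zero> \<in> J" "a \<in> J \<Longrightarrow> b \<in> J \<Longrightarrow> a \<oplus> b \<in> J" "a \<in> J \<Longrightarrow> \<ominus> a \<in> J" "a \<in> J \<Longrightarrow> b \<in> J \<Longrightarrow> a \<ominus> b \<in> J"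
    "a \<in> J \<Longrightarrow> c \<in> carrier A \<Longrightarrow> c \<otimes> a \<in> J" "a \<in> J \<Longrightarrow> c \<in> carrier A \<Longrightarrow> a \<otimes> c \<in> J"
    by (simp_all add: J.I_l_closed J.I_r_closed a_minus_def)
qed

lemma ideal_add_cancel:
  assumes J: "ideal J A" and "b \<in> J" "a \<in> carrier A" "a \<oplus> b \<in> J" shows "a \<in> J"
proof -
  have "a = (a \<oplus> b) \<ominus> b" using assms(2,3) ideal_subset[OF J] by (simp add: a_minus_def a_assoc r_neg subset_iff)
  then show ?thesis using ideal_closed(4)[OF J assms(4,2)] by simp
qed

section \<open>Radicals of Poisson ideals and primality of Poisson cores\<close>

text \<open>The power rule multiplied by \<open>y\<close>, so that the exponent n - 1 does not
  occur.\<close>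

lemma bracket_power:
  assumes y: "y \<in> carrier A" and b: "b \<in> carrier A"
  shows "\<lbrace>y [^] (n::nat), b\<rbrace> \<otimes> y = sc (of_nat n) \<otimes> (y [^] n \<otimes> \<lbrace>y, b\<rbrace>)"
proof (induction n)
  case 0
  then show ?case using y b bracket_closed by (simp add: bracket_one sc_0)
next
  case (Suc n)
  have d: "\<lbrace>y, b\<rbrace> \<in> carrier A" "\<lbrace>y [^] n, b\<rbrace> \<in> carrier A" "y [^] n \<in> carrier A" using y b bracket_closed by auto
  have "\<lbrace>y [^] Suc n, b\<rbrace> \<otimes> y = (y [^] n \<otimes> \<lbrace>y, b\<rbrace> \<oplus> y \<otimes> \<lbrace>y [^] n, b\<rbrace>) \<otimes> y"
    using y b d by (simp add: bracket_mult_left)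
  also have "\<dots> = y [^] n \<otimes> y \<otimes> \<lbrace>y, b\<rbrace> \<oplus> (\<lbrace>y [^] n, b\<rbrace> \<otimes> y) \<otimes> y"
    using y d by algebra
  also have "\<dots> = y [^] n \<otimes> y \<otimes> \<lbrace>y, b\<rbrace> \<oplus> (sc (of_nat n) \<otimes> (y [^] n \<otimes> \<lbrace>y, b\<rbrace>)) \<otimes> y"
    by (simp only: Suc)
  also have "\<dots> = (\<one> \<oplus> sc (of_nat n)) \<otimes> (y [^] n \<otimes> y \<otimes> \<lbrace>y, b\<rbrace>)"
    using y d sc_in[of "of_nat n"] by algebra
  also have "\<one> \<oplus> sc (of_nat n) = sc (of_nat (Suc n))" by (simp add: sc_add sc_1)
  finally show ?case by simp
qed

text \<open>This makes radicals of Poisson ideals Poisson. Put d = {a, b}. Bracketing a^(n - k) d^(2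
  k) in \<open>Q\<close> with \<open>b\<close> and multiplying by d trades one factor a for two
  factors d; the remaining term is a multiple of the element just bracketed, and the integer n - k
  is invertible. After n trades only d^(2 n) is left.\<close>

lemma bracket_nilpotent_mod:
  assumes Q: "poisson_ideal A Q" and a: "a \<in> carrier A" and b: "b \<in> carrier A" and n: "a [^] (n::nat) \<in> Q"
  shows "\<lbrace>a, b\<rbrace> [^] (2 * n) \<in> Q"
proof -
  have Q': "ideal Q A" and br: "\<And>x c. x \<in> Q \<Longrightarrow> c \<in> carrier A \<Longrightarrow> \<lbrace>x, c\<rbrace> \<in> Q"
    using Q by (auto simp: poisson_ideal_def)
  define d where "d = \<lbrace>a, b\<rbrace>"
  have d: "d \<in> carrier A" using a b by (simp add: d_def bracket_closed)
  have "k \<le> n \<Longrightarrow> a [^] (n - k) \<otimes> d [^] (2 * k) \<in> Q" for k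
  proof (induction k)
    case 0 then show ?case using n ideal_subset[OF Q'] by auto
  next
    case (Suc k)
    define m where "m = n - Suc k"
    have m: "n - k = Suc m" using Suc.prems by (simp add: m_def)
    define e where "e = d [^] (2 * k)"
    define p where "p = a [^] m"
    have c: "e \<in> carrier A" "p \<in> carrier A" "\<lbrace>e, b\<rbrace> \<in> carrier A" "\<lbrace>p, b\<rbrace> \<in> carrier A" "\<lbrace>d, b\<rbrace> \<in> carrier A"
      "\<lbrace>p \<otimes> a, b\<rbrace> \<in> carrier A"
      using a b d by (simp_all add: e_def p_def bracket_closed)
    have x: "p \<otimes> a \<otimes> e \<in> Q" using Suc m by (simp add: p_def e_def)
    have pow: "\<lbrace>p \<otimes> a, b\<rbrace> \<otimes> a = sc (of_nat (Suc m)) \<otimes> (p \<otimes> a \<otimes> d)"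
      using bracket_power[OF a b, of "Suc m"] by (simp add: p_def d_def)
    have pw: "\<lbrace>p, b\<rbrace> \<otimes> a = sc (of_nat m) \<otimes> (p \<otimes> d)"
      using bracket_power[OF a b, of m] by (simp add: p_def d_def)
    have pd: "\<lbrace>p \<otimes> a, b\<rbrace> = sc (of_nat (Suc m)) \<otimes> (p \<otimes> d)"
    proof -
      have "\<lbrace>p \<otimes> a, b\<rbrace> = p \<otimes> d \<oplus> \<lbrace>p, b\<rbrace> \<otimes> a" using bracket_mult_left[OF c(2) a b] c a
        by (simp add: d_def m_comm)
      also have "\<dots> = (\<one> \<oplus> sc (of_nat m)) \<otimes> (p \<otimes> d)" unfolding pw using c d sc_in[of "of_nat m"] by algebra
      also have "\<one> \<oplus> sc (of_nat m) = sc (of_nat (Suc m))" by (simp add: sc_add sc_1)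
      finally show ?thesis .
    qed
    have ed: "\<lbrace>e, b\<rbrace> \<otimes> d = sc (of_nat (2 * k)) \<otimes> (e \<otimes> \<lbrace>d, b\<rbrace>)"
      using bracket_power[OF d b, of "2 * k"] by (simp only: e_def)
    have "\<lbrace>p \<otimes> a \<otimes> e, b\<rbrace> \<otimes> d \<in> Q" using br[OF x b] ideal_closed(6)[OF Q' _ d] by blast
    also have "\<lbrace>p \<otimes> a \<otimes> e, b\<rbrace> = p \<otimes> a \<otimes> \<lbrace>e, b\<rbrace> \<oplus> e \<otimes> (sc (of_nat (Suc m)) \<otimes> (p \<otimes> d))"
      using bracket_mult_left[of "p \<otimes> a" e b] c a b unfolding pd by simp
    also have "(p \<otimes> a \<otimes> \<lbrace>e, b\<rbrace> \<oplus> e \<otimes> (sc (of_nat (Suc m)) \<otimes> (p \<otimes> d))) \<otimes> d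
       = sc (of_nat (Suc m)) \<otimes> (p \<otimes> (e \<otimes> d \<otimes> d)) \<oplus> p \<otimes> a \<otimes> (\<lbrace>e, b\<rbrace> \<otimes> d)"
      using c a d sc_in[of "of_nat (Suc m)"] by algebra
    finally have in1: "sc (of_nat (Suc m)) \<otimes> (p \<otimes> (e \<otimes> d \<otimes> d)) \<oplus> p \<otimes> a \<otimes> (\<lbrace>e, b\<rbrace> \<otimes> d) \<in> Q" .
    have "p \<otimes> a \<otimes> (\<lbrace>e, b\<rbrace> \<otimes> d) = (p \<otimes> a \<otimes> e) \<otimes> (sc (of_nat (2 * k)) \<otimes> \<lbrace>d, b\<rbrace>)"
      unfolding ed using c a sc_in[of "of_nat (2 * k)"] by algebra
    also have "\<dots> \<in> Q" using c by (intro ideal_closed(6)[OF Q' x]) simp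
    finally have "sc (of_nat (Suc m)) \<otimes> (p \<otimes> (e \<otimes> d \<otimes> d)) \<in> Q"
      using ideal_add_cancel[OF Q' _ _ in1] c d by simp
    then have "p \<otimes> (e \<otimes> d \<otimes> d) \<in> Q"
      using ideal_sc_cancel[OF Q', of "p \<otimes> (e \<otimes> d \<otimes> d)" "of_nat (Suc m)"] c d by (simp del: of_nat_Suc)
    then show ?case unfolding m_def[symmetric] p_def e_def by simp
  qed
  from this[of n] show ?thesis using d by (simp add: d_def)
qed

lemma prime_power_mem:
  assumes p: "primeideal p A" and x: "x \<in> carrier A" and n: "x [^] (n::nat) \<in> p" shows "x \<in> p"
  using n
proof (induction n)
  case 0
  then have "p = carrier A" using ideal.one_imp_carrier[OF primeideal.axioms(1)[OF p]] by simp
  then show ?case using x by simp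
next
  case (Suc n)
  then show ?case using primeideal.I_prime[OF p, of "x [^] n" x] x by auto
qed

lemma radical_power:
  assumes Q: "ideal Q A" and x: "x \<in> carrier A" and all: "\<And>p. primeideal p A \<Longrightarrow> Q \<subseteq> p \<Longrightarrow> x \<in> p"
  shows "\<exists>n. x [^] (n::nat) \<in> Q"
proof (rule ccontr)
  assume no: "\<not> ?thesis"
  let ?S = "range (\<lambda>n::nat. x [^] n)"
  have "\<exists>P. primeideal P A \<and> Q \<subseteq> P \<and> P \<inter> ?S = {}"
  proof (rule exists_prime_avoiding[OF Q])
    show "?S \<subseteq> carrier A" using x by auto
    show "\<one> \<in> ?S" by (rule image_eqI[of _ _ 0]) auto
    fix s t assume "s \<in> ?S" "t \<in> ?S"
    then show "s \<otimes> t \<in> ?S" using x by (auto simp: nat_pow_mult)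
  qed (use no in auto)
  then obtain P where P: "primeideal P A" "Q \<subseteq> P" "P \<inter> ?S = {}" by blast
  have "x [^] (1::nat) \<in> ?S" by blast
  then have "x \<in> ?S" using x by simp
  then show False using all[OF P(1,2)] P(3) by blast
qed

text \<open>The radical \<open>N\<close> of the core is Poisson and still inside \<open>J\<close>,
  so the core is radical. Hence the colon ideals \<open>col a\<close> are Poisson too. Now let a b
  lie in the core. If \<open>col a\<close> is inside \<open>J\<close>, it is inside the core and
  contains b. Otherwise it has an element x outside \<open>J\<close>; then \<open>col x\<close> is
  inside \<open>J\<close> by primality of \<open>J\<close>, hence inside the core, and it contains
  a.\<close>

theorem poisson_core_prime:
  assumes J: "primeideal J A"
  shows "poisson_prime A (poisson_core A J)"
proof -
  have JI: "ideal J A" by (rule primeideal.axioms(1)[OF J])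
  let ?Q = "poisson_core A J"
  note core = poisson_core_greatest[OF JI]
  have QI: "ideal ?Q A" and br: "\<And>x c. x \<in> ?Q \<Longrightarrow> c \<in> carrier A \<Longrightarrow> \<lbrace>x, c\<rbrace> \<in> ?Q"
    using core(1) by (auto simp: poisson_ideal_def)
  define N where "N = {x \<in> carrier A. \<forall>p. primeideal p A \<longrightarrow> ?Q \<subseteq> p \<longrightarrow> x \<in> p}"
  have NI: "ideal N A"
  proof (rule idealI[OF ring_axioms])
    show "subgroup N (add_monoid A)"
    proof (rule add.subgroupI)
      show "N \<subseteq> carrier A" by (auto simp: N_def)
      have "\<zero> \<in> N" by (auto simp: N_def intro: ideal_closed(1) primeideal.axioms(1))
      then show "N \<noteq> {}" by blast
    qed (auto simp: N_def intro: ideal_closed primeideal.axioms(1))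
  qed (auto simp: N_def intro: ideal_closed primeideal.axioms(1))
  have "poisson_ideal A N"
    unfolding poisson_ideal_def
  proof (intro conjI ballI NI)
    fix x c assume x: "x \<in> N" and c: "c \<in> carrier A"
    have xc: "x \<in> carrier A" using x by (simp add: N_def)
    then obtain n where n: "x [^] (n::nat) \<in> ?Q" using radical_power[OF QI xc] x by (auto simp: N_def)
    have "\<lbrace>x, c\<rbrace> [^] (2 * n) \<in> ?Q" by (rule bracket_nilpotent_mod[OF core(1) xc c n])
    then show "\<lbrace>x, c\<rbrace> \<in> N" unfolding N_def using prime_power_mem bracket_closed[OF xc c] by blast
  qed
  moreover have "N \<subseteq> J" using J core(2) by (auto simp: N_def)
  ultimately have NQ: "N \<subseteq> ?Q" by (rule core(3))
  have sq: "x \<in> ?Q" if x: "x \<in> carrier A" "x \<otimes> x \<in> ?Q" for x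
  proof -
    have "x \<in> N" unfolding N_def using x primeideal.I_prime[of _ A x x] by blast
    then show ?thesis using NQ by blast
  qed
  define col where "col a = {x \<in> carrier A. x \<otimes> a \<in> ?Q}" for a
  have col: "poisson_ideal A (col a)" if a: "a \<in> carrier A" for a
    unfolding poisson_ideal_def
  proof (intro conjI ballI)
    have mul: "c \<otimes> x \<in> col a" if "x \<in> col a" "c \<in> carrier A" for x c
      using that ideal_closed(5)[OF QI, of "x \<otimes> a" c] a by (simp add: col_def m_assoc)
    show "ideal (col a) A"
    proof (rule idealI[OF ring_axioms])
      show "subgroup (col a) (add_monoid A)"
      proof (rule add.subgroupI)
        show "col a \<subseteq> carrier A" by (auto simp: col_def)
        have "\<zero> \<in> col a" using a ideal_closed(1)[OF QI] by (simp add: col_def)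
        then show "col a \<noteq> {}" by blast
        show "\<ominus> x \<in> col a" if "x \<in> col a" for x
          using that a ideal_closed(3)[OF QI] by (simp add: col_def l_minus)
        show "x \<oplus> y \<in> col a" if "x \<in> col a" "y \<in> col a" for x y
          using that a ideal_closed(2)[OF QI] by (simp add: col_def l_distr)
      qed
      show "c \<otimes> x \<in> col a" if "x \<in> col a" "c \<in> carrier A" for x c by (rule mul[OF that])
      show "x \<otimes> c \<in> col a" if "x \<in> col a" "c \<in> carrier A" for x c
        using mul[OF that] that by (simp add: m_comm col_def)
    qed
    fix x c assume x: "x \<in> col a" and c: "c \<in> carrier A"
    have xc: "x \<in> carrier A" and xa: "x \<otimes> a \<in> ?Q" using x by (auto simp: col_def)
    let ?d = "\<lbrace>x, c\<rbrace>" and ?e = "\<lbrace>a, c\<rbrace>"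
    have cl: "?d \<in> carrier A" "?e \<in> carrier A" using xc a c bracket_closed by auto
    have "x \<otimes> ?e \<oplus> a \<otimes> ?d \<in> ?Q" using br[OF xa c] bracket_mult_left[OF xc a c] by simp
    \<comment> \<open>Multiplying by a {x, c} turns the Leibniz expansion of {x a, c} into the
      square of {x, c} a plus a multiple of x a; radicality then extracts the root.\<close>
    then have "(x \<otimes> ?e \<oplus> a \<otimes> ?d) \<otimes> (a \<otimes> ?d) \<in> ?Q" using ideal_closed(6)[OF QI] a cl by blast
    also have "(x \<otimes> ?e \<oplus> a \<otimes> ?d) \<otimes> (a \<otimes> ?d) = (?d \<otimes> a) \<otimes> (?d \<otimes> a) \<oplus> (x \<otimes> a) \<otimes> (?e \<otimes> ?d)"
      using xc a cl by algebra
    finally have sum: "(?d \<otimes> a) \<otimes> (?d \<otimes> a) \<oplus> (x \<otimes> a) \<otimes> (?e \<otimes> ?d) \<in> ?Q" .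
    have sqr: "(?d \<otimes> a) \<otimes> (?d \<otimes> a) \<in> ?Q"
      by (rule ideal_add_cancel[OF QI ideal_closed(6)[OF QI xa] _ sum]) (use cl a in auto)
    have "?d \<otimes> a \<in> ?Q" by (rule sq[OF _ sqr]) (use cl a in simp)
    then show "?d \<in> col a" using cl by (simp add: col_def)
  qed
  have "primeideal ?Q A"
  proof (rule primeidealI[OF QI M_cring])
    show "carrier A \<noteq> ?Q" using core(2) primeideal.I_notcarr[OF J] ideal_subset[OF JI] by blast
    fix a b assume a: "a \<in> carrier A" and b: "b \<in> carrier A" and ab: "a \<otimes> b \<in> ?Q"
    show "a \<in> ?Q \<or> b \<in> ?Q"
    proof (cases "col a \<subseteq> J")
      case True
      then have "col a \<subseteq> ?Q" by (rule core(3)[OF col[OF a]])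
      then show ?thesis using a b ab by (auto simp: col_def m_comm)
    next
      case False
      then obtain x where x: "x \<in> carrier A" "x \<otimes> a \<in> ?Q" "x \<notin> J" by (auto simp: col_def)
      have "col x \<subseteq> J"
        using core(2) x(1,3) primeideal.I_prime[OF J] by (auto simp: col_def)
      then have "col x \<subseteq> ?Q" by (rule core(3)[OF col[OF x(1)]])
      moreover have "a \<in> col x" using x a by (simp add: col_def m_comm)
      ultimately show ?thesis by blast
    qed
  qed
  then show ?thesis using core(1) by (simp add: poisson_prime_def)
qed

end

subsection \<open>The Nullstellensatz\<close>

text \<open>Gaussian elimination on the finitely many coordinates in \<open>F\<close>: each pivot
  uses up one index, and infinitely many remain.\<close>

lemma linear_dependence:
  fixes v :: "'c \<Rightarrow> 'm \<Rightarrow> complex"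
  assumes "finite F" "infinite \<Gamma>"
  shows "\<exists>G l. finite G \<and> G \<subseteq> \<Gamma> \<and> (\<exists>c\<in>G. l c \<noteq> 0) \<and> (\<forall>m\<in>F. (\<Sum>c\<in>G. l c * v c m) = 0)"
  using assms
proof (induction F arbitrary: \<Gamma> v)
  case empty
  then have "\<Gamma> \<noteq> {}" by auto
  then obtain c where "c \<in> \<Gamma>" by blast
  then show ?case by (intro exI[of _ "{c}"] exI[of _ "\<lambda>_. 1"]) auto
next
  case (insert k F)
  show ?case
  proof (cases "\<exists>c\<in>\<Gamma>. v c k \<noteq> 0")
    case False
    from insert.IH[OF insert.prems, of v] obtain G l where
      *: "finite G \<and> G \<subseteq> \<Gamma> \<and> (\<exists>c\<in>G. l c \<noteq> 0) \<and> (\<forall>m\<in>F. (\<Sum>c\<in>G. l c * v c m) = 0)"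
      by (elim exE)
    moreover from * False have "(\<Sum>c\<in>G. l c * v c k) = 0" by (intro sum.neutral) auto
    ultimately show ?thesis by (intro exI[of _ G] exI[of _ l]) auto
  next
    case True
    then obtain d where d: "d \<in> \<Gamma>" "v d k \<noteq> 0" by blast
    define w where "w c m = v c m - v c k / v d k * v d m" for c m
    have "infinite (\<Gamma> - {d})" using insert.prems by simp
    from insert.IH[OF this, of w] obtain G l where
      *: "finite G \<and> G \<subseteq> \<Gamma> - {d} \<and> (\<exists>c\<in>G. l c \<noteq> 0) \<and> (\<forall>m\<in>F. (\<Sum>c\<in>G. l c * w c m) = 0)"
      by (elim exE)
    then have G: "finite G" "G \<subseteq> \<Gamma> - {d}" "\<exists>c\<in>G. l c \<noteq> 0"
      "\<And>m. m \<in> F \<Longrightarrow> (\<Sum>c\<in>G. l c * w c m) = 0" by simp_all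
    define l' where "l' = l(d := - (\<Sum>c\<in>G. l c * (v c k / v d k)))"
    have dG: "d \<notin> G" using G by blast
    have "(\<Sum>c\<in>insert d G. l' c * v c m) = (\<Sum>c\<in>G. l c * w c m)" for m
    proof -
      have "(\<Sum>c\<in>G. l' c * v c m) = (\<Sum>c\<in>G. l c * v c m)" using dG by (intro sum.cong) (auto simp: l'_def)
      then have "(\<Sum>c\<in>insert d G. l' c * v c m) = (\<Sum>c\<in>G. l c * v c m) - (\<Sum>c\<in>G. l c * (v c k / v d k)) * v d m"
        using G(1) dG by (simp add: l'_def)
      also have "\<dots> = (\<Sum>c\<in>G. l c * w c m)"
        by (simp add: w_def algebra_simps sum_subtractf sum_distrib_left)
      finally show ?thesis .
    qed
    moreover have "(\<Sum>c\<in>G. l c * w c k) = 0" using d by (intro sum.neutral) (simp add: w_def)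
    moreover have "\<exists>c\<in>insert d G. l' c \<noteq> 0" using G(3) dG by (auto simp: l'_def)
    ultimately show ?thesis using G d by (intro exI[of _ "insert d G"] exI[of _ l']) auto
  qed
qed

context complex_poisson_algebra begin

definition peval :: "'a \<Rightarrow> complex poly \<Rightarrow> 'a" where
  "peval a q = fold_coeffs (\<lambda>c u. sc c \<oplus> a \<otimes> u) q \<zero>"

lemma peval_0: "peval a 0 = \<zero>" by (simp add: peval_def)

lemma peval_pCons: assumes "a \<in> carrier A" shows "peval a (pCons c q) = sc c \<oplus> a \<otimes> peval a q"
proof (cases "c = 0 \<and> q = 0")
  case True
  then show ?thesis using assms by (simp add: peval_def sc_0)
next
  case False
  then have "c \<noteq> 0 \<or> q \<noteq> 0" by blast
  then show ?thesis unfolding peval_def by (auto simp: fold_coeffs_pCons_coeff_not_0_eq fold_coeffs_pCons_not_0_0_eq)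
qed

lemma peval_in: "a \<in> carrier A \<Longrightarrow> peval a q \<in> carrier A"
  by (induction q) (auto simp: peval_0 peval_pCons)

lemma peval_add: assumes a: "a \<in> carrier A" shows "peval a (p + q) = peval a p \<oplus> peval a q"
proof (induction p q rule: poly_induct2)
  case (pCons c p d q)
  have i: "peval a p \<in> carrier A" "peval a q \<in> carrier A" "sc c \<in> carrier A" "sc d \<in> carrier A" using a by (simp_all add: peval_in)
  have "peval a (pCons c p + pCons d q) = (sc c \<oplus> sc d) \<oplus> a \<otimes> (peval a p \<oplus> peval a q)"
    using a by (simp add: peval_pCons pCons sc_add)
  also have "\<dots> = (sc c \<oplus> a \<otimes> peval a p) \<oplus> (sc d \<oplus> a \<otimes> peval a q)" using i a by algebra
  finally show ?case using a by (simp add: peval_pCons)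
qed (simp add: peval_0)

lemma peval_smult: assumes a: "a \<in> carrier A" shows "peval a (Polynomial.smult c p) = sc c \<otimes> peval a p"
proof (induction p)
  case (pCons d p)
  have i: "peval a p \<in> carrier A" "sc c \<in> carrier A" "sc d \<in> carrier A" using a by (simp_all add: peval_in)
  have "peval a (Polynomial.smult c (pCons d p)) = sc c \<otimes> sc d \<oplus> a \<otimes> (sc c \<otimes> peval a p)"
    using a by (simp add: peval_pCons pCons sc_mult)
  also have "\<dots> = sc c \<otimes> (sc d \<oplus> a \<otimes> peval a p)" using i a by algebra
  finally show ?case using a by (simp add: peval_pCons)
qed (simp add: peval_0)

lemma peval_mult: assumes a: "a \<in> carrier A" shows "peval a (p * q) = peval a p \<otimes> peval a q"
proof (induction p)
  case 0 then show ?case using a by (simp add: peval_0 peval_in)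
next
  case (pCons d p)
  have i: "peval a p \<in> carrier A" "peval a q \<in> carrier A" "sc d \<in> carrier A" using a by (simp_all add: peval_in)
  have "peval a (pCons d p * q) = sc d \<otimes> peval a q \<oplus> (sc 0 \<oplus> a \<otimes> (peval a p \<otimes> peval a q))"
    using a by (simp add: mult_pCons_left peval_add peval_smult peval_pCons pCons)
  also have "\<dots> = sc d \<otimes> peval a q \<oplus> a \<otimes> (peval a p \<otimes> peval a q)" using i a by (simp add: sc_0)
  also have "\<dots> = (sc d \<oplus> a \<otimes> peval a p) \<otimes> peval a q" using i a by algebra
  finally show ?case using a by (simp add: peval_pCons)
qed

lemma peval_linear: "a \<in> carrier A \<Longrightarrow> peval a [:- c, 1:] = a \<ominus> sc c"
  by (simp add: peval_pCons peval_0 sc_minus sc_1 a_minus_def a_comm)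

text \<open>Over the complex numbers the polynomial splits into linear factors, and the prime
  \<open>J\<close> must contain one of them.\<close>

lemma peval_root:
  assumes J: "primeideal J A" and a: "a \<in> carrier A"
  shows "q \<noteq> 0 \<Longrightarrow> peval a q \<in> J \<Longrightarrow> \<exists>c. a \<ominus> sc c \<in> J"
proof (induction "Polynomial.degree q" arbitrary: q rule: less_induct)
  case less
  have JI: "ideal J A" by (rule primeideal.axioms(1)[OF J])
  show ?case
  proof (cases "Polynomial.degree q = 0")
    case True
    then obtain c where c: "q = [:c:]" by (auto elim: degree_eq_zeroE)
    then have "c \<noteq> 0" "sc c \<otimes> \<one> \<in> J" using less.prems a by (simp_all add: peval_pCons peval_0)
    then have "\<one> \<in> J" using ideal_sc_cancel[OF JI, of \<one> c] by simp
    then have "J = carrier A" by (rule ideal.one_imp_carrier[OF JI])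
    then show ?thesis using primeideal.I_notcarr[OF J] by simp
  next
    case False
    then have "\<not> constant (poly q)" by (simp add: constant_degree)
    then obtain z where "poly q z = 0" using fundamental_theorem_of_algebra by blast
    then obtain p where p: "q = [:- z, 1:] * p" by (meson dvdE poly_eq_0_iff_dvd)
    have p0: "p \<noteq> 0" using p less.prems by auto
    have "Polynomial.degree q = Suc (Polynomial.degree p)" unfolding p using p0 by (subst degree_mult_eq) auto
    moreover have "(a \<ominus> sc z) \<otimes> peval a p \<in> J" using less.prems(2) a by (simp only: p peval_mult peval_linear)
    then have "a \<ominus> sc z \<in> J \<or> peval a p \<in> J"
      using primeideal.I_prime[OF J, of "a \<ominus> sc z" "peval a p"] a peval_in by simp
    ultimately show ?thesis using less.hyps[of p] p0 by auto
  qed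
qed

text \<open>Elements congruent to \<open>f\<^sup>n / (a - c)\<close> are linearly independent unless some \<open>a - c\<close> vanishes.\<close>

lemma partial_fractions:
  assumes J: "primeideal J A" and a: "a \<in> carrier A" and h: "h \<in> carrier A" "h \<notin> J"
    and G: "finite G" and b: "\<And>c. c \<in> G \<Longrightarrow> b c \<in> carrier A" "\<And>c. c \<in> G \<Longrightarrow> (a \<ominus> sc c) \<otimes> b c \<ominus> h \<in> J"
    and l: "d \<in> G" "l d \<noteq> 0" and rel: "(\<Oplus>c\<in>G. sc (l c) \<otimes> b c) = \<zero>"
  shows "\<exists>c. a \<ominus> sc c \<in> J"
proof -
  have JI: "ideal J A" by (rule primeideal.axioms(1)[OF J])
  define p where "p H = (\<Prod>c\<in>H. [:- c, 1:])" for H :: "complex set"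
  \<comment> \<open>Clearing denominators: modulo \<open>J\<close> the element \<open>b c\<close>
    behaves like h / (a - c), so multiplying by the product of all a - c leaves a polynomial in
    \<open>a\<close> times \<open>h\<close>.\<close>
  have main: "H \<subseteq> G \<Longrightarrow> peval a (p G) \<otimes> (\<Oplus>c\<in>H. sc (l c) \<otimes> b c) \<ominus> peval a (\<Sum>c\<in>H. Polynomial.smult (l c) (p (G - {c}))) \<otimes> h \<in> J"
    if "finite H" for H
    using that
  proof (induction H)
    case empty
    then show ?case using ideal_closed(1)[OF JI] h a by (simp add: peval_0 peval_in a_minus_def)
  next
    case (insert c H)
    let ?s = "\<Oplus>c\<in>H. sc (l c) \<otimes> b c" and ?t = "peval a (\<Sum>c\<in>H. Polynomial.smult (l c) (p (G - {c})))"
    let ?P = "peval a (p G)" and ?p = "peval a (p (G - {c}))"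
    have cG: "c \<in> G" using insert.prems by blast
    have HG: "\<And>c. c \<in> H \<Longrightarrow> b c \<in> carrier A" using insert.prems b by blast
    have i: "?s \<in> carrier A" "?t \<in> carrier A" "?P \<in> carrier A" "?p \<in> carrier A" "b c \<in> carrier A" "sc (l c) \<in> carrier A" "sc c \<in> carrier A"
      using a b cG HG by (auto intro!: finsum_closed peval_in)
    have "p G = [:- c, 1:] * p (G - {c})" unfolding p_def using G cG by (rule prod.remove)
    then have P: "?P = (a \<ominus> sc c) \<otimes> ?p" using a by (simp only: peval_mult peval_linear)
    have S: "(\<Oplus>c\<in>insert c H. sc (l c) \<otimes> b c) = sc (l c) \<otimes> b c \<oplus> ?s"
      using insert HG i by (intro finsum_insert) auto
    have T: "peval a (\<Sum>c\<in>insert c H. Polynomial.smult (l c) (p (G - {c}))) = sc (l c) \<otimes> ?p \<oplus> ?t"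
      using insert a by (simp add: peval_add peval_smult)
    have alg: "\<And>u q k e x y. u \<in> carrier A \<Longrightarrow> q \<in> carrier A \<Longrightarrow> k \<in> carrier A \<Longrightarrow> e \<in> carrier A \<Longrightarrow>
        x \<in> carrier A \<Longrightarrow> y \<in> carrier A \<Longrightarrow>
        (u \<otimes> q) \<otimes> (k \<otimes> e \<oplus> x) \<ominus> (k \<otimes> q \<oplus> y) \<otimes> h = (k \<otimes> q) \<otimes> (u \<otimes> e \<ominus> h) \<oplus> ((u \<otimes> q) \<otimes> x \<ominus> y \<otimes> h)"
      using h(1) by algebra
    have "?P \<otimes> (sc (l c) \<otimes> b c \<oplus> ?s) \<ominus> (sc (l c) \<otimes> ?p \<oplus> ?t) \<otimes> h =
      (sc (l c) \<otimes> ?p) \<otimes> ((a \<ominus> sc c) \<otimes> b c \<ominus> h) \<oplus> (?P \<otimes> ?s \<ominus> ?t \<otimes> h)"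
      unfolding P by (rule alg) (use i a in simp_all)
    also have "\<dots> \<in> J"
      using insert.IH insert.prems b(2)[OF cG] i by (intro ideal_closed(2,5)[OF JI]) auto
    finally show ?case unfolding S T .
  qed
  define q where "q = (\<Sum>c\<in>G. Polynomial.smult (l c) (p (G - {c})))"
  have qc: "peval a q \<in> carrier A" "peval a (p G) \<in> carrier A" using a by (simp_all add: peval_in)
  have "\<ominus> (peval a q \<otimes> h) \<in> J" using main[OF G subset_refl] qc h unfolding rel q_def[symmetric] by (simp add: a_minus_def)
  then have "\<ominus> (\<ominus> (peval a q \<otimes> h)) \<in> J" by (rule ideal_closed(3)[OF JI])
  then have "peval a q \<otimes> h \<in> J" using qc h by simp
  then have "peval a q \<in> J" using primeideal.I_prime[OF J qc(1) h(1)] h(2) by blast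
  moreover have "q \<noteq> 0"
  proof
    assume "q = 0"
    \<comment> \<open>At \<open>d\<close> every summand but the one for c = d has a vanishing
      factor.\<close>
    then have "0 = poly q d" by simp
    also have "\<dots> = (\<Sum>c\<in>G. l c * (\<Prod>e\<in>G - {c}. d - e))" by (simp add: q_def p_def poly_sum poly_prod)
    also have "\<dots> = (\<Sum>c\<in>{d}. l c * (\<Prod>e\<in>G - {c}. d - e))"
      using G l by (intro sum.mono_neutral_right) auto
    also have "\<dots> = l d * (\<Prod>e\<in>G - {d}. d - e)" by simp
    finally show False using l G by auto
  qed
  ultimately show ?thesis using peval_root[OF J a] by blast
qed

inductive_set lspan :: "'a set \<Rightarrow> 'a set" for M where
  zero: "\<zero> \<in> lspan M"
| step: "m \<in> M \<Longrightarrow> v \<in> lspan M \<Longrightarrow> sc c \<otimes> m \<oplus> v \<in> lspan M"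

lemma lspan_carrier: assumes "M \<subseteq> carrier A" shows "lspan M \<subseteq> carrier A"
proof
  fix v assume "v \<in> lspan M"
  then show "v \<in> carrier A" by induction (use assms in auto)
qed

lemma lspan_add: assumes M: "M \<subseteq> carrier A" and v: "v \<in> lspan M" shows "u \<in> lspan M \<Longrightarrow> u \<oplus> v \<in> lspan M"
proof (induction rule: lspan.induct)
  case zero then show ?case using v lspan_carrier[OF M] by auto
next
  case (step m u c)
  have i: "m \<in> carrier A" "u \<in> carrier A" "v \<in> carrier A" "sc c \<in> carrier A" using step v M lspan_carrier[OF M] by auto
  have "sc c \<otimes> m \<oplus> u \<oplus> v = sc c \<otimes> m \<oplus> (u \<oplus> v)" using i by algebra
  then show ?case using lspan.step[OF step(1,3)] by simp
qed

lemma lspan_scale: assumes M: "M \<subseteq> carrier A" shows "u \<in> lspan M \<Longrightarrow> sc d \<otimes> u \<in> lspan M"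
proof (induction rule: lspan.induct)
  case zero then show ?case by (simp add: lspan.zero)
next
  case (step m u c)
  have i: "m \<in> carrier A" "u \<in> carrier A" "sc d \<in> carrier A" "sc c \<in> carrier A" using step M lspan_carrier[OF M] by auto
  have "sc d \<otimes> (sc c \<otimes> m \<oplus> u) = sc (d * c) \<otimes> m \<oplus> sc d \<otimes> u" unfolding sc_mult using i by algebra
  then show ?case using lspan.step[OF step(1,3)] by simp
qed

lemma lspan_mult:
  assumes M: "M \<subseteq> carrier A" and mult: "\<And>m n. m \<in> M \<Longrightarrow> n \<in> M \<Longrightarrow> m \<otimes> n \<in> M" and v: "v \<in> lspan M"
  shows "u \<in> lspan M \<Longrightarrow> u \<otimes> v \<in> lspan M"
proof (induction rule: lspan.induct)
  case zero
  have "v \<in> carrier A" using v lspan_carrier[OF M] by blast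
  then show ?case by (simp add: lspan.zero)
next
  case (step m u c)
  have i: "m \<in> carrier A" "u \<in> carrier A" "v \<in> carrier A" "sc c \<in> carrier A" using step v M lspan_carrier[OF M] by auto
  have "m \<otimes> v \<in> lspan M" using v
  proof (induction rule: lspan.induct)
    case zero then show ?case using i by (simp add: lspan.zero)
  next
    case (step n w e)
    have j: "n \<in> carrier A" "w \<in> carrier A" "sc e \<in> carrier A" using step M lspan_carrier[OF M] by auto
    have "m \<otimes> (sc e \<otimes> n \<oplus> w) = sc e \<otimes> (m \<otimes> n) \<oplus> m \<otimes> w" using i(1) j by algebra
    then show ?case using lspan.step[OF mult[OF \<open>m \<in> M\<close> step(1)] step(3)] by simp
  qed
  then have "sc c \<otimes> (m \<otimes> v) \<in> lspan M" by (rule lspan_scale[OF M])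
  moreover have "(sc c \<otimes> m \<oplus> u) \<otimes> v = sc c \<otimes> (m \<otimes> v) \<oplus> u \<otimes> v" using i by algebra
  ultimately show ?case using lspan_add[OF M step(3)] by simp
qed

lemma lspan_finsum:
  assumes M: "M \<subseteq> carrier A"
  shows "v \<in> lspan M \<Longrightarrow> \<exists>F x. finite F \<and> F \<subseteq> M \<and> v = (\<Oplus>m\<in>F. sc (x m) \<otimes> m)"
proof (induction rule: lspan.induct)
  case zero
  then show ?case by (intro exI[of _ "{}"]) simp
next
  case (step n v c)
  then obtain F x where F: "finite F" "F \<subseteq> M" "v = (\<Oplus>m\<in>F. sc (x m) \<otimes> m)" by blast
  have FA: "F \<subseteq> carrier A" "n \<in> carrier A" using F M step by auto
  define y where "y = (\<lambda>m. if m \<in> F then x m else 0)"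
  have v: "v = (\<Oplus>m\<in>F - {n}. sc (y m) \<otimes> m) \<oplus> sc (y n) \<otimes> n"
  proof (cases "n \<in> F")
    case True
    then have "F = insert n (F - {n})" by blast
    then have "v = (\<Oplus>m\<in>insert n (F - {n}). sc (x m) \<otimes> m)" using F(3) by simp
    also have "\<dots> = sc (x n) \<otimes> n \<oplus> (\<Oplus>m\<in>F - {n}. sc (x m) \<otimes> m)" using F(1) FA by (intro finsum_insert) auto
    also have "(\<Oplus>m\<in>F - {n}. sc (x m) \<otimes> m) = (\<Oplus>m\<in>F - {n}. sc (y m) \<otimes> m)"
      using FA by (intro finsum_cong') (auto simp: y_def)
    finally show ?thesis using FA True by (simp add: y_def a_comm finsum_closed subset_iff Pi_iff)
  next
    case False
    have "v = (\<Oplus>m\<in>F - {n}. sc (y m) \<otimes> m)" unfolding F(3)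
      using FA False by (intro finsum_cong') (auto simp: y_def)
    then show ?thesis using FA False by (simp add: y_def sc_0 finsum_closed subset_iff Pi_iff)
  qed
  have c: "(\<Oplus>m\<in>F - {n}. sc (y m) \<otimes> m) \<in> carrier A" using FA by (intro finsum_closed) auto
  define z where "z = y(n := c + y n)"
  have "(\<Oplus>m\<in>insert n (F - {n}). sc (z m) \<otimes> m) = sc (z n) \<otimes> n \<oplus> (\<Oplus>m\<in>F - {n}. sc (z m) \<otimes> m)"
    using F(1) FA by (intro finsum_insert) auto
  also have "(\<Oplus>m\<in>F - {n}. sc (z m) \<otimes> m) = (\<Oplus>m\<in>F - {n}. sc (y m) \<otimes> m)"
    using FA by (intro finsum_cong') (auto simp: z_def)
  also have "sc (z n) \<otimes> n \<oplus> (\<Oplus>m\<in>F - {n}. sc (y m) \<otimes> m) = sc c \<otimes> n \<oplus> ((\<Oplus>m\<in>F - {n}. sc (y m) \<otimes> m) \<oplus> sc (y n) \<otimes> n)"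
  proof -
    have "sc (z n) = sc c \<oplus> sc (y n)" by (simp add: z_def sc_add)
    then show ?thesis using c FA by (simp add: l_distr a_ac)
  qed
  also have "\<dots> = sc c \<otimes> n \<oplus> v" by (simp add: v)
  finally have "sc c \<otimes> n \<oplus> v = (\<Oplus>m\<in>insert n (F - {n}). sc (z m) \<otimes> m)" ..
  moreover have "finite (insert n (F - {n}))" "insert n (F - {n}) \<subseteq> M" using F step(1) by auto
  ultimately show ?case by blast
qed

lemma lincomb_swap:
  assumes F: "finite F" "F \<subseteq> carrier A" and G: "finite G"
  shows "(\<Oplus>t\<in>G. sc (l t) \<otimes> (\<Oplus>m\<in>F. sc (v t m) \<otimes> m)) = (\<Oplus>m\<in>F. sc (\<Sum>t\<in>G. l t * v t m) \<otimes> m)"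
  using G
proof (induction G)
  case empty
  have "(\<Oplus>m\<in>F. sc 0 \<otimes> m) = (\<Oplus>m\<in>F. \<zero>)" using F by (intro finsum_cong') (auto simp: sc_0)
  then show ?case by simp
next
  case (insert t G)
  have cl: "(\<Oplus>m\<in>F. sc (v s m) \<otimes> m) \<in> carrier A" for s using F by (intro finsum_closed) auto
  have "(\<Oplus>t\<in>insert t G. sc (l t) \<otimes> (\<Oplus>m\<in>F. sc (v t m) \<otimes> m)) =
     sc (l t) \<otimes> (\<Oplus>m\<in>F. sc (v t m) \<otimes> m) \<oplus> (\<Oplus>m\<in>F. sc (\<Sum>t\<in>G. l t * v t m) \<otimes> m)"
    using insert cl by (subst finsum_insert) auto
  also have "sc (l t) \<otimes> (\<Oplus>m\<in>F. sc (v t m) \<otimes> m) = (\<Oplus>m\<in>F. sc (l t) \<otimes> (sc (v t m) \<otimes> m))"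
    using F by (intro finsum_rdistr) auto
  also have "\<dots> \<oplus> (\<Oplus>m\<in>F. sc (\<Sum>t\<in>G. l t * v t m) \<otimes> m) =
    (\<Oplus>m\<in>F. sc (l t) \<otimes> (sc (v t m) \<otimes> m) \<oplus> sc (\<Sum>t\<in>G. l t * v t m) \<otimes> m)"
    using F by (intro finsum_addf[symmetric]) auto
  also have "\<dots> = (\<Oplus>m\<in>F. sc (\<Sum>t\<in>insert t G. l t * v t m) \<otimes> m)"
  proof (rule finsum_cong')
    fix m assume "m \<in> F"
    then have m: "m \<in> carrier A" using F by blast
    show "sc (l t) \<otimes> (sc (v t m) \<otimes> m) \<oplus> sc (\<Sum>t\<in>G. l t * v t m) \<otimes> m = sc (\<Sum>t\<in>insert t G. l t * v t m) \<otimes> m"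
      using insert m by (simp add: sc_add sc_mult l_distr m_assoc)
  qed (use F in auto)
  finally show ?case .
qed

end

context complex_affine_poisson_algebra begin

text \<open>Words in a finite set of generators span. The Nullstellensatz plays this countable
  dimension off against the uncountably many complex numbers.\<close>

lemma countably_spanned: "\<exists>M. countable M \<and> M \<subseteq> carrier A \<and> carrier A = lspan M"
proof -
  obtain S where S: "finite S" "S \<subseteq> carrier A" "generate_ring A (scalars A \<union> S) = carrier A"
    using finitely_generated by blast
  define w where "w xs = foldr (\<otimes>) xs \<one>" for xs
  define M where "M = w ` lists S"
  have wc: "w xs \<in> carrier A" if "set xs \<subseteq> carrier A" for xs using that unfolding w_def by (induction xs) auto
  have app: "w xs \<otimes> w ys = w (xs @ ys)" if "set xs \<subseteq> carrier A" "set ys \<subseteq> carrier A" for xs ys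
    using that wc unfolding w_def by (induction xs) (auto simp: m_assoc)
  have M: "M \<subseteq> carrier A" using wc S by (auto simp: M_def)
  have mult: "m \<otimes> n \<in> M" if mn: "m \<in> M" "n \<in> M" for m n
  proof -
    obtain xs ys where xy: "xs \<in> lists S" "ys \<in> lists S" "m = w xs" "n = w ys" using mn by (auto simp: M_def)
    then have "m \<otimes> n = w (xs @ ys)" using app S by (simp add: in_lists_conv_set subset_iff)
    then show ?thesis using xy unfolding M_def by auto
  qed
  have oneM: "\<one> \<in> M" unfolding M_def w_def by (rule image_eqI[of _ _ "[]"]) auto
  have SM: "S \<subseteq> M"
  proof
    fix s assume "s \<in> S"
    then have "w [s] = s" "[s] \<in> lists S" using S by (auto simp: w_def)
    then show "s \<in> M" unfolding M_def by (metis imageI)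
  qed
  have base: "sc c \<otimes> m \<in> lspan M" if "m \<in> M" for m c
    using lspan.step[OF that lspan.zero, of c] that M by (auto simp: subset_iff)
  have "generate_ring A (scalars A \<union> S) \<subseteq> lspan M"
  proof
    fix x assume "x \<in> generate_ring A (scalars A \<union> S)"
    then show "x \<in> lspan M"
    proof induction
      case one then show ?case using base[of \<one> 1, OF oneM] by (simp add: sc_1)
    next
      case (incl h)
      show ?case
      proof (cases "h \<in> S")
        case True
        then have "h \<in> M" "h \<in> carrier A" using SM S by blast+
        then show ?thesis using base[of h 1] by (simp add: sc_1)
      next
        case False
        then obtain c where "h = sc c" using incl by (auto simp: scalars_sc)
        then show ?thesis using base[of \<one> c, OF oneM] by simp
      qed
    next
      case (a_inv h)
      have "h \<in> carrier A" using a_inv lspan_carrier[OF M] by blast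
      then have "\<ominus> h = sc (-1) \<otimes> h" using sc_minus[of 1] by (simp add: sc_1 l_minus)
      then show ?case using lspan_scale[OF M a_inv(2)] by simp
    next
      case (eng_add h1 h2) then show ?case by (intro lspan_add[OF M])
    next
      case (eng_mult h1 h2) then show ?case by (intro lspan_mult[OF M mult])
    qed
  qed
  then have "carrier A = lspan M" using lspan_carrier[OF M] S by blast
  moreover have "countable M" unfolding M_def using S(1) by (intro countable_image countable_lists countable_finite)
  ultimately show ?thesis using M by blast
qed

lemma uncountable_fiber:
  assumes "uncountable D" "f ` D \<subseteq> E" "countable E"
  shows "\<exists>y. infinite {x \<in> D. f x = y}"
proof (rule ccontr)
  assume no: "\<not> ?thesis"
  have "D = (\<Union>y\<in>f ` D. {x \<in> D. f x = y})" by blast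
  moreover have "countable (\<Union>y\<in>f ` D. {x \<in> D. f x = y})"
  proof (rule countable_UN)
    show "countable (f ` D)" using assms by (meson countable_subset)
    show "countable {x \<in> D. f x = y}" for y using no by (intro countable_finite) blast
  qed
  ultimately show False using assms(1) by metis
qed

text \<open>\<open>J\<close> is maximal among the ideals that contain \<open>P\<close> and miss the
  powers of \<open>f\<close>. If no a - c were in \<open>J\<close>, each would divide some f^n
  modulo \<open>J\<close>. These quotients lie in a space of countable dimension but are indexed by
  all complex c, so a linear dependence between them arises, which \<open>partial_fractions\<close>
  refutes.\<close>

theorem nullstellensatz:
  assumes P: "primeideal P A" and f: "f \<in> carrier A" "f \<notin> P"
  obtains J where "maximalideal J A" "P \<subseteq> J" "f \<notin> J" "\<And>a. a \<in> carrier A \<Longrightarrow> \<exists>c. a \<ominus> sc c \<in> J"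
proof -
  let ?S = "range (\<lambda>n::nat. f [^] n)"
  have PI: "ideal P A" by (rule primeideal.axioms(1)[OF P])
  have S: "?S \<subseteq> carrier A" "\<one> \<in> ?S" using f by (auto intro: image_eqI[of _ _ 0])
  have mult: "s \<otimes> t \<in> ?S" if "s \<in> ?S" "t \<in> ?S" for s t using that f by (auto simp: nat_pow_mult)
  have disj: "P \<inter> ?S = {}" using prime_power_mem[OF P f(1)] f(2) by blast
  obtain J where J: "primeideal J A" "P \<subseteq> J" "J \<inter> ?S = {}"
    and hit: "\<And>a. a \<in> carrier A \<Longrightarrow> a \<notin> J \<Longrightarrow> \<exists>m\<in>J. \<exists>r\<in>carrier A. m \<oplus> r \<otimes> a \<in> ?S"
    using exists_maximal_avoiding[OF PI S mult disj] by blast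
  have JI: "ideal J A" by (rule primeideal.axioms(1)[OF J(1)])
  have "f [^] (1::nat) \<in> ?S" by blast
  then have fJ: "f \<notin> J" using J(3) f by auto
  have res: "\<exists>c. a \<ominus> sc c \<in> J" if a: "a \<in> carrier A" for a
  proof (rule ccontr)
    assume no: "\<not> ?thesis"
    have "\<forall>c. \<exists>r n. r \<in> carrier A \<and> (a \<ominus> sc c) \<otimes> r \<ominus> f [^] (n::nat) \<in> J"
    proof
      fix c
      obtain m r n where m: "m \<in> J" "r \<in> carrier A" "m \<oplus> r \<otimes> (a \<ominus> sc c) = f [^] (n::nat)"
        using hit[of "a \<ominus> sc c"] no a by auto
      have mc: "m \<in> carrier A" using m ideal_subset[OF JI] by blast
      have "(a \<ominus> sc c) \<otimes> r \<ominus> (m \<oplus> r \<otimes> (a \<ominus> sc c)) = \<ominus> m" using a mc m(2) sc_in[of c] by algebra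
      then have "(a \<ominus> sc c) \<otimes> r \<ominus> f [^] n \<in> J" using m ideal_closed(3)[OF JI] by simp
      then show "\<exists>r n. r \<in> carrier A \<and> (a \<ominus> sc c) \<otimes> r \<ominus> f [^] (n::nat) \<in> J" using m by blast
    qed
    then obtain b n where b: "\<And>c. b c \<in> carrier A" "\<And>c. (a \<ominus> sc c) \<otimes> b c \<ominus> f [^] (n c :: nat) \<in> J" by metis
    obtain M where M: "countable M" "M \<subseteq> carrier A" "carrier A = lspan M" using countably_spanned by blast
    have "\<forall>c. \<exists>F x. finite F \<and> F \<subseteq> M \<and> b c = (\<Oplus>m\<in>F. sc (x m) \<otimes> m)"
      using lspan_finsum[OF M(2)] b(1) M(3) by blast
    then obtain F x where F: "\<And>c. finite (F c)" "\<And>c. F c \<subseteq> M" "\<And>c. b c = (\<Oplus>m\<in>F c. sc (x c m) \<otimes> m)" by metis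
    \<comment> \<open>Pigeonhole: infinitely many c share the exponent n and the finite set of
      spanning elements used by \<open>b c\<close>.\<close>
    have "countable {F. finite F \<and> F \<subseteq> M}" using M(1) by (simp add: countable_Collect_finite_subset)
    then have "\<exists>y. infinite {c \<in> UNIV. (n c, F c) = y}"
      using F by (intro uncountable_fiber[OF uncountable_UNIV_complex, of _ "UNIV \<times> {F. finite F \<and> F \<subseteq> M}"]) auto
    then obtain n0 F0 where inf: "infinite {c. n c = n0 \<and> F c = F0}" by auto
    then obtain c0 where "n c0 = n0" "F c0 = F0" by (metis (mono_tags, lifting) Collect_empty_eq finite.emptyI)
    then have F0: "finite F0" "F0 \<subseteq> carrier A" using F(1,2) M(2) by blast+
    obtain G l where G: "finite G" "G \<subseteq> {c. n c = n0 \<and> F c = F0}" "\<exists>c\<in>G. l c \<noteq> 0" "\<forall>m\<in>F0. (\<Sum>c\<in>G. l c * x c m) = 0"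
      using linear_dependence[OF F0(1) inf, of x] by blast
    have "(\<Oplus>c\<in>G. sc (l c) \<otimes> b c) = (\<Oplus>c\<in>G. sc (l c) \<otimes> (\<Oplus>m\<in>F0. sc (x c m) \<otimes> m))"
    proof (rule finsum_cong')
      fix c assume "c \<in> G"
      then have "F c = F0" using G by blast
      then show "sc (l c) \<otimes> b c = sc (l c) \<otimes> (\<Oplus>m\<in>F0. sc (x c m) \<otimes> m)" using F(3)[of c] by simp
    qed (use F0 in \<open>auto intro!: finsum_closed m_closed\<close>)
    also have "\<dots> = (\<Oplus>m\<in>F0. sc (\<Sum>c\<in>G. l c * x c m) \<otimes> m)" by (rule lincomb_swap[OF F0 G(1)])
    also have "\<dots> = (\<Oplus>m\<in>F0. \<zero>)" using G(4) F0 by (intro finsum_cong') (auto simp: sc_0)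
    also have "\<dots> = \<zero>" by simp
    finally have rel: "(\<Oplus>c\<in>G. sc (l c) \<otimes> b c) = \<zero>" .
    obtain d where d: "d \<in> G" "l d \<noteq> 0" using G(3) by blast
    have "f [^] n0 \<notin> J" using J(3) by blast
    moreover have "(a \<ominus> sc c) \<otimes> b c \<ominus> f [^] n0 \<in> J" if "c \<in> G" for c using b(2)[of c] that G(2) by auto
    ultimately show False
      using partial_fractions[OF J(1) a _ _ G(1) b(1) _ d rel, of "f [^] n0"] f(1) no by blast
  qed
  \<comment> \<open>Every element is a scalar modulo \<open>J\<close>, so an element outside
    \<open>J\<close> is an invertible scalar there.\<close>
  have "maximalideal J A"
  proof (rule maximalidealI[OF JI])
    show "carrier A \<noteq> J" using primeideal.I_notcarr[OF J(1)] by simp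
    fix K assume K: "ideal K A" "J \<subseteq> K" "K \<subseteq> carrier A"
    show "K = J \<or> K = carrier A"
    proof (cases "K = J")
      case False
      then obtain a where a: "a \<in> K" "a \<notin> J" using K by blast
      then have ac: "a \<in> carrier A" using K by blast
      obtain c where c: "a \<ominus> sc c \<in> J" using res[OF ac] by blast
      have "c \<noteq> 0" using c a ac by (auto simp: sc_0 a_minus_def)
      have "a \<ominus> (a \<ominus> sc c) \<in> K" using a c K ideal_closed(4)[OF K(1)] by blast
      moreover have "a \<ominus> (a \<ominus> sc c) = sc c \<otimes> \<one>" using ac sc_in[of c] by algebra
      ultimately have "\<one> \<in> K" using ideal_sc_cancel[OF K(1) one_closed \<open>c \<noteq> 0\<close>] by simp
      then show ?thesis using ideal.one_imp_carrier[OF K(1)] by simp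
    qed simp
  qed
  then show ?thesis using that J(2) fJ res by blast
qed

section \<open>Values at maximal ideals\<close>

lemma maxspec_prime: "m \<in> maxspec A \<Longrightarrow> primeideal m A"
  by (simp add: maxspec_def maximalideal_prime)

lemma residue:
  assumes m: "m \<in> maxspec A" and a: "a \<in> carrier A" shows "\<exists>c. a \<ominus> sc c \<in> m"
proof -
  have p: "primeideal m A" by (rule maxspec_prime[OF m])
  have mI: "ideal m A" by (rule primeideal.axioms(1)[OF p])
  have n1: "\<one> \<notin> m" using ideal.one_imp_carrier[OF mI] primeideal.I_notcarr[OF p] by auto
  obtain J where J: "maximalideal J A" "m \<subseteq> J" "\<one> \<notin> J" "\<And>a. a \<in> carrier A \<Longrightarrow> \<exists>c. a \<ominus> sc c \<in> J"
    by (rule nullstellensatz[OF p one_closed n1]) (rule that)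
  have JI: "ideal J A" by (rule maximalideal.axioms(1)[OF J(1)])
  have mm: "maximalideal m A" using m by (simp add: maxspec_def)
  have "J = m \<or> J = carrier A" using maximalideal.I_maximal[OF mm JI J(2) ideal_subset[OF JI]] .
  then have "J = m" using maximalideal.I_notcarr[OF J(1)] by auto
  then show ?thesis using J(4)[OF a] by simp
qed

lemma jacobson:
  assumes "primeideal P A" "f \<in> carrier A" "f \<notin> P"
  shows "\<exists>m\<in>maxspec A. P \<subseteq> m \<and> f \<notin> m"
proof -
  obtain J where "maximalideal J A" "P \<subseteq> J" "f \<notin> J" by (rule nullstellensatz[OF assms]) (rule that)
  then show ?thesis by (auto simp: maxspec_def)
qed

lemma eval_at_eq:
  assumes m: "m \<in> maxspec A" and c: "a \<ominus> sc c \<in> m" and a: "a \<in> carrier A" shows "eval_at A m a = c"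
proof -
  have p: "primeideal m A" by (rule maxspec_prime[OF m])
  have mI: "ideal m A" by (rule primeideal.axioms(1)[OF p])
  show ?thesis unfolding eval_at_def
  proof (rule the_equality)
    show "a \<ominus> c \<odot> \<one> \<in> m" using c by (simp add: sc_def)
    fix d assume "a \<ominus> d \<odot> \<one> \<in> m"
    then have d: "a \<ominus> sc d \<in> m" by (simp add: sc_def)
    show "d = c"
    proof (rule ccontr)
      assume "d \<noteq> c"
      have "(a \<ominus> sc c) \<ominus> (a \<ominus> sc d) \<in> m" by (rule ideal_closed(4)[OF mI c d])
      moreover have "(a \<ominus> sc c) \<ominus> (a \<ominus> sc d) = (sc d \<oplus> (\<ominus> sc c)) \<otimes> \<one>" using a sc_in[of c] sc_in[of d] by algebra
      ultimately have "sc (d + - c) \<otimes> \<one> \<in> m" by (simp only: sc_add sc_minus)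
      then have "\<one> \<in> m" using ideal_sc_cancel[OF mI one_closed, of "d + - c"] \<open>d \<noteq> c\<close> by simp
      then show False using ideal.one_imp_carrier[OF mI] primeideal.I_notcarr[OF p] by auto
    qed
  qed
qed

lemma eval_at_mem: "m \<in> maxspec A \<Longrightarrow> a \<in> carrier A \<Longrightarrow> a \<ominus> sc (eval_at A m a) \<in> m"
  using residue eval_at_eq by metis

lemma eval_at_simps:
  assumes m: "m \<in> maxspec A"
  shows "a \<in> carrier A \<Longrightarrow> b \<in> carrier A \<Longrightarrow> eval_at A m (a \<oplus> b) = eval_at A m a + eval_at A m b"
    "a \<in> carrier A \<Longrightarrow> b \<in> carrier A \<Longrightarrow> eval_at A m (a \<otimes> b) = eval_at A m a * eval_at A m b"
    "eval_at A m (sc c) = c" "eval_at A m \<one> = 1" "eval_at A m \<zero> = 0"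
    "a \<in> carrier A \<Longrightarrow> eval_at A m (\<ominus> a) = - eval_at A m a"
    "a \<in> carrier A \<Longrightarrow> b \<in> carrier A \<Longrightarrow> eval_at A m (a \<ominus> b) = eval_at A m a - eval_at A m b"
    "a \<in> carrier A \<Longrightarrow> eval_at A m a = 0 \<longleftrightarrow> a \<in> m"
proof -
  have p: "primeideal m A" by (rule maxspec_prime[OF m])
  have mI: "ideal m A" by (rule primeideal.axioms(1)[OF p])
  have z: "sc c \<ominus> sc c \<in> m" for c using ideal_closed(1)[OF mI] by (simp add: a_minus_def r_neg)
  show s: "eval_at A m (sc c) = c" for c by (rule eval_at_eq[OF m z]) simp
  show one: "eval_at A m \<one> = 1" using s[of 1] by (simp add: sc_1)
  show zero: "eval_at A m \<zero> = 0" using s[of 0] by (simp add: sc_0)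
  show add: "eval_at A m (a \<oplus> b) = eval_at A m a + eval_at A m b" if ab: "a \<in> carrier A" "b \<in> carrier A" for a b
  proof (rule eval_at_eq[OF m])
    let ?a = "sc (eval_at A m a)" and ?b = "sc (eval_at A m b)"
    have "(a \<ominus> ?a) \<oplus> (b \<ominus> ?b) \<in> m" by (intro ideal_closed(2)[OF mI] eval_at_mem[OF m] ab)
    moreover have "(a \<ominus> ?a) \<oplus> (b \<ominus> ?b) = (a \<oplus> b) \<ominus> (?a \<oplus> ?b)"
      using ab sc_in[of "eval_at A m a"] sc_in[of "eval_at A m b"] by algebra
    ultimately show "a \<oplus> b \<ominus> sc (eval_at A m a + eval_at A m b) \<in> m" by (simp only: sc_add)
  qed (use ab in simp)
  show mult: "eval_at A m (a \<otimes> b) = eval_at A m a * eval_at A m b" if ab: "a \<in> carrier A" "b \<in> carrier A" for a b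
  proof (rule eval_at_eq[OF m])
    let ?a = "sc (eval_at A m a)" and ?b = "sc (eval_at A m b)"
    have "b \<otimes> (a \<ominus> ?a) \<oplus> ?a \<otimes> (b \<ominus> ?b) \<in> m"
      by (intro ideal_closed(2,5)[OF mI] eval_at_mem[OF m] ab sc_in)
    moreover have "b \<otimes> (a \<ominus> ?a) \<oplus> ?a \<otimes> (b \<ominus> ?b) = (a \<otimes> b) \<ominus> (?a \<otimes> ?b)"
      using ab sc_in[of "eval_at A m a"] sc_in[of "eval_at A m b"] by algebra
    ultimately show "a \<otimes> b \<ominus> sc (eval_at A m a * eval_at A m b) \<in> m" by (simp only: sc_mult)
  qed (use ab in simp)
  show neg: "eval_at A m (\<ominus> a) = - eval_at A m a" if a: "a \<in> carrier A" for a
  proof -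
    have "eval_at A m (a \<oplus> \<ominus> a) = 0" using a zero by (simp add: r_neg)
    then show ?thesis using add[of a "\<ominus> a"] a by (simp add: eq_neg_iff_add_eq_0 add.commute)
  qed
  show "eval_at A m (a \<ominus> b) = eval_at A m a - eval_at A m b" if "a \<in> carrier A" "b \<in> carrier A"
    unfolding a_minus_def using that by (simp add: add neg)
  show "eval_at A m a = 0 \<longleftrightarrow> a \<in> m" if a: "a \<in> carrier A"
  proof
    assume "eval_at A m a = 0"
    then show "a \<in> m" using eval_at_mem[OF m a] a by (simp add: sc_0 a_minus_def)
  next
    assume "a \<in> m"
    then show "eval_at A m a = 0" using a by (intro eval_at_eq[OF m]) (simp_all add: sc_0 a_minus_def)
  qed
qed

subsection \<open>Locally closed Poisson primes\<close>

lemma openin_poisson_spec: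
  "openin (poisson_spec A) U \<longleftrightarrow> (\<exists>S\<subseteq>carrier A. U = {P. poisson_prime A P \<and> \<not> S \<subseteq> P})"
proof -
  have "openin (poisson_spec A) U \<longleftrightarrow> (\<exists>T. (\<exists>S\<subseteq>carrier A. T = {P. primeideal P A \<and> \<not> S \<subseteq> P}) \<and> U = T \<inter> {P. poisson_prime A P})"
    unfolding poisson_spec_def openin_subtopology openin_zariski by blast
  also have "\<dots> \<longleftrightarrow> (\<exists>S\<subseteq>carrier A. U = {P. primeideal P A \<and> \<not> S \<subseteq> P} \<inter> {P. poisson_prime A P})" by blast
  also have "\<dots> \<longleftrightarrow> (\<exists>S\<subseteq>carrier A. U = {P. poisson_prime A P \<and> \<not> S \<subseteq> P})"
  proof -
    have "{P. primeideal P A \<and> \<not> S \<subseteq> P} \<inter> {P. poisson_prime A P} = {P. poisson_prime A P \<and> \<not> S \<subseteq> P}" for S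
      by (auto simp: poisson_prime_def)
    then show ?thesis by simp
  qed
  finally show ?thesis .
qed

lemma topspace_poisson_spec: "topspace (poisson_spec A) = {P. poisson_prime A P}"
proof -
  have "openin (poisson_spec A) {P. poisson_prime A P}"
    unfolding openin_poisson_spec
  proof (intro exI[of _ "carrier A"] conjI)
    show "{P. poisson_prime A P} = {P. poisson_prime A P \<and> \<not> carrier A \<subseteq> P}"
      using primeideal.I_notcarr ideal_subset by (auto simp: poisson_prime_def poisson_ideal_def)
  qed simp
  then have "{P. poisson_prime A P} \<subseteq> topspace (poisson_spec A)" by (rule openin_subset)
  moreover have "topspace (poisson_spec A) \<subseteq> {P. poisson_prime A P}"
    using openin_topspace[of "poisson_spec A"] unfolding openin_poisson_spec by auto
  ultimately show ?thesis by blast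
qed

text \<open>The closed set may be shrunk to the closure of \<open>P\<close> and the open set to the
  locus where a single f is not contained, so the topology reduces to the choice of f.\<close>

lemma poisson_locally_closed_iff:
  "poisson_locally_closed A P \<longleftrightarrow> poisson_prime A P \<and>
    (\<exists>f\<in>carrier A. f \<notin> P \<and> (\<forall>Q. poisson_prime A Q \<longrightarrow> P \<subset> Q \<longrightarrow> f \<in> Q))"
proof (cases "poisson_prime A P")
  case True
  have PA: "P \<subseteq> carrier A" using True ideal_subset by (auto simp: poisson_prime_def poisson_ideal_def)
  show ?thesis
  proof
    assume "poisson_locally_closed A P"
    then obtain U C where U: "openin (poisson_spec A) U" and C: "closedin (poisson_spec A) C" and UC: "{P} = U \<inter> C"
      unfolding poisson_locally_closed_def by blast
    obtain S where S: "S \<subseteq> carrier A" "U = {P. poisson_prime A P \<and> \<not> S \<subseteq> P}" using U unfolding openin_poisson_spec by blast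
    obtain T where T: "{P. poisson_prime A P} - C = {P. poisson_prime A P \<and> \<not> T \<subseteq> P}" "C \<subseteq> {P. poisson_prime A P}"
      using C unfolding closedin_def topspace_poisson_spec openin_poisson_spec by blast
    have "P \<in> U" "P \<in> C" using UC by blast+
    then obtain f where f: "f \<in> S" "f \<notin> P" using S by blast
    have TP: "T \<subseteq> P" using \<open>P \<in> C\<close> T True by blast
    have "f \<in> Q" if Q: "poisson_prime A Q" "P \<subset> Q" for Q
    proof -
      have "Q \<in> C" using TP Q T by blast
      then have "Q \<notin> U" using UC Q by blast
      then show ?thesis using S Q f by blast
    qed
    then show "poisson_prime A P \<and> (\<exists>f\<in>carrier A. f \<notin> P \<and> (\<forall>Q. poisson_prime A Q \<longrightarrow> P \<subset> Q \<longrightarrow> f \<in> Q))"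
      using True f S by blast
  next
    assume "poisson_prime A P \<and> (\<exists>f\<in>carrier A. f \<notin> P \<and> (\<forall>Q. poisson_prime A Q \<longrightarrow> P \<subset> Q \<longrightarrow> f \<in> Q))"
    then obtain f where f: "f \<in> carrier A" "f \<notin> P" "\<And>Q. poisson_prime A Q \<Longrightarrow> P \<subset> Q \<Longrightarrow> f \<in> Q" by blast
    define U where "U = {Q. poisson_prime A Q \<and> \<not> {f} \<subseteq> Q}"
    define C where "C = {Q. poisson_prime A Q \<and> P \<subseteq> Q}"
    have "openin (poisson_spec A) U" unfolding openin_poisson_spec U_def using f by blast
    moreover have "closedin (poisson_spec A) C"
    proof -
      have "{P. poisson_prime A P} - C = {Q. poisson_prime A Q \<and> \<not> P \<subseteq> Q}" by (auto simp: C_def)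
      then show ?thesis unfolding closedin_def topspace_poisson_spec openin_poisson_spec using PA C_def by blast
    qed
    moreover have "{P} = U \<inter> C" using True f by (auto simp: U_def C_def)
    ultimately show "poisson_locally_closed A P" unfolding poisson_locally_closed_def using True by blast
  qed
qed (simp add: poisson_locally_closed_def)

text \<open>A maximal ideal above \<open>P\<close> that misses f has a core above \<open>P\<close>
  that misses f, and by the choice of f that core cannot be strictly larger.\<close>

theorem locally_closed_imp_primitive:
  assumes "poisson_locally_closed A P" shows "poisson_primitive A P"
proof -
  obtain f where P: "poisson_prime A P" and f: "f \<in> carrier A" "f \<notin> P" "\<And>Q. poisson_prime A Q \<Longrightarrow> P \<subset> Q \<Longrightarrow> f \<in> Q"
    using assms unfolding poisson_locally_closed_iff by blast
  have pP: "primeideal P A" "poisson_ideal A P" using P by (auto simp: poisson_prime_def)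
  obtain m where m: "m \<in> maxspec A" "P \<subseteq> m" "f \<notin> m" using jacobson[OF pP(1) f(1,2)] by blast
  have pm: "primeideal m A" by (rule maxspec_prime[OF m(1)])
  note core = poisson_core_greatest[OF primeideal.axioms(1)[OF pm]]
  have "P \<subseteq> poisson_core A m" by (rule core(3)[OF pP(2) m(2)])
  moreover have "f \<notin> poisson_core A m" using core(2) m(3) by blast
  ultimately have "P = poisson_core A m" using f(3)[OF poisson_core_prime[OF pm]] by blast
  then show ?thesis using m(1) unfolding poisson_primitive_def by blast
qed

end

subsection \<open>Quotients\<close>

text \<open>Operations on quotients and fractions are unions over all representatives; this reduces
  their computation to independence of the representative.\<close>

lemma UN_const_eq: "V \<noteq> {} \<Longrightarrow> (\<And>x. x \<in> V \<Longrightarrow> f x = Z) \<Longrightarrow> (\<Union>x\<in>V. f x) = Z"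
  by auto

context complex_poisson_algebra begin

lemma coset_eq_iff:
  assumes "ideal I A" "x \<in> carrier A" "y \<in> carrier A"
  shows "I +> x = I +> y \<longleftrightarrow> x \<ominus> y \<in> I"
  using quotient_eq_iff_same_a_r_cos[OF assms] by simp

lemma coset_mem: assumes I: "ideal I A" and y: "y \<in> carrier A" and x: "x \<in> I +> y"
  shows "x \<in> carrier A" "x \<ominus> y \<in> I"
proof -
  obtain i where i: "i \<in> I" "x = i \<oplus> y" using x by (auto simp: a_r_coset_def')
  have ic: "i \<in> carrier A" using i ideal_subset[OF I] by blast
  show "x \<in> carrier A" using i ic y by simp
  have "x \<ominus> y = i" using ic y unfolding i(2) by algebra
  then show "x \<ominus> y \<in> I" using i by simp
qed

lemma coset_self: assumes I: "ideal I A" and y: "y \<in> carrier A" shows "y \<in> I +> y"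
  using ideal_closed(1)[OF I] y by (force simp: a_r_coset_def')

lemma quot_ring_simps:
  assumes II: "ideal I A"
  shows "carrier (poisson_quot A I) = (\<lambda>x. I +> x) ` carrier A"
    "one (poisson_quot A I) = I +> \<one>" "zero (poisson_quot A I) = I +> \<zero>"
    "x \<in> carrier A \<Longrightarrow> y \<in> carrier A \<Longrightarrow> (I +> x) \<oplus>\<^bsub>poisson_quot A I\<^esub> (I +> y) = I +> (x \<oplus> y)"
    "x \<in> carrier A \<Longrightarrow> y \<in> carrier A \<Longrightarrow> (I +> x) \<otimes>\<^bsub>poisson_quot A I\<^esub> (I +> y) = I +> (x \<otimes> y)"
    "x \<in> carrier A \<Longrightarrow> c \<odot>\<^bsub>poisson_quot A I\<^esub> (I +> x) = I +> (c \<odot> x)"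
proof -
  have IA: "I \<subseteq> carrier A" by (rule ideal_subset[OF II])
  note h = ideal.rcos_ring_hom[OF II]
  show "carrier (poisson_quot A I) = (\<lambda>x. I +> x) ` carrier A"
    by (auto simp: poisson_quot_def FactRing_def A_RCOSETS_def')
  show "one (poisson_quot A I) = I +> \<one>" by (simp add: poisson_quot_def FactRing_def)
  have "I +> \<zero> = I" using a_coset_add_zero[OF IA] .
  then show "zero (poisson_quot A I) = I +> \<zero>" by (simp add: poisson_quot_def FactRing_def)
  show "(I +> x) \<oplus>\<^bsub>poisson_quot A I\<^esub> (I +> y) = I +> (x \<oplus> y)" if "x \<in> carrier A" "y \<in> carrier A"
    using ring_hom_add[OF h that] by (simp add: poisson_quot_def)
  show "(I +> x) \<otimes>\<^bsub>poisson_quot A I\<^esub> (I +> y) = I +> (x \<otimes> y)" if "x \<in> carrier A" "y \<in> carrier A"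
    using ring_hom_mult[OF h that] by (simp add: poisson_quot_def)
  show "c \<odot>\<^bsub>poisson_quot A I\<^esub> (I +> x) = I +> (c \<odot> x)" if x: "x \<in> carrier A"
  proof -
    have "(\<Union>y\<in>I +> x. I +> (c \<odot> y)) = I +> (c \<odot> x)"
    proof (rule UN_const_eq)
      show "I +> x \<noteq> {}" using coset_self[OF II x] by blast
      fix y assume y: "y \<in> I +> x"
      have yc: "y \<in> carrier A" "y \<ominus> x \<in> I" using coset_mem[OF II x y] by auto
      have "sc c \<otimes> (y \<ominus> x) \<in> I" by (rule ideal_closed(5)[OF II yc(2)]) simp
      moreover have "sc c \<otimes> (y \<ominus> x) = sc c \<otimes> y \<ominus> sc c \<otimes> x" using x yc sc_in[of c] by algebra
      ultimately show "I +> (c \<odot> y) = I +> (c \<odot> x)"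
        using x yc by (subst coset_eq_iff[OF II]) (auto simp: smult_sc)
    qed
    then show ?thesis by (simp add: poisson_quot_def)
  qed
qed

lemma quot_bracket:
  assumes I: "poisson_ideal A I" and x: "x \<in> carrier A" and y: "y \<in> carrier A"
  shows "\<lbrace>I +> x, I +> y\<rbrace>\<^bsub>poisson_quot A I\<^esub> = I +> \<lbrace>x, y\<rbrace>"
proof -
  have II: "ideal I A" and br: "\<And>x c. x \<in> I \<Longrightarrow> c \<in> carrier A \<Longrightarrow> \<lbrace>x, c\<rbrace> \<in> I"
    using I by (auto simp: poisson_ideal_def)
    have "(\<Union>a\<in>I +> x. \<Union>b\<in>I +> y. I +> \<lbrace>a, b\<rbrace>) = I +> \<lbrace>x, y\<rbrace>"
    proof (intro UN_const_eq)
      show "I +> x \<noteq> {}" "I +> y \<noteq> {}" using coset_self[OF II] x y by blast+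
      fix a b assume ab: "a \<in> I +> x" "b \<in> I +> y"
      have a: "a \<in> carrier A" "a \<ominus> x \<in> I" and b: "b \<in> carrier A" "b \<ominus> y \<in> I"
        using coset_mem[OF II x ab(1)] coset_mem[OF II y ab(2)] by auto
      \<comment> \<open>The two arguments are changed one at a time, from {a, b} to {x, b} and then
        to {x, y}.\<close>
      have 1: "\<lbrace>a \<ominus> x, b\<rbrace> = \<lbrace>a, b\<rbrace> \<ominus> \<lbrace>x, b\<rbrace>"
        using a b x by (simp add: a_minus_def bracket_add_left bracket_minus)
      have 2: "\<lbrace>b \<ominus> y, x\<rbrace> = \<lbrace>x, y\<rbrace> \<ominus> \<lbrace>x, b\<rbrace>"
        using b x y bracket_skew[of y x] bracket_skew[of b x] bracket_closed
        by (simp add: a_minus_def bracket_add_left bracket_minus a_comm)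
      have "\<lbrace>a \<ominus> x, b\<rbrace> \<ominus> \<lbrace>b \<ominus> y, x\<rbrace> \<in> I"
        by (intro ideal_closed(4)[OF II] br a b x)
      moreover have "(p \<ominus> q) \<ominus> (r \<ominus> q) = p \<ominus> r" if "p \<in> carrier A" "q \<in> carrier A" "r \<in> carrier A" for p q r
        using that by algebra
      ultimately have "\<lbrace>a, b\<rbrace> \<ominus> \<lbrace>x, y\<rbrace> \<in> I" unfolding 1 2 using a b x y bracket_closed by simp
      then show "I +> \<lbrace>a, b\<rbrace> = I +> \<lbrace>x, y\<rbrace>"
        using a b x y bracket_closed by (subst coset_eq_iff[OF II]) auto
    qed
    then show ?thesis by (simp add: poisson_quot_def)
qed

lemma cring_quot: assumes I: "ideal I A" shows "cring (poisson_quot A I)"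
proof -
  let ?B = "poisson_quot A I"
  note q = quot_ring_simps[OF I]
  have ex: "\<And>u. u \<in> carrier ?B \<Longrightarrow> \<exists>x\<in>carrier A. u = I +> x" unfolding q by blast
  have q_in: "\<And>x. x \<in> carrier A \<Longrightarrow> I +> x \<in> carrier ?B" unfolding q by blast
  show "cring ?B"
  proof (rule cringI)
    show "abelian_group ?B"
    proof (rule abelian_groupI)
      fix u v w
      show "\<zero>\<^bsub>?B\<^esub> \<in> carrier ?B" unfolding q(3) by (rule q_in) simp
      assume u: "u \<in> carrier ?B"
      obtain x where x: "x \<in> carrier A" "u = I +> x" using ex[OF u] by blast
      show "\<zero>\<^bsub>?B\<^esub> \<oplus>\<^bsub>?B\<^esub> u = u" using x by (simp add: q)
      have "(I +> \<ominus> x) \<oplus>\<^bsub>?B\<^esub> u = \<zero>\<^bsub>?B\<^esub>" using x by (simp add: q l_neg)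
      then show "\<exists>y\<in>carrier ?B. y \<oplus>\<^bsub>?B\<^esub> u = \<zero>\<^bsub>?B\<^esub>" using q_in[of "\<ominus> x"] x by blast
      assume v: "v \<in> carrier ?B"
      obtain y where y: "y \<in> carrier A" "v = I +> y" using ex[OF v] by blast
      show "u \<oplus>\<^bsub>?B\<^esub> v \<in> carrier ?B" using x y q_in by (simp add: q(4))
      show "u \<oplus>\<^bsub>?B\<^esub> v = v \<oplus>\<^bsub>?B\<^esub> u" using x y by (simp add: q(4) a_comm)
      assume w: "w \<in> carrier ?B"
      obtain z where z: "z \<in> carrier A" "w = I +> z" using ex[OF w] by blast
      show "u \<oplus>\<^bsub>?B\<^esub> v \<oplus>\<^bsub>?B\<^esub> w = u \<oplus>\<^bsub>?B\<^esub> (v \<oplus>\<^bsub>?B\<^esub> w)" using x y z by (simp add: q(4) a_assoc)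
    qed
    show "Group.comm_monoid ?B"
    proof (rule comm_monoidI)
      fix u v w
      show "\<one>\<^bsub>?B\<^esub> \<in> carrier ?B" unfolding q(2) by (rule q_in) simp
      assume u: "u \<in> carrier ?B"
      obtain x where x: "x \<in> carrier A" "u = I +> x" using ex[OF u] by blast
      show "\<one>\<^bsub>?B\<^esub> \<otimes>\<^bsub>?B\<^esub> u = u" using x by (simp add: q)
      assume v: "v \<in> carrier ?B"
      obtain y where y: "y \<in> carrier A" "v = I +> y" using ex[OF v] by blast
      show "u \<otimes>\<^bsub>?B\<^esub> v \<in> carrier ?B" using x y q_in by (simp add: q(5))
      show "u \<otimes>\<^bsub>?B\<^esub> v = v \<otimes>\<^bsub>?B\<^esub> u" using x y by (simp add: q(5) m_comm)
      assume w: "w \<in> carrier ?B"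
      obtain z where z: "z \<in> carrier A" "w = I +> z" using ex[OF w] by blast
      show "u \<otimes>\<^bsub>?B\<^esub> v \<otimes>\<^bsub>?B\<^esub> w = u \<otimes>\<^bsub>?B\<^esub> (v \<otimes>\<^bsub>?B\<^esub> w)" using x y z by (simp add: q(5) m_assoc)
    qed
    fix u v w assume u: "u \<in> carrier ?B" and v: "v \<in> carrier ?B" and w: "w \<in> carrier ?B"
    obtain x y z where "x \<in> carrier A" "u = I +> x" "y \<in> carrier A" "v = I +> y" "z \<in> carrier A" "w = I +> z"
      using ex[OF u] ex[OF v] ex[OF w] by blast
    then show "(u \<oplus>\<^bsub>?B\<^esub> v) \<otimes>\<^bsub>?B\<^esub> w = u \<otimes>\<^bsub>?B\<^esub> w \<oplus>\<^bsub>?B\<^esub> v \<otimes>\<^bsub>?B\<^esub> w"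
      by (simp add: q(4,5) l_distr)
  qed
qed

theorem quot_poisson_algebra:
  assumes I: "poisson_ideal A I" shows "complex_poisson_algebra (poisson_quot A I)"
proof -
  let ?B = "poisson_quot A I"
  have II: "ideal I A" using I by (simp add: poisson_ideal_def)
  note q = quot_ring_simps[OF II] quot_bracket[OF I]
  have ex: "\<And>u. u \<in> carrier ?B \<Longrightarrow> \<exists>x\<in>carrier A. u = I +> x" unfolding q by blast
  have q_in: "\<And>x. x \<in> carrier A \<Longrightarrow> I +> x \<in> carrier ?B" unfolding q by blast
  have "cring ?B" by (rule cring_quot[OF II])
  have "Module.algebra (ring_of_type_algebra :: complex ring) ?B"
  proof (rule algebraI)
    show "cring (ring_of_type_algebra :: complex ring)" by (rule R.is_cring)
    show "cring ?B" by fact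
  next
    fix u v and c d :: complex
    assume u: "u \<in> carrier ?B"
    obtain x where x: "x \<in> carrier A" "u = I +> x" using ex[OF u] by blast
    show "c \<odot>\<^bsub>?B\<^esub> u \<in> carrier ?B" using x q_in by (simp add: q(6))
    show "(c \<oplus>\<^bsub>ring_of_type_algebra\<^esub> d) \<odot>\<^bsub>?B\<^esub> u = c \<odot>\<^bsub>?B\<^esub> u \<oplus>\<^bsub>?B\<^esub> d \<odot>\<^bsub>?B\<^esub> u"
      using x by (simp add: q(4,6) ring_of_type_algebra_def smult_simps(1)[OF x(1) x(1)])
    show "(c \<otimes>\<^bsub>ring_of_type_algebra\<^esub> d) \<odot>\<^bsub>?B\<^esub> u = c \<odot>\<^bsub>?B\<^esub> (d \<odot>\<^bsub>?B\<^esub> u)"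
      using x by (simp add: q(6) ring_of_type_algebra_def smult_simps(3)[OF x(1) x(1)])
    show "\<one>\<^bsub>ring_of_type_algebra\<^esub> \<odot>\<^bsub>?B\<^esub> u = u"
      using x by (simp add: q(6) ring_of_type_algebra_def smult_simps(4)[OF x(1) x(1)])
    assume v: "v \<in> carrier ?B"
    obtain y where y: "y \<in> carrier A" "v = I +> y" using ex[OF v] by blast
    show "c \<odot>\<^bsub>?B\<^esub> (u \<oplus>\<^bsub>?B\<^esub> v) = c \<odot>\<^bsub>?B\<^esub> u \<oplus>\<^bsub>?B\<^esub> c \<odot>\<^bsub>?B\<^esub> v"
      using x y by (simp add: q(4,6) smult_simps(2)[OF x(1) y(1)])
    show "c \<odot>\<^bsub>?B\<^esub> u \<otimes>\<^bsub>?B\<^esub> v = c \<odot>\<^bsub>?B\<^esub> (u \<otimes>\<^bsub>?B\<^esub> v)"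
      using x y by (simp add: q(5,6) smult_simps(5)[OF x(1) y(1)])
  qed
  then show ?thesis
  proof (rule complex_poisson_algebra.intro, unfold_locales)
    fix u v w and c :: complex
    assume u: "u \<in> carrier ?B"
    obtain x where x: "x \<in> carrier A" "u = I +> x" using ex[OF u] by blast
    show "\<lbrace>u, u\<rbrace>\<^bsub>?B\<^esub> = \<zero>\<^bsub>?B\<^esub>" using x by (simp add: q(3,7) bracket_self)
    assume v: "v \<in> carrier ?B"
    obtain y where y: "y \<in> carrier A" "v = I +> y" using ex[OF v] by blast
    note b = bracket_closed[OF x(1) y(1)]
    show "\<lbrace>u, v\<rbrace>\<^bsub>?B\<^esub> \<in> carrier ?B" using x y b q_in by (simp add: q(7))
    show "\<lbrace>c \<odot>\<^bsub>?B\<^esub> u, v\<rbrace>\<^bsub>?B\<^esub> = c \<odot>\<^bsub>?B\<^esub> \<lbrace>u, v\<rbrace>\<^bsub>?B\<^esub>" using x y b by (simp add: q(6,7) bracket_smult_left)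
    show "\<lbrace>u, c \<odot>\<^bsub>?B\<^esub> v\<rbrace>\<^bsub>?B\<^esub> = c \<odot>\<^bsub>?B\<^esub> \<lbrace>u, v\<rbrace>\<^bsub>?B\<^esub>" using x y b by (simp add: q(6,7) bracket_smult_right)
    assume w: "w \<in> carrier ?B"
    obtain z where z: "z \<in> carrier A" "w = I +> z" using ex[OF w] by blast
    note b = b bracket_closed[OF x(1) z(1)] bracket_closed[OF y(1) z(1)] bracket_closed[OF z(1) x(1)]
    show "\<lbrace>u \<oplus>\<^bsub>?B\<^esub> v, w\<rbrace>\<^bsub>?B\<^esub> = \<lbrace>u, w\<rbrace>\<^bsub>?B\<^esub> \<oplus>\<^bsub>?B\<^esub> \<lbrace>v, w\<rbrace>\<^bsub>?B\<^esub>"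
      "\<lbrace>u, v \<oplus>\<^bsub>?B\<^esub> w\<rbrace>\<^bsub>?B\<^esub> = \<lbrace>u, v\<rbrace>\<^bsub>?B\<^esub> \<oplus>\<^bsub>?B\<^esub> \<lbrace>u, w\<rbrace>\<^bsub>?B\<^esub>"
      "\<lbrace>u \<otimes>\<^bsub>?B\<^esub> v, w\<rbrace>\<^bsub>?B\<^esub> = u \<otimes>\<^bsub>?B\<^esub> \<lbrace>v, w\<rbrace>\<^bsub>?B\<^esub> \<oplus>\<^bsub>?B\<^esub> v \<otimes>\<^bsub>?B\<^esub> \<lbrace>u, w\<rbrace>\<^bsub>?B\<^esub>"
      "\<lbrace>u, v \<otimes>\<^bsub>?B\<^esub> w\<rbrace>\<^bsub>?B\<^esub> = v \<otimes>\<^bsub>?B\<^esub> \<lbrace>u, w\<rbrace>\<^bsub>?B\<^esub> \<oplus>\<^bsub>?B\<^esub> w \<otimes>\<^bsub>?B\<^esub> \<lbrace>u, v\<rbrace>\<^bsub>?B\<^esub>"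
      using x y z b by (simp_all add: q(4,5,7) bracket_add_left bracket_add_right bracket_mult_left bracket_mult_right)
    show "\<lbrace>u, \<lbrace>v, w\<rbrace>\<^bsub>?B\<^esub>\<rbrace>\<^bsub>?B\<^esub> \<oplus>\<^bsub>?B\<^esub> \<lbrace>v, \<lbrace>w, u\<rbrace>\<^bsub>?B\<^esub>\<rbrace>\<^bsub>?B\<^esub> \<oplus>\<^bsub>?B\<^esub> \<lbrace>w, \<lbrace>u, v\<rbrace>\<^bsub>?B\<^esub>\<rbrace>\<^bsub>?B\<^esub> = \<zero>\<^bsub>?B\<^esub>"
      using x y z b bracket_closed by (simp add: q(3,4,7) bracket_jacobi)
  qed
qed

subsection \<open>Poisson centers of fraction fields\<close>

text \<open>By the quotient rule this is the numerator of {a/s, c} vanishing modulo \<open>P\<close>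
  for all c: the fraction a/s of A/P is Poisson central, expressed inside \<open>A\<close>.\<close>

definition commuting_fraction :: "'a set \<Rightarrow> 'a \<Rightarrow> 'a \<Rightarrow> bool" where
  "commuting_fraction P a s \<longleftrightarrow> (\<forall>c\<in>carrier A. s \<otimes> \<lbrace>a, c\<rbrace> \<ominus> a \<otimes> \<lbrace>s, c\<rbrace> \<in> P)"

context
  assumes nontrivial: "\<one> \<noteq> \<zero>"
    and no_zero_div: "\<And>a b. a \<in> carrier A \<Longrightarrow> b \<in> carrier A \<Longrightarrow> a \<otimes> b = \<zero> \<Longrightarrow> a = \<zero> \<or> b = \<zero>"
begin

lemma cancel_left:
  assumes "c \<in> carrier A" "c \<noteq> \<zero>" "a \<in> carrier A" "b \<in> carrier A" "c \<otimes> a = c \<otimes> b" shows "a = b"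
proof -
  have "c \<otimes> (a \<ominus> b) = c \<otimes> a \<ominus> c \<otimes> b" using assms(1,3,4) by algebra
  also have "\<dots> = \<zero>" using assms by (simp add: a_minus_def r_neg)
  finally have "a \<ominus> b = \<zero>" using no_zero_div[of c "a \<ominus> b"] assms by simp
  then show ?thesis using assms r_right_minus_eq by simp
qed

lemma mem_fraction:
  assumes "a \<in> carrier A" "s \<in> carrier A" "s \<noteq> \<zero>"
  shows "(b, t) \<in> fraction A a s \<longleftrightarrow> b \<in> carrier A \<and> t \<in> carrier A \<and> t \<noteq> \<zero> \<and> a \<otimes> t = b \<otimes> s"
  using assms by (auto simp: fraction_def frac_rel_def)

lemma fraction_eq_iff:
  assumes a: "a \<in> carrier A" "s \<in> carrier A" "s \<noteq> \<zero>" and b: "b \<in> carrier A" "t \<in> carrier A" "t \<noteq> \<zero>"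
  shows "fraction A a s = fraction A b t \<longleftrightarrow> a \<otimes> t = b \<otimes> s"
proof
  assume "fraction A a s = fraction A b t"
  moreover have "(b, t) \<in> fraction A b t" using b by (simp add: mem_fraction)
  ultimately have "(b, t) \<in> fraction A a s" by simp
  then show "a \<otimes> t = b \<otimes> s" using a by (simp add: mem_fraction)
next
  assume eq: "a \<otimes> t = b \<otimes> s"
  have "(c, u) \<in> fraction A a s \<longleftrightarrow> (c, u) \<in> fraction A b t" for c u
  proof (cases "c \<in> carrier A \<and> u \<in> carrier A \<and> u \<noteq> \<zero>")
    case True
    then have c: "c \<in> carrier A" "u \<in> carrier A" by auto
    have "t \<otimes> (a \<otimes> u) = u \<otimes> (a \<otimes> t)" "t \<otimes> (c \<otimes> s) = s \<otimes> (c \<otimes> t)" "u \<otimes> (b \<otimes> s) = s \<otimes> (b \<otimes> u)" using a b c by (simp_all add: m_ac)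
    then have "t \<otimes> (a \<otimes> u) = t \<otimes> (c \<otimes> s) \<longleftrightarrow> s \<otimes> (b \<otimes> u) = s \<otimes> (c \<otimes> t)" using eq by simp
    then have "a \<otimes> u = c \<otimes> s \<longleftrightarrow> b \<otimes> u = c \<otimes> t"
      using cancel_left[of t "a \<otimes> u" "c \<otimes> s"] cancel_left[of s "b \<otimes> u" "c \<otimes> t"] a b c by auto
    then show ?thesis using a b True by (simp add: mem_fraction)
  qed (use a b in \<open>auto simp: mem_fraction\<close>)
  then show "fraction A a s = fraction A b t" by (simp add: set_eq_iff split_paired_All)
qed

lemma carrier_frac: "carrier (poisson_frac A) = {fraction A a s | a s. a \<in> carrier A \<and> s \<in> carrier A \<and> s \<noteq> \<zero>}"
  by (auto simp: poisson_frac_def quotient_def fraction_def)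

lemma scalars_frac: "scalars (poisson_frac A) = range (\<lambda>z. fraction A (sc z) \<one>)"
proof -
  have "z \<odot>\<^bsub>poisson_frac A\<^esub> \<one>\<^bsub>poisson_frac A\<^esub> = fraction A (sc z) \<one>" for z
  proof -
    have "(\<Union>(a, s)\<in>fraction A \<one> \<one>. fraction A (z \<odot> a) s) = fraction A (sc z) \<one>"
    proof (rule UN_const_eq)
      have "(\<one>, \<one>) \<in> fraction A \<one> \<one>" using nontrivial by (simp add: mem_fraction)
      then show "fraction A \<one> \<one> \<noteq> {}" by blast
      fix p assume "p \<in> fraction A \<one> \<one>"
      then obtain a s where p: "p = (a, s)" "a \<in> carrier A" "s \<in> carrier A" "s \<noteq> \<zero>" "s = a"
        using nontrivial by (cases p) (auto simp: mem_fraction)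
      then show "(case p of (a, s) \<Rightarrow> fraction A (z \<odot> a) s) = fraction A (sc z) \<one>"
        using nontrivial by (simp add: fraction_eq_iff smult_sc)
    qed
    then show ?thesis by (simp add: poisson_frac_def)
  qed
  then show ?thesis by (simp add: scalars_def)
qed

text \<open>Bracket the identity a t = b s with c and combine with it. The claim comes out
  multiplied by s^2, which a domain lets one cancel.\<close>

lemma commuting_fraction_cong:
  assumes a: "a \<in> carrier A" "s \<in> carrier A" "s \<noteq> \<zero>" and b: "b \<in> carrier A" "t \<in> carrier A"
    and eq: "a \<otimes> t = b \<otimes> s" and cf: "commuting_fraction {\<zero>} a s"
  shows "commuting_fraction {\<zero>} b t"
  unfolding commuting_fraction_def
proof
  fix c assume c: "c \<in> carrier A"
  define da ds db dt where d: "da = \<lbrace>a, c\<rbrace>" "ds = \<lbrace>s, c\<rbrace>" "db = \<lbrace>b, c\<rbrace>" "dt = \<lbrace>t, c\<rbrace>"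
  have dc: "da \<in> carrier A" "ds \<in> carrier A" "db \<in> carrier A" "dt \<in> carrier A" using a b c by (simp_all add: d bracket_closed)
  have comm: "s \<otimes> da \<ominus> a \<otimes> ds = \<zero>" using cf c by (simp add: commuting_fraction_def d)
  have "\<lbrace>a \<otimes> t, c\<rbrace> = \<lbrace>b \<otimes> s, c\<rbrace>" by (simp add: eq)
  then have leib: "a \<otimes> dt \<oplus> t \<otimes> da = b \<otimes> ds \<oplus> s \<otimes> db" using a b c by (simp add: bracket_mult_left d)
  have "s \<otimes> s \<otimes> (t \<otimes> db \<ominus> b \<otimes> dt) = (s \<otimes> t) \<otimes> ((b \<otimes> ds \<oplus> s \<otimes> db) \<ominus> b \<otimes> ds) \<ominus> (b \<otimes> s) \<otimes> (s \<otimes> dt)"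
    using a b dc by algebra
  also have "\<dots> = (s \<otimes> t) \<otimes> ((a \<otimes> dt \<oplus> t \<otimes> da) \<ominus> b \<otimes> ds) \<ominus> (a \<otimes> t) \<otimes> (s \<otimes> dt)" by (simp only: leib eq)
  also have "\<dots> = t \<otimes> (t \<otimes> (s \<otimes> da) \<ominus> (b \<otimes> s) \<otimes> ds)"
    using a b dc by algebra
  also have "\<dots> = t \<otimes> (t \<otimes> (s \<otimes> da) \<ominus> (a \<otimes> t) \<otimes> ds)" by (simp only: eq)
  also have "\<dots> = t \<otimes> (t \<otimes> (s \<otimes> da \<ominus> a \<otimes> ds))" using a b dc by algebra
  also have "\<dots> = \<zero>" using b by (simp add: comm)
  finally have "s \<otimes> s \<otimes> (t \<otimes> db \<ominus> b \<otimes> dt) = \<zero>" .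
  then have "t \<otimes> db \<ominus> b \<otimes> dt = \<zero>"
    using no_zero_div[of "s \<otimes> s" "t \<otimes> db \<ominus> b \<otimes> dt"] no_zero_div[of s s] a b dc by auto
  then show "t \<otimes> \<lbrace>b, c\<rbrace> \<ominus> b \<otimes> \<lbrace>t, c\<rbrace> \<in> {\<zero>}" by (simp add: d)
qed

definition bracket_num :: "'a \<Rightarrow> 'a \<Rightarrow> 'a \<Rightarrow> 'a \<Rightarrow> 'a" where
  "bracket_num a s b t = (s \<otimes> t \<otimes> \<lbrace>a, b\<rbrace> \<oplus> a \<otimes> b \<otimes> \<lbrace>s, t\<rbrace>) \<ominus> (a \<otimes> t \<otimes> \<lbrace>s, b\<rbrace> \<oplus> s \<otimes> b \<otimes> \<lbrace>a, t\<rbrace>)"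

lemma bracket_frac:
  "\<lbrace>V, W\<rbrace>\<^bsub>poisson_frac A\<^esub> = (\<Union>(a, s)\<in>V. \<Union>(b, t)\<in>W. fraction A (bracket_num a s b t) (s \<otimes> s \<otimes> (t \<otimes> t)))"
  by (simp add: poisson_frac_def bracket_num_def)

lemma bracket_num_in:
  "a \<in> carrier A \<Longrightarrow> s \<in> carrier A \<Longrightarrow> b \<in> carrier A \<Longrightarrow> t \<in> carrier A \<Longrightarrow> bracket_num a s b t \<in> carrier A"
  by (simp add: bracket_num_def bracket_closed)

lemma den_nonzero: "s \<in> carrier A \<Longrightarrow> s \<noteq> \<zero> \<Longrightarrow> t \<in> carrier A \<Longrightarrow> t \<noteq> \<zero> \<Longrightarrow> s \<otimes> s \<otimes> (t \<otimes> t) \<noteq> \<zero>"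
  using no_zero_div by (metis m_closed)

text \<open>Bracketing with b/1 yields the condition. Conversely, the numerator of the bracket with
  b/t is a combination of the expressions for b and for t, both of which vanish.\<close>

lemma mem_center_frac:
  assumes a: "a \<in> carrier A" "s \<in> carrier A" "s \<noteq> \<zero>"
  shows "fraction A a s \<in> poisson_center (poisson_frac A) \<longleftrightarrow> commuting_fraction {\<zero>} a s"
proof
  have zero: "zero (poisson_frac A) = fraction A \<zero> \<one>" by (simp add: poisson_frac_def)
  assume "fraction A a s \<in> poisson_center (poisson_frac A)"
  then have cen: "\<And>W. W \<in> carrier (poisson_frac A) \<Longrightarrow> \<lbrace>fraction A a s, W\<rbrace>\<^bsub>poisson_frac A\<^esub> = fraction A \<zero> \<one>"
    by (simp add: poisson_center_def zero)
  show "commuting_fraction {\<zero>} a s"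
    unfolding commuting_fraction_def
  proof
    fix b assume b: "b \<in> carrier A"
    let ?n = "bracket_num a s b \<one>" and ?d = "s \<otimes> s \<otimes> (\<one> \<otimes> \<one>)"
    have W: "fraction A b \<one> \<in> carrier (poisson_frac A)" using b nontrivial by (auto simp: carrier_frac)
    have in1: "(a, s) \<in> fraction A a s" "(b, \<one>) \<in> fraction A b \<one>" using a b nontrivial by (simp_all add: mem_fraction)
    have nd: "?n \<in> carrier A" "?d \<in> carrier A" "?d \<noteq> \<zero>" using a b bracket_num_in den_nonzero[OF a(2,3)] nontrivial by auto
    have "(?n, ?d) \<in> fraction A ?n ?d" using nd by (simp add: mem_fraction)
    then have "(?n, ?d) \<in> \<lbrace>fraction A a s, fraction A b \<one>\<rbrace>\<^bsub>poisson_frac A\<^esub>"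
      unfolding bracket_frac using in1 by blast
    then have "(?n, ?d) \<in> fraction A \<zero> \<one>" using cen[OF W] by simp
    then have "?n = \<zero>" using nontrivial nd by (auto simp: mem_fraction)
    moreover have one: "\<lbrace>s, \<one>\<rbrace> = \<zero>" "\<lbrace>a, \<one>\<rbrace> = \<zero>" using a bracket_skew[of _ \<one>] bracket_one by simp_all
    have "?n = s \<otimes> \<lbrace>a, b\<rbrace> \<ominus> a \<otimes> \<lbrace>s, b\<rbrace>"
      using a b bracket_closed by (simp add: bracket_num_def one)
    ultimately show "s \<otimes> \<lbrace>a, b\<rbrace> \<ominus> a \<otimes> \<lbrace>s, b\<rbrace> \<in> {\<zero>}" by simp
  qed
next
  assume cf: "commuting_fraction {\<zero>} a s"
  have zero: "zero (poisson_frac A) = fraction A \<zero> \<one>" by (simp add: poisson_frac_def)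
  have "\<lbrace>fraction A a s, W\<rbrace>\<^bsub>poisson_frac A\<^esub> = fraction A \<zero> \<one>" if "W \<in> carrier (poisson_frac A)" for W
  proof -
    have "\<exists>b t. W = fraction A b t \<and> b \<in> carrier A \<and> t \<in> carrier A \<and> t \<noteq> \<zero>" using that by (simp add: carrier_frac)
    then obtain b t where "W = fraction A b t \<and> b \<in> carrier A \<and> t \<in> carrier A \<and> t \<noteq> \<zero>" by (elim exE)
    then have b: "b \<in> carrier A" "t \<in> carrier A" "t \<noteq> \<zero>" "W = fraction A b t" by simp_all
    have ne: "fraction A x y \<noteq> {}" if "x \<in> carrier A" "y \<in> carrier A" "y \<noteq> \<zero>" for x y
      using that mem_fraction[of x y x y] by auto
    have val: "fraction A (bracket_num p u q v) (u \<otimes> u \<otimes> (v \<otimes> v)) = fraction A \<zero> \<one>"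
      if pu: "(p, u) \<in> fraction A a s" and qv: "(q, v) \<in> W" for p u q v
    proof -
      have p: "p \<in> carrier A" "u \<in> carrier A" "u \<noteq> \<zero>" "a \<otimes> u = p \<otimes> s" using pu a by (simp_all add: mem_fraction)
      have q: "q \<in> carrier A" "v \<in> carrier A" "v \<noteq> \<zero>" using qv b by (simp_all add: mem_fraction)
      have cf': "commuting_fraction {\<zero>} p u" by (rule commuting_fraction_cong[OF a p(1,2,4) cf])
      then have z: "u \<otimes> \<lbrace>p, q\<rbrace> \<ominus> p \<otimes> \<lbrace>u, q\<rbrace> = \<zero>" "u \<otimes> \<lbrace>p, v\<rbrace> \<ominus> p \<otimes> \<lbrace>u, v\<rbrace> = \<zero>"
        using q by (simp_all add: commuting_fraction_def)
      have "bracket_num p u q v = v \<otimes> (u \<otimes> \<lbrace>p, q\<rbrace> \<ominus> p \<otimes> \<lbrace>u, q\<rbrace>) \<ominus> q \<otimes> (u \<otimes> \<lbrace>p, v\<rbrace> \<ominus> p \<otimes> \<lbrace>u, v\<rbrace>)"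
        unfolding bracket_num_def
        using p(1,2) q(1,2) bracket_closed[OF p(1) q(1)] bracket_closed[OF p(2) q(1)] bracket_closed[OF p(1) q(2)] bracket_closed[OF p(2) q(2)]
        by algebra
      then have "bracket_num p u q v = \<zero>" unfolding z using q by simp
      then show ?thesis using nontrivial den_nonzero[OF p(2,3) q(2,3)] p q by (simp add: fraction_eq_iff)
    qed
    show ?thesis unfolding bracket_frac
      using ne[OF a] ne[OF b(1-3)] val b(4) by (intro UN_const_eq) (auto intro!: UN_const_eq)
  qed
  then show "fraction A a s \<in> poisson_center (poisson_frac A)"
    using a by (auto simp: poisson_center_def carrier_frac zero)
qed

lemma center_frac_eq_scalars_iff:
  "poisson_center (poisson_frac A) = scalars (poisson_frac A) \<longleftrightarrow>
    (\<forall>a\<in>carrier A. \<forall>s\<in>carrier A. s \<noteq> \<zero> \<longrightarrow> commuting_fraction {\<zero>} a s \<longrightarrow> (\<exists>z. a = sc z \<otimes> s))"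
proof -
  have sc_center: "fraction A (sc z) \<one> \<in> poisson_center (poisson_frac A)" for z
    using nontrivial bracket_sc bracket_one by (subst mem_center_frac) (auto simp: commuting_fraction_def a_minus_def)
  have frac_sc: "fraction A a s = fraction A (sc z) \<one> \<longleftrightarrow> a = sc z \<otimes> s"
    if "a \<in> carrier A" "s \<in> carrier A" "s \<noteq> \<zero>" for a s z
    using that nontrivial by (simp add: fraction_eq_iff)
  show ?thesis
  proof
    assume eq: "poisson_center (poisson_frac A) = scalars (poisson_frac A)"
    show "\<forall>a\<in>carrier A. \<forall>s\<in>carrier A. s \<noteq> \<zero> \<longrightarrow> commuting_fraction {\<zero>} a s \<longrightarrow> (\<exists>z. a = sc z \<otimes> s)"
    proof (intro ballI impI)
      fix a s assume a: "a \<in> carrier A" "s \<in> carrier A" "s \<noteq> \<zero>" and "commuting_fraction {\<zero>} a s"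
      then have "fraction A a s \<in> scalars (poisson_frac A)" using mem_center_frac[OF a] eq by simp
      then obtain z where "fraction A a s = fraction A (sc z) \<one>" unfolding scalars_frac by blast
      then show "\<exists>z. a = sc z \<otimes> s" using frac_sc[OF a] by blast
    qed
  next
    assume all: "\<forall>a\<in>carrier A. \<forall>s\<in>carrier A. s \<noteq> \<zero> \<longrightarrow> commuting_fraction {\<zero>} a s \<longrightarrow> (\<exists>z. a = sc z \<otimes> s)"
    have "V \<in> scalars (poisson_frac A)" if V: "V \<in> poisson_center (poisson_frac A)" for V
    proof -
      have "V \<in> carrier (poisson_frac A)" using V by (simp add: poisson_center_def)
      then obtain a s where a: "a \<in> carrier A" "s \<in> carrier A" "s \<noteq> \<zero>" "V = fraction A a s" by (auto simp: carrier_frac)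
      then have "commuting_fraction {\<zero>} a s" using mem_center_frac[OF a(1-3)] V by simp
      then obtain z where "a = sc z \<otimes> s" using all a by blast
      then have "V = fraction A (sc z) \<one>" using frac_sc[OF a(1-3)] a(4) by simp
      then show ?thesis unfolding scalars_frac by blast
    qed
    then show "poisson_center (poisson_frac A) = scalars (poisson_frac A)"
      using sc_center unfolding scalars_frac by blast
  qed
qed

end

text \<open>Rationality is pulled back to \<open>A\<close>; all later arguments use this form and no
  fraction field.\<close>

theorem poisson_rational_iff:
  "poisson_rational A P \<longleftrightarrow> poisson_prime A P \<and>
    (\<forall>a\<in>carrier A. \<forall>s\<in>carrier A. s \<notin> P \<longrightarrow> commuting_fraction P a s \<longrightarrow> (\<exists>z. a \<ominus> sc z \<otimes> s \<in> P))"
proof (cases "poisson_prime A P")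
  case True
  then have p: "primeideal P A" and I: "poisson_ideal A P" and PI: "ideal P A"
    by (auto simp: poisson_prime_def poisson_ideal_def)
  let ?B = "poisson_quot A P"
  interpret B: complex_poisson_algebra ?B by (rule quot_poisson_algebra[OF I])
  note q = quot_ring_simps[OF PI] quot_bracket[OF I]
  have eq0: "P +> x = \<zero>\<^bsub>?B\<^esub> \<longleftrightarrow> x \<in> P" if "x \<in> carrier A" for x
    using that coset_eq_iff[OF PI that zero_closed] by (simp add: q(3) a_minus_def)
  have one: "\<one>\<^bsub>?B\<^esub> \<noteq> \<zero>\<^bsub>?B\<^esub>"
    using eq0[OF one_closed] ideal.one_imp_carrier[OF PI] primeideal.I_notcarr[OF p] by (auto simp: q(2))
  have dom: "a = \<zero>\<^bsub>?B\<^esub> \<or> b = \<zero>\<^bsub>?B\<^esub>" if ab: "a \<in> carrier ?B" "b \<in> carrier ?B" "a \<otimes>\<^bsub>?B\<^esub> b = \<zero>\<^bsub>?B\<^esub>" for a b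
  proof -
    obtain x where x: "a = P +> x" "x \<in> carrier A" by (rule imageE[OF ab(1)[unfolded q(1)]])
    obtain y where y: "b = P +> y" "y \<in> carrier A" by (rule imageE[OF ab(2)[unfolded q(1)]])
    have "x \<otimes> y \<in> P" using ab(3) eq0[of "x \<otimes> y"] x y by (simp add: q(5))
    then have "x \<in> P \<or> y \<in> P" by (rule primeideal.I_prime[OF p x(2) y(2)])
    then show ?thesis using eq0[OF x(2)] eq0[OF y(2)] x(1) y(1) by simp
  qed
  have minus: "(P +> x) \<ominus>\<^bsub>?B\<^esub> (P +> y) = P +> (x \<ominus> y)" if "x \<in> carrier A" "y \<in> carrier A" for x y
  proof -
    have "(P +> \<ominus> y) \<oplus>\<^bsub>?B\<^esub> (P +> y) = \<zero>\<^bsub>?B\<^esub>" using that by (simp add: q(3,4) l_neg)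
    then have "\<ominus>\<^bsub>?B\<^esub> (P +> y) = P +> \<ominus> y" using that by (intro B.minus_equality) (auto simp: q(1))
    then show ?thesis using that by (simp add: a_minus_def q(4))
  qed
  have bsc: "B.sc z = P +> sc z" for z by (simp add: B.sc_def sc_def q(2,6))
  have cf: "B.commuting_fraction {\<zero>\<^bsub>?B\<^esub>} (P +> a) (P +> s) \<longleftrightarrow> commuting_fraction P a s"
    if "a \<in> carrier A" "s \<in> carrier A" for a s
    unfolding B.commuting_fraction_def commuting_fraction_def q(1)
    using that bracket_closed by (simp add: q(5,7) minus eq0)
  have sceq: "P +> a = B.sc z \<otimes>\<^bsub>?B\<^esub> (P +> s) \<longleftrightarrow> a \<ominus> sc z \<otimes> s \<in> P" if "a \<in> carrier A" "s \<in> carrier A" for a s z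
    using that by (simp add: bsc q(5) coset_eq_iff[OF PI])
  have "poisson_center (poisson_frac ?B) = scalars (poisson_frac ?B) \<longleftrightarrow>
    (\<forall>a\<in>carrier A. \<forall>s\<in>carrier A. s \<notin> P \<longrightarrow> commuting_fraction P a s \<longrightarrow> (\<exists>z. a \<ominus> sc z \<otimes> s \<in> P))"
  proof -
    have "poisson_center (poisson_frac ?B) = scalars (poisson_frac ?B) \<longleftrightarrow>
      (\<forall>a\<in>carrier ?B. \<forall>s\<in>carrier ?B. s \<noteq> \<zero>\<^bsub>?B\<^esub> \<longrightarrow> B.commuting_fraction {\<zero>\<^bsub>?B\<^esub>} a s \<longrightarrow>
        (\<exists>z. a = B.sc z \<otimes>\<^bsub>?B\<^esub> s))"
      by (rule B.center_frac_eq_scalars_iff[OF one]) (rule dom)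
    then show ?thesis unfolding q(1) by (simp add: eq0 cf sceq)
  qed
  then show ?thesis using True by (simp add: poisson_rational_def)
qed (simp add: poisson_rational_def)

text \<open>
  For a central fraction \<open>z = u/w\<close> of \<open>A/P\<close>, the Poisson ideal \<open>A/P \<inter> z A/P\<close>, pulled back to \<open>A\<close>.
\<close>

lemma multiples_poisson_ideal:
  assumes P: "poisson_prime A P" and u: "u \<in> carrier A" and w: "w \<in> carrier A" "w \<notin> P"
    and cf: "commuting_fraction P u w"
  shows "poisson_ideal A {x \<in> carrier A. \<exists>b\<in>carrier A. x \<otimes> w \<ominus> b \<otimes> u \<in> P}" (is "poisson_ideal A ?W")
  unfolding poisson_ideal_def
proof (intro conjI ballI)
  have p: "primeideal P A" and PI: "ideal P A" and br: "\<And>x c. x \<in> P \<Longrightarrow> c \<in> carrier A \<Longrightarrow> \<lbrace>x, c\<rbrace> \<in> P"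
    using P by (auto simp: poisson_prime_def poisson_ideal_def)
  have mul: "c \<otimes> x \<in> ?W" if x: "x \<in> ?W" and c: "c \<in> carrier A" for x c
  proof -
    obtain b where b: "b \<in> carrier A" "x \<otimes> w \<ominus> b \<otimes> u \<in> P" "x \<in> carrier A" using x by blast
    have "c \<otimes> (x \<otimes> w \<ominus> b \<otimes> u) \<in> P" by (rule ideal_closed(5)[OF PI b(2) c])
    moreover have "c \<otimes> (x \<otimes> w \<ominus> b \<otimes> u) = (c \<otimes> x) \<otimes> w \<ominus> (c \<otimes> b) \<otimes> u" using b c u w by algebra
    ultimately show ?thesis using b c by (auto intro!: bexI[of _ "c \<otimes> b"])
  qed
  show "ideal ?W A"
  proof (rule idealI[OF ring_axioms])
    show "subgroup ?W (add_monoid A)"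
    proof (rule add.subgroupI)
      show "?W \<subseteq> carrier A" by blast
      have "\<zero> \<in> ?W" using u w ideal_closed(1)[OF PI] by (auto intro!: bexI[of _ \<zero>] simp: a_minus_def)
      then show "?W \<noteq> {}" by blast
      show "\<ominus> x \<in> ?W" if x: "x \<in> ?W" for x
      proof -
        have xc: "x \<in> carrier A" using x by blast
        then have "\<ominus> x = (\<ominus> \<one>) \<otimes> x" by (simp add: l_minus)
        then show ?thesis using mul[OF x, of "\<ominus> \<one>"] by simp
      qed
      fix x y assume "x \<in> ?W" "y \<in> ?W"
      then obtain b c where b: "b \<in> carrier A" "x \<otimes> w \<ominus> b \<otimes> u \<in> P" "x \<in> carrier A"
        and c: "c \<in> carrier A" "y \<otimes> w \<ominus> c \<otimes> u \<in> P" "y \<in> carrier A" by blast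
      have "(x \<otimes> w \<ominus> b \<otimes> u) \<oplus> (y \<otimes> w \<ominus> c \<otimes> u) \<in> P" by (rule ideal_closed(2)[OF PI b(2) c(2)])
      moreover have "(x \<otimes> w \<ominus> b \<otimes> u) \<oplus> (y \<otimes> w \<ominus> c \<otimes> u) = (x \<oplus> y) \<otimes> w \<ominus> (b \<oplus> c) \<otimes> u"
        using b c u w by algebra
      ultimately show "x \<oplus> y \<in> ?W" using b c by (auto intro!: bexI[of _ "b \<oplus> c"])
    qed
    show "c \<otimes> x \<in> ?W" if "x \<in> ?W" "c \<in> carrier A" for x c by (rule mul[OF that])
    show "x \<otimes> c \<in> ?W" if "x \<in> ?W" "c \<in> carrier A" for x c
    proof -
      have "x \<in> carrier A" using that by blast
      then have "x \<otimes> c = c \<otimes> x" using that by (simp add: m_comm)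
      then show ?thesis using mul[OF that] by simp
    qed
  qed
  fix x c assume x: "x \<in> ?W" and c: "c \<in> carrier A"
  obtain b where b: "b \<in> carrier A" "x \<otimes> w \<ominus> b \<otimes> u \<in> P" "x \<in> carrier A" using x by blast
  define dx dw db du where d: "dx = \<lbrace>x, c\<rbrace>" "dw = \<lbrace>w, c\<rbrace>" "db = \<lbrace>b, c\<rbrace>" "du = \<lbrace>u, c\<rbrace>"
  have dc: "dx \<in> carrier A" "dw \<in> carrier A" "db \<in> carrier A" "du \<in> carrier A"
    using b c u w by (simp_all add: d bracket_closed)
  have comm: "w \<otimes> du \<ominus> u \<otimes> dw \<in> P" using cf c by (simp add: commuting_fraction_def d)
  have "\<lbrace>x \<otimes> w \<ominus> b \<otimes> u, c\<rbrace> \<in> P" by (rule br[OF b(2) c])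
  also have "\<lbrace>x \<otimes> w \<ominus> b \<otimes> u, c\<rbrace> = (x \<otimes> dw \<oplus> w \<otimes> dx) \<ominus> (b \<otimes> du \<oplus> u \<otimes> db)"
    using b c u w by (simp add: a_minus_def bracket_add_left bracket_minus bracket_mult_left d)
  finally have leib: "(x \<otimes> dw \<oplus> w \<otimes> dx) \<ominus> (b \<otimes> du \<oplus> u \<otimes> db) \<in> P" .
  \<comment> \<open>Bracketing x w = b u with c gives four terms modulo \<open>P\<close>. As u/w is
    central, those with the brackets of w and u cancel, so {b, c} is the multiplier that puts {x, c}
    into the set.\<close>
  have "w \<otimes> (x \<otimes> dw \<ominus> b \<otimes> du) = dw \<otimes> (x \<otimes> w \<ominus> b \<otimes> u) \<ominus> b \<otimes> (w \<otimes> du \<ominus> u \<otimes> dw)"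
    using b u w dc by algebra
  also have "\<dots> \<in> P" by (rule ideal_closed(4)[OF PI ideal_closed(5)[OF PI b(2) dc(2)] ideal_closed(5)[OF PI comm b(1)]])
  finally have "x \<otimes> dw \<ominus> b \<otimes> du \<in> P"
    using primeideal.I_prime[OF p w(1), of "x \<otimes> dw \<ominus> b \<otimes> du"] w(2) b u dc by auto
  with leib have "((x \<otimes> dw \<oplus> w \<otimes> dx) \<ominus> (b \<otimes> du \<oplus> u \<otimes> db)) \<ominus> (x \<otimes> dw \<ominus> b \<otimes> du) \<in> P"
    by (rule ideal_closed(4)[OF PI])
  also have "((x \<otimes> dw \<oplus> w \<otimes> dx) \<ominus> (b \<otimes> du \<oplus> u \<otimes> db)) \<ominus> (x \<otimes> dw \<ominus> b \<otimes> du) = dx \<otimes> w \<ominus> db \<otimes> u"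
    using b u w dc by algebra
  finally show "\<lbrace>x, c\<rbrace> \<in> ?W" using dc unfolding d by blast
qed

end

context complex_affine_poisson_algebra begin

text \<open>Two Poisson ideals attached to a central fraction are compared with m: that of its
  denominators, which shows that the fraction has a value at m, and that of its multiples after this
  value is subtracted.\<close>

theorem primitive_imp_rational:
  assumes "poisson_primitive A P" shows "poisson_rational A P"
proof -
  obtain m where m: "m \<in> maxspec A" and Pm: "P = poisson_core A m" using assms by (auto simp: poisson_primitive_def)
  have pm: "primeideal m A" by (rule maxspec_prime[OF m])
  have mI: "ideal m A" by (rule primeideal.axioms(1)[OF pm])
  note core = poisson_core_greatest[OF mI, folded Pm]
  have P: "poisson_prime A P" using poisson_core_prime[OF pm] Pm by simp
  have p: "primeideal P A" and PI: "ideal P A" using P by (auto simp: poisson_prime_def poisson_ideal_def)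
  have "\<exists>z. a \<ominus> sc z \<otimes> s \<in> P" if a: "a \<in> carrier A" and s: "s \<in> carrier A" "s \<notin> P" and cf: "commuting_fraction P a s" for a s
  proof (cases "a \<in> P")
    case True
    then show ?thesis using a s by (intro exI[of _ 0]) (simp add: sc_0 a_minus_def)
  next
    case False
    have cf': "commuting_fraction P s a"
      unfolding commuting_fraction_def
    proof
      fix c assume c: "c \<in> carrier A"
      have "s \<otimes> \<lbrace>a, c\<rbrace> \<ominus> a \<otimes> \<lbrace>s, c\<rbrace> \<in> P" using cf c by (simp add: commuting_fraction_def)
      then have "\<ominus> (s \<otimes> \<lbrace>a, c\<rbrace> \<ominus> a \<otimes> \<lbrace>s, c\<rbrace>) \<in> P" by (rule ideal_closed(3)[OF PI])
      also have "\<ominus> (s \<otimes> \<lbrace>a, c\<rbrace> \<ominus> a \<otimes> \<lbrace>s, c\<rbrace>) = a \<otimes> \<lbrace>s, c\<rbrace> \<ominus> s \<otimes> \<lbrace>a, c\<rbrace>"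
        using a s(1) bracket_closed[OF a c] bracket_closed[OF s(1) c] by algebra
      finally show "a \<otimes> \<lbrace>s, c\<rbrace> \<ominus> s \<otimes> \<lbrace>a, c\<rbrace> \<in> P" .
    qed
    \<comment> \<open>The denominators of a/s in A/P. This Poisson ideal contains s, hence is not
      inside \<open>P\<close> and so not inside m: a/s = a'/b with b outside m.\<close>
    let ?J = "{x \<in> carrier A. \<exists>b\<in>carrier A. x \<otimes> a \<ominus> b \<otimes> s \<in> P}"
    have "s \<in> ?J"
    proof -
      have "s \<otimes> a \<ominus> a \<otimes> s = \<zero>" using a s(1) by algebra
      then have "s \<otimes> a \<ominus> a \<otimes> s \<in> P" using ideal_closed(1)[OF PI] by (simp only:)
      then show ?thesis using a s by blast
    qed
    then have "\<not> ?J \<subseteq> P" using s by blast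
    then have "\<not> ?J \<subseteq> m" using core(3)[OF multiples_poisson_ideal[OF P s(1) a False cf']] by blast
    then obtain b a' where b: "b \<in> carrier A" "b \<notin> m" and a': "a' \<in> carrier A" "b \<otimes> a \<ominus> a' \<otimes> s \<in> P" by blast
    \<comment> \<open>The value of a/s at m. Now y/s = k/b is a central fraction whose numerator k
      lies in m.\<close>
    define z where "z = eval_at A m a' / eval_at A m b"
    define y where "y = a \<ominus> sc z \<otimes> s"
    define k where "k = a' \<ominus> sc z \<otimes> b"
    have yc: "y \<in> carrier A" "k \<in> carrier A" using a s a' b by (simp_all add: y_def k_def)
    have "eval_at A m b \<noteq> 0" using eval_at_simps(8)[OF m b(1)] b(2) by simp
    then have "eval_at A m k = 0" using a' b by (simp add: k_def z_def eval_at_simps[OF m])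
    then have km: "k \<in> m" using eval_at_simps(8)[OF m yc(2)] by simp
    have yk: "b \<otimes> y \<ominus> k \<otimes> s \<in> P"
    proof -
      have "b \<otimes> y \<ominus> k \<otimes> s = b \<otimes> a \<ominus> a' \<otimes> s" unfolding y_def k_def using a s(1) a'(1) b(1) sc_in[of z] by algebra
      then show ?thesis using a' by simp
    qed
    have cfy: "commuting_fraction P y s"
      unfolding commuting_fraction_def
    proof
      fix c assume c: "c \<in> carrier A"
      have dy: "\<lbrace>y, c\<rbrace> = \<lbrace>a, c\<rbrace> \<ominus> sc z \<otimes> \<lbrace>s, c\<rbrace>"
        using a s c bracket_closed by (simp add: y_def a_minus_def bracket_add_left bracket_minus bracket_mult_left bracket_sc)
      have "s \<otimes> \<lbrace>y, c\<rbrace> \<ominus> y \<otimes> \<lbrace>s, c\<rbrace> = s \<otimes> \<lbrace>a, c\<rbrace> \<ominus> a \<otimes> \<lbrace>s, c\<rbrace>"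
        unfolding dy unfolding y_def
        using a s(1) bracket_closed[OF a c] bracket_closed[OF s(1) c] sc_in[of z] by algebra
      then show "s \<otimes> \<lbrace>y, c\<rbrace> \<ominus> y \<otimes> \<lbrace>s, c\<rbrace> \<in> P" using cf c by (simp add: commuting_fraction_def)
    qed
    \<comment> \<open>The multiples of k/b that lie in A/P. As k is in m and b is not, they lie in
      m, hence in its core \<open>P\<close>; since k itself is such a multiple, k and then y are in
      \<open>P\<close>.\<close>
    let ?I = "{x \<in> carrier A. \<exists>b\<in>carrier A. x \<otimes> s \<ominus> b \<otimes> y \<in> P}"
    have "?I \<subseteq> m"
    proof
      fix x assume "x \<in> ?I"
      then obtain c where c: "c \<in> carrier A" "x \<otimes> s \<ominus> c \<otimes> y \<in> P" "x \<in> carrier A" by blast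
      have "s \<otimes> (x \<otimes> b \<ominus> c \<otimes> k) = b \<otimes> (x \<otimes> s \<ominus> c \<otimes> y) \<oplus> c \<otimes> (b \<otimes> y \<ominus> k \<otimes> s)"
        using c b(1) s(1) yc by algebra
      also have "\<dots> \<in> P" using c b yk by (intro ideal_closed(2,5)[OF PI])
      finally have "x \<otimes> b \<ominus> c \<otimes> k \<in> P"
        using primeideal.I_prime[OF p s(1), of "x \<otimes> b \<ominus> c \<otimes> k"] s(2) c b yc by auto
      then have "(x \<otimes> b \<ominus> c \<otimes> k) \<oplus> c \<otimes> k \<in> m" using core(2) km c by (intro ideal_closed(2,5)[OF mI]) auto
      also have "(x \<otimes> b \<ominus> c \<otimes> k) \<oplus> c \<otimes> k = x \<otimes> b" using c b(1) yc by algebra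
      finally show "x \<in> m" using primeideal.I_prime[OF pm c(3) b(1)] b(2) by blast
    qed
    then have IP: "?I \<subseteq> P" by (rule core(3)[OF multiples_poisson_ideal[OF P yc(1) s cfy]])
    have "k \<otimes> s \<ominus> b \<otimes> y \<in> P"
    proof -
      have "k \<otimes> s \<ominus> b \<otimes> y = \<ominus> (b \<otimes> y \<ominus> k \<otimes> s)" using yc b(1) s(1) by algebra
      then show ?thesis using ideal_closed(3)[OF PI yk] by simp
    qed
    then have "k \<in> P" using IP yc b by blast
    then have "(b \<otimes> y \<ominus> k \<otimes> s) \<oplus> k \<otimes> s \<in> P" using yk s by (intro ideal_closed(2,6)[OF PI])
    also have "(b \<otimes> y \<ominus> k \<otimes> s) \<oplus> k \<otimes> s = b \<otimes> y" using yc b(1) s(1) by algebra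
    finally have "b \<otimes> y \<in> P" .
    then have "y \<in> P" using primeideal.I_prime[OF p b(1) yc(1)] b(2) core(2) by blast
    then show ?thesis unfolding y_def by blast
  qed
  then show ?thesis unfolding poisson_rational_iff using P by blast
qed

end

subsection \<open>Linear combinations\<close>

context complex_poisson_algebra begin

definition lcomb :: "nat set \<Rightarrow> (nat \<Rightarrow> complex) \<Rightarrow> (nat \<Rightarrow> 'a) \<Rightarrow> 'a" where
  "lcomb N c a = (\<Oplus>i\<in>N. sc (c i) \<otimes> a i)"

lemma lcomb_empty [simp]: "lcomb {} c a = \<zero>" by (simp add: lcomb_def)

lemma lcomb_in: "a \<in> N \<rightarrow> carrier A \<Longrightarrow> lcomb N c a \<in> carrier A"
  unfolding lcomb_def by (intro finsum_closed) auto

lemma lcomb_insert: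
  "finite N \<Longrightarrow> n \<notin> N \<Longrightarrow> a \<in> insert n N \<rightarrow> carrier A \<Longrightarrow> lcomb (insert n N) c a = sc (c n) \<otimes> a n \<oplus> lcomb N c a"
  unfolding lcomb_def by (intro finsum_insert) auto

lemma lcomb_cong:
  "(\<And>i. i \<in> N \<Longrightarrow> c i = d i) \<Longrightarrow> (\<And>i. i \<in> N \<Longrightarrow> a i = b i) \<Longrightarrow> b \<in> N \<rightarrow> carrier A \<Longrightarrow> lcomb N c a = lcomb N d b"
  unfolding lcomb_def by (intro finsum_cong') auto

lemma lcomb_add:
  assumes "finite N" "a \<in> N \<rightarrow> carrier A"
  shows "lcomb N (\<lambda>i. c i + d i) a = lcomb N c a \<oplus> lcomb N d a"
  using assms
proof (induction N)
  case (insert n N)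
  have i: "lcomb N c a \<in> carrier A" "lcomb N d a \<in> carrier A" "a n \<in> carrier A" "sc (c n) \<in> carrier A" "sc (d n) \<in> carrier A"
    using insert.prems by (auto intro!: lcomb_in)
  have "(sc (c n) \<oplus> sc (d n)) \<otimes> a n \<oplus> (lcomb N c a \<oplus> lcomb N d a) = (sc (c n) \<otimes> a n \<oplus> lcomb N c a) \<oplus> (sc (d n) \<otimes> a n \<oplus> lcomb N d a)"
    using i by (simp add: l_distr a_ac)
  then show ?case using insert by (simp add: lcomb_insert sc_add)
qed simp

lemma lcomb_scale:
  assumes "finite N" "a \<in> N \<rightarrow> carrier A"
  shows "lcomb N (\<lambda>i. z * c i) a = sc z \<otimes> lcomb N c a"
  using assms
proof (induction N)
  case (insert n N)
  have i: "lcomb N c a \<in> carrier A" "a n \<in> carrier A"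
    using insert.prems by (auto intro!: lcomb_in)
  then show ?case using insert by (simp add: lcomb_insert sc_mult r_distr m_assoc)
qed simp

lemma lcomb_mult:
  assumes "finite N" "a \<in> N \<rightarrow> carrier A" "x \<in> carrier A"
  shows "x \<otimes> lcomb N c a = lcomb N c (\<lambda>i. x \<otimes> a i)"
  using assms
proof (induction N)
  case (insert n N)
  have i: "lcomb N c a \<in> carrier A" "a n \<in> carrier A" "(\<lambda>i. x \<otimes> a i) \<in> insert n N \<rightarrow> carrier A"
    using insert.prems by (auto intro!: lcomb_in)
  have "x \<otimes> (sc (c n) \<otimes> a n) = sc (c n) \<otimes> (x \<otimes> a n)" using i insert.prems by (simp add: m_lcomm)
  then show ?case using insert i by (simp add: lcomb_insert r_distr)
qed simp

lemma lcomb_bracket: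
  assumes "finite N" "a \<in> N \<rightarrow> carrier A" "b \<in> carrier A"
  shows "\<lbrace>lcomb N c a, b\<rbrace> = lcomb N c (\<lambda>i. \<lbrace>a i, b\<rbrace>)"
  using assms
proof (induction N)
  case (insert n N)
  have i: "lcomb N c a \<in> carrier A" "a n \<in> carrier A" "(\<lambda>i. \<lbrace>a i, b\<rbrace>) \<in> insert n N \<rightarrow> carrier A"
    using insert.prems by (auto intro!: lcomb_in simp: Pi_iff bracket_closed)
  have "\<lbrace>sc (c n) \<otimes> a n, b\<rbrace> = sc (c n) \<otimes> \<lbrace>a n, b\<rbrace>"
    using i insert.prems by (simp add: bracket_mult_left bracket_sc bracket_closed)
  then show ?case using insert i by (simp add: lcomb_insert bracket_add_left)
qed (simp add: bracket_zero)

lemma lcomb_diff: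
  assumes "finite N" "a \<in> N \<rightarrow> carrier A" "b \<in> N \<rightarrow> carrier A"
  shows "lcomb N c a \<ominus> lcomb N c b = lcomb N c (\<lambda>i. a i \<ominus> b i)"
  using assms
proof (induction N)
  case (insert n N)
  have i: "lcomb N c a \<in> carrier A" "lcomb N c b \<in> carrier A" "a n \<in> carrier A" "b n \<in> carrier A" "(\<lambda>i. a i \<ominus> b i) \<in> insert n N \<rightarrow> carrier A"
    using insert.prems by (auto intro!: lcomb_in)
  have alg: "\<And>s x y u v. s \<in> carrier A \<Longrightarrow> x \<in> carrier A \<Longrightarrow> y \<in> carrier A \<Longrightarrow> u \<in> carrier A \<Longrightarrow> v \<in> carrier A \<Longrightarrow>
      (s \<otimes> x \<oplus> u) \<ominus> (s \<otimes> y \<oplus> v) = s \<otimes> (x \<ominus> y) \<oplus> (u \<ominus> v)" by algebra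
  show ?case using insert i alg[of "sc (c n)" "a n" "b n" "lcomb N c a" "lcomb N c b"] by (simp add: lcomb_insert)
qed (simp add: a_minus_def)

lemma lcomb_ideal:
  assumes "ideal P A" "finite N" "\<And>i. i \<in> N \<Longrightarrow> a i \<in> P"
  shows "lcomb N c a \<in> P"
  using assms(2,3)
proof (induction N)
  case empty then show ?case using ideal_closed(1)[OF assms(1)] by simp
next
  case (insert n N)
  have "a \<in> insert n N \<rightarrow> carrier A" using insert.prems ideal_subset[OF assms(1)] by blast
  then show ?case using insert ideal_closed(2,5)[OF assms(1)] by (simp add: lcomb_insert)
qed

lemma lcomb_const:
  assumes "finite N" "x \<in> carrier A"
  shows "lcomb N c (\<lambda>i. sc (z i) \<otimes> x) = sc (\<Sum>i\<in>N. c i * z i) \<otimes> x"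
  using assms by (induction N) (simp_all add: sc_0 lcomb_insert sc_add sc_mult l_distr m_assoc)

lemma ideal_diff_mem_iff:
  assumes "ideal P A" "x \<in> carrier A" "y \<in> carrier A" "x \<ominus> y \<in> P" shows "x \<in> P \<longleftrightarrow> y \<in> P"
proof
  assume "x \<in> P"
  then have "x \<ominus> (x \<ominus> y) \<in> P" using assms(4) by (rule ideal_closed(4)[OF assms(1)])
  also have "x \<ominus> (x \<ominus> y) = y" using assms(2,3) by algebra
  finally show "y \<in> P" .
next
  assume "y \<in> P"
  with assms(4) have "(x \<ominus> y) \<oplus> y \<in> P" by (rule ideal_closed(2)[OF assms(1)])
  also have "(x \<ominus> y) \<oplus> y = x" using assms(2,3) by algebra
  finally show "x \<in> P" .
qed

lemma prime_sc: assumes p: "primeideal P A" and x: "x \<in> carrier A" "sc c \<otimes> x \<in> P" "c \<noteq> 0" shows "x \<in> P"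
  by (rule ideal_sc_cancel[OF primeideal.axioms(1)[OF p] x(1,3,2)])

end

subsection \<open>Families of Poisson primes containing a rational one\<close>

text \<open>
  \<open>evt\<close> is the filter on \<open>E\<close> generated by the complements of the sets
  \<open>{g. a \<in> T g}\<close> with \<open>a \<notin> P\<close>; it plays the role of the generic point of \<open>E\<close>.
\<close>

locale prime_family = complex_poisson_algebra +
  fixes P :: "'a set" and E :: "'g set" and T :: "'g \<Rightarrow> 'a set"
  assumes rat: "poisson_rational A P"
    and T: "\<And>g. g \<in> E \<Longrightarrow> poisson_prime A (T g)" "\<And>g. g \<in> E \<Longrightarrow> P \<subseteq> T g"
begin

definition evt :: "('g \<Rightarrow> bool) \<Rightarrow> bool" where
  "evt S \<longleftrightarrow> (\<exists>a\<in>carrier A - P. \<forall>g\<in>E. a \<notin> T g \<longrightarrow> S g)"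

lemma P: "poisson_prime A P" "primeideal P A" "ideal P A" "\<And>x c. x \<in> P \<Longrightarrow> c \<in> carrier A \<Longrightarrow> \<lbrace>x, c\<rbrace> \<in> P"
  using rat by (auto simp: poisson_rational_def poisson_prime_def poisson_ideal_def)

lemma Tp: "g \<in> E \<Longrightarrow> primeideal (T g) A" "g \<in> E \<Longrightarrow> ideal (T g) A" "g \<in> E \<Longrightarrow> x \<in> T g \<Longrightarrow> c \<in> carrier A \<Longrightarrow> \<lbrace>x, c\<rbrace> \<in> T g"
  using T by (auto simp: poisson_prime_def poisson_ideal_def)

lemma one_notin: "primeideal Q A \<Longrightarrow> \<one> \<notin> Q"
  using ideal.one_imp_carrier[of Q A] primeideal.I_notcarr[of Q A] primeideal.axioms(1)[of Q A] by auto

lemma evt_all: "(\<And>g. g \<in> E \<Longrightarrow> S g) \<Longrightarrow> evt S"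
  unfolding evt_def using one_notin[OF P(2)] by blast

lemma evt_mono: "evt S \<Longrightarrow> (\<And>g. g \<in> E \<Longrightarrow> S g \<Longrightarrow> S' g) \<Longrightarrow> evt S'"
  unfolding evt_def by blast

lemma evt_conj: assumes "evt S" "evt S'" shows "evt (\<lambda>g. S g \<and> S' g)"
proof -
  obtain a b where ab: "a \<in> carrier A" "a \<notin> P" "b \<in> carrier A" "b \<notin> P"
    "\<And>g. g \<in> E \<Longrightarrow> a \<notin> T g \<Longrightarrow> S g" "\<And>g. g \<in> E \<Longrightarrow> b \<notin> T g \<Longrightarrow> S' g" using assms unfolding evt_def by blast
  have "a \<otimes> b \<notin> P" using primeideal.I_prime[OF P(2) ab(1,3)] ab by blast
  moreover have "S g \<and> S' g" if "g \<in> E" "a \<otimes> b \<notin> T g" for g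
    using that ideal_closed(5,6)[OF Tp(2)[OF that(1)]] ab by blast
  ultimately show ?thesis unfolding evt_def using ab by (intro bexI[of _ "a \<otimes> b"]) auto
qed

lemma evt_notin: "a \<in> carrier A \<Longrightarrow> a \<notin> P \<Longrightarrow> evt (\<lambda>g. a \<notin> T g)"
  unfolding evt_def by blast

text \<open>The coefficient vectors that send \<open>w\<close> into \<open>P\<close> form a linear
  subspace, proper because some \<open>w i\<close> is outside \<open>P\<close>, so one nonzero
  linear form vanishes on it. The induction finds it: either w k is a fixed combination of the
  others modulo \<open>P\<close> and is eliminated, or its coefficient has to vanish.\<close>

lemma evt_dependent:
  assumes "finite N"
  shows "w \<in> N \<rightarrow> carrier A \<Longrightarrow> (\<exists>i\<in>N. w i \<notin> P) \<Longrightarrow> evt (\<lambda>g. lcomb N (c g) w \<in> P) \<Longrightarrow>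
    \<exists>l. (\<exists>i\<in>N. l i \<noteq> 0) \<and> evt (\<lambda>g. (\<Sum>i\<in>N. l i * c g i) = 0)"
  using assms
proof (induction N arbitrary: c)
  case (insert k N)
  have wc: "w k \<in> carrier A" "w \<in> N \<rightarrow> carrier A" using insert.prems by auto
  have lc: "lcomb N d w \<in> carrier A" for d by (rule lcomb_in[OF wc(2)])
  show ?case
  proof (cases "\<exists>m. w k \<ominus> lcomb N m w \<in> P")
    case True
    then obtain m where m: "w k \<ominus> lcomb N m w \<in> P" by blast
    have "\<exists>i\<in>N. w i \<notin> P"
    proof (rule ccontr)
      assume no: "\<not> (\<exists>i\<in>N. w i \<notin> P)"
      then have "lcomb N m w \<in> P" using lcomb_ideal[OF P(3) insert.hyps(1)] by blast
      then have "w k \<in> P" using ideal_diff_mem_iff[OF P(3) wc(1) lc m] by simp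
      then show False using no insert.prems(2) by blast
    qed
    moreover define c' where "c' = (\<lambda>g i. c g i + c g k * m i)"
    have "evt (\<lambda>g. lcomb N (c' g) w \<in> P)"
    proof (rule evt_mono[OF insert.prems(3)])
      fix g assume in1: "lcomb (insert k N) (c g) w \<in> P"
      have eq: "lcomb N (c' g) w = lcomb N (c g) w \<oplus> sc (c g k) \<otimes> lcomb N m w"
        unfolding c'_def using insert.hyps wc by (simp add: lcomb_add lcomb_scale)
      have "lcomb (insert k N) (c g) w \<ominus> lcomb N (c' g) w = sc (c g k) \<otimes> (w k \<ominus> lcomb N m w)"
      proof -
        have "\<And>s x u v. s \<in> carrier A \<Longrightarrow> x \<in> carrier A \<Longrightarrow> u \<in> carrier A \<Longrightarrow> v \<in> carrier A \<Longrightarrow>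
          (s \<otimes> x \<oplus> u) \<ominus> (u \<oplus> s \<otimes> v) = s \<otimes> (x \<ominus> v)" by algebra
        then show ?thesis using insert.hyps insert.prems(1) wc lc by (simp add: lcomb_insert eq)
      qed
      also have "\<dots> \<in> P" using m by (intro ideal_closed(5)[OF P(3)]) auto
      finally show "lcomb N (c' g) w \<in> P"
        using ideal_diff_mem_iff[OF P(3) _ lc] in1 lcomb_in[OF insert.prems(1)] by blast
    qed
    ultimately obtain l where l: "\<exists>i\<in>N. l i \<noteq> 0" "evt (\<lambda>g. (\<Sum>i\<in>N. l i * c' g i) = 0)" using insert.IH[OF wc(2)] by blast
    define l' where "l' = l(k := \<Sum>i\<in>N. l i * m i)"
    have "(\<Sum>i\<in>insert k N. l' i * c g i) = (\<Sum>i\<in>N. l i * c' g i)" for g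
    proof -
      have "(\<Sum>i\<in>N. l' i * c g i) = (\<Sum>i\<in>N. l i * c g i)" using insert.hyps by (intro sum.cong) (auto simp: l'_def)
      then show ?thesis using insert.hyps
        by (simp add: l'_def c'_def algebra_simps sum.distrib sum_distrib_left)
    qed
    then have "evt (\<lambda>g. (\<Sum>i\<in>insert k N. l' i * c g i) = 0)" using l(2) by simp
    moreover have "\<exists>i\<in>insert k N. l' i \<noteq> 0" using l(1) insert.hyps by (auto simp: l'_def)
    ultimately show ?thesis by blast
  next
    case False
    have "evt (\<lambda>g. c g k = 0)"
    proof (rule evt_mono[OF insert.prems(3)], rule ccontr)
      fix g assume in1: "lcomb (insert k N) (c g) w \<in> P" and nz: "c g k \<noteq> 0"
      define m where "m = (\<lambda>i. (- inverse (c g k)) * c g i)"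
      have lm: "lcomb N m w = \<ominus> (sc (inverse (c g k)) \<otimes> lcomb N (c g) w)"
        unfolding m_def lcomb_scale[OF insert.hyps(1) wc(2)] sc_minus using lc by (simp add: l_minus)
      have si: "sc (inverse (c g k)) \<otimes> sc (c g k) = \<one>" by (rule sc_inverse[OF nz])
      have "\<And>s t x u. s \<in> carrier A \<Longrightarrow> t \<in> carrier A \<Longrightarrow> x \<in> carrier A \<Longrightarrow> u \<in> carrier A \<Longrightarrow>
          s \<otimes> (t \<otimes> x \<oplus> u) = (s \<otimes> t) \<otimes> x \<ominus> \<ominus> (s \<otimes> u)" by algebra
      then have "sc (inverse (c g k)) \<otimes> lcomb (insert k N) (c g) w = w k \<ominus> lcomb N m w"
        using insert.hyps insert.prems(1) wc lc by (simp add: lcomb_insert lm si)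
      moreover have "sc (inverse (c g k)) \<otimes> lcomb (insert k N) (c g) w \<in> P"
        using in1 by (intro ideal_closed(5)[OF P(3)]) auto
      ultimately show False using False by auto
    qed
    moreover have "(\<Sum>i\<in>insert k N. (if i = k then 1 else 0) * c g i) = c g k" for g
      using insert.hyps by (simp add: if_distrib[of "\<lambda>x. x * _"] cong: if_cong)
    ultimately show ?thesis by (intro exI[of _ "\<lambda>i. if i = k then 1 else 0"]) auto
  qed
qed simp

text \<open>Strong induction on the number of terms. A relation is shortened in one of three ways:
  drop a term in \<open>P\<close>, collapse everything onto one a n by rationality, or use a
  relation between the coefficients obtained by bracketing.\<close>

theorem evt_lcomb_mem:
  assumes "finite N"
  shows "a \<in> N \<rightarrow> carrier A \<Longrightarrow> evt (\<lambda>g. lcomb N (c g) a \<in> T g) \<Longrightarrow> evt (\<lambda>g. lcomb N (c g) a \<in> P)"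
  using assms
proof (induction "card N" arbitrary: N a c rule: less_induct)
  case less
  show ?case
  proof (cases "N = {}")
    case True
    then show ?thesis using ideal_closed(1)[OF P(3)] by (intro evt_all) simp
  next
    case False
    then obtain n where n: "n \<in> N" by blast
    define M where "M = N - {n}"
    have N: "N = insert n M" "n \<notin> M" "finite M" using n less.prems by (auto simp: M_def)
    have card: "card M < card N" using N by simp
    have aM: "a \<in> M \<rightarrow> carrier A" "a n \<in> carrier A" "a \<in> insert n M \<rightarrow> carrier A" using less.prems(1) N by auto
    have lcM: "lcomb M d a \<in> carrier A" "lcomb N d a \<in> carrier A" for d using aM less.prems by (auto intro: lcomb_in)
    have split: "lcomb N d a = sc (d n) \<otimes> a n \<oplus> lcomb M d a" for d
      unfolding N(1) by (rule lcomb_insert[OF N(3,2) aM(3)])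
    show ?thesis
    proof (cases "a n \<in> P")
      case True
      have d: "lcomb N d a \<ominus> lcomb M d a \<in> P" for d
      proof -
        have "\<And>x y. x \<in> carrier A \<Longrightarrow> y \<in> carrier A \<Longrightarrow> x \<oplus> y \<ominus> y = x" by algebra
        then have "lcomb N d a \<ominus> lcomb M d a = sc (d n) \<otimes> a n" using aM lcM by (simp add: split)
        then show ?thesis using ideal_closed(5)[OF P(3) True] by simp
      qed
      have "evt (\<lambda>g. lcomb M (c g) a \<in> T g)"
        by (rule evt_mono[OF less.prems(2)]) (use ideal_diff_mem_iff[OF Tp(2) lcM(2,1)] d T(2) in blast)
      then have "evt (\<lambda>g. lcomb M (c g) a \<in> P)" by (rule less.hyps[OF card aM(1) _ N(3)])
      then show ?thesis
        by (rule evt_mono) (use ideal_diff_mem_iff[OF P(3) lcM(2,1)] d in blast)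
    next
      case anP: False
      define w where "w b i = a n \<otimes> \<lbrace>a i, b\<rbrace> \<ominus> a i \<otimes> \<lbrace>a n, b\<rbrace>" for b i
      show ?thesis
      proof (cases "\<forall>b\<in>carrier A. \<forall>i\<in>M. w b i \<in> P")
        case True
        \<comment> \<open>Rationality of \<open>P\<close> enters here: a i / a n is central modulo
          \<open>P\<close>, hence constant. The relation becomes one scalar times a n, and as a n is
          generically outside \<open>T g\<close>, the scalar vanishes.\<close>
        have "\<exists>z. a i \<ominus> sc z \<otimes> a n \<in> P" if i: "i \<in> M" for i
        proof -
          have "commuting_fraction P (a i) (a n)" using True i by (simp add: commuting_fraction_def w_def)
          then show ?thesis using rat[unfolded poisson_rational_iff] aM i anP by blast
        qed
        then obtain z0 where z0: "\<And>i. i \<in> M \<Longrightarrow> a i \<ominus> sc (z0 i) \<otimes> a n \<in> P" by metis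
        define z where "z = z0(n := 1)"
        have z: "a i \<ominus> sc (z i) \<otimes> a n \<in> P" if "i \<in> N" for i
        proof (cases "i = n")
          case True
          then show ?thesis using aM ideal_closed(1)[OF P(3)] by (simp add: z_def sc_1 a_minus_def r_neg)
        next
          case False
          then show ?thesis using z0[of i] that N by (simp add: z_def)
        qed
        have fc: "(\<lambda>i. sc (z i) \<otimes> a n) \<in> N \<rightarrow> carrier A" using aM by auto
        have diff: "lcomb N d a \<ominus> sc (\<Sum>i\<in>N. d i * z i) \<otimes> a n \<in> P" for d
        proof -
          have "lcomb N d a \<ominus> lcomb N d (\<lambda>i. sc (z i) \<otimes> a n) = lcomb N d (\<lambda>i. a i \<ominus> sc (z i) \<otimes> a n)"
            by (rule lcomb_diff[OF less.prems(3,1) fc])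
          also have "\<dots> \<in> P" by (rule lcomb_ideal[OF P(3) less.prems(3) z])
          finally show ?thesis using aM less.prems by (simp add: lcomb_const)
        qed
        show ?thesis
        proof (rule evt_mono[OF evt_conj[OF less.prems(2) evt_notin[OF aM(2) anP]]])
          fix g assume g: "g \<in> E" and *: "lcomb N (c g) a \<in> T g \<and> a n \<notin> T g"
          let ?s = "\<Sum>i\<in>N. c g i * z i"
          have "sc ?s \<otimes> a n \<in> T g"
            using ideal_diff_mem_iff[OF Tp(2)[OF g] lcM(2), of "sc ?s \<otimes> a n" "c g"] diff[of "c g"] T(2)[OF g] * aM by auto
          then have "?s = 0" using prime_sc[OF Tp(1)[OF g] aM(2), of ?s] * by blast
          then have "sc ?s \<otimes> a n \<in> P" using aM ideal_closed(1)[OF P(3)] by (simp add: sc_0)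
          then show "lcomb N (c g) a \<in> P"
            using ideal_diff_mem_iff[OF P(3) lcM(2), of "sc ?s \<otimes> a n" "c g"] diff[of "c g"] aM by auto
        qed
      next
        case False
        then obtain b i0 where b: "b \<in> carrier A" and i0: "i0 \<in> M" "w b i0 \<notin> P" by blast
        have br: "\<lbrace>a i, b\<rbrace> \<in> carrier A" if "i \<in> N" for i using less.prems(1) that b by (auto intro: bracket_closed)
        have wM: "w b \<in> N \<rightarrow> carrier A" "w b \<in> M \<rightarrow> carrier A" using less.prems(1) br aM N by (auto simp: w_def Pi_iff)
        have wlc: "lcomb M d (w b) = a n \<otimes> \<lbrace>lcomb N d a, b\<rbrace> \<ominus> \<lbrace>a n, b\<rbrace> \<otimes> lcomb N d a" for d
        proof -
          have f: "(\<lambda>i. a n \<otimes> \<lbrace>a i, b\<rbrace>) \<in> N \<rightarrow> carrier A" "(\<lambda>i. \<lbrace>a n, b\<rbrace> \<otimes> a i) \<in> N \<rightarrow> carrier A" "(\<lambda>i. \<lbrace>a i, b\<rbrace>) \<in> N \<rightarrow> carrier A"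
            using less.prems(1) br aM n by auto
          have "a n \<otimes> \<lbrace>lcomb N d a, b\<rbrace> \<ominus> \<lbrace>a n, b\<rbrace> \<otimes> lcomb N d a = lcomb N d (\<lambda>i. a n \<otimes> \<lbrace>a i, b\<rbrace>) \<ominus> lcomb N d (\<lambda>i. \<lbrace>a n, b\<rbrace> \<otimes> a i)"
            using less.prems(1,3) aM(2) b f br[OF n] by (simp add: lcomb_bracket lcomb_mult)
          also have "\<dots> = lcomb N d (\<lambda>i. a n \<otimes> \<lbrace>a i, b\<rbrace> \<ominus> \<lbrace>a n, b\<rbrace> \<otimes> a i)" by (rule lcomb_diff[OF less.prems(3) f(1,2)])
          also have "\<dots> = lcomb N d (w b)"
            using less.prems(1) br n by (intro lcomb_cong wM) (auto simp: w_def Pi_iff m_comm)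
          also have "\<dots> = sc (d n) \<otimes> w b n \<oplus> lcomb M d (w b)"
            unfolding N(1) using wM by (intro lcomb_insert N) (simp add: N(1)[symmetric])
          also have "w b n = \<zero>" using aM br[OF n] by (simp add: w_def a_minus_def r_neg)
          finally show ?thesis using lcomb_in[OF wM(2)] by simp
        qed
        \<comment> \<open>\<open>T g\<close> is Poisson, so the bracketed relation stays in it, with
          the same coefficients and without the index \<open>n\<close>.\<close>
        have "evt (\<lambda>g. lcomb M (c g) (w b) \<in> T g)"
        proof (rule evt_mono[OF less.prems(2)])
          fix g assume g: "g \<in> E" "lcomb N (c g) a \<in> T g"
          show "lcomb M (c g) (w b) \<in> T g" unfolding wlc
            using ideal_closed(4,5)[OF Tp(2)[OF g(1)]] Tp(3)[OF g b] g(2) aM(2) br[OF n] by simp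
        qed
        then have "evt (\<lambda>g. lcomb M (c g) (w b) \<in> P)" by (rule less.hyps[OF card wM(2) _ N(3)])
        then obtain l where l: "\<exists>i\<in>M. l i \<noteq> 0" "evt (\<lambda>g. (\<Sum>i\<in>M. l i * c g i) = 0)"
          using evt_dependent[OF N(3) wM(2)] i0 by blast
        then obtain k where k: "k \<in> M" "l k \<noteq> 0" by blast
        \<comment> \<open>The relation between the coefficients, solved for that of
          \<open>a k\<close>. Substituting it replaces a i by a i - m i a k and removes the index k;
          its entry at n is 0 because the relation involves \<open>M\<close> only.\<close>
        define m where "m i = (if i = n then 0 else l i / l k)" for i
        define L where "L = N - {k}"
        have L: "N = insert k L" "k \<notin> L" "finite L" using k N less.prems by (auto simp: L_def)
        have cardL: "card L < card N" using L by simp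
        define a' where "a' i = a i \<ominus> sc (m i) \<otimes> a k" for i
        have ak: "a k \<in> carrier A" "a \<in> L \<rightarrow> carrier A" "a \<in> insert k L \<rightarrow> carrier A" using less.prems(1) L by auto
        have a'L: "a' \<in> L \<rightarrow> carrier A" using ak by (auto simp: a'_def Pi_iff)
        have eq: "lcomb L d a' = lcomb N d a" if "(\<Sum>i\<in>M. l i * d i) = 0" for d
        proof -
          have "(\<Sum>i\<in>N. d i * m i) = (\<Sum>i\<in>M. d i * m i)" unfolding N(1) using N by (simp add: m_def)
          also have "\<dots> = (\<Sum>i\<in>M. l i * d i) / l k"
            unfolding sum_divide_distrib using N by (intro sum.cong) (auto simp: m_def)
          finally have "(\<Sum>i\<in>N. d i * m i) = 0" using that by simp
          moreover have "m k = 1" using k N by (auto simp: m_def)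
          ultimately have s: "(\<Sum>i\<in>L. d i * m i) = - d k" unfolding L(1) using L(2,3) by (simp add: eq_neg_iff_add_eq_0 add.commute)
          have "lcomb L d a' = lcomb L d a \<ominus> lcomb L d (\<lambda>i. sc (m i) \<otimes> a k)"
            unfolding a'_def using ak L by (intro lcomb_diff[symmetric]) (auto simp: Pi_iff)
          also have "\<dots> = lcomb L d a \<ominus> (\<ominus> sc (d k)) \<otimes> a k" using ak L by (simp add: lcomb_const s sc_minus)
          also have "\<dots> = sc (d k) \<otimes> a k \<oplus> lcomb L d a"
            using ak lcomb_in[OF ak(2)] by (simp add: a_minus_def l_minus a_comm)
          also have "\<dots> = lcomb N d a" unfolding L(1) by (rule lcomb_insert[OF L(3,2) ak(3), symmetric])
          finally show ?thesis .
        qed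
        have "evt (\<lambda>g. lcomb L (c g) a' \<in> T g)"
          by (rule evt_mono[OF evt_conj[OF less.prems(2) l(2)]]) (use eq in auto)
        then have "evt (\<lambda>g. lcomb L (c g) a' \<in> P)" by (rule less.hyps[OF cardL a'L _ L(3)])
        then show ?thesis
          by (rule evt_mono[OF evt_conj[OF _ l(2)]]) (use eq in auto)
      qed
    qed
  qed
qed

end

section \<open>Functions on the maximal spectrum\<close>

interpretation Fn: complex_eval "\<lambda>c _. c" "\<lambda>x f. f x"
  by unfold_locales (auto simp: fun_eq_iff)

context complex_affine_poisson_algebra begin

definition pt :: "'a set set \<Rightarrow> 'a set \<Rightarrow> 'a set" where
  "pt Z x = (if x \<in> Z then x else (SOME z. z \<in> Z))"

text \<open>
  The value outside \<open>Z\<close> is that at some point of \<open>Z\<close>, so that \<open>hat Z\<close> is a unital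
  homomorphism to a ring of total functions.
\<close>

definition hat :: "'a set set \<Rightarrow> 'a \<Rightarrow> 'a set \<Rightarrow> complex" where
  "hat Z a = (\<lambda>x. eval_at A (pt Z x) a)"

abbreviation "coordinate_ring Z \<equiv> hat Z ` carrier A"

context
  fixes Z assumes Z: "Z \<subseteq> maxspec A" "Z \<noteq> {}"
begin

lemma pt: "pt Z x \<in> Z" "pt Z x \<in> maxspec A" "x \<in> Z \<Longrightarrow> pt Z x = x"
proof -
  show 1: "pt Z x \<in> Z" unfolding pt_def using Z(2) by (simp add: some_in_eq)
  then show "pt Z x \<in> maxspec A" using Z(1) by blast
  show "x \<in> Z \<Longrightarrow> pt Z x = x" by (simp add: pt_def)
qed

lemma hat_simps:
  "a \<in> carrier A \<Longrightarrow> b \<in> carrier A \<Longrightarrow> hat Z (a \<oplus> b) = hat Z a + hat Z b"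
  "a \<in> carrier A \<Longrightarrow> b \<in> carrier A \<Longrightarrow> hat Z (a \<otimes> b) = hat Z a * hat Z b"
  "a \<in> carrier A \<Longrightarrow> b \<in> carrier A \<Longrightarrow> hat Z (a \<ominus> b) = hat Z a - hat Z b"
  "a \<in> carrier A \<Longrightarrow> hat Z (\<ominus> a) = - hat Z a"
  "hat Z (sc c) = (\<lambda>_. c)" "hat Z \<one> = 1" "hat Z \<zero> = 0"
  by (auto simp: hat_def fun_eq_iff eval_at_simps[OF pt(2)])

lemma hat_eq_0_iff: assumes a: "a \<in> carrier A" shows "hat Z a = 0 \<longleftrightarrow> a \<in> vanishing_ideal A Z"
proof
  assume h: "hat Z a = 0"
  have "a \<in> z" if z: "z \<in> Z" for z
  proof -
    have "eval_at A z a = 0" using fun_cong[OF h, of z] pt(3)[OF z] by (simp add: hat_def)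
    then show ?thesis using eval_at_simps(8) Z(1) z a by blast
  qed
  then show "a \<in> vanishing_ideal A Z" using a by (simp add: vanishing_ideal_def)
next
  assume "a \<in> vanishing_ideal A Z"
  then have "eval_at A (pt Z x) a = 0" for x
    using eval_at_simps(8)[OF pt(2) a] pt(1)[of x] by (auto simp: vanishing_ideal_def)
  then show "hat Z a = 0" by (simp add: hat_def fun_eq_iff)
qed

lemma hat_eq_iff:
  "a \<in> carrier A \<Longrightarrow> b \<in> carrier A \<Longrightarrow> hat Z a = hat Z b \<longleftrightarrow> a \<ominus> b \<in> vanishing_ideal A Z"
  using hat_eq_0_iff[of "a \<ominus> b"] by (simp add: hat_simps)

lemma csub_coordinate_ring: "Fn.csub (coordinate_ring Z)"
  unfolding Fn.csub_def
proof (intro conjI ballI subsetI)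
  fix f assume "f \<in> range (\<lambda>(c::complex) (_::'a set). c)"
  then obtain c where "f = (\<lambda>_. c)" by blast
  then show "f \<in> coordinate_ring Z" using hat_simps(5)[of c] by (metis imageI sc_in)
next
  fix u v assume "u \<in> coordinate_ring Z" "v \<in> coordinate_ring Z"
  then obtain a b where "u = hat Z a" "v = hat Z b" "a \<in> carrier A" "b \<in> carrier A" by blast
  then show "u + v \<in> coordinate_ring Z" "u * v \<in> coordinate_ring Z"
    using hat_simps(1,2)[of a b] by (metis imageI a_closed m_closed)+
qed

lemma coordinate_ring_adjoin: "\<exists>bs. coordinate_ring Z = Fn.adjoin bs"
proof -
  obtain S where S: "finite S" "S \<subseteq> carrier A" "generate_ring A (scalars A \<union> S) = carrier A"
    using finitely_generated by blast
  obtain ss where ss: "set ss = S" using finite_list[OF S(1)] by blast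
  let ?D = "Fn.adjoin (map (hat Z) ss)"
  have D: "Fn.csub ?D" by (rule Fn.csub_adjoin)
  have "?D \<subseteq> coordinate_ring Z" using S ss by (intro Fn.adjoin_least csub_coordinate_ring) auto
  moreover have "hat Z a \<in> ?D" if "a \<in> carrier A" for a
  proof -
    have "a \<in> generate_ring A (scalars A \<union> S)" using that S by simp
    then have "a \<in> carrier A \<and> hat Z a \<in> ?D"
    proof induction
      case one then show ?case using Fn.csubD(1)[OF D, of 1] by (simp add: hat_simps one_fun_def)
    next
      case (incl h)
      show ?case
      proof (cases "h \<in> S")
        case True
        then show ?thesis using S ss Fn.set_adjoin[of "map (hat Z) ss"] by auto
      next
        case False
        then obtain c where "h = sc c" using incl by (auto simp: scalars_sc)
        then show ?thesis using Fn.csubD(1)[OF D, of c] by (simp add: hat_simps)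
      qed
    next
      case (a_inv h)
      then have "- hat Z h \<in> ?D" "h \<in> carrier A" using Fn.csubD(6)[OF D] by blast+
      then show ?case using hat_simps(4)[of h] by (metis a_inv_closed)
    next
      case (eng_add h1 h2) 
      then have "hat Z h1 + hat Z h2 \<in> ?D" "h1 \<in> carrier A" "h2 \<in> carrier A" using Fn.csubD(4)[OF D] by blast+
      then show ?case using hat_simps(1)[of h1 h2] by (metis a_closed)
    next
      case (eng_mult h1 h2) 
      then have "hat Z h1 * hat Z h2 \<in> ?D" "h1 \<in> carrier A" "h2 \<in> carrier A" using Fn.csubD(5)[OF D] by blast+
      then show ?case using hat_simps(2)[of h1 h2] by (metis m_closed)
    qed
    then show ?thesis ..
  qed
  ultimately show ?thesis by blast
qed

lemma cideal_hat: assumes J: "ideal J A" shows "Fn.cideal (coordinate_ring Z) (hat Z ` J)"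
  unfolding Fn.cideal_def
proof (intro conjI ballI)
  have JA: "J \<subseteq> carrier A" by (rule ideal_subset[OF J])
  then show "hat Z ` J \<subseteq> coordinate_ring Z" by blast
  show "0 \<in> hat Z ` J" using ideal_closed(1)[OF J] hat_simps(7) by (metis imageI)
  fix u v assume "u \<in> hat Z ` J" "v \<in> hat Z ` J"
  then obtain a b where ab: "u = hat Z a" "v = hat Z b" "a \<in> J" "b \<in> J" by blast
  have "a \<oplus> b \<in> J" by (rule ideal_closed(2)[OF J ab(3,4)])
  moreover have "u + v = hat Z (a \<oplus> b)" unfolding ab(1,2) using ab(3,4) JA by (intro hat_simps(1)[symmetric]) blast+
  ultimately show "u + v \<in> hat Z ` J" by blast
next
  have JA: "J \<subseteq> carrier A" by (rule ideal_subset[OF J])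
  fix c u assume "c \<in> coordinate_ring Z" "u \<in> hat Z ` J"
  then obtain a b where ab: "c = hat Z a" "u = hat Z b" "a \<in> carrier A" "b \<in> J" by blast
  have "a \<otimes> b \<in> J" by (rule ideal_closed(5)[OF J ab(4,3)])
  moreover have "c * u = hat Z (a \<otimes> b)" unfolding ab(1,2) using ab(3,4) JA by (intro hat_simps(2)[symmetric]) blast+
  ultimately show "c * u \<in> hat Z ` J" by blast
qed

end

section \<open>Chain conditions modulo the nilradical\<close>

abbreviation "nilrad \<equiv> vanishing_ideal A (maxspec A)"

lemma nilrad_prime: "primeideal p A \<Longrightarrow> nilrad \<subseteq> p"
  using jacobson unfolding vanishing_ideal_def by blast

lemma maxspec_nonempty: "primeideal p A \<Longrightarrow> maxspec A \<noteq> {}"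
  using jacobson[of p \<one>] ideal.one_imp_carrier[of p A] primeideal.I_notcarr[of p A] primeideal.axioms(1)[of p A] by auto

text \<open>Functions on \<open>maxspec A\<close> see \<open>A\<close> only modulo its nilradical,
  and their ring is noetherian. So \<open>B\<close> generates \<open>J\<close> as far as test ideals
  containing the nilradical can tell; primes and vanishing ideals do contain it.\<close>

lemma finitely_generated_mod_nilrad:
  assumes ne: "maxspec A \<noteq> {}" and J: "ideal J A"
  shows "\<exists>B. finite B \<and> B \<subseteq> J \<and> (\<forall>J'. ideal J' A \<longrightarrow> nilrad \<subseteq> J' \<longrightarrow> B \<subseteq> J' \<longrightarrow> J \<subseteq> J')"
proof -
  let ?h = "hat (maxspec A)" and ?R = "coordinate_ring (maxspec A)"
  note Z = subset_refl ne
  obtain bs where "?R = Fn.adjoin bs" using coordinate_ring_adjoin[OF Z] by blast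
  then have N: "Fn.noeth ?R" using Fn.noeth_adjoin by simp
  obtain B' where B': "finite B'" "B' \<subseteq> ?h ` J" "\<And>I. Fn.cideal ?R I \<Longrightarrow> B' \<subseteq> I \<Longrightarrow> ?h ` J \<subseteq> I"
    by (rule Fn.noethE[OF N cideal_hat[OF Z J]]) (rule that)
  obtain B where B: "B \<subseteq> J" "finite B" "B' = ?h ` B" using finite_subset_image[OF B'(1,2)] by blast
  have "J \<subseteq> J'" if J': "ideal J' A" "nilrad \<subseteq> J'" "B \<subseteq> J'" for J'
  proof
    fix a assume a: "a \<in> J"
    have "?h ` J \<subseteq> ?h ` J'" by (rule B'(3)[OF cideal_hat[OF Z J'(1)]]) (use B J' in blast)
    then obtain b where b: "b \<in> J'" "?h a = ?h b" using a by blast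
    have ab: "a \<in> carrier A" "b \<in> carrier A" using a b ideal_subset[OF J] ideal_subset[OF J'(1)] by auto
    have "a \<ominus> b \<in> J'" using hat_eq_iff[OF Z ab] b J'(2) by blast
    then show "a \<in> J'" using ideal_diff_mem_iff[OF J'(1) ab] b by simp
  qed
  then show ?thesis using B by blast
qed

lemma ascending_chain:
  assumes ne: "maxspec A \<noteq> {}" and J: "\<And>i::nat. ideal (J i) A" "\<And>i. nilrad \<subseteq> J i" "\<And>i. J i \<subseteq> J (Suc i)"
  shows "\<exists>n. J (Suc n) = J n"
proof -
  have mono: "i \<le> j \<Longrightarrow> J i \<subseteq> J j" for i j using J(3) by (rule lift_Suc_mono_le)
  have ch: "subset.chain {I. ideal I A} (range J)"
    unfolding subset_chain_def
  proof (intro conjI ballI)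
    show "range J \<subseteq> {I. ideal I A}" using J(1) by blast
    fix K L assume "K \<in> range J" "L \<in> range J"
    then obtain i j where ij: "K = J i" "L = J j" by blast
    show "K \<subseteq> L \<or> L \<subseteq> K" unfolding ij using mono[of i j] mono[of j i] by linarith
  qed
  have U: "ideal (\<Union>(range J)) A" using chain_Union_is_ideal[OF ch] by simp
  obtain B where B: "finite B" "B \<subseteq> \<Union>(range J)" "\<And>J'. ideal J' A \<Longrightarrow> nilrad \<subseteq> J' \<Longrightarrow> B \<subseteq> J' \<Longrightarrow> \<Union>(range J) \<subseteq> J'"
  proof -
    from finitely_generated_mod_nilrad[OF ne U] obtain B where
      "finite B \<and> B \<subseteq> \<Union>(range J) \<and> (\<forall>J'. ideal J' A \<longrightarrow> nilrad \<subseteq> J' \<longrightarrow> B \<subseteq> J' \<longrightarrow> \<Union>(range J) \<subseteq> J')" ..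
    then show thesis by (intro that[of B]) simp_all
  qed
  have "\<exists>n. B \<subseteq> J n" using B(1,2)
  proof (induction B)
    case (insert b B)
    then obtain m n where "B \<subseteq> J n" "b \<in> J m" by auto
    then show ?case using mono[of m "max m n"] mono[of n "max m n"] by (intro exI[of _ "max m n"]) auto
  qed simp
  then obtain n where "B \<subseteq> J n" by blast
  then have "\<Union>(range J) \<subseteq> J n" using B(3)[OF J(1,2)] by blast
  then have "J (Suc n) \<subseteq> J n" by blast
  then show ?thesis using J(3)[of n] by blast
qed

lemma maximal_ideal_in_family:
  assumes ne: "maxspec A \<noteq> {}" and F: "J0 \<in> \<F>" "\<And>J. J \<in> \<F> \<Longrightarrow> ideal J A" "\<And>J. J \<in> \<F> \<Longrightarrow> nilrad \<subseteq> J"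
  shows "\<exists>J\<in>\<F>. \<forall>J'\<in>\<F>. J \<subseteq> J' \<longrightarrow> J' = J"
proof (rule ccontr)
  assume no: "\<not> ?thesis"
  then have "\<forall>J\<in>\<F>. \<exists>J'\<in>\<F>. J \<subset> J'" by blast
  then obtain s where s: "\<And>J. J \<in> \<F> \<Longrightarrow> s J \<in> \<F> \<and> J \<subset> s J" by metis
  define J where "J n = (s ^^ n) J0" for n
  have JF: "J n \<in> \<F>" for n by (induction n) (use F(1) s in \<open>auto simp: J_def\<close>)
  have step: "J n \<subset> J (Suc n)" for n using s[OF JF[of n]] by (simp add: J_def)
  have "\<exists>n. J (Suc n) = J n"
  proof (rule ascending_chain[OF ne])
    show "ideal (J i) A" "nilrad \<subseteq> J i" for i by (rule F(2)[OF JF], rule F(3)[OF JF])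
    show "J i \<subseteq> J (Suc i)" for i using step by blast
  qed
  then show False using step by blast
qed

subsection \<open>Group actions\<close>

lemma finite_dimension_lcomb:
  "dimension n K V \<Longrightarrow> K = scalars A \<Longrightarrow>
    \<exists>a. a \<in> {..<n} \<rightarrow> carrier A \<and> (\<forall>v\<in>V. \<exists>c. v = lcomb {..<n} c a)"
proof (induction rule: dimension.induct)
  case (zero_dim K)
  then show ?case by simp
next
  case (Suc_dim u V n K)
  then obtain a where a: "a \<in> {..<n} \<rightarrow> carrier A" "\<And>v. v \<in> V \<Longrightarrow> \<exists>c. v = lcomb {..<n} c a" by blast
  define b where "b = a(n := u)"
  have b: "b \<in> {..<Suc n} \<rightarrow> carrier A" using a(1) Suc_dim(1) by (auto simp: b_def less_Suc_eq)
  have ins: "{..<Suc n} = insert n {..<n}" by auto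
  have "\<exists>c. v = lcomb {..<Suc n} c b" if mem: "v \<in> line_extension K u V" for v
  proof -
    have "\<exists>k\<in>K. \<exists>w\<in>V. v = k \<otimes> u \<oplus> w" using mem by (simp only: line_extension_mem_iff)
    then obtain k w where kw: "k \<in> K" "w \<in> V" "v = k \<otimes> u \<oplus> w" by (elim bexE) (rule that)
    have "k \<in> range sc" using kw(1) Suc_dim.prems by (simp add: scalars_sc)
    then obtain z where z: "k = sc z" by (elim rangeE)
    obtain c where c: "w = lcomb {..<n} c a" using a(2)[OF kw(2)] by (elim exE)
    have "lcomb {..<n} (c(n := z)) b = lcomb {..<n} c a"
      using a(1) by (intro lcomb_cong) (auto simp: b_def)
    moreover have "lcomb {..<Suc n} (c(n := z)) b = sc z \<otimes> u \<oplus> lcomb {..<n} (c(n := z)) b"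
      unfolding ins using lcomb_insert[of "{..<n}" n b "c(n := z)"] b ins by (simp add: b_def)
    ultimately have "v = lcomb {..<Suc n} (c(n := z)) b" using kw z c by simp
    then show ?thesis by blast
  qed
  then show ?case using b by blast
qed

context
  fixes G :: "(complex ^ 'n) monoid" and \<phi> :: "complex ^ 'n \<Rightarrow> 'a \<Rightarrow> 'a"
  assumes act: "rational_poisson_action G A \<phi>"
begin

lemma action:
  "group_action G (carrier A) \<phi>" "group G"
  "g \<in> carrier G \<Longrightarrow> \<phi> g \<in> ring_hom A A"
  "g \<in> carrier G \<Longrightarrow> a \<in> carrier A \<Longrightarrow> \<phi> g a \<in> carrier A"
  "g \<in> carrier G \<Longrightarrow> a \<in> carrier A \<Longrightarrow> b \<in> carrier A \<Longrightarrow> \<phi> g \<lbrace>a, b\<rbrace> = \<lbrace>\<phi> g a, \<phi> g b\<rbrace>"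
  "g \<in> carrier G \<Longrightarrow> a \<in> carrier A \<Longrightarrow> \<phi> (inv\<^bsub>G\<^esub> g) (\<phi> g a) = a"
  "g \<in> carrier G \<Longrightarrow> a \<in> carrier A \<Longrightarrow> \<phi> g (\<phi> (inv\<^bsub>G\<^esub> g) a) = a"
proof -
  show ga: "group_action G (carrier A) \<phi>" using act by (simp add: rational_poisson_action_def)
  show G: "group G" using group_action.group_hom[OF ga] by (simp add: group_hom_def)
  show "g \<in> carrier G \<Longrightarrow> \<phi> g \<in> ring_hom A A" for g using act by (simp add: rational_poisson_action_def)
  then show "g \<in> carrier G \<Longrightarrow> a \<in> carrier A \<Longrightarrow> \<phi> g a \<in> carrier A" by (rule ring_hom_closed)
  show "g \<in> carrier G \<Longrightarrow> a \<in> carrier A \<Longrightarrow> b \<in> carrier A \<Longrightarrow> \<phi> g \<lbrace>a, b\<rbrace> = \<lbrace>\<phi> g a, \<phi> g b\<rbrace>"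
    using act by (simp add: rational_poisson_action_def)
  show 1: "g \<in> carrier G \<Longrightarrow> a \<in> carrier A \<Longrightarrow> \<phi> (inv\<^bsub>G\<^esub> g) (\<phi> g a) = a" for g
    by (rule group_action.orbit_sym_aux[OF ga]) auto
  show "g \<in> carrier G \<Longrightarrow> a \<in> carrier A \<Longrightarrow> \<phi> g (\<phi> (inv\<^bsub>G\<^esub> g) a) = a"
    using 1[of "inv\<^bsub>G\<^esub> g"] group.inv_closed[OF G] group.inv_inv[OF G] by simp
qed

lemma locally_finite:
  assumes q: "q \<in> carrier A"
  shows "\<exists>n a. a \<in> {..<n} \<rightarrow> carrier A \<and> (\<forall>g\<in>carrier G. \<exists>c. \<phi> g q = lcomb {..<n} c a)"
  using act[unfolded rational_poisson_action_def, THEN conjunct2, THEN conjunct2]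
proof (elim exE conjE)
  fix \<V>
  assume V: "\<Union>\<V> = carrier A" and *: "\<forall>V\<in>\<V>. finite_dimension (scalars A) V \<and> (\<forall>g\<in>carrier G. \<phi> g ` V \<subseteq> V) \<and>
    (\<forall>v\<in>V. \<forall>\<xi>. linear_form_on A V \<xi> \<longrightarrow> regular_function (carrier G) (\<lambda>g. \<xi> (\<phi> g v)))"
  obtain W where W: "W \<in> \<V>" "q \<in> W" using q V by blast
  have fd: "finite_dimension (scalars A) W" and inv: "\<forall>g\<in>carrier G. \<phi> g ` W \<subseteq> W" using bspec[OF * W(1)] by simp_all
  obtain n where "dimension n (scalars A) W" using fd unfolding finite_dimension_def by (elim exE)
  from finite_dimension_lcomb[OF this refl] obtain a where
    a: "a \<in> {..<n} \<rightarrow> carrier A \<and> (\<forall>v\<in>W. \<exists>c. v = lcomb {..<n} c a)" by (elim exE)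
  have "\<forall>g\<in>carrier G. \<phi> g q \<in> W" using inv W(2) by blast
  then show ?thesis using a by (intro exI[of _ n] exI[of _ a]) simp
qed

text \<open>Written as a preimage under the inverse, a translate inherits primality from
  \<open>prime_vimage\<close>.\<close>

lemma translate_eq_vimage:
  assumes g: "g \<in> carrier G" and Q: "Q \<subseteq> carrier A"
  shows "\<phi> g ` Q = {y \<in> carrier A. \<phi> (inv\<^bsub>G\<^esub> g) y \<in> Q}"
proof
  show "\<phi> g ` Q \<subseteq> {y \<in> carrier A. \<phi> (inv\<^bsub>G\<^esub> g) y \<in> Q}"
  proof
    fix y assume "y \<in> \<phi> g ` Q"
    then obtain a where "a \<in> Q" "a \<in> carrier A" "y = \<phi> g a" using Q by blast
    then show "y \<in> {y \<in> carrier A. \<phi> (inv\<^bsub>G\<^esub> g) y \<in> Q}" using action(4,6)[OF g] by simp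
  qed
  show "{y \<in> carrier A. \<phi> (inv\<^bsub>G\<^esub> g) y \<in> Q} \<subseteq> \<phi> g ` Q"
  proof
    fix y assume "y \<in> {y \<in> carrier A. \<phi> (inv\<^bsub>G\<^esub> g) y \<in> Q}"
    then have "\<phi> (inv\<^bsub>G\<^esub> g) y \<in> Q" "y = \<phi> g (\<phi> (inv\<^bsub>G\<^esub> g) y)" using action(7)[OF g] by simp_all
    then show "y \<in> \<phi> g ` Q" by (metis imageI)
  qed
qed

lemma prime_vimage:
  assumes g: "g \<in> carrier G" and p: "primeideal p A"
  shows "primeideal {x \<in> carrier A. \<phi> g x \<in> p} A"
proof -
  have "ring_hom_ring A A (\<phi> g)" by (rule ring_hom_ringI2[OF ring_axioms ring_axioms action(3)[OF g]])
  then show ?thesis by (rule ring_hom_ring.primeideal_vimage[OF _ M_cring p])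
qed

lemma translate_poisson_prime:
  assumes g: "g \<in> carrier G" and Q: "poisson_prime A Q" shows "poisson_prime A (\<phi> g ` Q)"
proof -
  let ?i = "inv\<^bsub>G\<^esub> g"
  have i: "?i \<in> carrier G" using g group.inv_closed[OF action(2)] by simp
  have p: "primeideal Q A" and QI: "ideal Q A" and br: "\<And>x c. x \<in> Q \<Longrightarrow> c \<in> carrier A \<Longrightarrow> \<lbrace>x, c\<rbrace> \<in> Q"
    using Q by (auto simp: poisson_prime_def poisson_ideal_def)
  have eq: "\<phi> g ` Q = {y \<in> carrier A. \<phi> ?i y \<in> Q}" by (rule translate_eq_vimage[OF g ideal_subset[OF QI]])
  have pr: "primeideal (\<phi> g ` Q) A" unfolding eq by (rule prime_vimage[OF i p])
  have "\<lbrace>x, c\<rbrace> \<in> \<phi> g ` Q" if "x \<in> \<phi> g ` Q" "c \<in> carrier A" for x c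
    using that br action(4,5)[OF i] bracket_closed unfolding eq by simp
  then show ?thesis using pr primeideal.axioms(1)[OF pr] by (simp add: poisson_prime_def poisson_ideal_def)
qed

text \<open>Membership of a translated generator in \<open>P\<close> holds generically, by
  \<open>evt_lcomb_mem\<close>. Finitely many such conditions hold together, and
  \<open>dense\<close> provides a g that satisfies them all, so gQ lies in \<open>P\<close>.\<close>

theorem rational_in_orbit:
  assumes P: "poisson_rational A P" and Q: "poisson_prime A Q" and E: "E \<subseteq> carrier G"
    and sub: "\<And>g. g \<in> E \<Longrightarrow> P \<subseteq> \<phi> g ` Q"
    and dense: "\<And>a. a \<in> carrier A \<Longrightarrow> a \<notin> P \<Longrightarrow> \<exists>g\<in>E. a \<notin> \<phi> g ` Q"
  shows "\<exists>g\<in>E. \<phi> g ` Q = P"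
proof -
  have tp: "\<And>g. g \<in> E \<Longrightarrow> poisson_prime A (\<phi> g ` Q)" using translate_poisson_prime Q E by blast
  interpret F: prime_family A P E "\<lambda>g. \<phi> g ` Q"
    by unfold_locales (use P tp sub in auto)
  have QI: "ideal Q A" and pQ: "primeideal Q A" using Q by (auto simp: poisson_prime_def poisson_ideal_def)
  have ne: "maxspec A \<noteq> {}" by (rule maxspec_nonempty[OF pQ])
  from finitely_generated_mod_nilrad[OF ne QI] obtain B where
    B0: "finite B \<and> B \<subseteq> Q \<and> (\<forall>J'. ideal J' A \<longrightarrow> nilrad \<subseteq> J' \<longrightarrow> B \<subseteq> J' \<longrightarrow> Q \<subseteq> J')" ..
  then have B: "finite B" "B \<subseteq> Q" and BJ: "\<And>J'. ideal J' A \<Longrightarrow> nilrad \<subseteq> J' \<Longrightarrow> B \<subseteq> J' \<Longrightarrow> Q \<subseteq> J'" by simp_all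
  have single: "F.evt (\<lambda>g. \<phi> g q \<in> P)" if q: "q \<in> Q" for q
  proof -
    have qA: "q \<in> carrier A" using q ideal_subset[OF QI] by blast
    from locally_finite[OF qA] obtain n a where
      a0: "a \<in> {..<n} \<rightarrow> carrier A \<and> (\<forall>g\<in>carrier G. \<exists>c. \<phi> g q = lcomb {..<n} c a)" by (elim exE)
    then have a: "a \<in> {..<n} \<rightarrow> carrier A" by simp
    have "\<forall>g\<in>E. \<exists>c. \<phi> g q = lcomb {..<n} c a" using a0 E by (simp add: subset_iff)
    then obtain c where c: "\<And>g. g \<in> E \<Longrightarrow> \<phi> g q = lcomb {..<n} (c g) a" by metis
    have "F.evt (\<lambda>g. lcomb {..<n} (c g) a \<in> \<phi> g ` Q)" by (rule F.evt_all) (use c q in force)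
    then have "F.evt (\<lambda>g. lcomb {..<n} (c g) a \<in> P)" by (rule F.evt_lcomb_mem[OF finite_lessThan a])
    then show ?thesis by (rule F.evt_mono) (use c in simp)
  qed
  have "F.evt (\<lambda>g. \<forall>q\<in>B. \<phi> g q \<in> P)" using B
  proof (induction B)
    case empty then show ?case by (intro F.evt_all) simp
  next
    case (insert q B)
    then have "F.evt (\<lambda>g. \<phi> g q \<in> P \<and> (\<forall>q\<in>B. \<phi> g q \<in> P))" using single[of q] by (intro F.evt_conj) auto
    then show ?case by (rule F.evt_mono) auto
  qed
  then obtain a where a: "a \<in> carrier A - P" "\<forall>g\<in>E. a \<notin> \<phi> g ` Q \<longrightarrow> (\<forall>q\<in>B. \<phi> g q \<in> P)"
    unfolding F.evt_def by (elim bexE)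
  have "\<exists>g\<in>E. a \<notin> \<phi> g ` Q" using a(1) by (intro dense) simp_all
  then obtain g where "g \<in> E" "a \<notin> \<phi> g ` Q" by (elim bexE)
  with a(2) have g: "g \<in> E" "\<And>q. q \<in> B \<Longrightarrow> \<phi> g q \<in> P" by simp_all
  have gG: "g \<in> carrier G" using g E by blast
  let ?J = "{x \<in> carrier A. \<phi> g x \<in> P}"
  have J: "primeideal ?J A" by (rule prime_vimage[OF gG F.P(2)])
  have "Q \<subseteq> ?J"
    \<comment> \<open>The preimage of \<open>P\<close> is prime and therefore contains the
      nilradical, so it is enough to test the elements of \<open>B\<close>.\<close>
    by (rule BJ[OF primeideal.axioms(1)[OF J] nilrad_prime[OF J]]) (use g B ideal_subset[OF QI] in blast)
  then have "\<phi> g ` Q \<subseteq> P" by blast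
  then show ?thesis using sub[OF g(1)] g(1) by blast
qed

text \<open>For each of the finitely many Q, the translates strictly above \<open>P\<close> share an
  element outside \<open>P\<close>, since otherwise one of them would equal \<open>P\<close>. The
  product f of these elements lies in every primitive ideal strictly above \<open>P\<close>. It then
  lies in every larger Poisson prime R, because a maximal ideal above R that misses f would have a
  core missing f.\<close>

theorem rational_imp_locally_closed:
  assumes fin: "finite \<Q>" and prime: "\<And>Q. Q \<in> \<Q> \<Longrightarrow> poisson_prime A Q"
    and cover: "\<And>m. m \<in> maxspec A \<Longrightarrow> \<exists>Q\<in>\<Q>. \<exists>g\<in>carrier G. poisson_core A m = \<phi> g ` Q"
    and P: "poisson_rational A P"
  shows "poisson_locally_closed A P"
proof -
  have pP: "poisson_prime A P" "primeideal P A" "poisson_ideal A P" using P by (auto simp: poisson_rational_def poisson_prime_def)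
  define E where "E Q = {g \<in> carrier G. P \<subset> \<phi> g ` Q}" for Q
  have "\<exists>f\<in>carrier A - P. \<forall>Q\<in>\<Q>. \<forall>g\<in>E Q. f \<in> \<phi> g ` Q"
    using fin prime
  proof (induction \<Q>)
    case empty
    show ?case using primeideal.I_notcarr[OF pP(2)] ideal_subset[OF primeideal.axioms(1)[OF pP(2)]] by auto
  next
    case (insert Q \<Q>)
    then obtain f where f: "f \<in> carrier A" "f \<notin> P" "\<And>Q g. Q \<in> \<Q> \<Longrightarrow> g \<in> E Q \<Longrightarrow> f \<in> \<phi> g ` Q" by blast
    have "\<exists>a\<in>carrier A - P. \<forall>g\<in>E Q. a \<in> \<phi> g ` Q"
    proof (rule ccontr)
      assume "\<not> ?thesis"
      then have "\<exists>g\<in>E Q. \<phi> g ` Q = P"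
        using insert.prems[of Q] by (intro rational_in_orbit[OF P]) (auto simp: E_def)
      then show False by (auto simp: E_def)
    qed
    then obtain a where a: "a \<in> carrier A" "a \<notin> P" "\<And>g. g \<in> E Q \<Longrightarrow> a \<in> \<phi> g ` Q" by blast
    have "f \<otimes> a \<notin> P" using primeideal.I_prime[OF pP(2) f(1) a(1)] f(2) a(2) by blast
    moreover have "f \<otimes> a \<in> \<phi> g ` Q'" if "Q' \<in> insert Q \<Q>" "g \<in> E Q'" for Q' g
    proof -
      have "poisson_prime A (\<phi> g ` Q')" using that insert.prems by (intro translate_poisson_prime) (auto simp: E_def)
      then have I: "ideal (\<phi> g ` Q') A" by (simp add: poisson_prime_def poisson_ideal_def)
      show ?thesis
      proof (cases "Q' = Q")
        case True
        then show ?thesis using ideal_closed(5)[OF I, of a f] a(3) f(1) that by simp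
      next
        case False
        then show ?thesis using ideal_closed(6)[OF I, of f a] f(3) a(1) that by simp
      qed
    qed
    ultimately show ?case using f(1) a(1) by (intro bexI[of _ "f \<otimes> a"]) auto
  qed
  then obtain f where f: "f \<in> carrier A" "f \<notin> P" "\<And>Q g. Q \<in> \<Q> \<Longrightarrow> g \<in> E Q \<Longrightarrow> f \<in> \<phi> g ` Q" by blast
  have "f \<in> R" if R: "poisson_prime A R" "P \<subset> R" for R
  proof (rule ccontr)
    assume "f \<notin> R"
    have pR: "primeideal R A" "poisson_ideal A R" using R by (auto simp: poisson_prime_def)
    obtain m where m: "m \<in> maxspec A" "R \<subseteq> m" "f \<notin> m" using jacobson[OF pR(1) f(1) \<open>f \<notin> R\<close>] by blast
    note core = poisson_core_greatest[OF primeideal.axioms(1)[OF maxspec_prime[OF m(1)]]]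
    have "R \<subseteq> poisson_core A m" by (rule core(3)[OF pR(2) m(2)])
    obtain Q g where Q: "Q \<in> \<Q>" "g \<in> carrier G" "poisson_core A m = \<phi> g ` Q" using cover[OF m(1)] by blast
    have "g \<in> E Q" unfolding E_def using Q R(2) \<open>R \<subseteq> poisson_core A m\<close> by auto
    then have "f \<in> poisson_core A m" using f(3) Q by simp
    then show False using core(2) m(3) by blast
  qed
  then show ?thesis unfolding poisson_locally_closed_iff using pP(1) f by blast
qed

end

end

section \<open>Hamiltonian curves\<close>

text \<open>exp(-C t) u cannot increase and exp(C t) u cannot decrease, so a zero spreads forwards
  and backwards in time. Both directions serve to compare the two ends of a curve.\<close>

lemma gronwall_zero:
  fixes u u' :: "real \<Rightarrow> real"
  assumes der: "\<And>t. t \<in> {0..T} \<Longrightarrow> (u has_vector_derivative u' t) (at t within {0..T})"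
    and bound: "\<And>t. t \<in> {0..T} \<Longrightarrow> \<bar>u' t\<bar> \<le> C * u t"
    and pos: "\<And>t. t \<in> {0..T} \<Longrightarrow> 0 \<le> u t"
    and t0: "t0 \<in> {0..T}" "u t0 = 0" and t: "t \<in> {0..T}"
  shows "u t = 0"
proof -
  have der': "((\<lambda>s. exp (c * s) * u s) has_derivative (\<lambda>h. h * (exp (c * s) * (c * u s + u' s)))) (at s within {a..b})"
    if "a \<in> {0..T}" "b \<in> {0..T}" "a \<le> s" "s \<le> b" for a b c s
  proof -
    have s: "s \<in> {0..T}" using that by auto
    have "(u has_real_derivative u' s) (at s within {a..b})"
      using der[OF s] that by (auto simp: has_real_derivative_iff_has_vector_derivative intro: has_vector_derivative_within_subset)
    then have "((\<lambda>s. exp (c * s) * u s) has_real_derivative exp (c * s) * (c * u s + u' s)) (at s within {a..b})"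
      by (auto intro!: derivative_eq_intros simp: algebra_simps)
    then show ?thesis unfolding has_field_derivative_def
      by (rule has_derivative_eq_rhs) (auto simp: fun_eq_iff)
  qed
  show ?thesis
  proof (cases "t0 \<le> t")
    case True
    have "\<exists>s\<in>{t0..t}. exp (- C * t) * u t - exp (- C * t0) * u t0 = (t - t0) * (exp (- C * s) * (- C * u s + u' s))"
      by (rule mvt_very_simple[OF True der'[OF t0(1) t]])
    then obtain s where s: "s \<in> {t0..t}" "exp (- C * t) * u t - exp (- C * t0) * u t0 = (t - t0) * (exp (- C * s) * (- C * u s + u' s))"
      by (elim bexE)
    have "s \<in> {0..T}" using s(1) t0 t by auto
    then have "- C * u s + u' s \<le> 0" using bound[of s] by auto
    then have "(t - t0) * (exp (- C * s) * (- C * u s + u' s)) \<le> 0"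
      using True by (intro mult_nonneg_nonpos) auto
    then have "exp (- C * t) * u t \<le> 0" using s(2) t0(2) by simp
    then have "u t \<le> 0" by (simp add: mult_le_0_iff)
    then show ?thesis using pos[OF t] by simp
  next
    case False
    then have le: "t \<le> t0" by simp
    have "\<exists>s\<in>{t..t0}. exp (C * t0) * u t0 - exp (C * t) * u t = (t0 - t) * (exp (C * s) * (C * u s + u' s))"
      by (rule mvt_very_simple[OF le der'[OF t t0(1)]])
    then obtain s where s: "s \<in> {t..t0}" "exp (C * t0) * u t0 - exp (C * t) * u t = (t0 - t) * (exp (C * s) * (C * u s + u' s))"
      by (elim bexE)
    have "s \<in> {0..T}" using s(1) t0 t by auto
    then have "0 \<le> C * u s + u' s" using bound[of s] by auto
    then have "0 \<le> (t0 - t) * (exp (C * s) * (C * u s + u' s))"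
      using le by (intro mult_nonneg_nonneg) auto
    then have "exp (C * t) * u t \<le> 0" using s(2) t0(2) by simp
    then have "u t \<le> 0" by (simp add: mult_le_0_iff)
    then show ?thesis using pos[OF t] by simp
  qed
qed

lemma linear_ode_zero:
  fixes y :: "'i \<Rightarrow> real \<Rightarrow> complex" and M :: "'i \<Rightarrow> 'i \<Rightarrow> real \<Rightarrow> complex"
  assumes B: "finite B"
    and der: "\<And>f t. f \<in> B \<Longrightarrow> t \<in> {0..T} \<Longrightarrow> (y f has_vector_derivative (\<Sum>h\<in>B. M f h t * y h t)) (at t within {0..T})"
    and cont: "\<And>f h. f \<in> B \<Longrightarrow> h \<in> B \<Longrightarrow> continuous_on {0..T} (M f h)"
    and t0: "t0 \<in> {0..T}" "\<And>f. f \<in> B \<Longrightarrow> y f t0 = 0"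
    and t: "t \<in> {0..T}" and f: "f \<in> B"
  shows "y f t = 0"
proof -
  have "\<exists>K. \<forall>t\<in>{0..T}. norm (M f h t) \<le> K" if "f \<in> B" "h \<in> B" for f h
  proof -
    have "bounded (M f h ` {0..T})"
      by (rule compact_imp_bounded[OF compact_continuous_image[OF cont[OF that] compact_Icc]])
    then show ?thesis by (auto simp: bounded_iff)
  qed
  then obtain k where k: "\<And>f h t. f \<in> B \<Longrightarrow> h \<in> B \<Longrightarrow> t \<in> {0..T} \<Longrightarrow> norm (M f h t) \<le> k f h" by metis
  define K where "K = (\<Sum>f\<in>B. \<Sum>h\<in>B. \<bar>k f h\<bar>)"
  have K: "norm (M f h t) \<le> K" if "f \<in> B" "h \<in> B" "t \<in> {0..T}" for f h t
  proof -
    have "norm (M f h t) \<le> \<bar>k f h\<bar>" using k[OF that] by simp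
    also have "\<dots> \<le> (\<Sum>h\<in>B. \<bar>k f h\<bar>)" using B that by (intro member_le_sum) auto
    also have "\<dots> \<le> K" unfolding K_def using B that by (intro member_le_sum) (auto intro: sum_nonneg)
    finally show ?thesis .
  qed
  define u where "u t = (\<Sum>f\<in>B. y f t \<bullet> y f t)" for t
  define y' where "y' f t = (\<Sum>h\<in>B. M f h t * y h t)" for f t
  \<comment> \<open>The constant: the products 2 |y f| |y h| are bounded by |y f|^2 + |y h|^2, and
    summing over all pairs counts each square 2 \<open>card B\<close> times.\<close>
  have "u t = 0"
  proof (rule gronwall_zero[where u = u and T = T and t = t and ?t0.0 = t0 and u' = "\<lambda>t. \<Sum>f\<in>B. 2 * (y f t \<bullet> y' f t)" and C = "2 * (real (card B) * K)"])
    show "(u has_vector_derivative (\<Sum>f\<in>B. 2 * (y f t \<bullet> y' f t))) (at t within {0..T})" if t: "t \<in> {0..T}" for t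
      unfolding u_def
    proof (rule has_vector_derivative_sum)
      fix f assume f: "f \<in> B"
      have "(y f has_vector_derivative y' f t) (at t within {0..T})" using der[OF f t] by (simp add: y'_def)
      from bounded_bilinear.has_vector_derivative[OF bounded_bilinear_inner this this]
      show "((\<lambda>t. y f t \<bullet> y f t) has_vector_derivative 2 * (y f t \<bullet> y' f t)) (at t within {0..T})"
        by (simp add: inner_commute)
    qed
    show "\<bar>\<Sum>f\<in>B. 2 * (y f t \<bullet> y' f t)\<bar> \<le> 2 * (real (card B) * K) * u t" if t: "t \<in> {0..T}" for t
    proof -
      have bnd: "\<bar>2 * (y f t \<bullet> y' f t)\<bar> \<le> (\<Sum>h\<in>B. K * (y f t \<bullet> y f t + y h t \<bullet> y h t))" if f: "f \<in> B" for f
      proof -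
        have "\<bar>2 * (y f t \<bullet> y' f t)\<bar> \<le> 2 * (norm (y f t) * norm (y' f t))"
          using Cauchy_Schwarz_ineq2[of "y f t" "y' f t"] by simp
        also have "\<dots> \<le> 2 * (norm (y f t) * (\<Sum>h\<in>B. K * norm (y h t)))"
        proof -
          have "norm (y' f t) \<le> (\<Sum>h\<in>B. norm (M f h t * y h t))" unfolding y'_def by (rule norm_sum)
          also have "\<dots> \<le> (\<Sum>h\<in>B. K * norm (y h t))"
            using K[OF f _ t] by (intro sum_mono) (auto simp: norm_mult intro: mult_right_mono)
          finally show ?thesis by (intro mult_left_mono) auto
        qed
        also have "\<dots> = (\<Sum>h\<in>B. K * (2 * norm (y f t) * norm (y h t)))" by (simp add: sum_distrib_left mult_ac)
        also have "\<dots> \<le> (\<Sum>h\<in>B. K * (y f t \<bullet> y f t + y h t \<bullet> y h t))"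
        proof (rule sum_mono)
          fix h assume h: "h \<in> B"
          have "0 \<le> K" using K[OF f h t] norm_ge_zero order_trans by blast
          moreover have "2 * norm (y f t) * norm (y h t) \<le> y f t \<bullet> y f t + y h t \<bullet> y h t"
            using sum_squares_bound[of "norm (y f t)" "norm (y h t)"] by (simp add: power2_norm_eq_inner)
          ultimately show "K * (2 * norm (y f t) * norm (y h t)) \<le> K * (y f t \<bullet> y f t + y h t \<bullet> y h t)"
            by (rule mult_left_mono[rotated])
        qed
        finally show ?thesis .
      qed
      have "\<bar>\<Sum>f\<in>B. 2 * (y f t \<bullet> y' f t)\<bar> \<le> (\<Sum>f\<in>B. \<bar>2 * (y f t \<bullet> y' f t)\<bar>)" by (rule sum_abs)
      also have "\<dots> \<le> (\<Sum>f\<in>B. \<Sum>h\<in>B. K * (y f t \<bullet> y f t + y h t \<bullet> y h t))" by (rule sum_mono) (rule bnd)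
      also have "\<dots> = 2 * (real (card B) * K) * u t"
        by (simp add: u_def distrib_left sum.distrib sum_distrib_left[symmetric] sum_distrib_right[symmetric])
      finally show ?thesis .
    qed
    show "0 \<le> u t" for t by (auto simp: u_def intro: sum_nonneg)
    show "u t0 = 0" using t0 by (simp add: u_def)
  qed (use t t0 in auto)
  then show ?thesis using B f by (simp add: u_def sum_nonneg_eq_0_iff)
qed

context complex_affine_poisson_algebra begin

text \<open>The elements of this form make an ideal \<open>K\<close> containing the nilradical and
  \<open>B\<close>, hence \<open>J\<close>. The multipliers \<open>d\<close> will supply the matrix
  of a linear differential equation.\<close>

lemma ideal_combination:
  assumes ne: "maxspec A \<noteq> {}" and J: "ideal J A"
  shows "\<exists>B. finite B \<and> B \<subseteq> J \<and>
    (\<forall>a\<in>J. \<exists>d\<in>B \<rightarrow> carrier A. \<forall>x\<in>maxspec A. eval_at A x a = (\<Sum>f\<in>B. eval_at A x (d f) * eval_at A x f))"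
proof -
  from finitely_generated_mod_nilrad[OF ne J] obtain B where
    B0: "finite B \<and> B \<subseteq> J \<and> (\<forall>J'. ideal J' A \<longrightarrow> nilrad \<subseteq> J' \<longrightarrow> B \<subseteq> J' \<longrightarrow> J \<subseteq> J')" ..
  then have B: "finite B" "B \<subseteq> J" and BJ: "\<And>J'. ideal J' A \<Longrightarrow> nilrad \<subseteq> J' \<Longrightarrow> B \<subseteq> J' \<Longrightarrow> J \<subseteq> J'" by simp_all
  have BA: "B \<subseteq> carrier A" using B ideal_subset[OF J] by blast
  define K where "K = {a \<in> carrier A. \<exists>d\<in>B \<rightarrow> carrier A. \<forall>x\<in>maxspec A. eval_at A x a = (\<Sum>f\<in>B. eval_at A x (d f) * eval_at A x f)}"
  have KI: "a \<in> K" if "a \<in> carrier A" "d \<in> B \<rightarrow> carrier A"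
    "\<And>x. x \<in> maxspec A \<Longrightarrow> eval_at A x a = (\<Sum>f\<in>B. eval_at A x (d f) * eval_at A x f)" for a d
    unfolding K_def using that by blast
  have mul: "c \<otimes> a \<in> K" if a: "a \<in> K" and c: "c \<in> carrier A" for a c
  proof -
    obtain d where d: "a \<in> carrier A" "d \<in> B \<rightarrow> carrier A"
      "\<And>x. x \<in> maxspec A \<Longrightarrow> eval_at A x a = (\<Sum>f\<in>B. eval_at A x (d f) * eval_at A x f)" using a unfolding K_def by blast
    show ?thesis
    proof (rule KI[of _ "\<lambda>f. c \<otimes> d f"])
      fix x assume x: "x \<in> maxspec A"
      have "(\<Sum>f\<in>B. eval_at A x (c \<otimes> d f) * eval_at A x f) = (\<Sum>f\<in>B. eval_at A x c * (eval_at A x (d f) * eval_at A x f))"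
        using c d(2) by (intro sum.cong) (auto simp: eval_at_simps(2)[OF x] Pi_iff)
      then show "eval_at A x (c \<otimes> a) = (\<Sum>f\<in>B. eval_at A x (c \<otimes> d f) * eval_at A x f)"
        using c d by (simp add: eval_at_simps(2)[OF x] d(3)[OF x] sum_distrib_left)
    qed (use c d in auto)
  qed
  have "ideal K A"
  proof (rule idealI[OF ring_axioms])
    show "subgroup K (add_monoid A)"
    proof (rule add.subgroupI)
      show KA: "K \<subseteq> carrier A" by (auto simp: K_def)
      have "\<zero> \<in> K" by (rule KI[of _ "\<lambda>_. \<zero>"]) (auto simp: eval_at_simps)
      then show "K \<noteq> {}" by blast
      show "\<ominus> a \<in> K" if "a \<in> K" for a
      proof -
        have "a \<in> carrier A" using that KA by blast
        then have "\<ominus> a = (\<ominus> \<one>) \<otimes> a" by (simp add: l_minus)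
        then show ?thesis using mul[OF that, of "\<ominus> \<one>"] by simp
      qed
      fix a b assume "a \<in> K" "b \<in> K"
      then obtain d e where d: "a \<in> carrier A" "d \<in> B \<rightarrow> carrier A"
          "\<And>x. x \<in> maxspec A \<Longrightarrow> eval_at A x a = (\<Sum>f\<in>B. eval_at A x (d f) * eval_at A x f)"
        and e: "b \<in> carrier A" "e \<in> B \<rightarrow> carrier A"
          "\<And>x. x \<in> maxspec A \<Longrightarrow> eval_at A x b = (\<Sum>f\<in>B. eval_at A x (e f) * eval_at A x f)" unfolding K_def by blast
      show "a \<oplus> b \<in> K"
      proof (rule KI[of _ "\<lambda>f. d f \<oplus> e f"])
        fix x assume x: "x \<in> maxspec A"
        have "(\<Sum>f\<in>B. eval_at A x (d f \<oplus> e f) * eval_at A x f) =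
            (\<Sum>f\<in>B. eval_at A x (d f) * eval_at A x f + eval_at A x (e f) * eval_at A x f)"
          using d(2) e(2) by (intro sum.cong) (auto simp: eval_at_simps(1)[OF x] Pi_iff distrib_right)
        then show "eval_at A x (a \<oplus> b) = (\<Sum>f\<in>B. eval_at A x (d f \<oplus> e f) * eval_at A x f)"
          using d(1) e(1) by (simp add: eval_at_simps(1)[OF x] d(3)[OF x] e(3)[OF x] sum.distrib)
      qed (use d e in auto)
    qed
    show "c \<otimes> a \<in> K" if "a \<in> K" "c \<in> carrier A" for a c by (rule mul[OF that])
    show "a \<otimes> c \<in> K" if "a \<in> K" "c \<in> carrier A" for a c
    proof -
      have "a \<in> carrier A" using that by (simp add: K_def)
      then have "a \<otimes> c = c \<otimes> a" using that by (simp add: m_comm)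
      then show ?thesis using mul[OF that] by simp
    qed
  qed
  moreover have "nilrad \<subseteq> K"
  proof
    fix a assume a: "a \<in> nilrad"
    then have "a \<in> carrier A" "\<And>x. x \<in> maxspec A \<Longrightarrow> eval_at A x a = 0"
      using eval_at_simps(8) by (auto simp: vanishing_ideal_def)
    then show "a \<in> K" by (intro KI[of _ "\<lambda>_. \<zero>"]) (auto simp: eval_at_simps)
  qed
  moreover have "B \<subseteq> K"
  proof
    fix g assume g: "g \<in> B"
    show "g \<in> K"
    proof (rule KI[of _ "\<lambda>f. if f = g then \<one> else \<zero>"])
      fix x assume x: "x \<in> maxspec A"
      have "(\<Sum>f\<in>B. eval_at A x (if f = g then \<one> else \<zero>) * eval_at A x f) = (\<Sum>f\<in>B. if f = g then eval_at A x f else 0)"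
        by (intro sum.cong) (auto simp: eval_at_simps[OF x])
      then show "eval_at A x g = (\<Sum>f\<in>B. eval_at A x (if f = g then \<one> else \<zero>) * eval_at A x f)"
        using B g by simp
    qed (use g BA in auto)
  qed
  ultimately have "J \<subseteq> K" by (rule BJ)
  then show ?thesis using B unfolding K_def by blast
qed

text \<open>Along the curve the derivative of a generator f of \<open>P\<close> is a combination of
  the values of {a, f}. These brackets lie in \<open>P\<close> and are again combinations of the
  generators, so the generators satisfy a homogeneous linear system and vanish throughout once they
  vanish at \<open>t0\<close>.\<close>

lemma hamiltonian_curve_mem:
  assumes cur: "hamiltonian_curve A M T \<gamma>" and M: "M \<subseteq> maxspec A"
    and P: "poisson_ideal A P" and t0: "t0 \<in> {0..T}" "P \<subseteq> \<gamma> t0" and t: "t \<in> {0..T}"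
  shows "P \<subseteq> \<gamma> t"
proof -
  have \<gamma>: "\<gamma> s \<in> maxspec A" if "s \<in> {0..T}" for s using cur M that by (auto simp: hamiltonian_curve_def)
  have PI: "ideal P A" and br: "\<And>x c. x \<in> P \<Longrightarrow> c \<in> carrier A \<Longrightarrow> \<lbrace>x, c\<rbrace> \<in> P"
    using P by (auto simp: poisson_ideal_def)
  have PA: "P \<subseteq> carrier A" by (rule ideal_subset[OF PI])
  obtain S U F D where S: "finite S" "S \<subseteq> carrier A" and hol: "holomorphic_partials S U F D"
    and inU: "\<And>s. s \<in> {0..T} \<Longrightarrow> eval_coords A S (\<gamma> s) \<in> U"
    and der: "\<And>s b. s \<in> {0..T} \<Longrightarrow> b \<in> carrier A \<Longrightarrow> ((\<lambda>s. eval_at A (\<gamma> s) b) has_vector_derivative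
         (\<Sum>a\<in>S. D a (eval_coords A S (\<gamma> s)) * eval_at A (\<gamma> s) \<lbrace>a, b\<rbrace>)) (at s within {0..T})"
  proof -
    from cur[unfolded hamiltonian_curve_def, THEN conjunct2] obtain S U F D where
      "finite S \<and> S \<subseteq> carrier A \<and> holomorphic_partials S U F D \<and>
        (\<forall>t\<in>{0..T}. eval_coords A S (\<gamma> t) \<in> U \<and>
           (\<forall>b\<in>carrier A.
              ((\<lambda>s. eval_at A (\<gamma> s) b) has_vector_derivative
                (\<Sum>a\<in>S. D a (eval_coords A S (\<gamma> t)) * eval_at A (\<gamma> t) \<lbrace>a, b\<rbrace>))
              (at t within {0..T})))" by (elim exE)
    then show thesis by (intro that[of S U F D]) simp_all
  qed
  have ne: "maxspec A \<noteq> {}" using \<gamma>[OF t] by blast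
  from ideal_combination[OF ne PI] obtain B where
    B0: "finite B \<and> B \<subseteq> P \<and> (\<forall>a\<in>P. \<exists>d\<in>B \<rightarrow> carrier A. \<forall>x\<in>maxspec A. eval_at A x a = (\<Sum>f\<in>B. eval_at A x (d f) * eval_at A x f))" ..
  then have B: "finite B" "B \<subseteq> P" by simp_all
  have comb: "\<exists>d\<in>B \<rightarrow> carrier A. \<forall>x\<in>maxspec A. eval_at A x a = (\<Sum>f\<in>B. eval_at A x (d f) * eval_at A x f)" if "a \<in> P" for a
    using B0 that by simp
  have BA: "B \<subseteq> carrier A" using B PA by blast
  have "\<lbrace>a, f\<rbrace> \<in> P" if "a \<in> S" "f \<in> B" for a f
  proof -
    have af: "a \<in> carrier A" "f \<in> carrier A" "f \<in> P" using that S B BA by auto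
    then have "\<ominus> \<lbrace>f, a\<rbrace> \<in> P" by (intro ideal_closed(3)[OF PI] br)
    then show ?thesis using bracket_skew[OF af(1,2)] by simp
  qed
  then have ex: "\<forall>a\<in>S. \<forall>f\<in>B. \<exists>d. d \<in> B \<rightarrow> carrier A \<and> (\<forall>x\<in>maxspec A. eval_at A x \<lbrace>a, f\<rbrace> = (\<Sum>h\<in>B. eval_at A x (d h) * eval_at A x h))"
    using comb by (simp add: Bex_def)
  define e where "e a f = (SOME d. d \<in> B \<rightarrow> carrier A \<and>
    (\<forall>x\<in>maxspec A. eval_at A x \<lbrace>a, f\<rbrace> = (\<Sum>h\<in>B. eval_at A x (d h) * eval_at A x h)))" for a f
  have e0: "e a f \<in> B \<rightarrow> carrier A \<and> (\<forall>x\<in>maxspec A. eval_at A x \<lbrace>a, f\<rbrace> = (\<Sum>h\<in>B. eval_at A x (e a f h) * eval_at A x h))"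
    if "a \<in> S" "f \<in> B" for a f
    unfolding e_def by (rule someI_ex[OF bspec[OF bspec[OF ex that(1)] that(2)]])
  have e: "\<And>a f. a \<in> S \<Longrightarrow> f \<in> B \<Longrightarrow> e a f \<in> B \<rightarrow> carrier A"
    "\<And>a f x. a \<in> S \<Longrightarrow> f \<in> B \<Longrightarrow> x \<in> maxspec A \<Longrightarrow> eval_at A x \<lbrace>a, f\<rbrace> = (\<Sum>h\<in>B. eval_at A x (e a f h) * eval_at A x h)"
    using e0 by simp_all
  \<comment> \<open>The matrix of that system. Its entries are continuous because the partial
    derivatives and the coordinates along the curve are.\<close>
  define N where "N f h s = (\<Sum>a\<in>S. D a (eval_coords A S (\<gamma> s)) * eval_at A (\<gamma> s) (e a f h))" for f h s
  have cont_eval: "continuous_on {0..T} (\<lambda>s. eval_at A (\<gamma> s) b)" if "b \<in> carrier A" for b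
    unfolding continuous_on_eq_continuous_within
    using has_vector_derivative_continuous[OF der[OF _ that]] by blast
  have cont_coords: "continuous_on {0..T} (\<lambda>s. eval_coords A S (\<gamma> s))"
  proof (rule continuous_on_coordinatewise_then_product)
    fix i
    show "continuous_on {0..T} (\<lambda>s. eval_coords A S (\<gamma> s) i)"
      using cont_eval[of i] S(2) by (cases "i \<in> S") (auto simp: eval_coords_def)
  qed
  have contD: "continuous_on {0..T} (\<lambda>s. D a (eval_coords A S (\<gamma> s)))" if "a \<in> S" for a
  proof (rule continuous_on_compose2[OF _ cont_coords])
    show "continuous_on U (D a)" using hol that by (simp add: holomorphic_partials_def)
    show "(\<lambda>s. eval_coords A S (\<gamma> s)) ` {0..T} \<subseteq> U" using inU by blast
  qed
  have zero: "eval_at A (\<gamma> t) f = 0" if f: "f \<in> B" for f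
  proof (rule linear_ode_zero[where y = "\<lambda>f s. eval_at A (\<gamma> s) f" and M = N, OF B(1) _ _ t0(1) _ t f])
    show "eval_at A (\<gamma> t0) f = 0" if "f \<in> B" for f
      using eval_at_simps(8)[OF \<gamma>[OF t0(1)], of f] that BA B t0(2) by blast
    show "continuous_on {0..T} (N f h)" if "f \<in> B" "h \<in> B" for f h
      unfolding N_def
    proof (intro continuous_on_sum continuous_on_mult contD cont_eval)
      fix a assume "a \<in> S"
      then show "e a f h \<in> carrier A" using e(1)[of a f] that by blast
    qed
    fix f s assume f: "f \<in> B" and s: "s \<in> {0..T}"
    have "(\<Sum>h\<in>B. N f h s * eval_at A (\<gamma> s) h) = (\<Sum>h\<in>B. \<Sum>a\<in>S. D a (eval_coords A S (\<gamma> s)) * (eval_at A (\<gamma> s) (e a f h) * eval_at A (\<gamma> s) h))"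
      unfolding N_def by (simp add: sum_distrib_right mult.assoc)
    also have "\<dots> = (\<Sum>a\<in>S. \<Sum>h\<in>B. D a (eval_coords A S (\<gamma> s)) * (eval_at A (\<gamma> s) (e a f h) * eval_at A (\<gamma> s) h))"
      by (rule sum.swap)
    also have "\<dots> = (\<Sum>a\<in>S. D a (eval_coords A S (\<gamma> s)) * eval_at A (\<gamma> s) \<lbrace>a, f\<rbrace>)"
      by (intro sum.cong refl) (simp add: e(2)[OF _ f \<gamma>[OF s]] sum_distrib_left)
    finally show "((\<lambda>s. eval_at A (\<gamma> s) f) has_vector_derivative (\<Sum>h\<in>B. N f h s * eval_at A (\<gamma> s) h)) (at s within {0..T})"
      using der[OF s, of f] f BA by auto
  qed
  show ?thesis
  proof
    fix a assume a: "a \<in> P"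
    then obtain d where d: "\<forall>x\<in>maxspec A. eval_at A x a = (\<Sum>f\<in>B. eval_at A x (d f) * eval_at A x f)" using comb by blast
    have "eval_at A (\<gamma> t) a = (\<Sum>f\<in>B. eval_at A (\<gamma> t) (d f) * eval_at A (\<gamma> t) f)" using d \<gamma>[OF t] by simp
    also have "\<dots> = 0" using zero by (intro sum.neutral) auto
    finally show "a \<in> \<gamma> t" using eval_at_simps(8)[OF \<gamma>[OF t], of a] a PA by blast
  qed
qed

lemma hamiltonian_step_core:
  assumes step: "hamiltonian_step A M m n" and M: "M \<subseteq> maxspec A"
  shows "poisson_core A m = poisson_core A n"
proof -
  obtain T \<gamma> where T: "0 \<le> T" "hamiltonian_curve A M T \<gamma>" "\<gamma> 0 = m" "\<gamma> T = n"
    using step unfolding hamiltonian_step_def by blast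
  have ends: "0 \<in> {0..T}" "T \<in> {0..T}" using T(1) by auto
  then have mn: "m \<in> maxspec A" "n \<in> maxspec A" using T M by (auto simp: hamiltonian_curve_def)
  have I: "ideal m A" "ideal n A" using mn by (simp_all add: maxspec_def maximalideal.axioms(1))
  note cm = poisson_core_greatest[OF I(1)] and cn = poisson_core_greatest[OF I(2)]
  have "poisson_core A m \<subseteq> n"
    using hamiltonian_curve_mem[OF T(2) M cm(1) ends(1) _ ends(2)] cm(2) T(3,4) by simp
  moreover have "poisson_core A n \<subseteq> m"
    using hamiltonian_curve_mem[OF T(2) M cn(1) ends(2) _ ends(1)] cn(2) T(3,4) by simp
  ultimately show ?thesis by (intro equalityI cm(3)[OF cn(1)] cn(3)[OF cm(1)])
qed

lemma symplectic_leaf_core: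
  assumes n: "n \<in> symplectic_leaf A M m" and M: "M \<subseteq> maxspec A"
  shows "poisson_core A n = poisson_core A m"
proof -
  have "(hamiltonian_step A M)\<^sup>*\<^sup>* m n" using n by (simp add: symplectic_leaf_def)
  then show ?thesis by (induction rule: rtranclp_induct) (use hamiltonian_step_core[OF _ M] in auto)
qed

lemma smooth_stratum_subset: "smooth_stratum A i \<subseteq> maxspec A"
proof -
  have "sing_filtration A i \<subseteq> maxspec A"
    by (induction i) (auto simp: singular_locus_def Let_def)
  then show ?thesis by (auto simp: smooth_stratum_def)
qed

end

section \<open>Generic smoothness of closed subvarieties\<close>

text \<open>Since \<open>p\<close> contains the kernel, it is a union of fibres of \<open>h\<close>,
  and its image is prime. This moves chains of primes down to A/I and to the coordinate ring of a
  component.\<close>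

lemma primeideal_image:
  assumes h: "ring_hom_ring A S h" and S: "cring S" and surj: "h ` carrier A = carrier S"
    and p: "primeideal p A" and ker: "\<And>a. a \<in> carrier A \<Longrightarrow> h a = \<zero>\<^bsub>S\<^esub> \<Longrightarrow> a \<in> p"
  shows "primeideal (h ` p) S" "\<And>a. a \<in> carrier A \<Longrightarrow> h a \<in> h ` p \<longleftrightarrow> a \<in> p"
proof -
  interpret S: cring S by (rule S)
  interpret h: ring_hom_ring A S h by (rule h)
  interpret p: primeideal p A by (rule p)
  have pA: "\<And>a. a \<in> p \<Longrightarrow> a \<in> carrier A" using p.a_subset by blast
  show mem: "h a \<in> h ` p \<longleftrightarrow> a \<in> p" if a: "a \<in> carrier A" for a
  proof
    assume "h a \<in> h ` p"
    then obtain b where b: "b \<in> p" "h a = h b" by blast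
    have "h (a \<ominus>\<^bsub>A\<^esub> b) = \<zero>\<^bsub>S\<^esub>" using a b(2) pA[OF b(1)] by (simp add: a_minus_def S.r_neg)
    then have "a \<ominus>\<^bsub>A\<^esub> b \<in> p" using a pA[OF b(1)] by (intro ker) simp_all
    then have "(a \<ominus>\<^bsub>A\<^esub> b) \<oplus>\<^bsub>A\<^esub> b \<in> p" using b(1) by (rule p.a_closed)
    then show "a \<in> p" using a pA[OF b(1)] by (simp add: a_minus_def h.R.a_assoc h.R.l_neg)
  qed blast
  have mult: "s \<otimes>\<^bsub>S\<^esub> u \<in> h ` p" if u: "u \<in> h ` p" and s: "s \<in> carrier S" for u s
  proof -
    obtain a where a: "a \<in> p" "u = h a" using u by blast
    obtain b where b: "b \<in> carrier A" "s = h b" using s surj by blast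
    have "s \<otimes>\<^bsub>S\<^esub> u = h (b \<otimes>\<^bsub>A\<^esub> a)" using a(2) b pA[OF a(1)] by simp
    moreover have "b \<otimes>\<^bsub>A\<^esub> a \<in> p" using a b by (simp add: p.I_l_closed)
    ultimately show ?thesis by blast
  qed
  have sub: "h ` p \<subseteq> carrier S" using pA by auto
  have I: "ideal (h ` p) S"
  proof (rule idealI[OF S.ring_axioms])
    show "subgroup (h ` p) (add_monoid S)"
    proof (rule S.add.subgroupI)
      show "h ` p \<subseteq> carrier S" by (rule sub)
      show "h ` p \<noteq> {}" using additive_subgroup.zero_closed[OF p.additive_subgroup_axioms] by blast
      show "\<ominus>\<^bsub>S\<^esub> u \<in> h ` p" if "u \<in> h ` p" for u
      proof -
        have "u \<in> carrier S" using that sub by blast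
        then have "\<ominus>\<^bsub>S\<^esub> u = (\<ominus>\<^bsub>S\<^esub> \<one>\<^bsub>S\<^esub>) \<otimes>\<^bsub>S\<^esub> u" by (simp add: S.l_minus)
        then show ?thesis using mult[OF that] by simp
      qed
      fix u v assume "u \<in> h ` p" "v \<in> h ` p"
      then obtain a b where ab: "a \<in> p" "u = h a" "b \<in> p" "v = h b" by blast
      have "u \<oplus>\<^bsub>S\<^esub> v = h (a \<oplus>\<^bsub>A\<^esub> b)" using ab(2,4) pA[OF ab(1)] pA[OF ab(3)] by simp
      moreover have "a \<oplus>\<^bsub>A\<^esub> b \<in> p" using ab(1,3) by (rule p.a_closed)
      ultimately show "u \<oplus>\<^bsub>S\<^esub> v \<in> h ` p" by blast
    qed
    fix u s assume u: "u \<in> h ` p" "s \<in> carrier S"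
    show "s \<otimes>\<^bsub>S\<^esub> u \<in> h ` p" by (rule mult[OF u])
    then show "u \<otimes>\<^bsub>S\<^esub> s \<in> h ` p" using u sub S.m_comm[of u s] by auto
  qed
  show "primeideal (h ` p) S"
  proof (rule primeidealI[OF I S])
    have "\<one>\<^bsub>A\<^esub> \<notin> p" using p.one_imp_carrier p.I_notcarr by auto
    then have "h \<one>\<^bsub>A\<^esub> \<notin> h ` p" using mem[OF h.R.one_closed] by blast
    then show "carrier S \<noteq> h ` p" by (metis S.one_closed h.hom_one)
    fix u v assume u: "u \<in> carrier S" and v: "v \<in> carrier S" and uv: "u \<otimes>\<^bsub>S\<^esub> v \<in> h ` p"
    obtain a where a: "a \<in> carrier A" "u = h a" using u surj by blast
    obtain b where b: "b \<in> carrier A" "v = h b" using v surj by blast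
    have "h (a \<otimes>\<^bsub>A\<^esub> b) \<in> h ` p" using a b uv by simp
    then have "a \<otimes>\<^bsub>A\<^esub> b \<in> p" using mem[OF h.R.m_closed[OF a(1) b(1)]] by blast
    then show "u \<in> h ` p \<or> v \<in> h ` p" using p.I_prime a b by blast
  qed
qed

context complex_affine_poisson_algebra begin

lemma ideal_vanishing: assumes Z: "Z \<subseteq> maxspec A" shows "ideal (vanishing_ideal A Z) A"
proof -
  have I: "\<And>m. m \<in> Z \<Longrightarrow> ideal m A" using Z by (auto simp: maxspec_def maximalideal.axioms(1))
  show ?thesis
  proof (rule idealI[OF ring_axioms])
    show "subgroup (vanishing_ideal A Z) (add_monoid A)"
    proof (rule add.subgroupI)
      have "\<zero> \<in> vanishing_ideal A Z" using I ideal_closed(1) by (auto simp: vanishing_ideal_def)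
      then show "vanishing_ideal A Z \<noteq> {}" by blast
    qed (use I in \<open>auto simp: vanishing_ideal_def intro: ideal_closed\<close>)
  qed (use I in \<open>auto simp: vanishing_ideal_def intro: ideal_closed\<close>)
qed

lemma nilrad_subset_vanishing: "Z \<subseteq> maxspec A \<Longrightarrow> nilrad \<subseteq> vanishing_ideal A Z"
  by (auto simp: vanishing_ideal_def)

lemma ideal_colon: assumes I: "ideal I A" and g: "g \<in> carrier A" shows "ideal {x \<in> carrier A. x \<otimes> g \<in> I} A"
proof (rule idealI[OF ring_axioms])
  show "subgroup {x \<in> carrier A. x \<otimes> g \<in> I} (add_monoid A)"
  proof (rule add.subgroupI)
    have "\<zero> \<in> {x \<in> carrier A. x \<otimes> g \<in> I}" using g ideal_closed(1)[OF I] by simp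
    then show "{x \<in> carrier A. x \<otimes> g \<in> I} \<noteq> {}" by blast
  qed (use g ideal_closed(2,3)[OF I] in \<open>auto simp: l_minus l_distr\<close>)
  fix x c assume x: "x \<in> {x \<in> carrier A. x \<otimes> g \<in> I}" and c: "c \<in> carrier A"
  then have "c \<otimes> (x \<otimes> g) \<in> I" using ideal_closed(5)[OF I] by blast
  then show "c \<otimes> x \<in> {x \<in> carrier A. x \<otimes> g \<in> I}" "x \<otimes> c \<in> {x \<in> carrier A. x \<otimes> g \<in> I}"
    using x c g by (simp_all add: m_assoc m_lcomm)
qed

lemma vanishing_prime: assumes "primeideal p A" shows "vanishing_ideal A {m \<in> maxspec A. p \<subseteq> m} = p"
proof
  show "vanishing_ideal A {m \<in> maxspec A. p \<subseteq> m} \<subseteq> p"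
    using jacobson[OF assms] by (auto simp: vanishing_ideal_def)
  show "p \<subseteq> vanishing_ideal A {m \<in> maxspec A. p \<subseteq> m}"
    using ideal_subset[OF primeideal.axioms(1)[OF assms]] by (auto simp: vanishing_ideal_def)
qed

text \<open>An irreducible component of the closure of \<open>Z\<close>, which is all of it where \<open>g \<noteq> 0\<close>.\<close>

lemma exists_component:
  assumes Z: "Z \<subseteq> maxspec A" "Z \<noteq> {}"
  defines "I \<equiv> vanishing_ideal A Z"
  shows "\<exists>p g. primeideal p A \<and> I \<subseteq> p \<and> g \<in> carrier A \<and> g \<notin> p \<and> (\<forall>x\<in>p. x \<otimes> g \<in> I)"
proof -
  have ne: "maxspec A \<noteq> {}" using Z by blast
  have II: "ideal I A" unfolding I_def by (rule ideal_vanishing[OF Z(1)])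
  obtain z where z: "z \<in> Z" using Z(2) by blast
  have zp: "primeideal z A" using z Z(1) maxspec_prime by blast
  have "\<one> \<notin> z" using ideal.one_imp_carrier[OF primeideal.axioms(1)[OF zp]] primeideal.I_notcarr[OF zp] by auto
  then have oneI: "\<one> \<notin> I" using z by (auto simp: I_def vanishing_ideal_def)
  \<comment> \<open>The colon ideals of \<open>I\<close> by elements outside \<open>I\<close>; as
    for associated primes, a maximal one is prime.\<close>
  define col where "col g = {x \<in> carrier A. x \<otimes> g \<in> I}" for g
  define \<F> where "\<F> = col ` (carrier A - I)"
  have "\<exists>J\<in>\<F>. \<forall>J'\<in>\<F>. J \<subseteq> J' \<longrightarrow> J' = J"
  proof (rule maximal_ideal_in_family[OF ne])
    show "col \<one> \<in> \<F>" using oneI by (auto simp: \<F>_def)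
    fix J assume "J \<in> \<F>"
    then obtain g where g: "g \<in> carrier A" "J = col g" by (auto simp: \<F>_def)
    show "ideal J A" unfolding g(2) col_def by (rule ideal_colon[OF II g(1)])
    have "x \<otimes> g \<in> I" if "x \<in> I" for x using ideal_closed(6)[OF II that g(1)] .
    then have "I \<subseteq> J" using ideal_subset[OF II] by (auto simp: g(2) col_def)
    then show "nilrad \<subseteq> J" using nilrad_subset_vanishing[OF Z(1)] by (auto simp: I_def)
  qed
  then obtain J where J: "J \<in> \<F>" "\<And>J'. J' \<in> \<F> \<Longrightarrow> J \<subseteq> J' \<Longrightarrow> J' = J" by blast
  then obtain g where g: "g \<in> carrier A" "g \<notin> I" "J = col g" by (auto simp: \<F>_def)
  have JI: "ideal J A" unfolding g(3) col_def by (rule ideal_colon[OF II g(1)])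
  have "primeideal J A"
  proof (rule primeidealI[OF JI M_cring])
    have "\<one> \<notin> J" using g by (simp add: col_def)
    then show "carrier A \<noteq> J" by auto
    fix x y assume x: "x \<in> carrier A" and y: "y \<in> carrier A" and xy: "x \<otimes> y \<in> J"
    show "x \<in> J \<or> y \<in> J"
    proof (cases "x \<in> J")
      case False
      then have "x \<otimes> g \<notin> I" using x by (simp add: g(3) col_def)
      then have F: "col (x \<otimes> g) \<in> \<F>" using x g by (auto simp: \<F>_def)
      have "J \<subseteq> col (x \<otimes> g)"
      proof
        fix w assume w: "w \<in> J"
        then have wc: "w \<in> carrier A" "w \<otimes> g \<in> I" by (auto simp: g(3) col_def)
        have "x \<otimes> (w \<otimes> g) \<in> I" by (rule ideal_closed(5)[OF II wc(2) x])
        then show "w \<in> col (x \<otimes> g)" using wc x g by (simp add: col_def m_lcomm)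
      qed
      then have "col (x \<otimes> g) = J" by (rule J(2)[OF F])
      moreover have "y \<in> col (x \<otimes> g)" using xy x y g(1) by (simp add: g(3) col_def m_assoc m_lcomm)
      ultimately show ?thesis by blast
    qed simp
  qed
  moreover have "I \<subseteq> J" using ideal_closed(6)[OF II _ g(1)] ideal_subset[OF II] by (auto simp: g(3) col_def)
  \<comment> \<open>A vanishing ideal is radical: with g^2 it contains g.\<close>
  moreover have "g \<notin> J"
  proof
    assume "g \<in> J"
    then have gg: "g \<otimes> g \<in> I" by (simp add: g(3) col_def)
    have "g \<in> m" if m: "m \<in> Z" for m
    proof -
      have "primeideal m A" using m Z(1) maxspec_prime by blast
      then show ?thesis using primeideal.I_prime[of m A g g] gg m g(1) by (auto simp: I_def vanishing_ideal_def)
    qed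
    then have "g \<in> I" using g(1) by (auto simp: I_def vanishing_ideal_def)
    then show False using g(2) by simp
  qed
  moreover have "\<forall>x\<in>J. x \<otimes> g \<in> I" by (simp add: g(3) col_def)
  ultimately show ?thesis using g(1) by blast
qed

section \<open>Height and cotangent space at a point on a single component\<close>

text \<open>Away from g = 0 the closure of \<open>Z\<close> coincides with the irreducible component
  given by \<open>p\<close>. At a point m with g outside m, height and cotangent space of A/I may
  therefore be computed in the domain A/p, which is realised as \<open>Rp\<close>.\<close>

context
  fixes Z p g m
  assumes Z: "Z \<subseteq> maxspec A" and p: "primeideal p A" "vanishing_ideal A Z \<subseteq> p"
    and g: "g \<in> carrier A" "\<And>x. x \<in> p \<Longrightarrow> x \<otimes> g \<in> vanishing_ideal A Z"
    and m: "m \<in> Z" "g \<notin> m"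
begin

abbreviation "I \<equiv> vanishing_ideal A Z"
abbreviation "B \<equiv> poisson_quot A I"
abbreviation "V \<equiv> {m \<in> maxspec A. p \<subseteq> m}"
abbreviation "Rp \<equiv> coordinate_ring V"
abbreviation "n \<equiv> (\<lambda>x. I +> x) ` m"

lemma mI: "m \<in> maxspec A" "primeideal m A" "ideal m A" "I \<subseteq> m"
proof -
  show 1: "m \<in> maxspec A" using m Z by blast
  show 2: "primeideal m A" by (rule maxspec_prime[OF 1])
  show "ideal m A" by (rule primeideal.axioms(1)[OF 2])
  show "I \<subseteq> m" using m by (auto simp: vanishing_ideal_def)
qed

text \<open>p g is contained in \<open>I\<close>, so a prime over \<open>I\<close> that misses g
  absorbs p.\<close>

lemma p_subset: "primeideal q A \<Longrightarrow> I \<subseteq> q \<Longrightarrow> g \<notin> q \<Longrightarrow> p \<subseteq> q"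
proof
  fix x assume q: "primeideal q A" "I \<subseteq> q" "g \<notin> q" and x: "x \<in> p"
  have "x \<in> carrier A" using x ideal_subset[OF primeideal.axioms(1)[OF p(1)]] by blast
  then show "x \<in> q" using primeideal.I_prime[OF q(1), of x g] g(1) g(2)[OF x] q by blast
qed

lemma mV: "m \<in> V" using p_subset[OF mI(2,4) m(2)] mI(1) by blast

lemma V: "V \<subseteq> maxspec A" "V \<noteq> {}" using mV by blast+

lemma hat_p: "a \<in> carrier A \<Longrightarrow> hat V a = 0 \<longleftrightarrow> a \<in> p"
  using hat_eq_0_iff[OF V] vanishing_prime[OF p(1)] by simp

lemma hat_m: "hat V a m = eval_at A m a" using mV by (simp add: hat_def pt_def)

lemma hat_nx: "a \<in> carrier A \<Longrightarrow> hat V a \<in> Fn.nx Rp m \<longleftrightarrow> a \<in> m"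
  using eval_at_simps(8)[OF mI(1)] by (simp add: Fn.nx_def hat_m)

lemma csub_Rp: "Fn.csub Rp" by (rule csub_coordinate_ring[OF V])

lemma cdom_Rp: "Fn.cdom Rp"
  unfolding Fn.cdom_def
proof (intro conjI ballI impI csub_Rp)
  fix u v assume "u \<in> Rp" "v \<in> Rp" and uv: "u * v = 0"
  then obtain a b where ab: "a \<in> carrier A" "u = hat V a" "b \<in> carrier A" "v = hat V b" by blast
  then have "hat V (a \<otimes> b) = 0" using uv hat_simps(2)[OF V, of a b] by simp
  then have "a \<otimes> b \<in> p" using hat_p ab by simp
  then show "u = 0 \<or> v = 0" using primeideal.I_prime[OF p(1) ab(1,3)] hat_p ab by blast
qed

lemma hat_hom: "ring_hom_ring A (set_ring Rp) (hat V)"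
proof (rule ring_hom_ringI2)
  show "ring A" by (rule ring_axioms)
  show "ring (set_ring Rp)" using Fn.cring_set_ring[OF csub_Rp] by (simp add: cring_def)
  show "hat V \<in> ring_hom A (set_ring Rp)"
    by (rule ring_hom_memI) (auto simp: hat_simps(1,2,6)[OF V])
qed

lemma Iideal: "ideal I A" by (rule ideal_vanishing[OF Z])

lemma cringB: "cring B" by (rule cring_quot[OF Iideal])

lemma coset_hom: "ring_hom_ring A B (\<lambda>x. I +> x)"
proof (rule ring_hom_ringI2)
  show "ring A" by (rule ring_axioms)
  show "ring B" using cringB by (simp add: cring_def)
  show "(\<lambda>x. I +> x) \<in> ring_hom A B"
    by (rule ring_hom_memI) (simp_all add: quot_ring_simps[OF Iideal])
qed

lemma coset_surj: "(\<lambda>x. I +> x) ` carrier A = carrier B" by (simp add: quot_ring_simps[OF Iideal])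

lemma coset_ker: "a \<in> carrier A \<Longrightarrow> I +> a = \<zero>\<^bsub>B\<^esub> \<longleftrightarrow> a \<in> I"
  using coset_eq_iff[OF Iideal _ zero_closed] by (simp add: quot_ring_simps[OF Iideal] a_minus_def)

lemma hat_surj: "hat V ` carrier A = carrier (set_ring Rp)" by simp

lemma hat_ker: "a \<in> carrier A \<Longrightarrow> hat V a = \<zero>\<^bsub>set_ring Rp\<^esub> \<Longrightarrow> a \<in> p" using hat_p by simp

text \<open>A prime of A/I below \<open>n\<close> pulls back to a prime between \<open>I\<close> and
  m. It misses g, so it contains p and yields a prime of \<open>Rp\<close>. Chains thus correspond
  in both directions: \<open>chain_length_le\<close> bounds those of A/I, and
  \<open>prime_chain\<close> supplies one of length r.\<close>

lemma height_quot:
  assumes gr: "Fn.growth Rp r" and ch: "Fn.prime_chain Rp r m"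
  shows "height B n = enat r"
proof -
  define K where "K = {enat k | k. \<exists>C :: nat \<Rightarrow> 'a set set. (\<forall>i\<le>k. primeideal (C i) B) \<and> (\<forall>i<k. C i \<subset> C (Suc i)) \<and> C k = n}"
  have upper: "k \<le> r" if C: "\<And>i. i \<le> k \<Longrightarrow> primeideal (C i) B" "\<And>i. i < k \<Longrightarrow> C i \<subset> C (Suc i)" "C k = n" for k C
  proof -
    define a where "a i = {x \<in> carrier A. I +> x \<in> C i}" for i
    have pa: "primeideal (a i) A" if "i \<le> k" for i
      unfolding a_def by (rule ring_hom_ring.primeideal_vimage[OF coset_hom M_cring C(1)[OF that]])
    have Ia: "I \<subseteq> a i" if "i \<le> k" for i
    proof
      fix x assume x: "x \<in> I"
      then have xc: "x \<in> carrier A" using ideal_subset[OF Iideal] by blast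
      then have "I +> x = \<zero>\<^bsub>B\<^esub>" using coset_ker x by simp
      moreover have "\<zero>\<^bsub>B\<^esub> \<in> C i"
        by (rule additive_subgroup.zero_closed[OF ideal.axioms(1)[OF primeideal.axioms(1)[OF C(1)[OF that]]]])
      ultimately show "x \<in> a i" using xc by (simp add: a_def)
    qed
    have mono: "a i \<subset> a (Suc i)" if i: "i < k" for i
    proof -
      obtain u where u: "u \<in> C (Suc i)" "u \<notin> C i" using C(2)[OF i] by blast
      have "u \<in> carrier B" using u(1) C(1)[of "Suc i"] i ideal.axioms(1)[THEN additive_subgroup.a_subset] primeideal.axioms(1)
        by (metis Suc_leI in_mono)
      then obtain x where x: "u = I +> x" "x \<in> carrier A" unfolding coset_surj[symmetric] by (rule imageE)
      then have "x \<in> a (Suc i)" "x \<notin> a i" using u by (simp_all add: a_def)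
      moreover have "a i \<subseteq> a (Suc i)" using C(2)[OF i] by (auto simp: a_def)
      ultimately show ?thesis by blast
    qed
    have ak: "a k \<subseteq> m"
    proof
      fix x assume "x \<in> a k"
      then have x: "x \<in> carrier A" "I +> x \<in> n" by (simp_all add: a_def C(3))
      then obtain y where y: "y \<in> m" "I +> x = I +> y" by blast
      have yc: "y \<in> carrier A" using y ideal_subset[OF mI(3)] by blast
      have "x \<ominus> y \<in> m" using coset_eq_iff[OF Iideal x(1) yc] y(2) mI(4) by blast
      then show "x \<in> m" using ideal_diff_mem_iff[OF mI(3) x(1) yc] y(1) by simp
    qed
    have am: "a i \<subseteq> m" if "i \<le> k" for i
      using that
    proof (induction i rule: inc_induct)
      case base then show ?case by (rule ak)
    next
      case (step i) then show ?case using mono[of i] by blast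
    qed
    have pai: "p \<subseteq> a i" if "i \<le> k" for i
      using p_subset[OF pa[OF that] Ia[OF that]] am[OF that] m(2) by blast
    have img: "primeideal (hat V ` a i) (set_ring Rp)" "\<And>x. x \<in> carrier A \<Longrightarrow> hat V x \<in> hat V ` a i \<longleftrightarrow> x \<in> a i" if "i \<le> k" for i
    proof -
      have ker: "\<And>x. x \<in> carrier A \<Longrightarrow> hat V x = \<zero>\<^bsub>set_ring Rp\<^esub> \<Longrightarrow> x \<in> a i" using hat_ker pai[OF that] by blast
      show "primeideal (hat V ` a i) (set_ring Rp)"
        by (rule primeideal_image(1)[OF hat_hom Fn.cring_set_ring[OF csub_Rp] hat_surj pa[OF that] ker])
      show "\<And>x. x \<in> carrier A \<Longrightarrow> hat V x \<in> hat V ` a i \<longleftrightarrow> x \<in> a i"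
        by (rule primeideal_image(2)[OF hat_hom Fn.cring_set_ring[OF csub_Rp] hat_surj pa[OF that] ker])
    qed
    show "k \<le> r"
    proof (rule Fn.chain_length_le[OF cdom_Rp gr])
      show "Fn.cprime Rp (hat V ` a i)" if "i \<le> k" for i
        using img(1)[OF that] by (simp add: Fn.primeideal_set_ring[OF csub_Rp])
      show "hat V ` a i \<subset> hat V ` a (Suc i)" if i: "i < k" for i
      proof -
        obtain x where x: "x \<in> a (Suc i)" "x \<notin> a i" using mono[OF i] by blast
        then have "x \<in> carrier A" by (simp add: a_def)
        then have "hat V x \<notin> hat V ` a i" using img(2)[of i x] x i by simp
        then show ?thesis using mono[OF i] x(1) by blast
      qed
    qed
  qed
  have lower: "enat r \<in> K"
  proof -
    obtain P where P: "\<And>i. i \<le> r \<Longrightarrow> Fn.cprime Rp (P i)" "\<And>i. i < r \<Longrightarrow> P i \<subset> P (Suc i)" "P r = Fn.nx Rp m"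
      using ch unfolding Fn.prime_chain_def by blast
    define a where "a i = {x \<in> carrier A. hat V x \<in> P i}" for i
    have pa: "primeideal (a i) A" if "i \<le> r" for i
    proof -
      have "primeideal (P i) (set_ring Rp)" using P(1)[OF that] by (simp add: Fn.primeideal_set_ring[OF csub_Rp])
      then show ?thesis unfolding a_def by (rule ring_hom_ring.primeideal_vimage[OF hat_hom M_cring])
    qed
    have Ia: "I \<subseteq> a i" if "i \<le> r" for i
    proof
      fix x assume x: "x \<in> I"
      then have xc: "x \<in> carrier A" using ideal_subset[OF Iideal] by blast
      then have "hat V x = 0" using hat_p x p(2) by blast
      then show "x \<in> a i" using xc Fn.cprimeD(2)[OF P(1)[OF that]] by (simp add: a_def)
    qed
    have ar: "a r = m" using hat_nx ideal_subset[OF mI(3)] by (auto simp: a_def P(3))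
    have mono: "a i \<subset> a (Suc i)" if i: "i < r" for i
    proof -
      obtain u where u: "u \<in> P (Suc i)" "u \<notin> P i" using P(2)[OF i] by blast
      have "u \<in> Rp" using u(1) Fn.cprimeD(1)[OF P(1)[of "Suc i"]] i by auto
      then obtain x where x: "u = hat V x" "x \<in> carrier A" by (rule imageE)
      then have "x \<in> a (Suc i)" "x \<notin> a i" using u by (simp_all add: a_def)
      moreover have "a i \<subseteq> a (Suc i)" using P(2)[OF i] by (auto simp: a_def)
      ultimately show ?thesis by blast
    qed
    define C where "C i = (\<lambda>x. I +> x) ` a i" for i
    have ker: "x \<in> carrier A \<Longrightarrow> I +> x = \<zero>\<^bsub>B\<^esub> \<Longrightarrow> x \<in> a i" if "i \<le> r" for x i
      using coset_ker Ia[OF that] by blast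
    have "primeideal (C i) B" if "i \<le> r" for i
      unfolding C_def by (rule primeideal_image(1)[OF coset_hom cringB coset_surj pa[OF that] ker[OF that]])
    moreover have "C i \<subset> C (Suc i)" if i: "i < r" for i
    proof -
      obtain x where x: "x \<in> a (Suc i)" "x \<notin> a i" using mono[OF i] by blast
      then have xc: "x \<in> carrier A" by (simp add: a_def)
      have ir: "i \<le> r" using i by simp
      have "I +> x \<notin> C i" unfolding C_def
        using primeideal_image(2)[OF coset_hom cringB coset_surj pa[OF ir] ker[OF ir] xc] x by simp
      then show ?thesis using mono[OF i] x(1) unfolding C_def by blast
    qed
    moreover have "C r = n" by (simp add: C_def ar)
    ultimately show ?thesis unfolding K_def by blast
  qed
  have "x \<le> enat r" if "x \<in> K" for x
  proof -
    have "\<exists>k C. x = enat k \<and> (\<forall>i\<le>k. primeideal (C i) B) \<and> (\<forall>i<k. C i \<subset> C (Suc i)) \<and> C k = n"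
      using that unfolding K_def by (elim CollectE exE conjE) (intro exI conjI)
    then obtain k C where "x = enat k" "\<forall>i\<le>k. primeideal (C i) B" "\<forall>i<k. C i \<subset> C (Suc i)" "C k = n"
      by (elim exE conjE) (rule that)
    then show ?thesis using upper[of k C] by simp
  qed
  then have "Sup K = enat r" using lower by (intro antisym Sup_least Sup_upper)
  then show ?thesis unfolding height_def K_def .
qed

lemma mem_square_iff:
  assumes a: "a \<in> carrier A"
  shows "I +> a \<in> n \<cdot>\<^bsub>B\<^esub> n \<longleftrightarrow> hat V a \<in> Fn.N2 Rp m"
proof -
  interpret Bc: cring B by (rule cringB)
  note q = quot_ring_simps[OF Iideal]
  have nI: "ideal n B"
    by (rule primeideal.axioms(1)[OF primeideal_image(1)[OF coset_hom cringB coset_surj mI(2)]])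
      (use coset_ker mI(4) in blast)
  have sq: "ideal (n \<cdot>\<^bsub>B\<^esub> n) B" by (rule Bc.ideal_prod_is_ideal[OF nI nI])
  have mA: "m \<subseteq> carrier A" by (rule ideal_subset[OF mI(3)])
  have hatI: "hat V x = hat V y" if "x \<in> carrier A" "y \<in> carrier A" "I +> x = I +> y" for x y
    using that hat_eq_iff[OF V that(1,2)] coset_eq_iff[OF Iideal that(1,2)] vanishing_prime[OF p(1)] p(2) by blast
  have add: "I +> (x \<oplus> y) \<in> n \<cdot>\<^bsub>B\<^esub> n" if "x \<in> carrier A" "y \<in> carrier A" "I +> x \<in> n \<cdot>\<^bsub>B\<^esub> n" "I +> y \<in> n \<cdot>\<^bsub>B\<^esub> n" for x y
    using ideal_prod.sum[OF that(3,4)] that(1,2) by (simp add: q)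
  have scale: "I +> (c \<otimes> x) \<in> n \<cdot>\<^bsub>B\<^esub> n" if "c \<in> carrier A" "x \<in> carrier A" "I +> x \<in> n \<cdot>\<^bsub>B\<^esub> n" for c x
  proof -
    have "(I +> c) \<otimes>\<^bsub>B\<^esub> (I +> x) \<in> n \<cdot>\<^bsub>B\<^esub> n" by (rule ideal.I_l_closed[OF sq that(3)]) (use that in \<open>simp add: q\<close>)
    then show ?thesis using that by (simp add: q)
  qed
  have prod: "I +> (x \<otimes> y) \<in> n \<cdot>\<^bsub>B\<^esub> n" if "x \<in> m" "y \<in> m" for x y
  proof -
    have "(I +> x) \<otimes>\<^bsub>B\<^esub> (I +> y) \<in> n \<cdot>\<^bsub>B\<^esub> n" by (rule ideal_prod.prod) (use that in auto)
    then show ?thesis using that mA by (simp add: q subset_iff)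
  qed
  \<comment> \<open>The kernel p/I of the passage to A/p vanishes in the cotangent space: with c the
    nonzero value of g at m, c x is congruent to x (c - g) modulo \<open>I\<close>, a product of two
    elements of m.\<close>
  have pq: "I +> x \<in> n \<cdot>\<^bsub>B\<^esub> n" if x: "x \<in> p" for x
  proof -
    have xc: "x \<in> carrier A" using x ideal_subset[OF primeideal.axioms(1)[OF p(1)]] by blast
    have xm: "x \<in> m" using x mV by blast
    define c where "c = eval_at A m g"
    have c0: "c \<noteq> 0" using eval_at_simps(8)[OF mI(1) g(1)] m(2) by (simp add: c_def)
    have gc: "g \<ominus> sc c \<in> m" unfolding c_def by (rule eval_at_mem[OF mI(1) g(1)])
    have "x \<otimes> (\<ominus> (g \<ominus> sc c)) = sc c \<otimes> x \<ominus> x \<otimes> g" using xc g(1) sc_in[of c] by algebra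
    moreover have "I +> (x \<otimes> (\<ominus> (g \<ominus> sc c))) \<in> n \<cdot>\<^bsub>B\<^esub> n" by (rule prod[OF xm ideal_closed(3)[OF mI(3) gc]])
    moreover have "I +> (sc c \<otimes> x \<ominus> x \<otimes> g) = I +> (sc c \<otimes> x)"
    proof (subst coset_eq_iff[OF Iideal])
      have "(sc c \<otimes> x \<ominus> x \<otimes> g) \<ominus> sc c \<otimes> x = \<ominus> (x \<otimes> g)" using xc g(1) sc_in[of c] by algebra
      then show "(sc c \<otimes> x \<ominus> x \<otimes> g) \<ominus> sc c \<otimes> x \<in> I" using ideal_closed(3)[OF Iideal g(2)[OF x]] by simp
    qed (use xc g(1) in auto)
    ultimately have "I +> (sc c \<otimes> x) \<in> n \<cdot>\<^bsub>B\<^esub> n" by simp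
    then have "I +> (sc (inverse c) \<otimes> (sc c \<otimes> x)) \<in> n \<cdot>\<^bsub>B\<^esub> n"
      by (rule scale[OF sc_in m_closed[OF sc_in xc]])
    moreover have "sc (inverse c) \<otimes> (sc c \<otimes> x) = x"
      using sc_inverse[OF c0] xc by (simp add: m_assoc[symmetric])
    ultimately show ?thesis by simp
  qed
  show ?thesis
  proof
    have "\<exists>b\<in>carrier A. u = I +> b \<and> hat V b \<in> Fn.N2 Rp m" if "u \<in> n \<cdot>\<^bsub>B\<^esub> n" for u
      using that
    proof (induction rule: ideal_prod.induct)
      case (prod i j)
      then obtain x y where xy: "x \<in> m" "i = I +> x" "y \<in> m" "j = I +> y" by blast
      then have c: "x \<in> carrier A" "y \<in> carrier A" using mA by auto
      have "hat V x * hat V y \<in> Fn.N2 Rp m" using hat_nx c xy by (intro Fn.N2_closed(5)) auto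
      then have "hat V (x \<otimes> y) \<in> Fn.N2 Rp m" using hat_simps(2)[OF V c] by simp
      then show ?case using c xy by (intro bexI[of _ "x \<otimes> y"]) (simp_all add: q)
    next
      case (sum u v)
      then obtain b c where b: "b \<in> carrier A" "u = I +> b" "hat V b \<in> Fn.N2 Rp m"
        and c: "c \<in> carrier A" "v = I +> c" "hat V c \<in> Fn.N2 Rp m" by blast
      have "hat V (b \<oplus> c) \<in> Fn.N2 Rp m" using hat_simps(1)[OF V b(1) c(1)] Fn.N2_closed(2)[OF b(3) c(3)] by simp
      then show ?case using b c by (intro bexI[of _ "b \<oplus> c"]) (simp_all add: q)
    qed
    moreover assume "I +> a \<in> n \<cdot>\<^bsub>B\<^esub> n"
    ultimately obtain b where "b \<in> carrier A" "I +> a = I +> b" "hat V b \<in> Fn.N2 Rp m" by blast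
    then show "hat V a \<in> Fn.N2 Rp m" using hatI[OF a] by simp
  next
    assume h: "hat V a \<in> Fn.N2 Rp m"
    have "\<exists>b\<in>carrier A. u = hat V b \<and> I +> b \<in> n \<cdot>\<^bsub>B\<^esub> n" if "u \<in> Fn.N2 Rp m" for u
      using that unfolding Fn.N2_def
    proof (induction rule: Fn.V.span_induct_alt)
      case base
      have "I +> \<zero> \<in> n \<cdot>\<^bsub>B\<^esub> n" using additive_subgroup.zero_closed[OF ideal.axioms(1)[OF sq]] by (simp add: q)
      then show ?case using hat_simps(7)[OF V] by (intro bexI[of _ \<zero>]) simp_all
    next
      case (step c v y)
      obtain b where b: "b \<in> carrier A" "y = hat V b" "I +> b \<in> n \<cdot>\<^bsub>B\<^esub> n" using step(2) by blast
      obtain v1 v2 where v: "v = v1 * v2" "v1 \<in> Fn.nx Rp m" "v2 \<in> Fn.nx Rp m" using step(1) by blast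
      have "v1 \<in> Rp" "v2 \<in> Rp" using v by (auto simp: Fn.nx_def)
      then obtain x1 x2 where x: "x1 \<in> carrier A" "v1 = hat V x1" "x2 \<in> carrier A" "v2 = hat V x2" by blast
      then have xm: "x1 \<in> m" "x2 \<in> m" using v hat_nx by auto
      have "I +> (sc c \<otimes> (x1 \<otimes> x2)) \<in> n \<cdot>\<^bsub>B\<^esub> n" using x by (intro scale prod[OF xm]) auto
      then have "I +> (sc c \<otimes> (x1 \<otimes> x2) \<oplus> b) \<in> n \<cdot>\<^bsub>B\<^esub> n" using x b by (intro add) auto
      moreover have "(\<lambda>_. c) * v + y = hat V (sc c \<otimes> (x1 \<otimes> x2) \<oplus> b)"
        using x b v by (simp add: hat_simps(1)[OF V] hat_simps(2)[OF V] hat_simps(5)[OF V])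
      ultimately show ?case using x b by (intro bexI[of _ "sc c \<otimes> (x1 \<otimes> x2) \<oplus> b"]) simp_all
    qed
    then obtain b where b: "b \<in> carrier A" "hat V a = hat V b" "I +> b \<in> n \<cdot>\<^bsub>B\<^esub> n" using h by blast
    have "a \<ominus> b \<in> p" using hat_eq_iff[OF V a b(1)] b(2) vanishing_prime[OF p(1)] by simp
    then have "I +> ((a \<ominus> b) \<oplus> b) \<in> n \<cdot>\<^bsub>B\<^esub> n" using a b pq by (intro add) auto
    moreover have "(a \<ominus> b) \<oplus> b = a" using a b(1) by algebra
    ultimately show "I +> a \<in> n \<cdot>\<^bsub>B\<^esub> n" by simp
  qed
qed

text \<open>The cotangent vectors of the \<open>t i\<close> are lifted to elements
  \<open>\<tau> i\<close> of m. The notion of dimension adjoins one vector at a time, so their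
  independence is used in the form that \<open>\<tau> i\<close> is outside the span
  \<open>E i\<close> of its predecessors.\<close>

lemma cotangent_quot:
  assumes t: "\<And>i. i < r \<Longrightarrow> t i \<in> Rp" and sp: "Fn.spans Rp r t m = Rp" and du: "Fn.duals Rp r t m"
  shows "cotangent_dimension B n r"
proof -
  interpret Bc: cring B by (rule cringB)
  note q = quot_ring_simps[OF Iideal]
  define Q where "Q = n \<cdot>\<^bsub>B\<^esub> n"
  have nI: "ideal n B"
    by (rule primeideal.axioms(1)[OF primeideal_image(1)[OF coset_hom cringB coset_surj mI(2)]])
      (use coset_ker mI(4) in blast)
  have QI: "ideal Q B" unfolding Q_def by (rule Bc.ideal_prod_is_ideal[OF nI nI])
  define D where "D = B Quot Q"
  interpret D: cring D unfolding D_def by (rule ideal.quotient_is_cring[OF QI cringB])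
  define \<psi> where "\<psi> a = Q +>\<^bsub>B\<^esub> (I +> a)" for a
  have hD: "(+>\<^bsub>B\<^esub>) Q \<in> ring_hom B D" unfolding D_def by (rule ideal.rcos_ring_hom[OF QI])
  have hB: "(\<lambda>x. I +> x) \<in> ring_hom A B" using ring_hom_ring.homh[OF coset_hom] .
  have \<psi>_in: "\<psi> a \<in> carrier D" if "a \<in> carrier A" for a
    unfolding \<psi>_def by (rule ring_hom_closed[OF hD]) (use that in \<open>simp add: q\<close>)
  have \<psi>_add: "\<psi> (a \<oplus> b) = \<psi> a \<oplus>\<^bsub>D\<^esub> \<psi> b" if "a \<in> carrier A" "b \<in> carrier A" for a b
    using that ring_hom_add[OF hD, of "I +> a" "I +> b"] by (simp add: \<psi>_def q)
  have \<psi>_mult: "\<psi> (a \<otimes> b) = \<psi> a \<otimes>\<^bsub>D\<^esub> \<psi> b" if "a \<in> carrier A" "b \<in> carrier A" for a b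
    using that ring_hom_mult[OF hD, of "I +> a" "I +> b"] by (simp add: \<psi>_def q)
  have \<psi>_eq: "\<psi> a = \<psi> b \<longleftrightarrow> hat V a - hat V b \<in> Fn.N2 Rp m" if a: "a \<in> carrier A" "b \<in> carrier A" for a b
  proof -
    have "(I +> b) \<oplus>\<^bsub>B\<^esub> (I +> (a \<ominus> b)) = I +> a"
    proof -
      have "b \<oplus> (a \<ominus> b) = a" using a by algebra
      then show ?thesis using a by (simp add: q)
    qed
    moreover have "\<And>u v. u \<in> carrier B \<Longrightarrow> v \<in> carrier B \<Longrightarrow> (u \<oplus>\<^bsub>B\<^esub> v) \<ominus>\<^bsub>B\<^esub> u = v"
      by (metis Bc.minus_eq Bc.a_comm Bc.a_assoc Bc.r_neg Bc.r_zero Bc.a_inv_closed)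
    ultimately have "(I +> a) \<ominus>\<^bsub>B\<^esub> (I +> b) = I +> (a \<ominus> b)"
      using a coset_surj by (metis imageI minus_closed)
    then have "\<psi> a = \<psi> b \<longleftrightarrow> I +> (a \<ominus> b) \<in> Q"
      unfolding \<psi>_def using Bc.quotient_eq_iff_same_a_r_cos[OF QI, of "I +> a" "I +> b"] a by (simp add: q)
    also have "\<dots> \<longleftrightarrow> hat V a - hat V b \<in> Fn.N2 Rp m"
      unfolding Q_def using mem_square_iff[of "a \<ominus> b"] hat_simps(3)[OF V a] a by simp
    finally show ?thesis .
  qed
  have "\<forall>i. \<exists>s. i < r \<longrightarrow> s \<in> carrier A \<and> t i = hat V s" using t by blast
  then obtain s where s: "\<And>i. i < r \<Longrightarrow> s i \<in> carrier A" "\<And>i. i < r \<Longrightarrow> t i = hat V (s i)" by metis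
  \<comment> \<open>The default zero keeps \<open>\<tau> i\<close> in m for every index.\<close>
  define \<tau> where "\<tau> i = (if i < r then s i \<ominus> sc (eval_at A m (s i)) else \<zero>)" for i
  have \<tau>m: "\<tau> i \<in> m" for i
    using eval_at_mem[OF mI(1) s(1)] ideal_closed(1)[OF mI(3)] by (simp add: \<tau>_def)
  have \<tau>A: "\<tau> i \<in> carrier A" for i using \<tau>m ideal_subset[OF mI(3)] by blast
  have hat\<tau>: "hat V (\<tau> i) = Fn.dv m (t i)" if "i < r" for i
    using s that by (simp add: \<tau>_def hat_simps(3)[OF V] hat_simps(5)[OF V] Fn.dv_def hat_m)
  have hat_lc: "hat V (lcomb {..<i} c \<tau>) = Fn.lin i t m c" if "i \<le> r" for i c
    using that
  proof (induction i)
    case 0 then show ?case by (simp add: hat_simps(7)[OF V] Fn.lin_def)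
  next
    case (Suc i)
    have ins: "{..<Suc i} = insert i {..<i}" by auto
    have "lcomb {..<Suc i} c \<tau> = sc (c i) \<otimes> \<tau> i \<oplus> lcomb {..<i} c \<tau>"
      unfolding ins by (rule lcomb_insert) (use \<tau>A in auto)
    then have "hat V (lcomb {..<Suc i} c \<tau>) = (\<lambda>_. c i) * hat V (\<tau> i) + hat V (lcomb {..<i} c \<tau>)"
      using \<tau>A lcomb_in[of \<tau> "{..<i}" c] by (simp add: hat_simps(1)[OF V] hat_simps(2)[OF V] hat_simps(5)[OF V])
    also have "\<dots> = hat V (lcomb {..<i} c \<tau>) + (\<lambda>_. c i) * hat V (\<tau> i)" by (rule add.commute)
    also have "\<dots> = Fn.lin i t m c + (\<lambda>_. c i) * Fn.dv m (t i)" using Suc by (simp add: hat\<tau>)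
    also have "\<dots> = Fn.lin (Suc i) t m c" by (simp add: Fn.lin_def)
    finally show ?case .
  qed
  define E where "E i = {\<psi> (lcomb {..<i} c \<tau>) | c. True}" for i
  define K where "K = (\<lambda>x. Q +>\<^bsub>B\<^esub> x) ` scalars B"
  have K: "K = range (\<lambda>z. \<psi> (sc z))"
  proof -
    have "scalars B = range (\<lambda>z. I +> sc z)" by (simp add: scalars_def q sc_def)
    then show ?thesis by (auto simp: K_def \<psi>_def)
  qed
  have dim: "i \<le> r \<Longrightarrow> D.dimension i K (E i)" for i
  proof (induction i)
    case 0
    have "\<psi> \<zero> \<oplus>\<^bsub>D\<^esub> \<psi> \<zero> = \<psi> \<zero>" using \<psi>_add[of \<zero> \<zero>] by simp
    then have "\<psi> \<zero> = \<zero>\<^bsub>D\<^esub>" using \<psi>_in[of \<zero>] D.add.l_cancel_one by simp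
    then have "E 0 = {\<zero>\<^bsub>D\<^esub>}" by (auto simp: E_def)
    then show ?case by (simp add: D.zero_dim)
  next
    case (Suc i)
    have i: "i < r" using Suc.prems by simp
    have ins: "{..<Suc i} = insert i {..<i}" by auto
    have split: "lcomb {..<Suc i} c \<tau> = sc (c i) \<otimes> \<tau> i \<oplus> lcomb {..<i} c \<tau>" for c
      unfolding ins by (rule lcomb_insert) (use \<tau>A in auto)
    have lcA: "lcomb {..<i} c \<tau> \<in> carrier A" for c by (rule lcomb_in) (use \<tau>A in auto)
    have \<psi>split: "\<psi> (lcomb {..<Suc i} c \<tau>) = \<psi> (sc (c i)) \<otimes>\<^bsub>D\<^esub> \<psi> (\<tau> i) \<oplus>\<^bsub>D\<^esub> \<psi> (lcomb {..<i} c \<tau>)" for c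
      using \<tau>A lcA by (simp add: split \<psi>_add \<psi>_mult)
    have notin: "\<psi> (\<tau> i) \<notin> E i"
    proof
      assume "\<psi> (\<tau> i) \<in> E i"
      then obtain c where "\<psi> (\<tau> i) = \<psi> (lcomb {..<i} c \<tau>)" by (auto simp: E_def)
      then have N2: "Fn.dv m (t i) - Fn.lin i t m c \<in> Fn.N2 Rp m"
        using \<psi>_eq[OF \<tau>A lcA] hat\<tau>[OF i] hat_lc[of i c] i by simp
      \<comment> \<open>The dependence of \<open>\<tau> i\<close> on its predecessors, padded by
        zeros to a relation among all r differentials; its coefficient 1 at i contradicts
        \<open>duals\<close>.\<close>
      define f where "f j = (if j < i then - c j else if j = i then 1 else 0)" for j
      have "Fn.lin r t m f = Fn.lin (Suc i) t m f"
        unfolding Fn.lin_def using i by (intro sum.mono_neutral_right) (auto simp: f_def fun_eq_iff)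
      also have "\<dots> = Fn.lin i t m f + Fn.dv m (t i)" by (simp add: Fn.lin_def f_def fun_eq_iff)
      also have "Fn.lin i t m f = - Fn.lin i t m c"
        unfolding Fn.lin_def sum_negf[symmetric] by (rule sum.cong) (auto simp: f_def fun_eq_iff)
      also have "- Fn.lin i t m c + Fn.dv m (t i) = Fn.dv m (t i) - Fn.lin i t m c"
        by (rule uminus_add_conv_diff)
      finally have "Fn.lin r t m f \<in> Fn.N2 Rp m" using N2 by (simp only:)
      from Fn.duals_independent[OF csub_Rp t du this i] have "f i = 0" .
      then show False by (simp add: f_def)
    qed
    have "D.line_extension K (\<psi> (\<tau> i)) (E i) = E (Suc i)"
    proof (rule equalityI; rule subsetI)
      fix v assume "v \<in> D.line_extension K (\<psi> (\<tau> i)) (E i)"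
      then obtain k e where ke: "k \<in> K" "e \<in> E i" "v = k \<otimes>\<^bsub>D\<^esub> \<psi> (\<tau> i) \<oplus>\<^bsub>D\<^esub> e"
        unfolding D.line_extension_mem_iff by blast
      obtain z where z: "k = \<psi> (sc z)" using ke(1) K by blast
      obtain c where c: "e = \<psi> (lcomb {..<i} c \<tau>)" using ke(2) by (auto simp: E_def)
      have "lcomb {..<i} (c(i := z)) \<tau> = lcomb {..<i} c \<tau>" by (rule lcomb_cong) (use \<tau>A in auto)
      then have "v = \<psi> (lcomb {..<Suc i} (c(i := z)) \<tau>)" unfolding \<psi>split ke(3) z c by simp
      then show "v \<in> E (Suc i)" unfolding E_def by blast
    next
      fix v assume "v \<in> E (Suc i)"
      then obtain c where "v = \<psi> (lcomb {..<Suc i} c \<tau>)" by (auto simp: E_def)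
      then show "v \<in> D.line_extension K (\<psi> (\<tau> i)) (E i)"
        unfolding D.line_extension_mem_iff \<psi>split K E_def by blast
    qed
    moreover have "D.dimension (Suc i) K (D.line_extension K (\<psi> (\<tau> i)) (E i))"
      using Suc by (intro D.Suc_dim \<psi>_in \<tau>A notin) simp
    ultimately show ?case by simp
  qed
  have "E r = (\<lambda>x. Q +>\<^bsub>B\<^esub> x) ` n"
  proof
    show "E r \<subseteq> (\<lambda>x. Q +>\<^bsub>B\<^esub> x) ` n"
    proof
      fix v assume "v \<in> E r"
      then obtain c where c: "v = \<psi> (lcomb {..<r} c \<tau>)" by (auto simp: E_def)
      have "lcomb {..<r} c \<tau> \<in> m" by (rule lcomb_ideal[OF mI(3)]) (use \<tau>m in auto)
      then show "v \<in> (\<lambda>x. Q +>\<^bsub>B\<^esub> x) ` n" unfolding c \<psi>_def by blast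
    qed
    show "(\<lambda>x. Q +>\<^bsub>B\<^esub> x) ` n \<subseteq> E r"
    proof
      fix v assume "v \<in> (\<lambda>x. Q +>\<^bsub>B\<^esub> x) ` n"
      then obtain a where a: "a \<in> m" "v = \<psi> a" by (auto simp: \<psi>_def)
      have ac: "a \<in> carrier A" using a ideal_subset[OF mI(3)] by blast
      have "hat V a \<in> Fn.spans Rp r t m" using sp ac by simp
      then obtain f where f: "Fn.dv m (hat V a) - Fn.lin r t m f \<in> Fn.N2 Rp m" unfolding Fn.spans_def by blast
      have "Fn.dv m (hat V a) = hat V a"
        using eval_at_simps(8)[OF mI(1) ac] a(1) by (simp add: Fn.dv_def hat_m fun_eq_iff)
      then have "\<psi> a = \<psi> (lcomb {..<r} f \<tau>)"
        using \<psi>_eq[OF ac lcomb_in] \<tau>A hat_lc[of r f] f by auto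
      then show "v \<in> E r" unfolding a(2) E_def by blast
    qed
  qed
  then have "D.dimension r K ((\<lambda>x. Q +>\<^bsub>B\<^esub> x) ` n)" using dim[of r] by simp
  then show ?thesis unfolding cotangent_dimension_def Let_def K_def D_def Q_def .
qed

end

text \<open>f comes from generic smoothness of one component; the factor g discards the points on
  other components. The product is outside the prime p, hence outside the vanishing ideal.\<close>

theorem generically_smooth_points:
  assumes Z: "Z \<subseteq> maxspec A" "Z \<noteq> {}"
  shows "\<exists>f\<in>carrier A - vanishing_ideal A Z.
    \<forall>m\<in>Z. f \<notin> m \<longrightarrow> smooth_point (poisson_quot A (vanishing_ideal A Z)) ((\<lambda>x. vanishing_ideal A Z +> x) ` m)"
proof -
  let ?I = "vanishing_ideal A Z"
  obtain p g where p: "primeideal p A" "?I \<subseteq> p" and g: "g \<in> carrier A" "g \<notin> p" "\<And>x. x \<in> p \<Longrightarrow> x \<otimes> g \<in> ?I"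
    using exists_component[OF Z] by blast
  let ?V = "{m \<in> maxspec A. p \<subseteq> m}"
  have V: "?V \<subseteq> maxspec A" "?V \<noteq> {}" using jacobson[OF p(1) g(1,2)] by blast+
  obtain bs where bs: "coordinate_ring ?V = Fn.adjoin bs" using coordinate_ring_adjoin[OF V] by blast
  have dom: "Fn.cdom (coordinate_ring ?V)"
    unfolding Fn.cdom_def
  proof (intro conjI ballI impI csub_coordinate_ring[OF V])
    fix u v assume "u \<in> coordinate_ring ?V" "v \<in> coordinate_ring ?V" and uv: "u * v = 0"
    then obtain a b where ab: "a \<in> carrier A" "u = hat ?V a" "b \<in> carrier A" "v = hat ?V b" by blast
    then have "hat ?V (a \<otimes> b) = 0" using uv hat_simps(2)[OF V, of a b] by simp
    then have "a \<otimes> b \<in> p" using hat_eq_0_iff[OF V, of "a \<otimes> b"] vanishing_prime[OF p(1)] ab by simp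
    then have "a \<in> p \<or> b \<in> p" by (rule primeideal.I_prime[OF p(1) ab(1,3)])
    then show "u = 0 \<or> v = 0" using hat_eq_0_iff[OF V] vanishing_prime[OF p(1)] ab by simp
  qed
  from Fn.generically_smooth[of bs] dom bs obtain r t where
    rt: "Fn.growth (coordinate_ring ?V) r \<and> (\<forall>i<r. t i \<in> coordinate_ring ?V) \<and>
     (\<exists>f\<in>coordinate_ring ?V. f \<noteq> 0 \<and> (\<forall>x. f x \<noteq> 0 \<longrightarrow>
        Fn.prime_chain (coordinate_ring ?V) r x \<and> Fn.spans (coordinate_ring ?V) r t x = coordinate_ring ?V \<and> Fn.duals (coordinate_ring ?V) r t x))"
    by auto
  then obtain h where h: "h \<in> coordinate_ring ?V" "h \<noteq> 0" "\<And>x. h x \<noteq> 0 \<Longrightarrow>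
        Fn.prime_chain (coordinate_ring ?V) r x \<and> Fn.spans (coordinate_ring ?V) r t x = coordinate_ring ?V \<and> Fn.duals (coordinate_ring ?V) r t x"
    by blast
  obtain f where f: "f \<in> carrier A" "h = hat ?V f" using h(1) by blast
  have fp: "f \<notin> p" using h(2) f hat_eq_0_iff[OF V f(1)] vanishing_prime[OF p(1)] by simp
  have fg: "f \<otimes> g \<notin> p" using primeideal.I_prime[OF p(1) f(1) g(1)] fp g(2) by blast
  show ?thesis
  proof (intro bexI[of _ "f \<otimes> g"] ballI impI)
    show "f \<otimes> g \<in> carrier A - ?I" using fg p(2) f g by auto
    fix m assume m: "m \<in> Z" and fgm: "f \<otimes> g \<notin> m"
    have mm: "m \<in> maxspec A" using m Z by blast
    have mI: "ideal m A" by (rule primeideal.axioms(1)[OF maxspec_prime[OF mm]])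
    have fm: "f \<notin> m" "g \<notin> m" using fgm ideal_closed(5,6)[OF mI] f(1) g(1) by blast+
    note ctx = Z(1) p g(1) g(3) m fm(2)
    have mV: "m \<in> ?V" by (rule mV[OF ctx])
    have "h m = eval_at A m f" unfolding f(2) by (rule hat_m[OF ctx])
    then have hm: "h m \<noteq> 0" using eval_at_simps(8)[OF mm f(1)] fm(1) by simp
    have "height (poisson_quot A ?I) ((\<lambda>x. ?I +> x) ` m) = enat r"
      by (rule height_quot[OF ctx]) (use rt h(3)[OF hm] in auto)
    moreover have "cotangent_dimension (poisson_quot A ?I) ((\<lambda>x. ?I +> x) ` m) r"
      by (rule cotangent_quot[OF ctx, of r t]) (use rt h(3)[OF hm] in auto)
    ultimately show "smooth_point (poisson_quot A ?I) ((\<lambda>x. ?I +> x) ` m)"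
      unfolding smooth_point_def by blast
  qed
qed

theorem smooth_strata_cover:
  assumes m: "m \<in> maxspec A"
  shows "\<exists>i. m \<in> smooth_stratum A i"
proof -
  have ne: "maxspec A \<noteq> {}" using m by blast
  let ?Z = "sing_filtration A"
  have Z: "?Z i \<subseteq> maxspec A" for i
    by (induction i) (auto simp: singular_locus_def Let_def)
  have dec: "?Z (Suc i) \<subseteq> ?Z i" for i by (auto simp: singular_locus_def Let_def)
  have strict: "vanishing_ideal A (?Z (Suc i)) \<noteq> vanishing_ideal A (?Z i)" if Zi: "?Z i \<noteq> {}" for i
  proof -
    obtain f where f: "f \<in> carrier A" "f \<notin> vanishing_ideal A (?Z i)"
      "\<And>m. m \<in> ?Z i \<Longrightarrow> f \<notin> m \<Longrightarrow> smooth_point (poisson_quot A (vanishing_ideal A (?Z i))) ((\<lambda>x. vanishing_ideal A (?Z i) +> x) ` m)"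
      using generically_smooth_points[OF Z Zi] by (elim bexE) auto
    have "f \<in> vanishing_ideal A (?Z (Suc i))"
      unfolding vanishing_ideal_def[of A "?Z (Suc i)"] using f(1,3) by (auto simp: singular_locus_def Let_def)
    then show ?thesis using f(2) by blast
  qed
  have "\<exists>k. vanishing_ideal A (?Z (Suc k)) = vanishing_ideal A (?Z k)"
  proof (rule ascending_chain[OF ne])
    show "ideal (vanishing_ideal A (?Z i)) A" "nilrad \<subseteq> vanishing_ideal A (?Z i)" for i
      by (rule ideal_vanishing[OF Z], rule nilrad_subset_vanishing[OF Z])
    show "vanishing_ideal A (?Z i) \<subseteq> vanishing_ideal A (?Z (Suc i))" for i
      using dec[of i] unfolding vanishing_ideal_def by blast
  qed
  \<comment> \<open>The ideals become stationary, which is possible only at an empty stage; a point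
    in no stratum would belong to every stage.\<close>
  then obtain k where k: "?Z k = {}" using strict by blast
  show ?thesis
  proof (rule ccontr)
    assume no: "\<not> ?thesis"
    have "m \<in> ?Z i" for i
    proof (induction i)
      case 0 then show ?case using m by simp
    next
      case (Suc i) then show ?case using no unfolding smooth_stratum_def by blast
    qed
    then show False using k by blast
  qed
qed

end

section \<open>Finitely many orbits\<close>

context complex_affine_poisson_algebra begin

context
  fixes G :: "(complex ^ 'n) monoid" and \<phi>
  assumes act: "rational_poisson_action G A \<phi>"
begin

lemma poisson_core_translate:
  assumes g: "g \<in> carrier G" and m: "primeideal m A"
  shows "poisson_core A (\<phi> g ` m) = \<phi> g ` poisson_core A m"
proof -
  let ?i = "inv\<^bsub>G\<^esub> g"
  have i: "?i \<in> carrier G" using g group.inv_closed[OF action(2)[OF act]] by simp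
  have mI: "ideal m A" by (rule primeideal.axioms(1)[OF m])
  have mA: "m \<subseteq> carrier A" by (rule ideal_subset[OF mI])
  have t: "primeideal (\<phi> g ` m) A"
    unfolding translate_eq_vimage[OF act g mA] by (rule prime_vimage[OF act i m])
  have tI: "ideal (\<phi> g ` m) A" by (rule primeideal.axioms(1)[OF t])
  let ?K = "poisson_core A (\<phi> g ` m)"
  have cp: "poisson_prime A (poisson_core A m)" "poisson_prime A ?K"
    by (rule poisson_core_prime[OF m], rule poisson_core_prime[OF t])
  show ?thesis
  proof
    have "poisson_ideal A (\<phi> g ` poisson_core A m)"
      using translate_poisson_prime[OF act g cp(1)] by (simp add: poisson_prime_def)
    moreover have "\<phi> g ` poisson_core A m \<subseteq> \<phi> g ` m" using poisson_core_greatest(2)[OF mI] by blast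
    ultimately show "\<phi> g ` poisson_core A m \<subseteq> ?K" by (rule poisson_core_greatest(3)[OF tI])
    have Km: "?K \<subseteq> \<phi> g ` m" by (rule poisson_core_greatest(2)[OF tI])
    have "poisson_ideal A (\<phi> ?i ` ?K)"
      using translate_poisson_prime[OF act i cp(2)] by (simp add: poisson_prime_def)
    moreover have "\<phi> ?i ` ?K \<subseteq> m"
    proof
      fix x assume "x \<in> \<phi> ?i ` ?K"
      then obtain y where "y \<in> m" "x = \<phi> ?i (\<phi> g y)" using Km by blast
      then show "x \<in> m" using action(6)[OF act g] mA by auto
    qed
    ultimately have sub: "\<phi> ?i ` ?K \<subseteq> poisson_core A m" by (rule poisson_core_greatest(3)[OF mI])
    show "?K \<subseteq> \<phi> g ` poisson_core A m"
    proof
      fix x assume x: "x \<in> ?K"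
      then have "x \<in> carrier A" using Km ideal_subset[OF tI] by blast
      then have "x = \<phi> g (\<phi> ?i x)" using action(7)[OF act g] by simp
      moreover have "\<phi> ?i x \<in> poisson_core A m" using x sub by blast
      ultimately show "x \<in> \<phi> g ` poisson_core A m" by (rule image_eqI)
    qed
  qed
qed

text \<open>Leaves and symplectic cores are treated together: what counts is a cover by nonempty
  point sets on each of which the Poisson core is constant. Cores commute with translation, so one
  core for each orbit represents them all.\<close>

lemma finite_orbits_cores:
  assumes fin: "finite (orbits G \<L> (act_on_point_sets \<phi>))"
    and sub: "\<And>L. L \<in> \<L> \<Longrightarrow> L \<subseteq> maxspec A" and ne: "\<And>L. L \<in> \<L> \<Longrightarrow> L \<noteq> {}"
    and core: "\<And>L m n. L \<in> \<L> \<Longrightarrow> m \<in> L \<Longrightarrow> n \<in> L \<Longrightarrow> poisson_core A m = poisson_core A n"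
    and cov: "\<And>m. m \<in> maxspec A \<Longrightarrow> \<exists>L\<in>\<L>. m \<in> L"
  shows "\<exists>\<Q>. finite \<Q> \<and> (\<forall>Q\<in>\<Q>. poisson_prime A Q) \<and>
    (\<forall>m\<in>maxspec A. \<exists>Q\<in>\<Q>. \<exists>g\<in>carrier G. poisson_core A m = \<phi> g ` Q)"
proof -
  let ?act = "act_on_point_sets \<phi>"
  define r where "r U = (SOME L. L \<in> \<L> \<and> U = orbit G ?act L)" for U
  define c where "c U = (SOME m. m \<in> r U)" for U
  have r: "r U \<in> \<L>" "U = orbit G ?act (r U)" if "U \<in> orbits G \<L> ?act" for U
  proof -
    have "\<exists>L. L \<in> \<L> \<and> U = orbit G ?act L" using that by (auto simp: orbits_def)
    then have "r U \<in> \<L> \<and> U = orbit G ?act (r U)" unfolding r_def by (rule someI_ex)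
    then show "r U \<in> \<L>" "U = orbit G ?act (r U)" by simp_all
  qed
  have c: "c U \<in> r U" "c U \<in> maxspec A" if "U \<in> orbits G \<L> ?act" for U
  proof -
    show "c U \<in> r U" unfolding c_def some_in_eq by (rule ne[OF r(1)[OF that]])
    then show "c U \<in> maxspec A" using sub[OF r(1)[OF that]] by blast
  qed
  define \<Q> where "\<Q> = (\<lambda>U. poisson_core A (c U)) ` orbits G \<L> ?act"
  have "\<exists>Q\<in>\<Q>. \<exists>g\<in>carrier G. poisson_core A m = \<phi> g ` Q" if m: "m \<in> maxspec A" for m
  proof -
    obtain L where L: "L \<in> \<L>" "m \<in> L" using cov[OF m] by blast
    define U where "U = orbit G ?act L"
    have U: "U \<in> orbits G \<L> ?act" using L(1) by (auto simp: U_def orbits_def)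
    \<comment> \<open>The next lines show that \<open>L\<close> lies in its own orbit, because the
      identity of \<open>G\<close> fixes every point of \<open>L\<close>.\<close>
    have one: "\<one>\<^bsub>G\<^esub> \<in> carrier G"
      by (rule monoid.one_closed[OF group.is_monoid[OF action(2)[OF act]]])
    have id: "\<phi> \<one>\<^bsub>G\<^esub> a = a" if "a \<in> carrier A" for a
      using group_action.id_eq_one[OF action(1)[OF act]] that by (metis restrict_apply')
    have "\<phi> \<one>\<^bsub>G\<^esub> ` n = n" if "n \<in> L" for n
    proof -
      have "n \<in> maxspec A" using that sub[OF L(1)] by blast
      then have "n \<subseteq> carrier A" by (intro ideal_subset primeideal.axioms(1) maxspec_prime)
      then have "\<phi> \<one>\<^bsub>G\<^esub> ` n = (\<lambda>a. a) ` n" by (intro image_cong refl id) blast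
      then show ?thesis by simp
    qed
    then have "(\<lambda>n. \<phi> \<one>\<^bsub>G\<^esub> ` n) ` L = (\<lambda>n. n) ` L" by (intro image_cong refl)
    then have "?act \<one>\<^bsub>G\<^esub> L = L" by (simp add: act_on_point_sets_def)
    then have "L \<in> U" using one unfolding U_def orbit_def by blast
    then obtain g where g: "g \<in> carrier G" "L = ?act g (r U)" using r(2)[OF U] unfolding orbit_def by blast
    then obtain n where n: "n \<in> r U" "m = \<phi> g ` n" using L(2) by (auto simp: act_on_point_sets_def)
    have "primeideal n A" using n(1) sub[OF r(1)[OF U]] maxspec_prime by blast
    then have "poisson_core A m = \<phi> g ` poisson_core A n" unfolding n(2) by (rule poisson_core_translate[OF g(1)])
    also have "poisson_core A n = poisson_core A (c U)" by (rule core[OF r(1)[OF U] n(1) c(1)[OF U]])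
    finally show ?thesis using U g(1) unfolding \<Q>_def by blast
  qed
  moreover have "poisson_prime A Q" if "Q \<in> \<Q>" for Q
    using that c(2) maxspec_prime poisson_core_prime unfolding \<Q>_def by blast
  moreover have "finite \<Q>" unfolding \<Q>_def by (rule finite_imageI[OF fin])
  ultimately show ?thesis by blast
qed

end

lemma symplectic_leaf_subset: "m \<in> M \<Longrightarrow> symplectic_leaf A M m \<subseteq> M"
proof
  fix n assume m: "m \<in> M" and "n \<in> symplectic_leaf A M m"
  then have "(hamiltonian_step A M)\<^sup>*\<^sup>* m n" by (simp add: symplectic_leaf_def)
  then show "n \<in> M"
    by (induction rule: rtranclp_induct) (use m in \<open>auto simp: hamiltonian_step_def hamiltonian_curve_def Pi_iff\<close>)
qed

lemma finite_leaf_orbits_cores: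
  fixes G :: "(complex ^ 'n) monoid"
  assumes act: "rational_poisson_action G A \<phi>"
    and fin: "finite (orbits G (symplectic_leaves A) (act_on_point_sets \<phi>))"
  shows "\<exists>\<Q>. finite \<Q> \<and> (\<forall>Q\<in>\<Q>. poisson_prime A Q) \<and>
    (\<forall>m\<in>maxspec A. \<exists>Q\<in>\<Q>. \<exists>g\<in>carrier G. poisson_core A m = \<phi> g ` Q)"
proof (rule finite_orbits_cores[OF act fin])
  have self: "m \<in> symplectic_leaf A M m" for M m by (simp add: symplectic_leaf_def)
  {
    fix L assume "L \<in> symplectic_leaves A"
    then obtain i m where L: "L = symplectic_leaf A (smooth_stratum A i) m" "m \<in> smooth_stratum A i"
      unfolding symplectic_leaves_def by blast
    show "L \<subseteq> maxspec A" using symplectic_leaf_subset[OF L(2)] smooth_stratum_subset[of i] L(1) by blast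
    show "L \<noteq> {}" using self L(1) by blast
    show "poisson_core A m = poisson_core A n" if "m \<in> L" "n \<in> L" for m n
      using that symplectic_leaf_core[OF _ smooth_stratum_subset] unfolding L(1) by metis
  }
  show "\<exists>L\<in>symplectic_leaves A. m \<in> L" if m: "m \<in> maxspec A" for m
  proof -
    obtain i where "m \<in> smooth_stratum A i" using smooth_strata_cover m by blast
    then have "symplectic_leaf A (smooth_stratum A i) m \<in> symplectic_leaves A"
      unfolding symplectic_leaves_def by blast
    then show ?thesis using self by blast
  qed
qed

lemma finite_core_orbits_cores:
  fixes G :: "(complex ^ 'n) monoid"
  assumes act: "rational_poisson_action G A \<phi>"
    and fin: "finite (orbits G (symplectic_cores A) (act_on_point_sets \<phi>))"
  shows "\<exists>\<Q>. finite \<Q> \<and> (\<forall>Q\<in>\<Q>. poisson_prime A Q) \<and>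
    (\<forall>m\<in>maxspec A. \<exists>Q\<in>\<Q>. \<exists>g\<in>carrier G. poisson_core A m = \<phi> g ` Q)"
  by (rule finite_orbits_cores[OF act fin])
    (auto simp: symplectic_cores_def quotient_def)

end

theorem theoremD:
  fixes A :: "'a poisson_algebra" and G :: "(complex ^ 'n) monoid"
    and \<phi> :: "complex ^ 'n \<Rightarrow> 'a \<Rightarrow> 'a"
  assumes "complex_affine_poisson_algebra A"
    and "algebraic_group G"
    and "rational_poisson_action G A \<phi>"
    and "finite (orbits G (symplectic_leaves A) (act_on_point_sets \<phi>)) \<or>
         finite (orbits G (symplectic_cores A) (act_on_point_sets \<phi>))"
  shows "poisson_dixmier_moeglin A"
proof -
  interpret complex_affine_poisson_algebra A by (rule assms(1))
  have "\<exists>\<Q>. finite \<Q> \<and> (\<forall>Q\<in>\<Q>. poisson_prime A Q) \<and>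
    (\<forall>m\<in>maxspec A. \<exists>Q\<in>\<Q>. \<exists>g\<in>carrier G. poisson_core A m = \<phi> g ` Q)"
    using assms(4) finite_leaf_orbits_cores[OF assms(3)] finite_core_orbits_cores[OF assms(3)] by (elim disjE)
  then obtain \<Q> where Q: "finite \<Q>" "\<And>Q. Q \<in> \<Q> \<Longrightarrow> poisson_prime A Q"
    "\<And>m. m \<in> maxspec A \<Longrightarrow> \<exists>Q\<in>\<Q>. \<exists>g\<in>carrier G. poisson_core A m = \<phi> g ` Q"
    by (elim exE conjE) auto
  have "poisson_locally_closed A P" if "poisson_rational A P" for P
    by (rule rational_imp_locally_closed[OF assms(3) Q that])
  then show ?thesis
    unfolding poisson_dixmier_moeglin_def
    using locally_closed_imp_primitive primitive_imp_rational by blast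
qed

end
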